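(* Let $k$ be a number field or one of its completions, let $\mathbb{O}$ be an octonion algebra over $k$, let $G_k=\mathrm{Aut}_k(\mathbb{O})$ be its automorphism group regarded as an algebraic group over $k$, and set $\tilde G_{\overline{k}}=G_{\overline{k}}$. Fix $x\in\mathbb{O}\otimes_k\overline{k}$ perpendicular to $1_{\mathbb{O}}$ with $N(x)\neq 0$. Let $\tilde H_{\overline{k}}=\mathrm{Stab}_x(G_{\overline{k}})$ be the stabilizer of $x$ in $G_{\overline{k}}$, with natural inclusion $\tilde f:\tilde H_{\overline{k}}\hookrightarrow\tilde G_{\overline{k}}$. Then the set of triples $(H_k,G_k,f:H_k\to G_k)$ (with $H_k$ an algebraic group over $k$ and $f$ a morphism over $k$), considered up to $G_k(k)$-conjugacy, that become $\tilde G_{\overline{k}}(\overline{k})$-conjugate to $\tilde f:\tilde H_{\overline{k}}\hookrightarrow\tilde G_{\overline{k}}$ after base change to $\overline{k}$ is in natural bijection with the set of isomorphism classes of quadratic étale algebras $A$ over $k$ that have an embedding $A\hookrightarrow\mathbb{O}$.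
   Context: An octonion algebra over $k$ is an $8$-dimensional (alternative, unital) $k$-algebra obtained from a quaternion algebra by the Cayley–Dickson construction. It has a standard involution $\sigma$, a multiplicative nondegenerate quadratic norm form $N(u)=u\sigma(u)$, and associated bilinear form $(u,v)=\tfrac12(u\sigma(v)+v\sigma(u))$; "perpendicular" refers to this form, and all of this extends to $\mathbb{O}\otimes_k\overline{k}$. $G_k$ is the group scheme $G(K)=\mathrm{Aut}_K(K\otimes_k\mathbb{O})$, a semisimple group of type $G_2$. Two triples $f:H_k\to G_k$ and $f':H'_k\to G_k$ are $G_k(k)$-conjugate if there are $g\in G_k(k)$ and an isomorphism $\varphi:H_k\to H'_k$ over $k$ with $g f(\cdot)g^{-1}=f'\circ\varphi$ (so, for injective maps, the images are conjugate subgroups under $G_k(k)$); $\tilde G_{\overline{k}}(\overline{k})$-conjugacy is defined in the same way over $\overline{k}$. The natural bijection assigns to an embedded quadratic étale algebra $A\hookrightarrow\mathbb{O}$ the conjugacy class of the stabilizer in $G_k$ of the line of elements of $A$ perpendicular to $1$ (i.e. the stabilizer of a nonzero element of that line). *)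

theory Defs
  imports
    "HOL-Algebra.Algebra"
    "HOL-Algebra.Algebraic_Closure_Type"
    "HOL-Library.Numeral_Type"
begin

section \<open>Number fields and their completions\<close>

definition is_number_field :: "'k::field_char_0 set \<Rightarrow> bool" where
  "is_number_field F \<longleftrightarrow> subfield F ring_of_type_algebra \<and>
     (\<exists>B. finite B \<and> B \<subseteq> F \<and> (\<forall>x\<in>F. \<exists>c :: 'k \<Rightarrow> rat. x = (\<Sum>b\<in>B. of_rat (c b) * b)))"

definition is_absolute_value :: "('k::field \<Rightarrow> real) \<Rightarrow> bool" where
  "is_absolute_value v \<longleftrightarrow>
     (\<forall>x. v x \<ge> 0) \<and> (\<forall>x. v x = 0 \<longleftrightarrow> x = 0) \<and>
     (\<forall>x y. v (x * y) = v x * v y) \<and> (\<forall>x y. v (x + y) \<le> v x + v y) \<and>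
     (\<exists>x. x \<noteq> 0 \<and> v x \<noteq> 1)"

definition is_complete_for :: "('k::field \<Rightarrow> real) \<Rightarrow> bool" where
  "is_complete_for v \<longleftrightarrow>
     (\<forall>s :: nat \<Rightarrow> 'k.
        (\<forall>\<epsilon>>0. \<exists>M. \<forall>m\<ge>M. \<forall>n\<ge>M. v (s m - s n) < \<epsilon>) \<longrightarrow>
        (\<exists>l. \<forall>\<epsilon>>0. \<exists>M. \<forall>n\<ge>M. v (s n - l) < \<epsilon>))"

text \<open>The completion of a number field at an (archimedean or non-archimedean) place: a field,
  complete for a nontrivial absolute value, that contains the number field as a dense subfield.\<close>

definition is_completion_of_number_field :: "'k::field_char_0 itself \<Rightarrow> bool" where
  "is_completion_of_number_field _ \<longleftrightarrow>
     (\<exists>(v :: 'k \<Rightarrow> real) F. is_absolute_value v \<and> is_complete_for v \<and> is_number_field F \<and>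
        (\<forall>x. \<forall>\<epsilon>>0. \<exists>y\<in>F. v (x - y) < \<epsilon>))"


section \<open>Algebras\<close>

text \<open>All algebras, associative or not, are records of type \<open>module\<close>. The locale
  \<^locale>\<open>algebra\<close> is that of commutative associative algebras.\<close>

definition unital_algebra :: "('c, 'm) ring_scheme \<Rightarrow> ('c, 'a) module \<Rightarrow> bool" where
  "unital_algebra K A \<longleftrightarrow> module K A \<and>
     \<one>\<^bsub>A\<^esub> \<in> carrier A \<and>
     (\<forall>x\<in>carrier A. \<one>\<^bsub>A\<^esub> \<otimes>\<^bsub>A\<^esub> x = x \<and> x \<otimes>\<^bsub>A\<^esub> \<one>\<^bsub>A\<^esub> = x) \<and>
     (\<forall>x\<in>carrier A. \<forall>y\<in>carrier A. x \<otimes>\<^bsub>A\<^esub> y \<in> carrier A) \<and>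
     (\<forall>x\<in>carrier A. \<forall>y\<in>carrier A. \<forall>z\<in>carrier A.
        (x \<oplus>\<^bsub>A\<^esub> y) \<otimes>\<^bsub>A\<^esub> z = (x \<otimes>\<^bsub>A\<^esub> z) \<oplus>\<^bsub>A\<^esub> (y \<otimes>\<^bsub>A\<^esub> z) \<and>
        z \<otimes>\<^bsub>A\<^esub> (x \<oplus>\<^bsub>A\<^esub> y) = (z \<otimes>\<^bsub>A\<^esub> x) \<oplus>\<^bsub>A\<^esub> (z \<otimes>\<^bsub>A\<^esub> y)) \<and>
     (\<forall>c\<in>carrier K. \<forall>x\<in>carrier A. \<forall>y\<in>carrier A.
        (c \<odot>\<^bsub>A\<^esub> x) \<otimes>\<^bsub>A\<^esub> y = c \<odot>\<^bsub>A\<^esub> (x \<otimes>\<^bsub>A\<^esub> y) \<and>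
        x \<otimes>\<^bsub>A\<^esub> (c \<odot>\<^bsub>A\<^esub> y) = c \<odot>\<^bsub>A\<^esub> (x \<otimes>\<^bsub>A\<^esub> y))"

text \<open>The ring \<open>K\<close> only serves to delimit the scalars. Homomorphisms are extensional, so
  that each one is represented by exactly one function.\<close>

definition alg_homs ::
  "('c, 'm) ring_scheme \<Rightarrow> ('c, 'a) module \<Rightarrow> ('c, 'b) module \<Rightarrow> ('a \<Rightarrow> 'b) set" where
  "alg_homs K A B = {h \<in> carrier A \<rightarrow>\<^sub>E carrier B. h \<one>\<^bsub>A\<^esub> = \<one>\<^bsub>B\<^esub> \<and>
     (\<forall>x\<in>carrier A. \<forall>y\<in>carrier A.
        h (x \<oplus>\<^bsub>A\<^esub> y) = h x \<oplus>\<^bsub>B\<^esub> h y \<and> h (x \<otimes>\<^bsub>A\<^esub> y) = h x \<otimes>\<^bsub>B\<^esub> h y) \<and>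
     (\<forall>c\<in>carrier K. \<forall>x\<in>carrier A. h (c \<odot>\<^bsub>A\<^esub> x) = c \<odot>\<^bsub>B\<^esub> h x)}"

definition alg_embeddings ::
  "('c, 'm) ring_scheme \<Rightarrow> ('c, 'a) module \<Rightarrow> ('c, 'b) module \<Rightarrow> ('a \<Rightarrow> 'b) set" where
  "alg_embeddings K A B = {h \<in> alg_homs K A B. inj_on h (carrier A)}"

definition alg_isos ::
  "('c, 'm) ring_scheme \<Rightarrow> ('c, 'a) module \<Rightarrow> ('c, 'b) module \<Rightarrow> ('a \<Rightarrow> 'b) set" where
  "alg_isos K A B = {h \<in> alg_homs K A B. bij_betw h (carrier A) (carrier B)}"

abbreviation comm_alg :: "('c::field, 'u) module \<Rightarrow> bool" where
  "comm_alg \<equiv> algebra ring_of_type_algebra"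

abbreviation homs :: "('c::field, 'a) module \<Rightarrow> ('c, 'b) module \<Rightarrow> ('a \<Rightarrow> 'b) set" where
  "homs \<equiv> alg_homs ring_of_type_algebra"

definition finitely_generated_alg :: "('c::field, 'u) module \<Rightarrow> bool" where
  "finitely_generated_alg A \<longleftrightarrow> (\<exists>S. finite S \<and> S \<subseteq> carrier A \<and>
     (\<forall>B. S \<subseteq> B \<and> B \<subseteq> carrier A \<and> \<one>\<^bsub>A\<^esub> \<in> B \<and>
        (\<forall>x\<in>B. \<forall>y\<in>B. x \<oplus>\<^bsub>A\<^esub> y \<in> B \<and> x \<otimes>\<^bsub>A\<^esub> y \<in> B) \<and> (\<forall>c. \<forall>x\<in>B. c \<odot>\<^bsub>A\<^esub> x \<in> B)
        \<longrightarrow> B = carrier A))"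

text \<open>The field \<open>'c\<close> as an algebra over \<open>'k\<close> by way of \<open>j\<close>.\<close>

definition field_alg :: "('k::field \<Rightarrow> 'c::field) \<Rightarrow> ('k, 'c) module" where
  "field_alg j = \<lparr>carrier = UNIV, monoid.mult = (*), one = 1, ring.zero = 0, add = (+),
     module.smult = (\<lambda>a x. j a * x)\<rparr>"

definition restrict_scalars :: "('k \<Rightarrow> 'c) \<Rightarrow> ('c, 'u) module \<Rightarrow> ('k, 'u) module" where
  "restrict_scalars j R = \<lparr>carrier = carrier R, monoid.mult = monoid.mult R, one = one R,
     ring.zero = ring.zero R, add = add R,
     module.smult = (\<lambda>a. module.smult R (j a))\<rparr>"

lemma restrict_scalars_id [simp]: "restrict_scalars id R = R"
  by (simp add: restrict_scalars_def)

definition struct_map :: "('c, 'u) module \<Rightarrow> 'c \<Rightarrow> 'u" where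
  "struct_map R c = c \<odot>\<^bsub>R\<^esub> \<one>\<^bsub>R\<^esub>"


section \<open>Extension of scalars of a finite-dimensional algebra\<close>

definition is_basis :: "('k::field, 'a) module \<Rightarrow> ('i::finite \<Rightarrow> 'a) \<Rightarrow> bool" where
  "is_basis A e \<longleftrightarrow> range e \<subseteq> carrier A \<and>
     (\<forall>v\<in>carrier A. \<exists>!c :: 'i \<Rightarrow> 'k. v = (\<Oplus>\<^bsub>A\<^esub>i\<in>UNIV. c i \<odot>\<^bsub>A\<^esub> e i))"

definition coord :: "('k::field, 'a) module \<Rightarrow> ('i::finite \<Rightarrow> 'a) \<Rightarrow> 'a \<Rightarrow> 'i \<Rightarrow> 'k" where
  "coord A e v = (THE c. v = (\<Oplus>\<^bsub>A\<^esub>i\<in>UNIV. c i \<odot>\<^bsub>A\<^esub> e i))"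

text \<open>\<open>A \<otimes>\<^sub>k R\<close> for an algebra \<open>A\<close> with basis \<open>e\<close> and a commutative \<open>k\<close>-algebra \<open>R\<close>:
  the free \<open>R\<close>-module on \<open>e\<close>, its elements given by their coordinates, with the structure
  constants of \<open>A\<close>.\<close>

definition extend_scalars ::
  "('k::field, 'a) module \<Rightarrow> ('i::finite \<Rightarrow> 'a) \<Rightarrow> ('k, 'u) module \<Rightarrow> ('u, 'i \<Rightarrow> 'u) module" where
  "extend_scalars A e R = \<lparr>
     carrier = {v. range v \<subseteq> carrier R},
     monoid.mult = (\<lambda>v w l. \<Oplus>\<^bsub>R\<^esub>i\<in>UNIV. \<Oplus>\<^bsub>R\<^esub>m\<in>UNIV.
        (v i \<otimes>\<^bsub>R\<^esub> w m) \<otimes>\<^bsub>R\<^esub> struct_map R (coord A e (e i \<otimes>\<^bsub>A\<^esub> e m) l)),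
     one = (\<lambda>l. struct_map R (coord A e \<one>\<^bsub>A\<^esub> l)),
     ring.zero = (\<lambda>l. \<zero>\<^bsub>R\<^esub>),
     add = (\<lambda>v w l. v l \<oplus>\<^bsub>R\<^esub> w l),
     module.smult = (\<lambda>r v l. r \<otimes>\<^bsub>R\<^esub> v l)\<rparr>"

text \<open>The \<open>R\<close>-linear extension of a \<open>k\<close>-linear endomorphism \<open>t\<close> of \<open>A\<close>.\<close>

definition extend_linear ::
  "('k::field, 'a) module \<Rightarrow> ('i::finite \<Rightarrow> 'a) \<Rightarrow> ('k, 'u) module \<Rightarrow> ('a \<Rightarrow> 'a)
     \<Rightarrow> ('i \<Rightarrow> 'u) \<Rightarrow> ('i \<Rightarrow> 'u)" where
  "extend_linear A e R t v = (\<lambda>l. \<Oplus>\<^bsub>R\<^esub>i\<in>UNIV. v i \<otimes>\<^bsub>R\<^esub> struct_map R (coord A e (t (e i)) l))"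

abbreviation alg_over_ac ::
  "('k::field, 'a) module \<Rightarrow> ('i::finite \<Rightarrow> 'a) \<Rightarrow> ('k alg_closure, 'i \<Rightarrow> 'k alg_closure) module"
  where
  "alg_over_ac A e \<equiv> extend_scalars A e (field_alg to_ac)"

abbreviation linear_over_ac ::
  "('k::field, 'a) module \<Rightarrow> ('i::finite \<Rightarrow> 'a) \<Rightarrow> ('a \<Rightarrow> 'a)
     \<Rightarrow> ('i \<Rightarrow> 'k alg_closure) \<Rightarrow> ('i \<Rightarrow> 'k alg_closure)" where
  "linear_over_ac A e t \<equiv> extend_linear A e (field_alg to_ac) t"

text \<open>The image in the extension to \<open>R\<close> of an element with coordinates \<open>x\<close> over the base field.\<close>

definition base_point :: "('c, 'u) module \<Rightarrow> ('i \<Rightarrow> 'c) \<Rightarrow> 'i \<Rightarrow> 'u" where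
  "base_point R x = (\<lambda>l. struct_map R (x l))"


section \<open>Octonion algebras\<close>

text \<open>The quaternion algebra \<open>(a, b)\<close> (characteristic not two) in the basis \<open>1, i, j, ij\<close>
  with \<open>i\<^sup>2 = a\<close>, \<open>j\<^sup>2 = b\<close>, \<open>ij = -ji\<close>.\<close>

type_synonym 'k quat = "'k \<times> 'k \<times> 'k \<times> 'k"

definition quat_alg :: "'k::field \<Rightarrow> 'k \<Rightarrow> ('k, 'k quat) module" where
  "quat_alg a b = \<lparr>
     carrier = UNIV,
     monoid.mult = (\<lambda>(x0, x1, x2, x3) (y0, y1, y2, y3).
       (x0 * y0 + a * x1 * y1 + b * x2 * y2 - a * b * x3 * y3,
        x0 * y1 + x1 * y0 - b * x2 * y3 + b * x3 * y2,
        x0 * y2 + x2 * y0 + a * x1 * y3 - a * x3 * y1,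
        x0 * y3 + x3 * y0 + x1 * y2 - x2 * y1)),
     one = (1, 0, 0, 0),
     ring.zero = (0, 0, 0, 0),
     add = (\<lambda>(x0, x1, x2, x3) (y0, y1, y2, y3). (x0 + y0, x1 + y1, x2 + y2, x3 + y3)),
     module.smult = (\<lambda>c (x0, x1, x2, x3). (c * x0, c * x1, c * x2, c * x3))\<rparr>"

definition quat_conj :: "'k::field quat \<Rightarrow> 'k quat" where
  "quat_conj = (\<lambda>(x0, x1, x2, x3). (x0, - x1, - x2, - x3))"

definition cayley_dickson ::
  "('k, 'q) module \<Rightarrow> ('q \<Rightarrow> 'q) \<Rightarrow> 'k \<Rightarrow> ('k, 'q \<times> 'q) module" where
  "cayley_dickson Q s c = \<lparr>
     carrier = carrier Q \<times> carrier Q,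
     monoid.mult = (\<lambda>(u, v) (u', v').
       (u \<otimes>\<^bsub>Q\<^esub> u' \<oplus>\<^bsub>Q\<^esub> c \<odot>\<^bsub>Q\<^esub> (s v' \<otimes>\<^bsub>Q\<^esub> v), v' \<otimes>\<^bsub>Q\<^esub> u \<oplus>\<^bsub>Q\<^esub> v \<otimes>\<^bsub>Q\<^esub> s u')),
     one = (\<one>\<^bsub>Q\<^esub>, \<zero>\<^bsub>Q\<^esub>),
     ring.zero = (\<zero>\<^bsub>Q\<^esub>, \<zero>\<^bsub>Q\<^esub>),
     add = (\<lambda>(u, v) (u', v'). (u \<oplus>\<^bsub>Q\<^esub> u', v \<oplus>\<^bsub>Q\<^esub> v')),
     module.smult = (\<lambda>r (u, v). (r \<odot>\<^bsub>Q\<^esub> u, r \<odot>\<^bsub>Q\<^esub> v))\<rparr>"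

definition cd_conj :: "('k, 'q) module \<Rightarrow> ('q \<Rightarrow> 'q) \<Rightarrow> 'q \<times> 'q \<Rightarrow> 'q \<times> 'q" where
  "cd_conj Q s = (\<lambda>(u, v). (s u, \<ominus>\<^bsub>Q\<^esub> v))"

text \<open>\<open>A\<close> is an octonion algebra with standard involution \<open>\<sigma>\<close>.\<close>

definition octonion_algebra :: "('k::field, 'a) module \<Rightarrow> ('a \<Rightarrow> 'a) \<Rightarrow> bool" where
  "octonion_algebra A \<sigma> \<longleftrightarrow> unital_algebra ring_of_type_algebra A \<and>
     (\<exists>a b c. a \<noteq> 0 \<and> b \<noteq> 0 \<and> c \<noteq> 0 \<and>
        (\<exists>\<psi>\<in>alg_isos ring_of_type_algebra (cayley_dickson (quat_alg a b) quat_conj c) A.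
           \<forall>u\<in>carrier (cayley_dickson (quat_alg a b) quat_conj c).
             \<sigma> (\<psi> u) = \<psi> (cd_conj (quat_alg a b) quat_conj u)))"

text \<open>Norm and bilinear form take values in the line spanned by \<open>1\<close>, which is not identified
  with the base field here.\<close>

definition norm_form :: "('c, 'a) module \<Rightarrow> ('a \<Rightarrow> 'a) \<Rightarrow> 'a \<Rightarrow> 'a" where
  "norm_form A \<sigma> u = u \<otimes>\<^bsub>A\<^esub> \<sigma> u"

definition bilin_form :: "('c::field, 'a) module \<Rightarrow> ('a \<Rightarrow> 'a) \<Rightarrow> 'a \<Rightarrow> 'a \<Rightarrow> 'a" where
  "bilin_form A \<sigma> u v = (1 / 2) \<odot>\<^bsub>A\<^esub> (u \<otimes>\<^bsub>A\<^esub> \<sigma> v \<oplus>\<^bsub>A\<^esub> v \<otimes>\<^bsub>A\<^esub> \<sigma> u)"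

definition perpendicular :: "('c::field, 'a) module \<Rightarrow> ('a \<Rightarrow> 'a) \<Rightarrow> 'a \<Rightarrow> 'a \<Rightarrow> bool" where
  "perpendicular A \<sigma> u v \<longleftrightarrow> bilin_form A \<sigma> u v = \<zero>\<^bsub>A\<^esub>"


section \<open>Quadratic etale algebras\<close>

definition split_alg :: "('c::field, 'i \<Rightarrow> 'c) module" where
  "split_alg = \<lparr>carrier = UNIV, monoid.mult = (\<lambda>v w l. v l * w l), one = (\<lambda>l. 1),
     ring.zero = (\<lambda>l. 0), add = (\<lambda>v w l. v l + w l),
     module.smult = (\<lambda>c v l. c * v l)\<rparr>"

text \<open>A finite-dimensional commutative algebra is etale if it becomes isomorphic to a power of
  the base field over an algebraic closure; quadratic means of dimension two.\<close>

definition quadratic_etale :: "('k::field, 'a) module \<Rightarrow> bool" where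
  "quadratic_etale A \<longleftrightarrow> comm_alg A \<and>
     (\<exists>b :: 2 \<Rightarrow> 'a. is_basis A b \<and>
        alg_isos ring_of_type_algebra (alg_over_ac A b)
          (split_alg :: ('k alg_closure, 2 \<Rightarrow> 'k alg_closure) module) \<noteq> {})"

text \<open>Every two-dimensional algebra has an isomorphic copy with carrier in \<open>'k \<times> 'k\<close>.\<close>

definition embedded_quadratic_etale :: "('k::field, 'o) module \<Rightarrow> ('k, 'k \<times> 'k) module set" where
  "embedded_quadratic_etale \<O> =
     {A. quadratic_etale A \<and> alg_embeddings ring_of_type_algebra A \<O> \<noteq> {}}"

definition etale_iso :: "('k::field, 'o) module \<Rightarrow> ('k, 'k \<times> 'k) module rel" where
  "etale_iso \<O> = {(A, B). A \<in> embedded_quadratic_etale \<O> \<and> B \<in> embedded_quadratic_etale \<O> \<and>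
     alg_isos ring_of_type_algebra A B \<noteq> {}}"


section \<open>Algebraic groups as functors of points\<close>

text \<open>A group functor on the commutative \<open>'c\<close>-algebras with carrier in \<open>'u\<close>, with points in
  \<open>'g\<close>. The type \<open>'u\<close> acts as the universe of test algebras: over an infinite
  field \<open>'c\<close>, every algebra of finite type has a copy with carrier in \<open>'u\<close> as soon as \<open>'c\<close>
  injects into \<open>'u\<close>.\<close>

record ('c, 'u, 'g) grp_functor =
  pts :: "('c, 'u) module \<Rightarrow> 'g monoid"
  pmap :: "('c, 'u) module \<Rightarrow> ('c, 'u) module \<Rightarrow> ('u \<Rightarrow> 'u) \<Rightarrow> 'g \<Rightarrow> 'g"

definition is_grp_functor :: "('c::field, 'u, 'g) grp_functor \<Rightarrow> bool" where
  "is_grp_functor F \<longleftrightarrow>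
     (\<forall>R. comm_alg R \<longrightarrow> group (pts F R)) \<and>
     (\<forall>R S. comm_alg R \<and> comm_alg S \<longrightarrow> (\<forall>h\<in>homs R S. pmap F R S h \<in> hom (pts F R) (pts F S))) \<and>
     (\<forall>R. comm_alg R \<longrightarrow> (\<forall>p\<in>carrier (pts F R). pmap F R R (\<lambda>r\<in>carrier R. r) p = p)) \<and>
     (\<forall>R S T. comm_alg R \<and> comm_alg S \<and> comm_alg T \<longrightarrow>
        (\<forall>h\<in>homs R S. \<forall>h'\<in>homs S T. \<forall>p\<in>carrier (pts F R).
           pmap F R T (compose (carrier R) h' h) p = pmap F S T h' (pmap F R S h p)))"

text \<open>An algebraic group is an affine group scheme of finite type: a group functor that is
  representable by a finitely generated algebra.\<close>

definition representable_fin_type :: "('c::field, 'u, 'g) grp_functor \<Rightarrow> bool" where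
  "representable_fin_type F \<longleftrightarrow>
     (\<exists>A :: ('c, 'u) module. comm_alg A \<and> finitely_generated_alg A \<and>
        (\<exists>\<eta>. (\<forall>R. comm_alg R \<longrightarrow> bij_betw (\<eta> R) (homs A R) (carrier (pts F R))) \<and>
             (\<forall>R S. comm_alg R \<and> comm_alg S \<longrightarrow> (\<forall>h\<in>homs R S. \<forall>p\<in>homs A R.
                \<eta> S (compose (carrier A) h p) = pmap F R S h (\<eta> R p)))))"

definition algebraic_group :: "('c::field, 'u, 'g) grp_functor \<Rightarrow> bool" where
  "algebraic_group F \<longleftrightarrow> is_grp_functor F \<and> representable_fin_type F"

type_synonym ('c, 'u, 'g, 'h) pts_map = "('c, 'u) module \<Rightarrow> 'g \<Rightarrow> 'h"

definition grp_morphism ::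
  "('c::field, 'u, 'g) grp_functor \<Rightarrow> ('c, 'u, 'h) grp_functor \<Rightarrow> ('c, 'u, 'g, 'h) pts_map \<Rightarrow> bool"
  where
  "grp_morphism F F' f \<longleftrightarrow>
     (\<forall>R. comm_alg R \<longrightarrow> f R \<in> hom (pts F R) (pts F' R)) \<and>
     (\<forall>R S. comm_alg R \<and> comm_alg S \<longrightarrow> (\<forall>h\<in>homs R S. \<forall>p\<in>carrier (pts F R).
        f S (pmap F R S h p) = pmap F' R S h (f R p)))"

definition grp_isomorphism ::
  "('c::field, 'u, 'g) grp_functor \<Rightarrow> ('c, 'u, 'h) grp_functor \<Rightarrow> ('c, 'u, 'g, 'h) pts_map \<Rightarrow> bool"
  where
  "grp_isomorphism F F' f \<longleftrightarrow> grp_morphism F F' f \<and>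
     (\<forall>R. comm_alg R \<longrightarrow> f R \<in> iso (pts F R) (pts F' R))"

definition base_change ::
  "('k \<Rightarrow> 'c) \<Rightarrow> ('k, 'u, 'g) grp_functor \<Rightarrow> ('c, 'u, 'g) grp_functor" where
  "base_change j F = \<lparr>pts = (\<lambda>R. pts F (restrict_scalars j R)),
     pmap = (\<lambda>R S. pmap F (restrict_scalars j R) (restrict_scalars j S))\<rparr>"

definition base_change_map ::
  "('k \<Rightarrow> 'c) \<Rightarrow> ('k, 'u, 'g, 'h) pts_map \<Rightarrow> ('c, 'u, 'g, 'h) pts_map" where
  "base_change_map j f = (\<lambda>R. f (restrict_scalars j R))"


section \<open>The automorphism group of an algebra, stabilizers and conjugacy\<close>

definition aut_pts ::
  "('k::field, 'a) module \<Rightarrow> ('i::finite \<Rightarrow> 'a) \<Rightarrow> ('k, 'u) module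
     \<Rightarrow> (('i \<Rightarrow> 'u) \<Rightarrow> ('i \<Rightarrow> 'u)) monoid" where
  "aut_pts A e R = (BijGroup (carrier (extend_scalars A e R)))
     \<lparr>carrier := alg_isos R (extend_scalars A e R) (extend_scalars A e R)\<rparr>"

text \<open>The \<open>S\<close>-linear map that agrees with \<open>g\<close> on the basis, up to \<open>h\<close>.\<close>

definition aut_map ::
  "('k::field, 'a) module \<Rightarrow> ('i::finite \<Rightarrow> 'a) \<Rightarrow> ('k, 'u) module \<Rightarrow> ('k, 'w) module \<Rightarrow> ('u \<Rightarrow> 'w)
     \<Rightarrow> (('i \<Rightarrow> 'u) \<Rightarrow> ('i \<Rightarrow> 'u)) \<Rightarrow> (('i \<Rightarrow> 'w) \<Rightarrow> ('i \<Rightarrow> 'w))" where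
  "aut_map A e R S h g = (\<lambda>v\<in>carrier (extend_scalars A e S). \<lambda>l.
     \<Oplus>\<^bsub>S\<^esub>i\<in>UNIV. v i \<otimes>\<^bsub>S\<^esub> h (g (\<lambda>m. if m = i then \<one>\<^bsub>R\<^esub> else \<zero>\<^bsub>R\<^esub>) l))"

definition aut_group ::
  "('k::field, 'a) module \<Rightarrow> ('i::finite \<Rightarrow> 'a) \<Rightarrow> ('k, 'u, ('i \<Rightarrow> 'u) \<Rightarrow> ('i \<Rightarrow> 'u)) grp_functor"
  where
  "aut_group A e = \<lparr>pts = aut_pts A e, pmap = aut_map A e\<rparr>"

definition stabilizer ::
  "('c, 'u, ('i \<Rightarrow> 'u) \<Rightarrow> ('i \<Rightarrow> 'u)) grp_functor \<Rightarrow> ('i \<Rightarrow> 'c)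
     \<Rightarrow> ('c, 'u, ('i \<Rightarrow> 'u) \<Rightarrow> ('i \<Rightarrow> 'u)) grp_functor" where
  "stabilizer F x = F\<lparr>pts := (\<lambda>R. (pts F R)
     \<lparr>carrier := {g \<in> carrier (pts F R). g (base_point R x) = base_point R x}\<rparr>)\<rparr>"

text \<open>A triple \<open>(H, G, f)\<close> whose target \<open>G\<close> is the automorphism group of the given algebra is
  represented by the pair \<open>(H, f)\<close>.\<close>

type_synonym ('c, 'u, 'i) grp_over =
  "('c, 'u, ('i \<Rightarrow> 'u) \<Rightarrow> ('i \<Rightarrow> 'u)) grp_functor
   \<times> ('c, 'u, ('i \<Rightarrow> 'u) \<Rightarrow> ('i \<Rightarrow> 'u), ('i \<Rightarrow> 'u) \<Rightarrow> ('i \<Rightarrow> 'u)) pts_map"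

text \<open>Conjugacy, over the extension field \<open>'c\<close> of \<open>'k\<close>, of groups over \<open>'c\<close> mapping to the
  automorphism group of \<open>A\<close>, by a \<open>'c\<close>-rational point of the latter.\<close>

definition conjugate_over ::
  "('k::field \<Rightarrow> 'c::field) \<Rightarrow> ('k, 'a) module \<Rightarrow> ('i::finite \<Rightarrow> 'a)
     \<Rightarrow> ('c, 'u, 'i) grp_over \<Rightarrow> ('c, 'u, 'i) grp_over \<Rightarrow> bool" where
  "conjugate_over j A e = (\<lambda>(H, f) (H', f').
     \<exists>g\<in>carrier (aut_pts A e (field_alg j)). \<exists>\<phi>. grp_isomorphism H H' \<phi> \<and>
       (\<forall>R. comm_alg R \<longrightarrow> (\<forall>p\<in>carrier (pts H R).
          let G\<^sub>R = pts (base_change j (aut_group A e)) R;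
              g\<^sub>R = aut_map A e (field_alg j) (restrict_scalars j R) (struct_map R) g
          in g\<^sub>R \<otimes>\<^bsub>G\<^sub>R\<^esub> f R p \<otimes>\<^bsub>G\<^sub>R\<^esub> inv\<^bsub>G\<^sub>R\<^esub> g\<^sub>R = f' R (\<phi> R p))))"

definition stab_inclusion ::
  "('k::field \<Rightarrow> 'c::field) \<Rightarrow> ('k, 'a) module \<Rightarrow> ('i::finite \<Rightarrow> 'a) \<Rightarrow> ('i \<Rightarrow> 'c)
     \<Rightarrow> ('c, 'u, 'i) grp_over" where
  "stab_inclusion j A e x = (stabilizer (base_change j (aut_group A e)) x, \<lambda>R p. p)"

text \<open>The triples over \<open>'k\<close> that become conjugate over the algebraic closure to the stabilizer
  of \<open>x\<close>.\<close>

definition forms_of_stabilizer ::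
  "('k::field, 'a) module \<Rightarrow> ('i::finite \<Rightarrow> 'a) \<Rightarrow> ('i \<Rightarrow> 'k alg_closure)
     \<Rightarrow> ('k, 'u, 'i) grp_over set" where
  "forms_of_stabilizer A e x = {(H, f). algebraic_group H \<and> grp_morphism H (aut_group A e) f \<and>
     conjugate_over to_ac A e (base_change to_ac H, base_change_map to_ac f)
       (stab_inclusion to_ac A e x)}"

definition forms_conj ::
  "('k::field, 'a) module \<Rightarrow> ('i::finite \<Rightarrow> 'a) \<Rightarrow> ('i \<Rightarrow> 'k alg_closure)
     \<Rightarrow> ('k, 'u, 'i) grp_over rel" where
  "forms_conj A e x = {(t, t'). t \<in> forms_of_stabilizer A e x \<and> t' \<in> forms_of_stabilizer A e x \<and>
     conjugate_over id A e t t'}"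

end

theory Submission
  imports Defs "HOL-Library.Product_Plus"
begin

text \<open>
Call an octonion pure if it is perpendicular to \<open>1\<close>. Both sets in the bijection are classified by
the same invariant, the norm of a pure element modulo nonzero squares.

On the side of algebras, a pure \<open>y\<close> with \<open>n = N(y) \<noteq> 0\<close> satisfies \<open>y\<^sup>2 = - n\<close> and so generates a copy of
the etale algebra \<open>quad n\<close>. Conversely, an etale algebra is reduced (\<open>etale_reduced\<close>); hence an embedded
one meets the pure elements in a line on which the norm does not vanish, and it is isomorphic to
\<open>quad n\<close> for every nonzero value \<open>n\<close> of the norm on that line (\<open>pure_norm_ofD\<close>). Finally \<open>quad n\<close> and
\<open>quad m\<close> are isomorphic exactly if \<open>m / n\<close> is a nonzero square (\<open>quad_iso_iff\<close>).

On the side of groups, two properties of octonions over a field \<open>K\<close> of characteristic zero decide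
everything. The group of automorphisms acts transitively on the pure elements of a given nonzero norm
(\<open>transitive\<close>), and a pure element that is fixed by the stabilizer of \<open>y\<close> is a multiple of \<open>y\<close>
(\<open>fixed_by_stabilizer\<close>). If \<open>g\<close> conjugates the stabilizer of \<open>y\<close> to that of \<open>y'\<close>, then both \<open>g y\<close> and \<open>y'\<close>
are fixed by the same group, so they are proportional and \<open>N(y') = t\<^sup>2 N(y)\<close>; conversely this equation
yields \<open>g\<close> with \<open>g (t y) = y'\<close> (\<open>stab_conj_iff\<close>). Over the algebraic closure all nonzero norms
differ by squares, so the stabilizer of every rational pure \<open>y\<close> of nonzero norm is a form of the given
stabilizer (\<open>stab_form\<close>).

It remains to see that each form \<open>(H, f)\<close> is such a stabilizer (\<open>form_onto_stab\<close>). Over the closure, \<open>f\<close>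
identifies \<open>H\<close> with the stabilizer of some pure \<open>x'\<close>. Apply to the coordinates of \<open>x'\<close> a \<open>k\<close>-linear
functional on the closure that takes the value \<open>1\<close> at one of them. The result \<open>y\<close> is a nonzero rational
vector. A point of \<open>H\<close> over a \<open>k\<close>-algebra \<open>R\<close> acts by a matrix over \<open>R\<close> that fixes \<open>x'\<close>, and the functional
is \<open>R\<close>-linear after extension of scalars, so the matrix fixes \<open>y\<close> too (\<open>functional_point_fixed\<close>). Then
the stabilizer of \<open>x'\<close> fixes \<open>y\<close>, so \<open>y\<close> is proportional to \<open>x'\<close> and both have the same stabilizer over
the closure. That \<open>f\<close> maps \<open>H(R)\<close> bijectively onto the stabilizer of \<open>y\<close> follows by faithfully flat
descent: \<open>R\<close> is the equalizer of the two maps from its extension \<open>T\<close> to the closure to the extension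
of \<open>T\<close>, and \<open>H\<close> is representable (\<open>descent_onto_stab\<close>).

The test algebras all have their carrier in one type. The coordinate ring of a stabilizer and the
extension of an algebra to the closure have to be realized inside this type; both are obtained as
quotients of algebras of terms by the kernel of an interpretation, with terms encoded injectively
(\<open>coded_algebra\<close>).
\<close>

section \<open>Octonions as pairs of quaternions\<close>

type_synonym 'f oct = "'f quat \<times> 'f quat"

abbreviation CD :: "'f::field \<Rightarrow> 'f \<Rightarrow> 'f \<Rightarrow> ('f, 'f oct) module" where
  "CD a b c \<equiv> cayley_dickson (quat_alg a b) quat_conj c"

definition omult :: "'f::field \<Rightarrow> 'f \<Rightarrow> 'f \<Rightarrow> 'f oct \<Rightarrow> 'f oct \<Rightarrow> 'f oct" where
  "omult a b c = monoid.mult (CD a b c)"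

definition oscale :: "'f::field \<Rightarrow> 'f oct \<Rightarrow> 'f oct" where
  "oscale r = (\<lambda>((x0, x1, x2, x3), (x4, x5, x6, x7)).
     ((r * x0, r * x1, r * x2, r * x3), (r * x4, r * x5, r * x6, r * x7)))"

definition oone :: "'f::field oct" where
  "oone = ((1, 0, 0, 0), (0, 0, 0, 0))"

definition oconj :: "'f::field oct \<Rightarrow> 'f oct" where
  "oconj = (\<lambda>(u, v). (quat_conj u, - v))"

text \<open>The bilinear form of the norm, whose diagonal is the norm form of the quaternion algebra minus \<open>c\<close> times
a second copy of it.\<close>

definition obil :: "'f::field \<Rightarrow> 'f \<Rightarrow> 'f \<Rightarrow> 'f oct \<Rightarrow> 'f oct \<Rightarrow> 'f" where
  "obil a b c = (\<lambda>((x0, x1, x2, x3), (x4, x5, x6, x7)) ((y0, y1, y2, y3), (y4, y5, y6, y7)).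
     x0 * y0 - a * x1 * y1 - b * x2 * y2 + a * b * x3 * y3
     - c * (x4 * y4 - a * x5 * y5 - b * x6 * y6 + a * b * x7 * y7))"

lemma quat_alg_simps:
  "carrier (quat_alg a b) = UNIV"
  "\<one>\<^bsub>quat_alg a b\<^esub> = (1, 0, 0, 0)"
  "\<zero>\<^bsub>quat_alg a b\<^esub> = 0"
  "u \<oplus>\<^bsub>quat_alg a b\<^esub> v = u + v"
  by (auto simp: quat_alg_def zero_prod_def plus_prod_def split: prod.splits)

lemma quat_alg_minus: "\<ominus>\<^bsub>quat_alg a b\<^esub> v = - v"
proof -
  have "\<exists>y. y + x = 0" for x :: "'a quat"
    by (rule exI[of _ "- x"]) simp
  then have "abelian_group (quat_alg a b)"
    by (intro abelian_groupI; simp only: quat_alg_simps) (auto simp: add.assoc add.commute)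
  then interpret Q: abelian_group "quat_alg a b" .
  show ?thesis
    by (rule Q.minus_equality) (auto simp: quat_alg_simps)
qed

lemma CD_simps:
  "carrier (CD a b c) = UNIV"
  "monoid.mult (CD a b c) = omult a b c"
  "\<one>\<^bsub>CD a b c\<^esub> = oone"
  "\<zero>\<^bsub>CD a b c\<^esub> = 0"
  "u \<oplus>\<^bsub>CD a b c\<^esub> v = u + v"
  "r \<odot>\<^bsub>CD a b c\<^esub> v = oscale r v"
  by (auto simp: cayley_dickson_def quat_alg_def oone_def oscale_def omult_def zero_prod_def
      plus_prod_def split: prod.splits)

lemma cd_conj_eq: "cd_conj (quat_alg a b) quat_conj = oconj"
  by (auto simp: cd_conj_def oconj_def quat_alg_minus)

text \<open>The multiplication table, for identities that are best checked in the eight coordinates.\<close>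

lemma omult_Pair:
  "omult a b c ((x0, x1, x2, x3), (x4, x5, x6, x7)) ((y0, y1, y2, y3), (y4, y5, y6, y7)) =
    ((x0*y0 + a*x1*y1 + b*x2*y2 - a*b*x3*y3 + c*(y4*x4 - a*y5*x5 - b*y6*x6 + a*b*y7*x7),
      x0*y1 + x1*y0 - b*x2*y3 + b*x3*y2 + c*(y4*x5 - y5*x4 + b*y6*x7 - b*y7*x6),
      x0*y2 + x2*y0 + a*x1*y3 - a*x3*y1 + c*(y4*x6 - y6*x4 - a*y5*x7 + a*y7*x5),
      x0*y3 + x3*y0 + x1*y2 - x2*y1 + c*(y4*x7 - y7*x4 - y5*x6 + y6*x5)),
     (y4*x0 + a*y5*x1 + b*y6*x2 - a*b*y7*x3 + x4*y0 - a*x5*y1 - b*x6*y2 + a*b*x7*y3,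
      y4*x1 + y5*x0 - b*y6*x3 + b*y7*x2 - x4*y1 + x5*y0 + b*x6*y3 - b*x7*y2,
      y4*x2 + y6*x0 + a*y5*x3 - a*y7*x1 - x4*y2 + x6*y0 - a*x5*y3 + a*x7*y1,
      y4*x3 + y7*x0 + y5*x2 - y6*x1 - x4*y3 + x7*y0 - x5*y2 + x6*y1))"
  by (simp add: omult_def cayley_dickson_def quat_alg_def quat_conj_def algebra_simps)

lemmas oct_Pair_simps = omult_Pair oscale_def oone_def oconj_def quat_conj_def obil_def zero_prod_def

lemma oct_cases: obtains x0 x1 x2 x3 x4 x5 x6 x7 where "x = ((x0, x1, x2, x3), (x4, x5, x6, x7))"
  by (cases x) (metis surj_pair)

lemma omult_one [simp]: "omult a b c oone x = x" "omult a b c x oone = x"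
  by (cases x rule: oct_cases; simp add: oct_Pair_simps)+

lemma oscale_simps:
  "oscale r (x + y) = oscale r x + oscale r y"
  "oscale (r + s) x = oscale r x + oscale s x"
  "oscale r (oscale s x) = oscale (r * s) x"
  "oscale 1 x = x" "oscale 0 x = 0" "oscale r 0 = 0" "oscale (- 1) x = - x"
  by (cases x rule: oct_cases; cases y rule: oct_cases; simp add: oct_Pair_simps algebra_simps)+

lemma oconj_simps:
  "oconj (x + y) = oconj x + oconj y" "oconj (oscale r x) = oscale r (oconj x)"
  "oconj (oconj x) = x" "oconj oone = oone"
  by (cases x rule: oct_cases; cases y rule: oct_cases; simp add: oct_Pair_simps algebra_simps)+

section \<open>Identities in quaternion and octonion algebras\<close>

text \<open>The identities for octonion products follow from the associativity of the quaternions by way of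
\<open>omult_quat\<close>, the multiplication of pairs.\<close>

definition qmult :: "'f::field \<Rightarrow> 'f \<Rightarrow> 'f quat \<Rightarrow> 'f quat \<Rightarrow> 'f quat" where
  "qmult a b = monoid.mult (quat_alg a b)"

definition qscale :: "'f::field \<Rightarrow> 'f quat \<Rightarrow> 'f quat" where
  "qscale r = (\<lambda>(x0, x1, x2, x3). (r * x0, r * x1, r * x2, r * x3))"

definition qnorm :: "'f::field \<Rightarrow> 'f \<Rightarrow> 'f quat \<Rightarrow> 'f" where
  "qnorm a b = (\<lambda>(x0, x1, x2, x3). x0 * x0 - a * x1 * x1 - b * x2 * x2 + a * b * x3 * x3)"

lemma quat_cases: obtains x0 x1 x2 x3 where "x = (x0, x1, x2, x3)"
  by (cases x)

lemmas quat_Pair_simps = qmult_def quat_alg_def qscale_def qnorm_def quat_conj_def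

lemma qmult_assoc: "qmult a b (qmult a b x y) z = qmult a b x (qmult a b y z)"
  by (cases x rule: quat_cases; cases y rule: quat_cases; cases z rule: quat_cases)
    (simp add: quat_Pair_simps algebra_simps)

lemma qmult_simps:
  "qmult a b (x + y) z = qmult a b x z + qmult a b y z"
  "qmult a b z (x + y) = qmult a b z x + qmult a b z y"
  "qmult a b (qscale r x) y = qscale r (qmult a b x y)"
  "qmult a b x (qscale r y) = qscale r (qmult a b x y)"
  "qmult a b (- x) y = - qmult a b x y"
  "qmult a b x (- y) = - qmult a b x y"
  by (cases x rule: quat_cases; cases y rule: quat_cases; cases z rule: quat_cases;
      simp add: quat_Pair_simps algebra_simps)+

lemma quat_conj_simps:
  "quat_conj (x + y) = quat_conj x + quat_conj y" "quat_conj (qscale r x) = qscale r (quat_conj x)"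
  "quat_conj (- x) = - quat_conj x"
  "quat_conj (quat_conj x) = x" "quat_conj (qmult a b x y) = qmult a b (quat_conj y) (quat_conj x)"
  by (cases x rule: quat_cases; cases y rule: quat_cases; simp add: quat_Pair_simps algebra_simps)+

lemma quat_conj_cancel:
  "qmult a b (quat_conj x) (qmult a b x y) = qscale (qnorm a b x) y"
  "qmult a b x (qmult a b (quat_conj x) y) = qscale (qnorm a b x) y"
  "qmult a b y (qmult a b x (quat_conj x)) = qscale (qnorm a b x) y"
  "qmult a b y (qmult a b (quat_conj x) x) = qscale (qnorm a b x) y"
  by (cases x rule: quat_cases; cases y rule: quat_cases; simp add: quat_Pair_simps algebra_simps)+

lemma qscale_simps:
  "qscale r (x + y) = qscale r x + qscale r y" "qscale r (- x) = - qscale r x"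
  "qscale r (x - y) = qscale r x - qscale r y"
  "qscale (r - s) x = qscale r x - qscale s x" "qscale r (qscale s x) = qscale (r * s) x"
  by (cases x rule: quat_cases; cases y rule: quat_cases; simp add: quat_Pair_simps algebra_simps)+

lemma omult_quat:
  "omult a b c (u, v) (u', v') = (qmult a b u u' + qscale c (qmult a b (quat_conj v') v),
     qmult a b v' u + qmult a b v (quat_conj u'))"
  by (simp add: omult_def cayley_dickson_def qmult_def quat_alg_simps)
    (simp add: quat_alg_def qscale_def)

lemma oscale_quat: "oscale r (u, v) = (qscale r u, qscale r v)"
  by (cases u rule: quat_cases; cases v rule: quat_cases; simp add: oscale_def qscale_def)

lemma obil_quat: "obil a b c (u, v) (u, v) = qnorm a b u - c * qnorm a b v"
  by (cases u rule: quat_cases; cases v rule: quat_cases; simp add: obil_def qnorm_def)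

lemma omult_add_left: "omult a b c (x + y) z = omult a b c x z + omult a b c y z"
proof -
  obtain u v p q w m where "x = (u, v)" "y = (p, q)" "z = (w, m)" by (cases x, cases y, cases z)
  then show ?thesis
    by (simp add: omult_quat oscale_quat qmult_simps quat_conj_simps qscale_simps mult.commute)
qed

lemma omult_add_right: "omult a b c z (x + y) = omult a b c z x + omult a b c z y"
proof -
  obtain u v p q w m where "x = (u, v)" "y = (p, q)" "z = (w, m)" by (cases x, cases y, cases z)
  then show ?thesis
    by (simp add: omult_quat oscale_quat qmult_simps quat_conj_simps qscale_simps mult.commute)
qed

lemma omult_scale_left: "omult a b c (oscale r x) y = oscale r (omult a b c x y)"
proof -
  obtain u v p q where "x = (u, v)" "y = (p, q)" by (cases x, cases y)
  then show ?thesis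
    by (simp add: omult_quat oscale_quat qmult_simps quat_conj_simps qscale_simps mult.commute)
qed

lemma omult_scale_right: "omult a b c x (oscale r y) = oscale r (omult a b c x y)"
proof -
  obtain u v p q where "x = (u, v)" "y = (p, q)" by (cases x, cases y)
  then show ?thesis
    by (simp add: omult_quat oscale_quat qmult_simps quat_conj_simps qscale_simps mult.commute)
qed

lemma oconj_mult: "oconj (omult a b c x y) = omult a b c (oconj y) (oconj x)"
proof -
  obtain u v p q where "x = (u, v)" "y = (p, q)" by (cases x, cases y)
  then show ?thesis
    by (simp add: omult_quat oconj_def qmult_simps quat_conj_simps add.commute)
qed

text \<open>The form of alternativity that, with its linearizations below, takes the place of associativity in
computations with products of three octonions.\<close>

lemma oconj_mult_cancel: "omult a b c (oconj x) (omult a b c x y) = oscale (obil a b c x x) y"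
proof -
  obtain u v p q where "x = (u, v)" "y = (p, q)" by (cases x, cases y)
  then show ?thesis
    by (simp add: omult_quat oscale_quat obil_quat oconj_def qmult_simps quat_conj_simps
        qmult_assoc quat_conj_cancel qscale_simps)
qed

lemma obil_add_self: "obil a b c (x + z) (x + z) = obil a b c x x + 2 * obil a b c x z + obil a b c z z"
  by (cases x rule: oct_cases; cases z rule: oct_cases) (simp add: oct_Pair_simps algebra_simps)

text \<open>Polarization of \<open>oconj_mult_cancel\<close>. Its mirror image \<open>omult_mult_oconj\<close> follows by conjugation.\<close>

lemma oconj_mult_mult:
  "omult a b c (oconj x) (omult a b c z y) + omult a b c (oconj z) (omult a b c x y)
     = oscale (2 * obil a b c x z) y"
  using oconj_mult_cancel[of a b c "x + z" y]
  by (simp add: oconj_simps(1) omult_add_left omult_add_right obil_add_self oconj_mult_cancel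
      oscale_simps(2) add.assoc) (simp add: add.commute add.left_commute)

lemma obil_commute: "obil a b c x y = obil a b c y x"
  by (cases x rule: oct_cases; cases y rule: oct_cases) (simp add: oct_Pair_simps)

lemma obil_simps:
  "obil a b c (x + y) z = obil a b c x z + obil a b c y z"
  "obil a b c (oscale r x) z = r * obil a b c x z"
  "obil a b c (oconj x) (oconj y) = obil a b c x y"
  by (cases x rule: oct_cases; cases y rule: oct_cases; cases z rule: oct_cases;
      simp add: oct_Pair_simps algebra_simps)+

lemma obil_simps':
  "obil a b c z (x + y) = obil a b c z x + obil a b c z y"
  "obil a b c z (oscale r x) = r * obil a b c z x"
  by (metis obil_commute obil_simps(1), metis obil_commute obil_simps(2))

lemma oconj_eq: "oconj x = oscale (2 * obil a b c oone x) oone - x"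
  by (cases x rule: oct_cases) (simp add: oct_Pair_simps)

lemma omult_zero [simp]: "omult a b c 0 x = 0" "omult a b c x 0 = 0"
  using omult_scale_left[of a b c 0 0 x] omult_scale_right[of a b c x 0 0]
  by (simp_all add: oscale_simps)

lemma omult_minus: "omult a b c (- x) y = - omult a b c x y" "omult a b c x (- y) = - omult a b c x y"
  using omult_scale_left[of a b c "-1" x y] omult_scale_right[of a b c x "-1" y]
  by (simp_all add: oscale_simps)

lemma oscale_minus: "oscale r (- x) = - oscale r x" "oscale (- r) x = - oscale r x"
  by (cases x rule: oct_cases; simp add: oct_Pair_simps)+

lemma oscale_diff: "oscale r (x - y) = oscale r x - oscale r y"
  by (metis add_uminus_conv_diff oscale_minus(1) oscale_simps(1))

lemma oscale_diff_left: "oscale (r - s) x = oscale r x - oscale s x"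
  using oscale_simps(2)[of r "- s" x] by (simp add: oscale_minus)

lemma oconj_minus: "oconj (- x) = - oconj x"
  by (cases x rule: oct_cases) (simp add: oct_Pair_simps)

lemma obil_zero [simp]: "obil a b c 0 x = 0" "obil a b c x 0 = 0"
  using obil_simps(2)[of a b c 0 0 x] obil_simps'(2)[of a b c x 0 0] by (simp_all add: oscale_simps)

lemma obil_minus: "obil a b c (- x) y = - obil a b c x y" "obil a b c x (- y) = - obil a b c x y"
  using obil_simps(2)[of a b c "-1" x y] obil_simps'(2)[of a b c x "-1" y]
  by (simp_all add: oscale_simps)

lemma omult_mult_oconj:
  "omult a b c (omult a b c y x) (oconj z) + omult a b c (omult a b c y z) (oconj x)
     = oscale (2 * obil a b c x z) y"
  using arg_cong[OF oconj_mult_mult[of a b c "oconj x" "oconj z" "oconj y"], of oconj]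
  by (simp add: oconj_simps oconj_mult obil_simps(3) add.commute)

lemma omult_oconj_add:
  "omult a b c x (oconj z) + omult a b c z (oconj x) = oscale (2 * obil a b c x z) oone"
  using omult_mult_oconj[of a b c oone x z] by simp

section \<open>Doubling a subalgebra by a perpendicular element\<close>

lemma oct_double_cancel:
  fixes x :: "'f::field_char_0 oct"
  shows "x + x = oscale (2 * r) y \<longleftrightarrow> x = oscale r y"
  by (cases x rule: oct_cases; cases y rule: oct_cases)
    (auto simp: oct_Pair_simps mult_2 simp flip: mult_2 mult.assoc)

lemma omult_diff:
  "omult a b c (x - y) z = omult a b c x z - omult a b c y z"
  "omult a b c z (x - y) = omult a b c z x - omult a b c z y"
  by (simp_all only: diff_conv_add_uminus omult_add_left omult_add_right omult_minus)

locale oct_params =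
  fixes a b c :: "'f::field_char_0"
  assumes nz: "a \<noteq> 0" "b \<noteq> 0" "c \<noteq> 0"
begin

abbreviation mul (infixl "\<star>" 70) where "x \<star> y \<equiv> omult a b c x y"
abbreviation B where "B \<equiv> obil a b c"

lemma nondegenerate:
  assumes "\<And>w. B x w = 0" shows "x = 0"
proof (cases x rule: oct_cases)
  case (1 x0 x1 x2 x3 x4 x5 x6 x7)
  show ?thesis
    using nz assms[of "((1,0,0,0),(0,0,0,0))"] assms[of "((0,1,0,0),(0,0,0,0))"]
      assms[of "((0,0,1,0),(0,0,0,0))"] assms[of "((0,0,0,1),(0,0,0,0))"]
      assms[of "((0,0,0,0),(1,0,0,0))"] assms[of "((0,0,0,0),(0,1,0,0))"]
      assms[of "((0,0,0,0),(0,0,1,0))"] assms[of "((0,0,0,0),(0,0,0,1))"]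
    by (simp add: 1 oct_Pair_simps)
qed

lemma oconj_cancel: "oconj x \<star> (x \<star> y) = oscale (B x x) y"
  using oconj_mult_mult[of a b c x x y] by (simp add: oct_double_cancel)

lemma mult_oconj: "x \<star> oconj x = oscale (B x x) oone"
  using omult_oconj_add[of a b c x x] by (simp add: oct_double_cancel)

lemma pure_oconj: "B oone x = 0 \<Longrightarrow> oconj x = - x"
  using oconj_eq[of x a b c] by (simp add: oscale_simps)

lemma pure_square: "B oone x = 0 \<Longrightarrow> x \<star> x = oscale (- B x x) oone"
  using mult_oconj[of x] by (metis pure_oconj omult_minus(2) oscale_minus(2) minus_minus)

end

text \<open>If \<open>l\<close> is perpendicular to a subalgebra \<open>D\<close> that is closed under conjugation, then products of
elements of \<open>D + D l\<close> are given by the formulas of the Cayley-Dickson construction. All of them follow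
from the linearized cancellation law, in which the scalar term vanishes by perpendicularity.\<close>

locale doubling = oct_params a b c for a b c :: "'f::field_char_0" +
  fixes D :: "'f oct set" and l :: "'f oct"
  assumes one_D: "oone \<in> D" and mult_D: "\<And>u v. u \<in> D \<Longrightarrow> v \<in> D \<Longrightarrow> u \<star> v \<in> D"
    and conj_D: "\<And>u. u \<in> D \<Longrightarrow> oconj u \<in> D" and perp: "\<And>u. u \<in> D \<Longrightarrow> B u l = 0"
begin

lemma conj_l: "oconj l = - l"
  using perp[OF one_D] by (rule pure_oconj)

lemma doubling_swap: "u \<in> D \<Longrightarrow> u \<star> l = l \<star> oconj u"
  using omult_oconj_add[of a b c u l] perp[of u]
  by (simp add: conj_l omult_minus oscale_simps)

lemma doubling_left:
  assumes "u \<in> D" "v \<in> D" shows "u \<star> (v \<star> l) = (v \<star> u) \<star> l"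
proof -
  have "u \<star> (l \<star> oconj v) = l \<star> (oconj u \<star> oconj v)"
    using oconj_mult_mult[of a b c "oconj u" l "oconj v"] perp[of "oconj u"] assms conj_D
    by (simp add: oconj_simps oconj_mult conj_l omult_minus oscale_simps)
  then show ?thesis
    using assms by (simp add: doubling_swap mult_D oconj_simps oconj_mult)
qed

lemma doubling_right:
  assumes "u \<in> D" "v \<in> D" shows "(v \<star> l) \<star> u = (v \<star> oconj u) \<star> l"
  using omult_mult_oconj[of a b c v l "oconj u"] perp[of "oconj u"] assms conj_D
  by (simp add: oconj_simps oconj_mult conj_l omult_minus oscale_simps obil_commute[of a b c l "oconj u"])

lemma doubling_both:
  assumes "u \<in> D" "v \<in> D" shows "(u \<star> l) \<star> (v \<star> l) = oscale (- B l l) (oconj v \<star> u)"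
proof -
  have ul: "oconj (u \<star> l) = - (u \<star> l)"
    using assms by (simp add: oconj_mult oconj_simps conj_l omult_minus doubling_swap)
  have ll: "l \<star> (l \<star> w) = oscale (- B l l) w" for w
    using oconj_cancel[of l w] by (metis conj_l omult_minus(1) oscale_minus(2) minus_minus)
  \<comment> \<open>Identify the scalar \<open>2 * B (u \<star> l) l\<close> by evaluating its defining sum; it involves only \<open>B l l\<close> and the trace of \<open>u\<close>.\<close>
  have "oscale (2 * B (u \<star> l) l) oone = (u \<star> l) \<star> oconj l + l \<star> oconj (u \<star> l)"
    using omult_oconj_add[of a b c "u \<star> l" l] by simp
  also have "(u \<star> l) \<star> oconj l = oscale (B l l) u"
    using omult_mult_oconj[of a b c u l l] by (simp add: oct_double_cancel)
  also have "l \<star> oconj (u \<star> l) = oscale (B l l) (oconj u)"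
    using assms by (simp add: ul omult_minus) (simp add: doubling_swap ll oscale_minus)
  also have "oscale (B l l) u + oscale (B l l) (oconj u) = oscale (B l l * (2 * B oone u)) oone"
    by (simp add: oconj_eq[of u a b c] oscale_diff oscale_simps)
  finally have bul: "oscale (2 * B (u \<star> l) l) w = oscale (B l l * (2 * B oone u)) w" for w
    by (metis omult_one(1) omult_scale_left)
  \<comment> \<open>Move \<open>u \<star> l\<close> past \<open>l\<close> by polarized cancellation, so that the remaining product cancels \<open>l\<close>.\<close>
  have "(u \<star> l) \<star> (l \<star> oconj v) + l \<star> ((u \<star> l) \<star> oconj v) = - oscale (2 * B (u \<star> l) l) (oconj v)"
    using oconj_mult_mult[of a b c "oconj (u \<star> l)" l "oconj v"]
    by (simp add: oconj_simps(3) oconj_minus ul conj_l omult_minus obil_minus oscale_minus)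
  also have "l \<star> ((u \<star> l) \<star> oconj v) = oscale (- B l l) (oconj v \<star> oconj u)"
  proof -
    have "(u \<star> l) \<star> oconj v = l \<star> oconj (u \<star> v)"
      using assms doubling_right[of "oconj v" u] doubling_swap[of "u \<star> v"]
      by (simp add: conj_D mult_D oconj_simps)
    then show ?thesis by (simp add: ll oconj_mult)
  qed
  also have "oconj v \<star> oconj u = oscale (2 * B oone u) (oconj v) - oconj v \<star> u"
    by (simp add: oconj_eq[of u a b c] omult_diff omult_scale_right)
  finally have "(u \<star> l) \<star> (l \<star> oconj v) = - oscale (2 * B (u \<star> l) l) (oconj v)
      - oscale (- B l l) (oscale (2 * B oone u) (oconj v) - oconj v \<star> u)"
    by (simp only: eq_diff_eq)
  then show ?thesis
    using assms by (simp add: doubling_swap[of v] bul oscale_simps(3) oscale_minus oscale_diff)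
qed

end

section \<open>The isomorphism given by a basic triple\<close>

text \<open>Pure elements \<open>y\<close>, \<open>z\<close>, \<open>l\<close> of nonzero norm such that \<open>1\<close>, \<open>y\<close>, \<open>z\<close>, \<open>y z\<close>, \<open>l\<close> are pairwise
perpendicular. They play the role of the three generators of a Cayley-Dickson algebra with
parameters \<open>- N(y)\<close>, \<open>- N(z)\<close>, \<open>- N(l)\<close>: doubling the span of \<open>1\<close> and \<open>y\<close> by \<open>z\<close>, and the result by \<open>l\<close>,
gives the isomorphism \<open>theta\<close>.\<close>

locale basic_triple = oct_params a b c for a b c :: "'f::field_char_0" +
  fixes y z l :: "'f oct"
  assumes y: "B oone y = 0" "B y y \<noteq> 0"
    and z: "B oone z = 0" "B y z = 0" "B z z \<noteq> 0"
    and l: "B oone l = 0" "B y l = 0" "B z l = 0" "B (y \<star> z) l = 0" "B l l \<noteq> 0"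
begin

definition cmp :: "'f \<Rightarrow> 'f \<Rightarrow> 'f oct" where
  "cmp s t = oscale s oone + oscale t y"

definition emb :: "'f quat \<Rightarrow> 'f oct" where
  "emb = (\<lambda>(x0, x1, x2, x3). cmp x0 x1 + cmp x2 x3 \<star> z)"

definition theta :: "'f oct \<Rightarrow> 'f oct" where
  "theta = (\<lambda>(p, q). emb p + emb q \<star> l)"

lemma cmp_add: "cmp s t + cmp s' t' = cmp (s + s') (t + t')"
  by (simp add: cmp_def oscale_simps)

lemma cmp_minus: "- cmp s t = cmp (- s) (- t)"
  by (simp add: cmp_def oscale_minus)

lemma cmp_scale: "oscale r (cmp s t) = cmp (r * s) (r * t)"
  by (simp add: cmp_def oscale_simps)

lemma cmp_mult: "cmp s t \<star> cmp s' t' = cmp (s * s' - B y y * t * t') (s * t' + t * s')"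
  using pure_square[OF y(1)]
  by (simp add: cmp_def omult_add_left omult_add_right omult_scale_left omult_scale_right
      oscale_simps oscale_diff oscale_diff_left oscale_minus algebra_simps)

lemma cmp_conj: "oconj (cmp s t) = cmp s (- t)"
  using pure_oconj[OF y(1)] by (simp add: cmp_def oconj_simps oscale_minus)

lemma cmp_simps: "cmp 1 0 = oone" "cmp 0 0 = 0" "cmp 0 1 = y"
  by (simp_all add: cmp_def oscale_simps)

lemma cmp_range: "cmp s t \<in> range (\<lambda>(s, t). cmp s t)"
  by auto

sublocale D1: doubling a b c "range (\<lambda>(s, t). cmp s t)" z
proof unfold_locales
  show "oone \<in> range (\<lambda>(s, t). cmp s t)"
    using cmp_range[of 1 0] by (simp add: cmp_simps)
next
  fix u v assume "u \<in> range (\<lambda>(s, t). cmp s t)" "v \<in> range (\<lambda>(s, t). cmp s t)"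
  then obtain s t s' t' where "u = cmp s t" "v = cmp s' t'" by auto
  then show "u \<star> v \<in> range (\<lambda>(s, t). cmp s t)"
    by (simp only: cmp_mult cmp_range)
next
  fix u assume "u \<in> range (\<lambda>(s, t). cmp s t)"
  then obtain s t where u: "u = cmp s t" by auto
  show "oconj u \<in> range (\<lambda>(s, t). cmp s t)"
    by (simp only: u cmp_conj cmp_range)
  show "B u z = 0"
    by (simp add: u cmp_def obil_simps(1,2) z)
qed

lemmas D1_rules = D1.doubling_left[OF cmp_range cmp_range]
  D1.doubling_right[OF cmp_range cmp_range] D1.doubling_both[OF cmp_range cmp_range]

lemma emb_add: "emb (p + q) = emb p + emb q"
  by (cases p; cases q) (simp add: emb_def omult_add_left cmp_add[symmetric])

lemma emb_scale: "emb (qscale r p) = oscale r (emb p)"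
  by (cases p) (simp add: emb_def qscale_def omult_scale_left cmp_scale[symmetric] oscale_simps)

lemma emb_one: "emb (1, 0, 0, 0) = oone"
  by (simp add: emb_def cmp_simps)

lemma emb_conj: "oconj (emb p) = emb (quat_conj p)"
  using D1.doubling_swap[OF cmp_range]
  by (cases p) (simp add: emb_def quat_conj_def oconj_simps oconj_mult cmp_conj D1.conj_l omult_minus
      flip: cmp_minus)

lemma emb_mult: "emb p \<star> emb q = emb (qmult (- B y y) (- B z z) p q)"
proof -
  obtain p0 p1 p2 p3 q0 q1 q2 q3 where pq: "p = (p0, p1, p2, p3)" "q = (q0, q1, q2, q3)"
    by (cases p, cases q)
  have "emb p \<star> emb q = (cmp p0 p1 \<star> cmp q0 q1 + oscale (- B z z) (oconj (cmp q2 q3) \<star> cmp p2 p3))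
      + (cmp q2 q3 \<star> cmp p0 p1 + cmp p2 p3 \<star> oconj (cmp q0 q1)) \<star> z"
    by (simp add: pq emb_def omult_add_left omult_add_right D1_rules)
  also have "\<dots> = emb (qmult (- B y y) (- B z z) p q)"
    by (simp add: pq cmp_conj cmp_mult cmp_scale cmp_add)
      (simp add: emb_def qmult_def quat_alg_def algebra_simps)
  finally show ?thesis .
qed

sublocale D2: doubling a b c "range emb" l
proof unfold_locales
  show "oone \<in> range emb" using emb_one by (metis rangeI)
next
  fix u v assume "u \<in> range emb" "v \<in> range emb"
  then show "u \<star> v \<in> range emb" by (auto simp: emb_mult)
next
  fix u assume "u \<in> range emb"
  then show "oconj u \<in> range emb" "B u l = 0"
    by (auto simp: emb_conj)
      (auto simp: emb_def cmp_def omult_add_left omult_scale_left obil_simps(1,2) l)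
qed

lemma emb_zero: "emb (0, 0, 0, 0) = 0"
  by (simp add: emb_def cmp_simps)

lemma emb_minus: "emb (- p) = - emb p"
  using emb_scale[of "-1" p] by (cases p) (simp add: qscale_def oscale_simps)

lemma theta_add: "theta (v + w) = theta v + theta w"
proof -
  obtain p q p' q' where "v = (p, q)" "w = (p', q')" by (cases v, cases w)
  then show ?thesis by (simp add: theta_def omult_add_left emb_add)
qed

lemma theta_scale: "theta (oscale r v) = oscale r (theta v)"
proof -
  obtain p q where "v = (p, q)" by (cases v)
  then show ?thesis by (simp add: theta_def oscale_quat omult_scale_left emb_scale oscale_simps)
qed

lemma theta_one: "theta oone = oone"
proof -
  have "theta ((1, 0, 0, 0), (0, 0, 0, 0)) = oone"
    by (simp add: theta_def emb_one emb_zero)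
  then show ?thesis by (simp add: oone_def)
qed

lemma theta_y: "theta ((0, 1, 0, 0), (0, 0, 0, 0)) = y"
  by (simp add: theta_def emb_zero) (simp add: emb_def cmp_simps)

lemma theta_conj: "theta (oconj v) = oconj (theta v)"
proof -
  obtain p q where "v = (p, q)" by (cases v)
  moreover have "theta (oconj (p, q)) = emb (quat_conj p) + emb (- q) \<star> l"
    by (simp add: oconj_def theta_def)
  moreover have "theta (p, q) = emb p + emb q \<star> l"
    by (simp add: theta_def)
  ultimately show ?thesis
    by (simp add: oconj_simps oconj_mult emb_conj[symmetric] D2.conj_l omult_minus emb_minus
        D2.doubling_swap)
qed

lemma theta_mult: "theta v \<star> theta w = theta (omult (- B y y) (- B z z) (- B l l) v w)"
proof -
  obtain p q p' q' where vw: "v = (p, q)" "w = (p', q')" by (cases v, cases w)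
  have "theta v \<star> theta w = (emb p \<star> emb p' + oscale (- B l l) (oconj (emb q') \<star> emb q))
      + (emb q' \<star> emb p + emb q \<star> oconj (emb p')) \<star> l"
    by (simp add: vw theta_def omult_add_left omult_add_right D2.doubling_left D2.doubling_right
        D2.doubling_both)
  also have "\<dots> = theta (omult (- B y y) (- B z z) (- B l l) v w)"
    by (simp add: vw omult_quat emb_conj emb_mult flip: emb_scale emb_add) (simp add: theta_def)
  finally show ?thesis .
qed

sublocale T: oct_params "- B y y" "- B z z" "- B l l"
  by unfold_locales (simp_all add: y z l)

text \<open>As \<open>theta\<close> respects products and conjugates, it respects norms.\<close>

lemma theta_bil: "B (theta v) (theta w) = T.B v w"
proof -
  have N: "B (theta v) (theta v) = T.B v v" for v
  proof -
    have "oscale (B (theta v) (theta v)) oone = theta (oscale (T.B v v) oone)"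
      by (metis T.mult_oconj mult_oconj theta_conj theta_mult)
    then have "oscale (B (theta v) (theta v)) oone = oscale (T.B v v) oone"
      by (simp add: theta_scale theta_one)
    then show ?thesis by (simp add: oscale_def oone_def)
  qed
  show ?thesis
    using N[of "v + w"] by (simp add: theta_add obil_add_self N)
qed

text \<open>A map that respects a nondegenerate bilinear form is injective.\<close>

lemma theta_inj: "inj theta"
proof (rule injI)
  fix v w assume eq: "theta v = theta w"
  have "T.B (v - w) u = 0" for u
  proof -
    have "theta (v - w) = 0"
      using theta_add[of "v - w" w] eq by simp
    then show ?thesis by (simp flip: theta_bil)
  qed
  then have "v - w = 0" by (rule T.nondegenerate)
  then show "v = w" by simp
qed

end

section \<open>Automorphisms of the octonions\<close>

text \<open>Quantified octonions are to be kept as single elements.\<close>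

declare split_paired_All [simp del] split_paired_Ex [simp del]

lemma oct_linear_inj_imp_surj:
  fixes f :: "'f::field_char_0 oct \<Rightarrow> 'f oct"
  assumes add: "\<And>v w. f (v + w) = f v + f w" and scale: "\<And>r v. f (oscale r v) = oscale r (f v)"
    and inj: "inj f"
  shows "surj f"
proof -
  interpret V: vector_space "oscale :: 'f \<Rightarrow> 'f oct \<Rightarrow> 'f oct"
    by unfold_locales (simp_all add: oscale_simps)
  define S :: "'f oct set" where "S = {((1,0,0,0),(0,0,0,0)), ((0,1,0,0),(0,0,0,0)),
    ((0,0,1,0),(0,0,0,0)), ((0,0,0,1),(0,0,0,0)), ((0,0,0,0),(1,0,0,0)), ((0,0,0,0),(0,1,0,0)),
    ((0,0,0,0),(0,0,1,0)), ((0,0,0,0),(0,0,0,1))}"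
  have span: "x \<in> V.span S" for x
  proof (cases x rule: oct_cases)
    case (1 x0 x1 x2 x3 x4 x5 x6 x7)
    have "x = oscale x0 ((1,0,0,0),(0,0,0,0)) + oscale x1 ((0,1,0,0),(0,0,0,0))
      + oscale x2 ((0,0,1,0),(0,0,0,0)) + oscale x3 ((0,0,0,1),(0,0,0,0))
      + oscale x4 ((0,0,0,0),(1,0,0,0)) + oscale x5 ((0,0,0,0),(0,1,0,0))
      + oscale x6 ((0,0,0,0),(0,0,1,0)) + oscale x7 ((0,0,0,0),(0,0,0,1))"
      by (simp add: 1 oscale_def)
    also have "\<dots> \<in> V.span S"
      by (intro V.span_add V.span_scale V.span_base) (simp_all add: S_def)
    finally show ?thesis .
  qed
  obtain E where E: "E \<subseteq> S" "V.independent E" "S \<subseteq> V.span E"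
    using V.maximal_independent_subset by blast
  interpret V: finite_dimensional_vector_space oscale E
  proof unfold_locales
    show "finite E" using E(1) by (rule finite_subset) (simp add: S_def)
    show "V.independent E" by (fact E)
    show "V.span E = UNIV"
      using span V.span_minimal[OF E(3) V.subspace_span] by blast
  qed
  have "Vector_Spaces.linear oscale oscale f"
    by unfold_locales (simp_all add: add scale)
  then show ?thesis using inj by (rule V.linear_inj_imp_surj)
qed

definition oct_hom ::
  "'f::field \<Rightarrow> 'f \<Rightarrow> 'f \<Rightarrow> 'f \<Rightarrow> 'f \<Rightarrow> 'f \<Rightarrow> ('f oct \<Rightarrow> 'f oct) \<Rightarrow> bool" where
  "oct_hom a b c a' b' c' f \<longleftrightarrow> (\<forall>v w. f (v + w) = f v + f w) \<and> (\<forall>r v. f (oscale r v) = oscale r (f v))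
     \<and> f oone = oone \<and> (\<forall>v w. f (omult a b c v w) = omult a' b' c' (f v) (f w))"

definition oct_aut :: "'f::field \<Rightarrow> 'f \<Rightarrow> 'f \<Rightarrow> ('f oct \<Rightarrow> 'f oct) \<Rightarrow> bool" where
  "oct_aut a b c g \<longleftrightarrow> oct_hom a b c a b c g \<and> bij g"

lemma oct_hom_comp:
  "oct_hom a b c a' b' c' f \<Longrightarrow> oct_hom a' b' c' a2 b2 c2 g \<Longrightarrow> oct_hom a b c a2 b2 c2 (g \<circ> f)"
  by (auto simp: oct_hom_def)

lemma oct_hom_inv:
  assumes "oct_hom a b c a' b' c' f" "bij f" shows "oct_hom a' b' c' a b c (inv_into UNIV f)"
proof -
  have [simp]: "f (inv_into UNIV f v) = v" "inv_into UNIV f (f v) = v" for v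
    using assms(2) by (simp_all add: bij_is_surj surj_f_inv_f bij_is_inj)
  have eq: "f u = f v \<Longrightarrow> u = v" for u v
    using assms(2) by (simp add: bij_is_inj inj_eq)
  have f: "f (v + w) = f v + f w" "f (oscale r v) = oscale r (f v)" "f oone = oone"
    "f (omult a b c v w) = omult a' b' c' (f v) (f w)" for v w r
    using assms(1) unfolding oct_hom_def by blast+
  show ?thesis
    unfolding oct_hom_def by (intro conjI allI; rule eq) (simp_all add: f)
qed

context oct_params
begin

lemma obil_sum: "B (\<Sum>e\<in>S. f e) w = (\<Sum>e\<in>S. B (f e) w)"
  by (induct S rule: infinite_finite_induct) (simp_all add: obil_simps)

text \<open>The vectors perpendicular to four given ones form a space of dimension at least four. If it were
totally isotropic, a nonzero vector in it would be perpendicular to itself, to this space, and to the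
nondegenerate span of the four vectors, hence to everything.\<close>

lemma perp_exists:
  assumes S: "S = {e0, e1, e2, e3}" and nz_S: "\<And>e. e \<in> S \<Longrightarrow> B e e \<noteq> 0"
    and orth: "\<And>e e'. e \<in> S \<Longrightarrow> e' \<in> S \<Longrightarrow> e \<noteq> e' \<Longrightarrow> B e e' = 0"
  shows "\<exists>v. (\<forall>e\<in>S. B e v = 0) \<and> B v v \<noteq> 0"
proof (rule ccontr)
  assume "\<not> ?thesis"
  then have iso: "B v v = 0" if "\<forall>e\<in>S. B e v = 0" for v using that by blast
  have iso2: "B v w = 0" if "\<forall>e\<in>S. B e v = 0" "\<forall>e\<in>S. B e w = 0" for v w
  proof -
    have "\<forall>e\<in>S. B e (v + w) = 0" using that by (simp add: obil_simps')
    then have "B (v + w) (v + w) = 0" by (rule iso)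
    then show ?thesis using iso[OF that(1)] iso[OF that(2)] by (simp add: obil_add_self)
  qed
  \<comment> \<open>The four functionals, padded by zeros, give a map that is not onto, hence not injective.\<close>
  define f :: "'f oct \<Rightarrow> 'f oct" where "f = (\<lambda>v. ((B v e0, B v e1, B v e2, B v e3), 0))"
  have "\<not> inj f"
  proof
    assume "inj f"
    then have "surj f"
      by (rule oct_linear_inj_imp_surj[rotated 2])
        (simp_all add: f_def obil_simps oscale_quat qscale_def zero_prod_def)
    then obtain v where "((0, 0, 0, 0), (1, 0, 0, 0)) = f v" by (metis surjD)
    then show False by (simp add: f_def zero_prod_def)
  qed
  then obtain v1 v2 where v12: "f v1 = f v2" "v1 \<noteq> v2" unfolding inj_def by blast
  define v where "v = v1 + oscale (- 1) v2"
  have v: "\<forall>e\<in>S. B v e = 0" "\<forall>e\<in>S. B e v = 0"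
    using v12(1) by (auto simp: S f_def v_def obil_simps(1,2) obil_simps')
      (simp_all add: obil_commute)
  have "B v w = 0" for w
  proof -
    \<comment> \<open>The component of \<open>w\<close> perpendicular to the four vectors.\<close>
    define p where "p = w + oscale (- 1) (\<Sum>e\<in>S. oscale (B w e / B e e) e)"
    have fin: "finite S" by (simp add: S)
    have "B (\<Sum>e\<in>S. oscale (B w e / B e e) e) e' = B w e'" if "e' \<in> S" for e'
    proof -
      have "B (\<Sum>e\<in>S. oscale (B w e / B e e) e) e' = (\<Sum>e\<in>S. if e = e' then B w e' else 0)"
        unfolding obil_sum using that nz_S orth by (intro sum.cong) (auto simp: obil_simps(2))
      then show ?thesis using fin that by simp
    qed
    then have "\<forall>e\<in>S. B p e = 0" by (simp add: p_def obil_simps(1,2))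
    then have "B v p = 0" using v iso2[of v p] by (simp add: obil_commute[of a b c p])
    moreover have "B (\<Sum>e\<in>S. oscale (B w e / B e e) e) v = 0"
      unfolding obil_sum using v by (simp add: obil_simps(2))
    ultimately show ?thesis
      by (simp add: p_def obil_simps') (simp add: obil_commute)
  qed
  then have "v = 0" by (rule nondegenerate)
  then show False using v12(2) by (simp add: v_def oscale_simps)
qed

lemma obil_mult_left: "B (x \<star> u) w = B u (oconj x \<star> w)"
  by (cases x rule: oct_cases; cases u rule: oct_cases; cases w rule: oct_cases)
    (simp add: oct_Pair_simps algebra_simps)

lemma obil_one: "B oone oone = 1"
  by (simp add: oct_Pair_simps)

lemma second_vector_exists:
  assumes "B oone y = 0" "B y y \<noteq> 0"
  shows "\<exists>z. B oone z = 0 \<and> B y z = 0 \<and> B z z \<noteq> 0"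
proof -
  have "\<exists>z. (\<forall>e\<in>{oone, oone, y, y}. B e z = 0) \<and> B z z \<noteq> 0"
  proof (rule perp_exists[OF refl])
    fix e e' assume "e \<in> {oone, oone, y, y}" "e' \<in> {oone, oone, y, y}" "e \<noteq> e'"
    then show "B e e' = 0" using assms(1) obil_commute[of a b c y oone] by auto
  qed (use assms(2) obil_one in auto)
  then show ?thesis by auto
qed

lemma perp_product:
  assumes y: "B oone y = 0" and z: "B oone z = 0" "B y z = 0"
  shows "B oone (y \<star> z) = 0" "B y (y \<star> z) = 0" "B z (y \<star> z) = 0" "B (y \<star> z) (y \<star> z) = B y y * B z z"
proof -
  have adj: "B w (y \<star> z) = - B z (y \<star> w)" for w
    using obil_mult_left[of y z w] pure_oconj[OF y]
    by (simp add: omult_minus obil_minus obil_commute[of a b c w])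
  have yz: "oconj y \<star> (y \<star> z) = oscale (B y y) z" by (rule oconj_cancel)
  show "B oone (y \<star> z) = 0" "B y (y \<star> z) = 0"
    using z pure_square[OF y]
    by (simp_all add: adj obil_simps' obil_commute[of a b c z])
  show "B (y \<star> z) (y \<star> z) = B y y * B z z"
    by (simp add: obil_mult_left[of y z "y \<star> z"] yz obil_simps')
  have "B z (y \<star> z) = - B z (y \<star> z)" by (rule adj)
  then show "B z (y \<star> z) = 0"
    by simp
qed

lemma basic_triple_exists:
  assumes y: "B oone y = 0" "B y y \<noteq> 0" and z: "B oone z = 0" "B y z = 0" "B z z \<noteq> 0"
  shows "\<exists>l. basic_triple a b c y z l"
proof -
  note yz = perp_product[OF y(1) z(1,2)]
  have "\<exists>l. (\<forall>e\<in>{oone, y, z, y \<star> z}. B e l = 0) \<and> B l l \<noteq> 0"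
  proof (rule perp_exists[OF refl])
    fix e e' assume "e \<in> {oone, y, z, y \<star> z}" "e' \<in> {oone, y, z, y \<star> z}" "e \<noteq> e'"
    then show "B e e' = 0"
      using y z yz obil_commute[of a b c y oone] obil_commute[of a b c z oone]
        obil_commute[of a b c z y] obil_commute[of a b c "y \<star> z" oone]
        obil_commute[of a b c "y \<star> z" y] obil_commute[of a b c "y \<star> z" z] by auto
  qed (use y z yz obil_one in auto)
  then show ?thesis
    using y z nz by (auto simp: basic_triple_def basic_triple_axioms_def oct_params_def)
qed

end

lemma oct_aut_comp: "oct_aut a b c g \<Longrightarrow> oct_aut a b c h \<Longrightarrow> oct_aut a b c (h \<circ> g)"
  unfolding oct_aut_def by (auto intro: oct_hom_comp bij_comp)

context basic_triple
begin

lemma theta_hom: "oct_hom (- B y y) (- B z z) (- B l l) a b c theta"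
  by (simp add: oct_hom_def theta_add theta_scale theta_one theta_mult)

lemma theta_bij: "bij theta"
  using theta_inj oct_linear_inj_imp_surj[OF theta_add theta_scale theta_inj] by (simp add: bij_def)

lemma theta_transport_aut:
  assumes "oct_aut (- B y y) (- B z z) (- B l l) s"
  shows "oct_aut a b c (theta \<circ> s \<circ> inv_into UNIV theta)"
  unfolding oct_aut_def
proof
  show "oct_hom a b c a b c (theta \<circ> s \<circ> inv_into UNIV theta)"
    using assms oct_hom_inv[OF theta_hom theta_bij] theta_hom
    unfolding oct_aut_def by (blast intro: oct_hom_comp)
  show "bij (theta \<circ> s \<circ> inv_into UNIV theta)"
    using assms theta_bij unfolding oct_aut_def by (blast intro: bij_comp bij_imp_bij_inv)
qed

end

context oct_params
begin

text \<open>Equal norms mean equal parameters, so that both maps \<open>theta\<close> have the same domain and one can be composed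
with the inverse of the other.\<close>

lemma transitive_triples:
  assumes "basic_triple a b c y z l" "basic_triple a b c y' z' l'"
    and "B y y = B y' y'" "B z z = B z' z'" "B l l = B l' l'"
  shows "\<exists>g. oct_aut a b c g \<and> g y = y'"
proof -
  interpret T: basic_triple a b c y z l by fact
  interpret T': basic_triple a b c y' z' l' by fact
  let ?g = "T'.theta \<circ> inv_into UNIV T.theta"
  have "oct_hom a b c a b c ?g"
    using oct_hom_comp[OF oct_hom_inv[OF T.theta_hom T.theta_bij]] T'.theta_hom assms(3-5) by simp
  moreover have "bij ?g"
    using T.theta_bij T'.theta_bij by (blast intro: bij_comp bij_imp_bij_inv)
  moreover have "?g y = y'"
    using inv_into_f_f[OF T.theta_inj, of "((0, 1, 0, 0), (0, 0, 0, 0))"]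
    by (simp add: T.theta_y T'.theta_y)
  ultimately show ?thesis unfolding oct_aut_def by blast
qed

text \<open>If \<open>y\<close> and \<open>y'\<close> are linearly independent and span a nondegenerate plane, complete each of them within
this plane to a perpendicular basis; the two completions have equal norms, and a common third
element \<open>l\<close> serves both.\<close>

lemma transitive_generic:
  assumes y: "B oone y = 0" and y': "B oone y' = 0" and n: "B y y = n" "B y' y' = n" "n \<noteq> 0"
    and generic: "B y y' \<noteq> n" "B y y' \<noteq> - n"
  shows "\<exists>g. oct_aut a b c g \<and> g y = y'"
proof -
  define r where "r = B y y' / n"
  define z where "z = y' + oscale (- r) y"
  define z' where "z' = y + oscale (- r) y'"
  have ry: "B y y' = r * n" "B y' y = r * n"
    using n(3) by (simp_all add: r_def obil_commute[of a b c y' y])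
  have r: "1 - r * r \<noteq> 0"
    using generic n(3) by (auto simp: ry square_eq_1_iff)
  have z: "B oone z = 0" "B y z = 0" "B z z = n * (1 - r * r)"
    and z': "B oone z' = 0" "B y' z' = 0" "B z' z' = n * (1 - r * r)"
    using y y' by (simp_all add: z_def z'_def obil_simps obil_simps' n ry algebra_simps)
  obtain l where l: "basic_triple a b c y z l"
    using basic_triple_exists[of y z] y z n r by auto
  interpret T: basic_triple a b c y z l by fact
  have eqs: "y' = z + oscale r y" "z' = oscale (1 - r * r) y + oscale (- r) z"
    by (simp_all add: z_def z'_def oscale_simps oscale_diff oscale_minus oscale_diff_left)
  have zy: "B (z \<star> y) l = 0"
  proof -
    have "- (y \<star> z) - z \<star> y = 0"
      using omult_oconj_add[of a b c y z] z(2) pure_oconj[OF y] pure_oconj[OF z(1)]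
      by (simp add: omult_minus oscale_simps)
    then have "z \<star> y = - (y \<star> z)" by (simp only: right_minus_eq)
    then show ?thesis using T.l by (simp add: obil_minus)
  qed
  have "basic_triple a b c y' z' l"
  proof unfold_locales
    show "B z' l = 0" "B y' l = 0"
      using T.l unfolding eqs by (simp_all add: obil_simps oscale_simps)
    have "y' \<star> z' = oscale (1 - r * r) (z \<star> y) + (oscale (- r) (z \<star> z)
        + (oscale ((1 - r * r) * r) (y \<star> y) + oscale (- r * r) (y \<star> z)))"
      unfolding eqs by (simp add: omult_add_left omult_add_right omult_scale_left omult_scale_right
          oscale_simps add.assoc)
    then show "B (y' \<star> z') l = 0"
      using T.l zy by (simp add: obil_simps pure_square[OF y] pure_square[OF z(1)])
  qed (use y' z' n r T.l in auto)
  with l show ?thesis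
    using transitive_triples n z(3) z'(3) by metis
qed

text \<open>If \<open>y' = \<plusminus> y\<close>, or if both span a degenerate plane, pass through a third element \<open>w\<close> of the same norm that is
in general position to both. Such elements lie on the conic \<open>N(w) = n\<close> in the plane spanned by \<open>y\<close> and
\<open>y z\<close>, which has a rational parametrization by \<open>t\<close>; only finitely many \<open>t\<close> are excluded.\<close>

lemma transitive:
  assumes y: "B oone y = 0" and y': "B oone y' = 0" and eq: "B y y = B y' y'" and nz_y: "B y y \<noteq> 0"
  shows "\<exists>g. oct_aut a b c g \<and> g y = y'"
proof -
  define n where "n = B y y"
  have n: "B y y = n" "B y' y' = n" "n \<noteq> 0" using eq nz_y by (simp_all add: n_def)
  show ?thesis
  proof (cases "B y y' = n \<or> B y y' = - n")
    case False
    then show ?thesis using transitive_generic[OF y y' n] by blast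
  next
    case True
    then obtain s where s: "B y y' = s * n" "s * s = 1"
      by (metis minus_mult_minus mult_1 mult_minus_left)
    obtain z where z: "B oone z = 0" "B y z = 0" "B z z \<noteq> 0"
      using second_vector_exists y nz_y by blast
    note yz = perp_product[OF y z(1,2)]
    define m where "m = - B z z"
    define d where "d = B y' (y \<star> z)"
    have m: "m \<noteq> 0" "B (y \<star> z) (y \<star> z) = - n * m" using z yz n by (simp_all add: m_def)
    \<comment> \<open>The excluded parameters: the poles of the parametrization, and those where \<open>B w y = \<plusminus> n\<close> or \<open>B w y' = \<plusminus> n\<close>.\<close>
    have "finite ({t. t * t = 1 / m} \<union> {0, d / (s * n * m), s * n / d})"
    proof -
      have "finite {t. t * t = w}" for w :: 'f
      proof (cases "\<exists>u. u * u = w")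
        case True
        then obtain u where "u * u = w" by blast
        then have "{t. t * t = w} \<subseteq> {u, - u}" by (auto simp: square_eq_iff)
        then show ?thesis by (rule finite_subset) simp
      next
        case False
        then have "{t. t * t = w} = {}" by blast
        then show ?thesis by simp
      qed
      then show ?thesis by simp
    qed
    then obtain t where t: "t \<notin> {t. t * t = 1 / m} \<union> {0, d / (s * n * m), s * n / d}"
      using infinite_UNIV_char_0[where ?'a='f] by (metis ex_new_if_finite)
    have sn: "s \<noteq> 0" using s(2) by auto
    have t1: "1 - t * t * m \<noteq> 0" "t \<noteq> 0" and t2: "t * (s * n * m) \<noteq> d"
      using t m n(3) sn by (auto simp: field_simps)
    have t3: "t * d \<noteq> s * n"
      using t n(3) sn by (cases "d = 0") (auto simp: eq_divide_eq)
    define q where "q = 1 - t * t * m"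
    define w where "w = oscale ((1 + t * t * m) / q) y + oscale (- 2 * t / q) (y \<star> z)"
    have q: "q \<noteq> 0" using t1 by (simp add: q_def)
    have w: "B oone w = 0"
      using y yz by (simp add: w_def obil_simps')
    have yz': "B (y \<star> z) y = 0" using yz(2) by (simp add: obil_commute)
    have wn: "B w w = n"
    proof -
      have "B w w = n * ((1 + t * t * m) * (1 + t * t * m) - 4 * (t * t * m)) / (q * q)"
        using q by (simp add: w_def obil_simps obil_simps' yz(2) yz' m(2) n field_simps)
      also have "(1 + t * t * m) * (1 + t * t * m) - 4 * (t * t * m) = q * q"
        by (simp add: q_def algebra_simps)
      finally show ?thesis using q by simp
    qed
    have yw: "B y w = n * (1 + t * t * m) / q"
      by (simp add: w_def obil_simps' yz n)
    have "B y w \<noteq> n" "B y w \<noteq> - n"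
      using q n m t1(2) by (auto simp: yw field_simps q_def)
    then obtain g where g: "oct_aut a b c g" "g y = w"
      using transitive_generic[OF y w n(1) wn n(3)] by blast
    have wy': "B w y' = (s * n * (1 + t * t * m) - 2 * t * d) / q"
      using q by (simp add: w_def obil_simps s d_def obil_commute[of a b c "y \<star> z" y'] field_simps)
    have c1: "s * n * (1 + t * t * m) - 2 * t * d \<noteq> s * n * q"
    proof
      assume "s * n * (1 + t * t * m) - 2 * t * d = s * n * q"
      then have "2 * t * (t * (s * n * m) - d) = 0" by (simp add: q_def algebra_simps)
      then show False using t1(2) t2 by simp
    qed
    have c2: "s * n * (1 + t * t * m) - 2 * t * d \<noteq> - (s * n * q)"
    proof
      assume "s * n * (1 + t * t * m) - 2 * t * d = - (s * n * q)"
      then have "2 * (s * n - t * d) = 0" by (simp add: q_def algebra_simps)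
      then show False using t3 by simp
    qed
    have "s = 1 \<or> s = - 1" using s(2) by (simp add: square_eq_1_iff)
    then have "B w y' \<noteq> n" "B w y' \<noteq> - n"
      using c1 c2 q by (auto simp: wy' divide_eq_eq eq_divide_eq)
    then obtain h where "oct_aut a b c h" "h w = y'"
      using transitive_generic[OF w y' wn n(2,3)] by blast
    with g show ?thesis
      using oct_aut_comp[of a b c g h] by (intro exI[of _ "h \<circ> g"]) simp
  qed
qed

lemma sign_aut: "oct_aut a b c (\<lambda>(p, q). (p, - q))"
proof -
  have "bij (\<lambda>(p, q). (p, - q) :: 'f oct)"
    by (rule involuntory_imp_bij) auto
  moreover have "oct_hom a b c a b c (\<lambda>(p, q). (p, - q))"
    unfolding oct_hom_def
  proof (intro conjI allI)
    fix v w :: "'f oct" and r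
    obtain p q p' q' where vw: "v = (p, q)" "w = (p', q')" by (cases v, cases w)
    show "(\<lambda>(p, q). (p, - q)) (v + w) = (\<lambda>(p, q). (p, - q)) v + (\<lambda>(p, q). (p, - q)) w"
      "(\<lambda>(p, q). (p, - q)) (oscale r v) = oscale r ((\<lambda>(p, q). (p, - q)) v)"
      "(\<lambda>(p, q). (p, - q)) (v \<star> w) = (\<lambda>(p, q). (p, - q)) v \<star> (\<lambda>(p, q). (p, - q)) w"
      "(\<lambda>(p, q). (p, - q)) (oone :: 'f oct) = oone"
      unfolding vw
      by (simp_all add: omult_quat oscale_quat qmult_simps quat_conj_simps qscale_simps oone_def)
  qed
  ultimately show ?thesis by (simp add: oct_aut_def)
qed

text \<open>The involution of the quaternions that fixes \<open>1, i\<close> and negates \<open>j, ij\<close>, that is, conjugation by \<open>i\<close>.\<close>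

definition qsign :: "'f quat \<Rightarrow> 'f quat" where
  "qsign = (\<lambda>(x0, x1, x2, x3). (x0, x1, - x2, - x3))"

lemma qsign_simps:
  "qsign (p + q) = qsign p + qsign q" "qsign (qscale r p) = qscale r (qsign p)"
  "qsign (quat_conj p) = quat_conj (qsign p)"
  "qsign (qmult a b p q) = qmult a b (qsign p) (qsign q)" "qsign (qsign p) = p"
  "qsign (0, 0, 0, 0) = (0, 0, 0, 0)" "qsign (1, 0, 0, 0) = (1, 0, 0, 0)"
  by (cases p rule: quat_cases; cases q rule: quat_cases; simp add: quat_Pair_simps qsign_def)+

lemma qsign_aut: "oct_aut a b c (map_prod qsign qsign)"
proof -
  have "bij (map_prod qsign qsign)"
    by (rule involuntory_imp_bij) (auto simp: qsign_simps)
  moreover have "oct_hom a b c a b c (map_prod qsign qsign)"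
    unfolding oct_hom_def
  proof (intro conjI allI)
    fix v w :: "'f oct" and r
    obtain p q p' q' where vw: "v = (p, q)" "w = (p', q')" by (cases v, cases w)
    show "map_prod qsign qsign (v + w) = map_prod qsign qsign v + map_prod qsign qsign w"
      "map_prod qsign qsign (oscale r v) = oscale r (map_prod qsign qsign v)"
      "map_prod qsign qsign (v \<star> w) = map_prod qsign qsign v \<star> map_prod qsign qsign w"
      "map_prod qsign qsign oone = oone"
      unfolding vw by (simp_all add: omult_quat oscale_quat qsign_simps oone_def)
  qed
  ultimately show ?thesis by (simp add: oct_aut_def)
qed

text \<open>Complete \<open>y\<close> to a basic triple. In the coordinates given by \<open>theta\<close>, where \<open>y\<close> becomes the first
generator, the stabilizer contains the sign changes \<open>sign_aut\<close> and \<open>qsign_aut\<close>. Their common fixed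
vectors are the combinations of \<open>1\<close> and \<open>y\<close>.\<close>

lemma fixed_by_stabilizer:
  assumes y: "B oone y = 0" "B y y \<noteq> 0"
    and fix_v: "\<And>g. oct_aut a b c g \<Longrightarrow> g y = y \<Longrightarrow> g v = v"
  shows "\<exists>r s. v = oscale r oone + oscale s y"
proof -
  obtain z where "B oone z = 0" "B y z = 0" "B z z \<noteq> 0"
    using second_vector_exists y by blast
  then obtain l where "basic_triple a b c y z l"
    using basic_triple_exists y by blast
  then interpret T: basic_triple a b c y z l .
  obtain u where v: "v = T.theta u" using T.theta_bij by (metis bij_pointE)
  have inv: "inv_into UNIV T.theta (T.theta u) = u" for u
    by (simp add: T.theta_inj)
  have inv_y: "inv_into UNIV T.theta y = ((0, 1, 0, 0), (0, 0, 0, 0))"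
    using inv[of "((0, 1, 0, 0), (0, 0, 0, 0))"] by (simp only: T.theta_y)
  have "s u = u" if s: "oct_aut (- B y y) (- B z z) (- B l l) s"
    and sy: "s ((0, 1, 0, 0), (0, 0, 0, 0)) = ((0, 1, 0, 0), (0, 0, 0, 0))" for s
  proof -
    have "(T.theta \<circ> s \<circ> inv_into UNIV T.theta) v = v"
      by (rule fix_v[OF T.theta_transport_aut[OF s]])
        (simp add: inv_y sy T.theta_y)
    then show ?thesis by (simp add: v inv inj_eq[OF T.theta_inj])
  qed
  from this[OF T.T.sign_aut] this[OF T.T.qsign_aut]
  have u: "(\<lambda>(p, q). (p, - q)) u = u" "map_prod T.T.qsign T.T.qsign u = u"
    by (simp_all add: T.T.qsign_def)
  obtain x0 x1 x2 x3 x4 x5 x6 x7 where ux: "u = ((x0, x1, x2, x3), (x4, x5, x6, x7))"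
    by (rule oct_cases)
  have "u = ((x0, x1, 0, 0), (0, 0, 0, 0))"
    using u by (simp add: ux T.T.qsign_def neg_equal_iff_equal equal_neg_zero neg_equal_zero)
  then have "u = oscale x0 oone + oscale x1 ((0, 1, 0, 0), (0, 0, 0, 0))"
    by (simp add: oscale_def oone_def)
  then have "v = oscale x0 oone + oscale x1 y"
    by (simp add: v T.theta_add T.theta_scale T.theta_one T.theta_y)
  then show ?thesis by blast
qed

end

section \<open>Commutative algebras and homomorphisms\<close>

lemma rota_simps [simp]:
  "carrier (ring_of_type_algebra :: 'c::field ring) = UNIV"
  "x \<otimes>\<^bsub>ring_of_type_algebra\<^esub> y = (x * y :: 'c)"
  "x \<oplus>\<^bsub>ring_of_type_algebra\<^esub> y = (x + y :: 'c)"
  "\<one>\<^bsub>ring_of_type_algebra\<^esub> = (1 :: 'c)"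
  "\<zero>\<^bsub>ring_of_type_algebra\<^esub> = (0 :: 'c)"
  by (simp_all add: ring_of_type_algebra_def)

lemma comm_algI:
  fixes R :: "('c::field, 'u) module"
  assumes "cring R"
    and "\<And>c x. x \<in> carrier R \<Longrightarrow> c \<odot>\<^bsub>R\<^esub> x \<in> carrier R"
    and "\<And>c d x. x \<in> carrier R \<Longrightarrow> (c + d) \<odot>\<^bsub>R\<^esub> x = c \<odot>\<^bsub>R\<^esub> x \<oplus>\<^bsub>R\<^esub> d \<odot>\<^bsub>R\<^esub> x"
    and "\<And>c x y. x \<in> carrier R \<Longrightarrow> y \<in> carrier R \<Longrightarrow> c \<odot>\<^bsub>R\<^esub> (x \<oplus>\<^bsub>R\<^esub> y) = c \<odot>\<^bsub>R\<^esub> x \<oplus>\<^bsub>R\<^esub> c \<odot>\<^bsub>R\<^esub> y"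
    and "\<And>c d x. x \<in> carrier R \<Longrightarrow> (c * d) \<odot>\<^bsub>R\<^esub> x = c \<odot>\<^bsub>R\<^esub> (d \<odot>\<^bsub>R\<^esub> x)"
    and "\<And>x. x \<in> carrier R \<Longrightarrow> 1 \<odot>\<^bsub>R\<^esub> x = x"
    and "\<And>c x y. x \<in> carrier R \<Longrightarrow> y \<in> carrier R \<Longrightarrow> (c \<odot>\<^bsub>R\<^esub> x) \<otimes>\<^bsub>R\<^esub> y = c \<odot>\<^bsub>R\<^esub> (x \<otimes>\<^bsub>R\<^esub> y)"
  shows "comm_alg R"
proof -
  interpret cring R by fact
  show ?thesis
    by (rule algebraI) (use assms in \<open>auto simp: is_abelian_group intro: cring_from_type_algebra\<close>)
qed

lemma comm_algD:
  fixes R :: "('c::field, 'u) module"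
  assumes "comm_alg R"
  shows comm_alg_cring: "cring R"
    and comm_alg_smult_closed: "\<And>c x. x \<in> carrier R \<Longrightarrow> c \<odot>\<^bsub>R\<^esub> x \<in> carrier R"
    and comm_alg_smult_l_distr:
      "\<And>c d x. x \<in> carrier R \<Longrightarrow> (c + d) \<odot>\<^bsub>R\<^esub> x = c \<odot>\<^bsub>R\<^esub> x \<oplus>\<^bsub>R\<^esub> d \<odot>\<^bsub>R\<^esub> x"
    and comm_alg_smult_r_distr: "\<And>c x y. x \<in> carrier R \<Longrightarrow> y \<in> carrier R \<Longrightarrow>
      c \<odot>\<^bsub>R\<^esub> (x \<oplus>\<^bsub>R\<^esub> y) = c \<odot>\<^bsub>R\<^esub> x \<oplus>\<^bsub>R\<^esub> c \<odot>\<^bsub>R\<^esub> y"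
    and comm_alg_smult_assoc:
      "\<And>c d x. x \<in> carrier R \<Longrightarrow> (c * d) \<odot>\<^bsub>R\<^esub> x = c \<odot>\<^bsub>R\<^esub> (d \<odot>\<^bsub>R\<^esub> x)"
    and comm_alg_smult_one: "\<And>x. x \<in> carrier R \<Longrightarrow> 1 \<odot>\<^bsub>R\<^esub> x = x"
    and comm_alg_smult_mult: "\<And>c x y. x \<in> carrier R \<Longrightarrow> y \<in> carrier R \<Longrightarrow>
      (c \<odot>\<^bsub>R\<^esub> x) \<otimes>\<^bsub>R\<^esub> y = c \<odot>\<^bsub>R\<^esub> (x \<otimes>\<^bsub>R\<^esub> y)"
proof -
  interpret algebra ring_of_type_algebra R by fact
  show "cring R" by unfold_locales
  fix c d :: 'c and x y
  show "x \<in> carrier R \<Longrightarrow> c \<odot>\<^bsub>R\<^esub> x \<in> carrier R" by simp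
  show "x \<in> carrier R \<Longrightarrow> (c + d) \<odot>\<^bsub>R\<^esub> x = c \<odot>\<^bsub>R\<^esub> x \<oplus>\<^bsub>R\<^esub> d \<odot>\<^bsub>R\<^esub> x"
    using smult_l_distr[of c d x] by simp
  show "x \<in> carrier R \<Longrightarrow> (c * d) \<odot>\<^bsub>R\<^esub> x = c \<odot>\<^bsub>R\<^esub> (d \<odot>\<^bsub>R\<^esub> x)"
    using smult_assoc1[of c d x] by simp
  show "x \<in> carrier R \<Longrightarrow> 1 \<odot>\<^bsub>R\<^esub> x = x"
    using smult_one[of x] by simp
  assume "x \<in> carrier R" "y \<in> carrier R"
  then show "c \<odot>\<^bsub>R\<^esub> (x \<oplus>\<^bsub>R\<^esub> y) = c \<odot>\<^bsub>R\<^esub> x \<oplus>\<^bsub>R\<^esub> c \<odot>\<^bsub>R\<^esub> y"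
    "(c \<odot>\<^bsub>R\<^esub> x) \<otimes>\<^bsub>R\<^esub> y = c \<odot>\<^bsub>R\<^esub> (x \<otimes>\<^bsub>R\<^esub> y)"
    using smult_r_distr[of c x y] smult_assoc2[of c x y] by simp_all
qed

lemma struct_map_simps:
  fixes R :: "('c::field, 'u) module"
  assumes R: "comm_alg R"
  shows "struct_map R c \<in> carrier R" "struct_map R 1 = \<one>\<^bsub>R\<^esub>" "struct_map R 0 = \<zero>\<^bsub>R\<^esub>"
    "struct_map R (c + d) = struct_map R c \<oplus>\<^bsub>R\<^esub> struct_map R d"
    "struct_map R (c * d) = struct_map R c \<otimes>\<^bsub>R\<^esub> struct_map R d"
    "x \<in> carrier R \<Longrightarrow> struct_map R c \<otimes>\<^bsub>R\<^esub> x = c \<odot>\<^bsub>R\<^esub> x"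
proof -
  note r = comm_algD[OF R]
  interpret cring R by (rule r)
  show s: "struct_map R c \<in> carrier R" for c by (simp add: struct_map_def r)
  show "struct_map R 1 = \<one>\<^bsub>R\<^esub>" by (simp add: struct_map_def r)
  show add: "struct_map R (c + d) = struct_map R c \<oplus>\<^bsub>R\<^esub> struct_map R d" for c d
    by (simp add: struct_map_def r)
  show "struct_map R 0 = \<zero>\<^bsub>R\<^esub>" using add[of 0 0] s[of 0] by (metis add.inv_closed add.l_cancel_one add_0)
  show "struct_map R (c * d) = struct_map R c \<otimes>\<^bsub>R\<^esub> struct_map R d"
    by (simp add: struct_map_def r)
  show "x \<in> carrier R \<Longrightarrow> struct_map R c \<otimes>\<^bsub>R\<^esub> x = c \<odot>\<^bsub>R\<^esub> x"
    by (simp add: struct_map_def r)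
qed

lemma homsD:
  assumes "h \<in> homs R S"
  shows homs_closed: "\<And>x. x \<in> carrier R \<Longrightarrow> h x \<in> carrier S"
    and homs_one: "h \<one>\<^bsub>R\<^esub> = \<one>\<^bsub>S\<^esub>"
    and homs_add: "\<And>x y. x \<in> carrier R \<Longrightarrow> y \<in> carrier R \<Longrightarrow> h (x \<oplus>\<^bsub>R\<^esub> y) = h x \<oplus>\<^bsub>S\<^esub> h y"
    and homs_mult: "\<And>x y. x \<in> carrier R \<Longrightarrow> y \<in> carrier R \<Longrightarrow> h (x \<otimes>\<^bsub>R\<^esub> y) = h x \<otimes>\<^bsub>S\<^esub> h y"
    and homs_smult: "\<And>c x. x \<in> carrier R \<Longrightarrow> h (c \<odot>\<^bsub>R\<^esub> x) = c \<odot>\<^bsub>S\<^esub> h x"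
    and homs_ext: "h \<in> extensional (carrier R)"
  using assms by (auto simp: alg_homs_def PiE_iff)

lemma homs_zero:
  fixes R :: "('c::field, 'u) module"
  assumes "comm_alg R" "comm_alg S" "h \<in> homs R S" shows "h \<zero>\<^bsub>R\<^esub> = \<zero>\<^bsub>S\<^esub>"
proof -
  interpret R: cring R by (rule comm_alg_cring) fact
  interpret S: cring S by (rule comm_alg_cring) fact
  have "h \<zero>\<^bsub>R\<^esub> \<in> carrier S" "h \<zero>\<^bsub>R\<^esub> \<oplus>\<^bsub>S\<^esub> h \<zero>\<^bsub>R\<^esub> = h \<zero>\<^bsub>R\<^esub>"
    using homs_add[OF assms(3), of "\<zero>\<^bsub>R\<^esub>" "\<zero>\<^bsub>R\<^esub>"] homs_closed[OF assms(3)] by auto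
  then show ?thesis by simp
qed

lemma homs_finsum:
  fixes R :: "('c::field, 'u) module"
  assumes "comm_alg R" "comm_alg S" "h \<in> homs R S" "finite F" "f \<in> F \<rightarrow> carrier R"
  shows "h (\<Oplus>\<^bsub>R\<^esub>i\<in>F. f i) = (\<Oplus>\<^bsub>S\<^esub>i\<in>F. h (f i))"
proof -
  interpret R: cring R by (rule comm_alg_cring) fact
  interpret S: cring S by (rule comm_alg_cring) fact
  note h = homsD[OF assms(3)]
  show ?thesis
    using assms(4,5)
  proof (induct F)
    case empty
    then show ?case using homs_zero[OF assms(1-3)] by simp
  next
    case (insert x F)
    then have "f \<in> F \<rightarrow> carrier R" "f x \<in> carrier R" by auto
    with insert show ?case by (simp add: h Pi_iff)
  qed
qed

lemma homs_struct_map: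
  fixes R :: "('c::field, 'u) module"
  assumes "h \<in> homs R S" "comm_alg R" shows "h (struct_map R c) = struct_map S c"
proof -
  interpret R: cring R by (rule comm_alg_cring) fact
  show ?thesis by (simp add: struct_map_def homsD[OF assms(1)])
qed

lemma homs_id: "comm_alg R \<Longrightarrow> (\<lambda>r\<in>carrier R. r) \<in> homs R R"
proof -
  assume R: "comm_alg R"
  interpret R: cring R by (rule comm_alg_cring) fact
  show ?thesis by (auto simp: alg_homs_def comm_alg_smult_closed[OF R])
qed

lemma homs_compose:
  assumes "comm_alg R" "h \<in> homs R S" "h' \<in> homs S T"
  shows "compose (carrier R) h' h \<in> homs R T"
proof -
  interpret R: cring R by (rule comm_alg_cring) fact
  show ?thesis
    using homsD[OF assms(2)] homsD[OF assms(3)]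
    by (auto simp: alg_homs_def compose_def comm_alg_smult_closed[OF assms(1)])
qed

section \<open>Free modules and linear maps\<close>

definition vecs :: "('c, 'm) ring_scheme \<Rightarrow> ('i \<Rightarrow> 'c) set" where
  "vecs R = {v. \<forall>i. v i \<in> carrier R}"

definition unit_vec :: "('c, 'm) ring_scheme \<Rightarrow> 'i \<Rightarrow> 'i \<Rightarrow> 'c" where
  "unit_vec R i = (\<lambda>m. if m = i then \<one>\<^bsub>R\<^esub> else \<zero>\<^bsub>R\<^esub>)"

definition linear_on :: "('u, 'm) ring_scheme \<Rightarrow> (('i \<Rightarrow> 'u) \<Rightarrow> ('i \<Rightarrow> 'u)) \<Rightarrow> bool" where
  "linear_on R P \<longleftrightarrow> (\<forall>v\<in>vecs R. P v \<in> vecs R) \<and>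
     (\<forall>v\<in>vecs R. \<forall>w\<in>vecs R. P (\<lambda>l. v l \<oplus>\<^bsub>R\<^esub> w l) = (\<lambda>l. P v l \<oplus>\<^bsub>R\<^esub> P w l)) \<and>
     (\<forall>r\<in>carrier R. \<forall>v\<in>vecs R. P (\<lambda>l. r \<otimes>\<^bsub>R\<^esub> v l) = (\<lambda>l. r \<otimes>\<^bsub>R\<^esub> P v l))"

definition mat_map :: "('u, 'm) ring_scheme \<Rightarrow> ('i \<Rightarrow> 'i \<Rightarrow> 'u) \<Rightarrow> ('i::finite \<Rightarrow> 'u) \<Rightarrow> ('i \<Rightarrow> 'u)" where
  "mat_map R p v = (\<lambda>l. \<Oplus>\<^bsub>R\<^esub>i\<in>UNIV. v i \<otimes>\<^bsub>R\<^esub> p i l)"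

lemma vecsD: "v \<in> vecs R \<Longrightarrow> v i \<in> carrier R" by (simp add: vecs_def)

lemma linear_onD:
  assumes "linear_on R P"
  shows "v \<in> vecs R \<Longrightarrow> P v \<in> vecs R" "v \<in> vecs R \<Longrightarrow> P v l \<in> carrier R"
    "v \<in> vecs R \<Longrightarrow> w \<in> vecs R \<Longrightarrow> P (\<lambda>l. v l \<oplus>\<^bsub>R\<^esub> w l) = (\<lambda>l. P v l \<oplus>\<^bsub>R\<^esub> P w l)"
    "r \<in> carrier R \<Longrightarrow> v \<in> vecs R \<Longrightarrow> P (\<lambda>l. r \<otimes>\<^bsub>R\<^esub> v l) = (\<lambda>l. r \<otimes>\<^bsub>R\<^esub> P v l)"
  using assms by (auto simp: linear_on_def vecs_def)

context cring
begin

lemma unit_vec_closed [simp]: "unit_vec R i \<in> vecs R"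
  by (simp add: unit_vec_def vecs_def)

text \<open>Split off one coordinate of \<open>v\<close> at a time.\<close>

lemma linear_expand:
  assumes P: "linear_on R P" and v: "v \<in> vecs R"
  shows "P v = mat_map R (\<lambda>i. P (unit_vec R i)) v"
proof -
  note P = linear_onD[OF P]
  define cut where "cut F = (\<lambda>l. if l \<in> F then v l else \<zero>)" for F
  have cut: "cut F \<in> vecs R" for F using v by (auto simp: cut_def vecs_def)
  have "P (cut F) l = (\<Oplus>i\<in>F. v i \<otimes> P (unit_vec R i) l)" if "finite F" for F l
    using that
  proof (induct F)
    case empty
    have "cut {} = (\<lambda>l. \<zero> \<otimes> cut {} l)" by (auto simp: cut_def)
    then have "P (cut {}) = (\<lambda>l. \<zero> \<otimes> P (cut {}) l)"
      using P(4)[OF zero_closed cut] by metis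
    then have "P (cut {}) l = \<zero> \<otimes> P (cut {}) l" by metis
    then show ?case using P(2)[OF cut] by simp
  next
    case (insert i F)
    have eq: "cut (insert i F) = (\<lambda>l. v i \<otimes> unit_vec R i l \<oplus> cut F l)"
      using insert(2) vecsD[OF v] by (auto simp: cut_def unit_vec_def)
    have vi: "(\<lambda>l. v i \<otimes> unit_vec R i l) \<in> vecs R"
      using vecsD[OF v] by (auto simp: vecs_def unit_vec_def)
    have "P (cut (insert i F)) l = v i \<otimes> P (unit_vec R i) l \<oplus> P (cut F) l"
      unfolding eq using P(3)[OF vi cut] P(4)[OF vecsD[OF v] unit_vec_closed] by simp
    also have "\<dots> = (\<Oplus>i\<in>insert i F. v i \<otimes> P (unit_vec R i) l)"
      using insert P(2)[OF unit_vec_closed] vecsD[OF v] by (simp add: Pi_iff)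
    finally show ?case .
  qed
  from this[of UNIV] show ?thesis by (simp add: cut_def mat_map_def fun_eq_iff)
qed

lemma linear_eqI:
  fixes P Q :: "('i::finite \<Rightarrow> 'a) \<Rightarrow> ('i \<Rightarrow> 'a)"
  assumes "linear_on R P" "linear_on R Q" "\<And>i. P (unit_vec R i) = Q (unit_vec R i)" "v \<in> vecs R"
  shows "P v = Q v"
  using linear_expand[OF assms(1,4)] linear_expand[OF assms(2,4)] assms(3) by simp

lemma linear_mat_map:
  fixes p :: "'i::finite \<Rightarrow> 'i \<Rightarrow> 'a"
  assumes p: "\<And>i. p i \<in> vecs R" shows "linear_on R (mat_map R p)"
  unfolding linear_on_def
proof (intro conjI ballI)
  fix v w :: "'i \<Rightarrow> 'a" and r assume v: "v \<in> vecs R"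
  note pc = vecsD[OF p] vecsD[OF v]
  show "mat_map R p v \<in> vecs R"
    by (auto simp: mat_map_def vecs_def pc intro!: finsum_closed)
  show "mat_map R p (\<lambda>l. r \<otimes> v l) = (\<lambda>l. r \<otimes> mat_map R p v l)" if "r \<in> carrier R"
    using that by (auto simp: mat_map_def pc finsum_rdistr m_assoc Pi_iff intro!: ext finsum_cong')
  assume w: "w \<in> vecs R"
  show "mat_map R p (\<lambda>l. v l \<oplus> w l) = (\<lambda>l. mat_map R p v l \<oplus> mat_map R p w l)"
    by (auto simp: mat_map_def pc vecsD[OF w] l_distr Pi_iff intro!: ext finsum_addf)
qed

lemma mat_map_unit:
  assumes p: "\<And>i. p i \<in> vecs R" shows "mat_map R p (unit_vec R i) = p i"
proof
  fix l
  have "(\<Oplus>m\<in>UNIV. unit_vec R i m \<otimes> p m l) = (\<Oplus>m\<in>UNIV. if i = m then p m l else \<zero>)"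
    using vecsD[OF p] by (intro finsum_cong') (auto simp: unit_vec_def)
  also have "\<dots> = p i l"
    using vecsD[OF p] by (subst add.finprod_singleton) auto
  finally show "mat_map R p (unit_vec R i) l = p i l" by (simp add: mat_map_def)
qed

end

section \<open>Automorphisms after extension of scalars\<close>

lemma extend_scalars_simps:
  "carrier (extend_scalars A e R) = vecs R"
  "v \<oplus>\<^bsub>extend_scalars A e R\<^esub> w = (\<lambda>l. v l \<oplus>\<^bsub>R\<^esub> w l)"
  "r \<odot>\<^bsub>extend_scalars A e R\<^esub> v = (\<lambda>l. r \<otimes>\<^bsub>R\<^esub> v l)"
  "\<one>\<^bsub>extend_scalars A e R\<^esub> = (\<lambda>l. struct_map R (coord A e \<one>\<^bsub>A\<^esub> l))"
  by (auto simp: extend_scalars_def vecs_def)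

definition xmult :: "('k::field, 'a) module \<Rightarrow> ('i::finite \<Rightarrow> 'a) \<Rightarrow> ('k, 'u) module
     \<Rightarrow> ('i \<Rightarrow> 'u) \<Rightarrow> ('i \<Rightarrow> 'u) \<Rightarrow> ('i \<Rightarrow> 'u)" where
  "xmult A e R = monoid.mult (extend_scalars A e R)"

definition xone :: "('k::field, 'a) module \<Rightarrow> ('i::finite \<Rightarrow> 'a) \<Rightarrow> ('k, 'u) module \<Rightarrow> ('i \<Rightarrow> 'u)" where
  "xone A e R = one (extend_scalars A e R)"

text \<open>The product is a combination of the linear maps \<open>mat_map\<close>, so that its bilinearity and its
compatibility with homomorphisms reduce to those of \<open>mat_map\<close>.\<close>

lemma xmult_eq: "xmult A e R v w = mat_map R (\<lambda>i. mat_map R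
    (\<lambda>m l. struct_map R (coord A e (e i \<otimes>\<^bsub>A\<^esub> e m) l)) w) v"
  if "comm_alg R" "v \<in> vecs R" "w \<in> vecs R"
proof -
  interpret cring R using that(1) by (rule comm_algD)
  show ?thesis
    using vecsD[OF that(2)] vecsD[OF that(3)] struct_map_simps(1)[OF that(1)]
    by (auto simp: xmult_def extend_scalars_def mat_map_def finsum_rdistr m_assoc Pi_iff
        intro!: ext finsum_cong')
qed

lemma xmult_linear_left:
  assumes R: "comm_alg R" and w: "w \<in> vecs R" shows "linear_on R (\<lambda>v. xmult A e R v w)"
proof -
  interpret cring R using R by (rule comm_algD)
  have p: "mat_map R (\<lambda>m l. struct_map R (coord A e (e i \<otimes>\<^bsub>A\<^esub> e m) l)) w \<in> vecs R" for i
    by (rule linear_onD(1)[OF linear_mat_map w]) (simp add: vecs_def struct_map_simps R)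
  show ?thesis
    using linear_mat_map[OF p] w
    by (auto simp: linear_on_def xmult_eq[OF R] vecs_def)
qed

lemma xmult_linear_right:
  fixes R :: "('k::field, 'u) module" and e :: "'i::finite \<Rightarrow> 'a"
  assumes R: "comm_alg R" and v: "v \<in> vecs R" shows "linear_on R (xmult A e R v)"
proof -
  interpret cring R using R by (rule comm_algD)
  let ?q = "\<lambda>i. mat_map R (\<lambda>m l. struct_map R (coord A e (e i \<otimes>\<^bsub>A\<^esub> e m) l))"
  have q: "linear_on R (?q i)" for i
    by (rule linear_mat_map) (simp add: vecs_def struct_map_simps R)
  note q = linear_onD[OF q] and vc = vecsD[OF v]
  have eq: "xmult A e R v w l = (\<Oplus>\<^bsub>R\<^esub>i\<in>UNIV. v i \<otimes>\<^bsub>R\<^esub> ?q i w l)" if "w \<in> vecs R" for w l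
    using that by (simp add: xmult_eq[OF R v]) (simp add: mat_map_def)
  show ?thesis
    unfolding linear_on_def
  proof (intro conjI ballI)
    fix w w' :: "'i \<Rightarrow> 'u" and r assume w: "w \<in> vecs R"
    show "xmult A e R v w \<in> vecs R"
      unfolding vecs_def mem_Collect_eq eq[OF w] using q(2)[OF w] vc by (auto intro!: finsum_closed)
    show "xmult A e R v (\<lambda>l. r \<otimes>\<^bsub>R\<^esub> w l) = (\<lambda>l. r \<otimes>\<^bsub>R\<^esub> xmult A e R v w l)" if r: "r \<in> carrier R"
    proof -
      have rw: "(\<lambda>l. r \<otimes>\<^bsub>R\<^esub> w l) \<in> vecs R" using r w by (auto simp: vecs_def)
      show ?thesis
        using q(2)[OF w] vc r
        by (auto simp: eq w rw q(4) finsum_rdistr m_lcomm Pi_iff intro!: ext finsum_cong')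
    qed
    assume w': "w' \<in> vecs R"
    show "xmult A e R v (\<lambda>l. w l \<oplus>\<^bsub>R\<^esub> w' l) = (\<lambda>l. xmult A e R v w l \<oplus>\<^bsub>R\<^esub> xmult A e R v w' l)"
    proof -
      have ww: "(\<lambda>l. w l \<oplus>\<^bsub>R\<^esub> w' l) \<in> vecs R" using w w' by (auto simp: vecs_def)
      show ?thesis
        using q(2)[OF w] q(2)[OF w'] vc
        by (auto simp: eq w w' ww q(3) r_distr Pi_iff intro!: ext finsum_addf)
    qed
  qed
qed

lemmas xmult_closed = linear_onD(1)[OF xmult_linear_right]

lemma xone_closed: "comm_alg R \<Longrightarrow> xone A e R \<in> vecs R"
  by (simp add: xone_def extend_scalars_simps vecs_def struct_map_simps)

lemma linear_on_comp: "linear_on R P \<Longrightarrow> linear_on R Q \<Longrightarrow> linear_on R (\<lambda>v. P (Q v))"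
  by (simp add: linear_on_def)

section \<open>Functoriality in the ring of coefficients\<close>

lemma map_vecs: "h \<in> homs R S \<Longrightarrow> v \<in> vecs R \<Longrightarrow> h \<circ> v \<in> vecs S"
  by (auto simp: vecs_def homs_closed)

lemma map_unit_vec:
  assumes "comm_alg R" "comm_alg S" "h \<in> homs R S"
  shows "h \<circ> unit_vec R i = unit_vec S i"
  using homs_zero[OF assms] homs_one[OF assms(3)] by (auto simp: unit_vec_def)

lemma map_mat_map:
  fixes p :: "'i::finite \<Rightarrow> 'i \<Rightarrow> 'u"
  assumes "comm_alg R" "comm_alg S" "h \<in> homs R S" "v \<in> vecs R" "\<And>i. p i \<in> vecs R"
  shows "h \<circ> mat_map R p v = mat_map S (\<lambda>i. h \<circ> p i) (h \<circ> v)"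
proof
  fix l
  interpret R: cring R by (rule comm_alg_cring) fact
  interpret S: cring S by (rule comm_alg_cring) fact
  have c: "v i \<in> carrier R" "p i l \<in> carrier R" for i l using assms(4,5) by (auto simp: vecs_def)
  show "(h \<circ> mat_map R p v) l = mat_map S (\<lambda>i. h \<circ> p i) (h \<circ> v) l"
    by (simp add: mat_map_def homs_finsum[OF assms(1-3)] c homs_mult[OF assms(3)] Pi_iff)
qed

lemma map_xmult:
  assumes R: "comm_alg R" and S: "comm_alg S" and h: "h \<in> homs R S" and v: "v \<in> vecs R" and w: "w \<in> vecs R"
  shows "h \<circ> xmult A e R v w = xmult A e S (h \<circ> v) (h \<circ> w)"
proof -
  interpret R: cring R by (rule comm_alg_cring) fact
  have c: "(\<lambda>l. struct_map R (coord A e (e i \<otimes>\<^bsub>A\<^esub> e m) l)) \<in> vecs R" for i m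
    by (simp add: vecs_def struct_map_simps R)
  have "h \<circ> (\<lambda>l. struct_map R (coord A e (e i \<otimes>\<^bsub>A\<^esub> e m) l))
      = (\<lambda>l. struct_map S (coord A e (e i \<otimes>\<^bsub>A\<^esub> e m) l))" for i m
    by (auto simp: homs_struct_map[OF h R])
  then show ?thesis
    using linear_onD(1)[OF R.linear_mat_map w] c
    by (simp add: xmult_eq R S v w map_vecs[OF h] map_mat_map[OF R S h])
qed

lemma map_xone:
  assumes "comm_alg R" "h \<in> homs R S" shows "h \<circ> xone A e R = xone A e S"
  by (auto simp: xone_def extend_scalars_simps homs_struct_map[OF assms(2,1)])

section \<open>The automorphism group\<close>

abbreviation auts where "auts A e R \<equiv> carrier (aut_pts A e R)"

lemma aut_iff:
  "g \<in> auts A e R \<longleftrightarrow> g \<in> extensional (vecs R) \<and> linear_on R g \<and> g (xone A e R) = xone A e R \<and>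
     (\<forall>v\<in>vecs R. \<forall>w\<in>vecs R. g (xmult A e R v w) = xmult A e R (g v) (g w)) \<and> bij_betw g (vecs R) (vecs R)"
  by (auto simp: aut_pts_def alg_isos_def alg_homs_def linear_on_def extend_scalars_simps(1-3) xone_def
      xmult_def PiE_iff)

lemma autD:
  assumes "g \<in> auts A e R"
  shows "g \<in> extensional (vecs R)" "linear_on R g" "g (xone A e R) = xone A e R"
    "\<And>v w. v \<in> vecs R \<Longrightarrow> w \<in> vecs R \<Longrightarrow> g (xmult A e R v w) = xmult A e R (g v) (g w)"
    "bij_betw g (vecs R) (vecs R)" "\<And>v. v \<in> vecs R \<Longrightarrow> g v \<in> vecs R"
  using assms unfolding aut_iff by (auto simp: linear_on_def)

text \<open>Both sides of the multiplicativity law are bilinear.\<close>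

lemma autI_unit_vec:
  assumes R: "comm_alg R" and g: "g \<in> extensional (vecs R)" "linear_on R g"
    and g1: "g (xone A e R) = xone A e R" "bij_betw g (vecs R) (vecs R)"
    and mult: "\<And>i m. g (xmult A e R (unit_vec R i) (unit_vec R m))
      = xmult A e R (g (unit_vec R i)) (g (unit_vec R m))"
  shows "g \<in> auts A e R"
proof -
  interpret cring R using R by (rule comm_algD)
  have 1: "g (xmult A e R (unit_vec R i) w) = xmult A e R (g (unit_vec R i)) (g w)" if "w \<in> vecs R" for i w
    by (rule linear_eqI[OF linear_on_comp[OF g(2) xmult_linear_right[OF R]]
          linear_on_comp[OF xmult_linear_right[OF R] g(2)] mult that])
      (auto intro: linear_onD(1)[OF g(2)])
  have "g (xmult A e R v w) = xmult A e R (g v) (g w)" if "v \<in> vecs R" "w \<in> vecs R" for v w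
    by (rule linear_eqI[OF linear_on_comp[OF g(2) xmult_linear_left[OF R]]
          linear_on_comp[OF xmult_linear_left[OF R] g(2)] 1 that(1)])
      (use that in \<open>auto intro: linear_onD(1)[OF g(2)]\<close>)
  with g g1 show ?thesis unfolding aut_iff by blast
qed

lemma aut_mult: "g \<in> auts A e R \<Longrightarrow> h \<in> auts A e R \<Longrightarrow> g \<otimes>\<^bsub>aut_pts A e R\<^esub> h = compose (vecs R) g h"
  by (simp add: aut_pts_def BijGroup_def Bij_def aut_iff[unfolded aut_pts_def, simplified]
      extend_scalars_simps(1))

lemma aut_one: "\<one>\<^bsub>aut_pts A e R\<^esub> = (\<lambda>v\<in>vecs R. v)"
  by (simp add: aut_pts_def BijGroup_def extend_scalars_simps(1))

lemma linear_on_restrict: "linear_on R P \<Longrightarrow> cring R \<Longrightarrow> linear_on R (restrict P (vecs R))"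
  by (simp add: linear_on_def) (simp add: vecs_def cring.cring_simprules)

lemma aut_inverse:
  fixes R :: "('k::field, 'u) module" and e :: "'i::finite \<Rightarrow> 'a"
  assumes R: "comm_alg R" and g: "g \<in> auts A e R"
  shows "restrict (inv_into (vecs R) g) (vecs R) \<in> auts A e R"
proof -
  interpret cring R using R by (rule comm_algD)
  note g = autD[OF g]
  let ?i = "inv_into (vecs R) g"
  have i: "g (?i v) = v" "?i (g v) = v" "?i v \<in> vecs R" if "v \<in> vecs R" for v
    using that g(5) by (auto simp: bij_betw_inv_into_right bij_betw_inv_into_left bij_betw_def
        intro: inv_into_into f_inv_into_f)
  have inj: "v = w" if "g v = g w" "v \<in> vecs R" "w \<in> vecs R" for v w
    using that g(5) by (auto simp: bij_betw_def inj_on_def)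
  have "linear_on R ?i"
    unfolding linear_on_def
  proof (intro conjI ballI)
    fix v w :: "'i \<Rightarrow> 'u" and r assume v: "v \<in> vecs R"
    show "?i v \<in> vecs R" using i v by blast
    show "?i (\<lambda>l. r \<otimes>\<^bsub>R\<^esub> v l) = (\<lambda>l. r \<otimes>\<^bsub>R\<^esub> ?i v l)" if r: "r \<in> carrier R"
    proof -
      have c: "(\<lambda>l. r \<otimes>\<^bsub>R\<^esub> v l) \<in> vecs R" "(\<lambda>l. r \<otimes>\<^bsub>R\<^esub> ?i v l) \<in> vecs R"
        using r v i(3)[OF v] by (auto simp: vecs_def)
      then show ?thesis using r v by - (rule inj; auto simp: i linear_onD(4)[OF g(2)])
    qed
    assume w: "w \<in> vecs R"
    have c: "(\<lambda>l. v l \<oplus>\<^bsub>R\<^esub> w l) \<in> vecs R" "(\<lambda>l. ?i v l \<oplus>\<^bsub>R\<^esub> ?i w l) \<in> vecs R"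
      using v w i(3)[OF v] i(3)[OF w] by (auto simp: vecs_def)
    then show "?i (\<lambda>l. v l \<oplus>\<^bsub>R\<^esub> w l) = (\<lambda>l. ?i v l \<oplus>\<^bsub>R\<^esub> ?i w l)"
      using v w by - (rule inj; auto simp: i linear_onD(3)[OF g(2)])
  qed
  moreover have "?i (xone A e R) = xone A e R"
    using i(2)[OF xone_closed[OF R, of A e]] g(3) by simp
  moreover have "?i (xmult A e R v w) = xmult A e R (?i v) (?i w)" if "v \<in> vecs R" "w \<in> vecs R" for v w
    using that by - (rule inj; auto simp: i g(4) xmult_closed[OF R])
  ultimately show ?thesis
    unfolding aut_iff
    using bij_betw_inv_into[OF g(5)]
    by (auto simp: linear_on_restrict is_cring xone_closed[OF R] xmult_closed[OF R] i)
qed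

lemma aut_compose:
  assumes R: "comm_alg R" and g: "g \<in> auts A e R" and h: "h \<in> auts A e R"
  shows "compose (vecs R) g h \<in> auts A e R"
proof -
  interpret cring R using R by (rule comm_algD)
  note g = autD[OF g] and h = autD[OF h]
  have "linear_on R (restrict (\<lambda>v. g (h v)) (vecs R))"
    using linear_on_comp[OF g(2) h(2)] is_cring by (rule linear_on_restrict)
  then show ?thesis
    unfolding aut_iff
    using bij_betw_compose[OF h(5) g(5)]
    by (auto simp: compose_def xone_closed[OF R] xmult_closed[OF R] g h)
qed

lemma aut_id:
  fixes R :: "('k::field, 'u) module" and e :: "'i::finite \<Rightarrow> 'a"
  assumes R: "comm_alg R"
  shows "(\<lambda>v\<in>vecs R. v) \<in> auts A e R"
proof -
  interpret cring R using R by (rule comm_algD)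
  have "linear_on R (restrict (\<lambda>v. v) (vecs R :: ('i \<Rightarrow> 'u) set))"
    by (rule linear_on_restrict[OF _ is_cring]) (simp add: linear_on_def)
  then show ?thesis
    unfolding aut_iff
    by (auto simp: xone_closed[OF R] xmult_closed[OF R] bij_betw_def inj_on_def)
qed

lemma aut_group: "comm_alg R \<Longrightarrow> group (aut_pts A e R)"
proof -
  assume R: "comm_alg R"
  let ?X = "extend_scalars A e R"
  have "subgroup (auts A e R) (BijGroup (carrier ?X))"
  proof (rule group.subgroupI[OF group_BijGroup])
    have B: "auts A e R \<subseteq> Bij (vecs R)"
      by (auto simp: aut_iff Bij_def)
    show "auts A e R \<subseteq> carrier (BijGroup (carrier ?X))"
      using B by (simp add: BijGroup_def extend_scalars_simps(1))
    show "auts A e R \<noteq> {}" using aut_id[OF R] by blast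
    fix g assume g: "g \<in> auts A e R"
    show "inv\<^bsub>BijGroup (carrier ?X)\<^esub> g \<in> auts A e R"
      using inv_BijGroup[OF subsetD[OF B g]] aut_inverse[OF R g] by (simp add: extend_scalars_simps(1))
    fix h assume h: "h \<in> auts A e R"
    show "g \<otimes>\<^bsub>BijGroup (carrier ?X)\<^esub> h \<in> auts A e R"
      using g h B aut_compose[OF R g h] by (auto simp: BijGroup_def extend_scalars_simps(1))
  qed
  then have "group ((BijGroup (carrier ?X))\<lparr>carrier := auts A e R\<rparr>)"
    by (rule subgroup.subgroup_is_group) (rule group_BijGroup)
  then show ?thesis by (simp add: aut_pts_def)
qed

lemma aut_mult_apply:
  "g \<in> auts A e R \<Longrightarrow> h \<in> auts A e R \<Longrightarrow> v \<in> vecs R \<Longrightarrow> (g \<otimes>\<^bsub>aut_pts A e R\<^esub> h) v = g (h v)"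
  by (simp add: aut_mult compose_def)

lemma aut_inv_apply:
  assumes R: "comm_alg R" and g: "g \<in> auts A e R" and v: "v \<in> vecs R"
  shows "(inv\<^bsub>aut_pts A e R\<^esub> g) (g v) = v" "g ((inv\<^bsub>aut_pts A e R\<^esub> g) v) = v"
proof -
  interpret G: group "aut_pts A e R" using R by (rule aut_group)
  show "(inv\<^bsub>aut_pts A e R\<^esub> g) (g v) = v"
    using aut_mult_apply[OF G.inv_closed[OF g] g v] G.l_inv[OF g] v by (simp add: aut_one)
  show "g ((inv\<^bsub>aut_pts A e R\<^esub> g) v) = v"
    using aut_mult_apply[OF g G.inv_closed[OF g] v] G.r_inv[OF g] v by (simp add: aut_one)
qed

lemma aut_eqI:
  "g \<in> auts A e R \<Longrightarrow> h \<in> auts A e R \<Longrightarrow> comm_alg R \<Longrightarrow>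
    (\<And>i. g (unit_vec R i) = h (unit_vec R i)) \<Longrightarrow> g = h"
  using cring.linear_eqI[OF comm_alg_cring autD(2) autD(2), of R g A e h]
  by (intro extensionalityI[OF autD(1) autD(1)]) auto

section \<open>Automorphisms as a functor\<close>

lemma aut_map_eq:
  "aut_map A e R S h g = restrict (mat_map S (\<lambda>i. h \<circ> g (unit_vec R i))) (vecs S)"
  by (auto simp: aut_map_def mat_map_def unit_vec_def extend_scalars_simps(1) fun_eq_iff restrict_def)

context
  fixes R :: "('k::field, 'u) module" and S :: "('k, 'w) module" and h
  assumes R: "comm_alg R" and S: "comm_alg S" and h: "h \<in> homs R S"
begin

interpretation R: cring R using R by (rule comm_algD)
interpretation S: cring S using S by (rule comm_algD)

lemma aut_map_linear:
  assumes g: "\<And>i. g (unit_vec R i) \<in> vecs R"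
  shows "linear_on S (aut_map A e R S h g)"
  unfolding aut_map_eq by (intro linear_on_restrict S.linear_mat_map map_vecs[OF h] g S.is_cring)

text \<open>This characterizes \<open>aut_map\<close>, as the vectors \<open>h \<circ> v\<close> include the unit vectors; the functorial
properties of \<open>aut_map\<close> all follow from it.\<close>

lemma aut_map_apply:
  assumes g: "linear_on R g" and v: "v \<in> vecs R"
  shows "aut_map A e R S h g (h \<circ> v) = h \<circ> g v"
  using map_mat_map[OF R S h v, of "\<lambda>i. g (unit_vec R i)"] linear_onD(1)[OF g] v
  by (simp add: aut_map_eq map_vecs[OF h] R.linear_expand[OF g v, symmetric])

lemma aut_map_unit_vec:
  assumes g: "linear_on R g"
  shows "aut_map A e R S h g (unit_vec S i) = h \<circ> g (unit_vec R i)"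
  using aut_map_apply[OF g R.unit_vec_closed] by (simp add: map_unit_vec[OF R S h])

lemma aut_map_compose_inverse:
  assumes g: "linear_on R g" and g': "linear_on R g'"
    and inv: "\<And>v. v \<in> vecs R \<Longrightarrow> g (g' v) = v" and v: "v \<in> vecs S"
  shows "aut_map A e R S h g (aut_map A e R S h g' v) = v"
proof -
  have "linear_on S (aut_map A e R S h g)" "linear_on S (aut_map A e R S h g')"
    using linear_onD(1)[OF g] linear_onD(1)[OF g'] by (auto intro: aut_map_linear)
  then have L: "linear_on S (\<lambda>v. aut_map A e R S h g (aut_map A e R S h g' v))"
    by (rule linear_on_comp)
  show ?thesis
  proof (rule S.linear_eqI[OF L _ _ v])
    show "linear_on S (\<lambda>v. v)" by (simp add: linear_on_def)
    show "aut_map A e R S h g (aut_map A e R S h g' (unit_vec S i)) = unit_vec S i" for i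
      using linear_onD(1)[OF g' R.unit_vec_closed]
      by (simp add: aut_map_unit_vec[OF g'] aut_map_apply[OF g] inv map_unit_vec[OF R S h])
  qed
qed

lemma aut_map_aut:
  assumes g: "g \<in> auts A e R" shows "aut_map A e R S h g \<in> auts A e S"
proof (rule autI_unit_vec[OF S])
  note g' = autD[OF aut_inverse[OF R g]]
  note gd = autD[OF g]
  let ?g' = "restrict (inv_into (vecs R) g) (vecs R)"
  have i: "g (?g' v) = v" "?g' (g v) = v" if "v \<in> vecs R" for v
    using that gd(5,6) by (auto simp: bij_betw_inv_into_right bij_betw_inv_into_left)
  show "aut_map A e R S h g \<in> extensional (vecs S)" by (simp add: aut_map_eq)
  show lin: "linear_on S (aut_map A e R S h g)" using gd by (auto intro: aut_map_linear)
  have lin': "linear_on S (aut_map A e R S h ?g')" using g' by (auto intro!: aut_map_linear)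
  show "aut_map A e R S h g (xone A e S) = xone A e S"
    using aut_map_apply[OF gd(2) xone_closed[OF R, of A e], of A e] by (simp add: map_xone[OF R h] gd)
  show "bij_betw (aut_map A e R S h g) (vecs S) (vecs S)"
    by (rule bij_betw_byWitness[where f'="aut_map A e R S h ?g'"])
      (auto simp: aut_map_compose_inverse[OF gd(2) g'(2) i(1)]
        aut_map_compose_inverse[OF g'(2) gd(2) i(2)] linear_onD(1)[OF lin] linear_onD(1)[OF lin'])
  fix i m
  show "aut_map A e R S h g (xmult A e S (unit_vec S i) (unit_vec S m))
      = xmult A e S (aut_map A e R S h g (unit_vec S i)) (aut_map A e R S h g (unit_vec S m))"
    unfolding aut_map_unit_vec[OF gd(2)]
    by (simp add: map_unit_vec[OF R S h, symmetric] map_xmult[OF R S h, symmetric]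
        aut_map_apply[OF gd(2)] xmult_closed[OF R] gd)
qed

lemma aut_map_mult:
  assumes g: "g \<in> auts A e R" and g': "g' \<in> auts A e R"
  shows "aut_map A e R S h (g \<otimes>\<^bsub>aut_pts A e R\<^esub> g')
    = aut_map A e R S h g \<otimes>\<^bsub>aut_pts A e S\<^esub> aut_map A e R S h g'"
proof (rule aut_eqI[OF _ _ S])
  interpret G: group "aut_pts A e R" using R by (rule aut_group)
  interpret GS: group "aut_pts A e S" using S by (rule aut_group)
  show "aut_map A e R S h (g \<otimes>\<^bsub>aut_pts A e R\<^esub> g') \<in> auts A e S"
    using g g' by (intro aut_map_aut G.m_closed)
  show "aut_map A e R S h g \<otimes>\<^bsub>aut_pts A e S\<^esub> aut_map A e R S h g' \<in> auts A e S"
    using g g' by (intro aut_map_aut GS.m_closed)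
  show "aut_map A e R S h (g \<otimes>\<^bsub>aut_pts A e R\<^esub> g') (unit_vec S i)
      = (aut_map A e R S h g \<otimes>\<^bsub>aut_pts A e S\<^esub> aut_map A e R S h g') (unit_vec S i)" for i
    using autD(2)[OF G.m_closed[OF g g']] autD(2)[OF g] autD(2,6)[OF g']
    by (simp add: aut_map_unit_vec aut_mult_apply aut_map_aut g g' aut_map_apply)
      (simp add: comp_def)
qed

lemma aut_map_hom: "aut_map A e R S h \<in> hom (aut_pts A e R) (aut_pts A e S)"
  by (intro homI aut_map_aut aut_map_mult)

lemma aut_map_inj:
  assumes "inj_on h (carrier R)" "g \<in> auts A e R" "g' \<in> auts A e R"
    and eq: "aut_map A e R S h g = aut_map A e R S h g'"
  shows "g = g'"
proof (rule aut_eqI[OF assms(2,3) R])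
  fix i
  have "h \<circ> g (unit_vec R i) = h \<circ> g' (unit_vec R i)"
    using eq aut_map_unit_vec[OF autD(2)[OF assms(2)], of A e i]
      aut_map_unit_vec[OF autD(2)[OF assms(3)], of A e i] by simp
  then show "g (unit_vec R i) = g' (unit_vec R i)"
    using assms(1) vecsD[OF autD(6)[OF assms(2) R.unit_vec_closed]]
      vecsD[OF autD(6)[OF assms(3) R.unit_vec_closed]]
    by (auto simp: fun_eq_iff inj_on_def)
qed

end

lemma aut_map_id:
  assumes R: "comm_alg R" and g: "g \<in> auts A e R"
  shows "aut_map A e R R (\<lambda>r\<in>carrier R. r) g = g"
proof (rule aut_eqI[OF aut_map_aut[OF R R homs_id[OF R] g] g R])
  interpret cring R using R by (rule comm_algD)
  show "aut_map A e R R (\<lambda>r\<in>carrier R. r) g (unit_vec R i) = g (unit_vec R i)" for i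
    using vecsD[OF autD(6)[OF g unit_vec_closed]]
    by (auto simp: aut_map_unit_vec[OF R R homs_id[OF R] autD(2)[OF g]])
qed

lemma aut_map_compose:
  assumes R: "comm_alg R" and S: "comm_alg S" and T: "comm_alg T"
    and h: "h \<in> homs R S" and h': "h' \<in> homs S T" and g: "g \<in> auts A e R"
  shows "aut_map A e R T (compose (carrier R) h' h) g = aut_map A e S T h' (aut_map A e R S h g)"
proof (rule aut_eqI[OF _ _ T])
  interpret cring R using R by (rule comm_algD)
  note hh = homs_compose[OF R h h'] and gS = aut_map_aut[OF R S h g]
  show "aut_map A e R T (compose (carrier R) h' h) g \<in> auts A e T"
    by (rule aut_map_aut[OF R T hh g])
  show "aut_map A e S T h' (aut_map A e R S h g) \<in> auts A e T"
    by (rule aut_map_aut[OF S T h' gS])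
  show "aut_map A e R T (compose (carrier R) h' h) g (unit_vec T i)
      = aut_map A e S T h' (aut_map A e R S h g) (unit_vec T i)" for i
    using vecsD[OF autD(6)[OF g unit_vec_closed]]
    by (simp add: aut_map_unit_vec[OF R T hh autD(2)[OF g]] aut_map_unit_vec[OF S T h' autD(2)[OF gS]]
        aut_map_unit_vec[OF R S h autD(2)[OF g]])
      (auto simp: compose_def)
qed

section \<open>Quotients of term algebras inside the universe\<close>

text \<open>The quotient of a set \<open>T\<close> of terms by the kernel of an interpretation \<open>sem\<close> which is compatible with
the operations and identifies the two sides of every law of commutative algebras. The class of a term
is represented by the code of one chosen member, so the quotient has its carrier in the type of codes.\<close>

locale coded_algebra =
  fixes T :: "'t set" and code :: "'t \<Rightarrow> 'u" and sem :: "'t \<Rightarrow> 's"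
    and tone :: 't and tadd tmul :: "'t \<Rightarrow> 't \<Rightarrow> 't" and tsm :: "'c::field \<Rightarrow> 't \<Rightarrow> 't"
  assumes code_inj: "inj_on code T"
    and T_closed: "tone \<in> T" "\<And>s t. s \<in> T \<Longrightarrow> t \<in> T \<Longrightarrow> tadd s t \<in> T"
      "\<And>s t. s \<in> T \<Longrightarrow> t \<in> T \<Longrightarrow> tmul s t \<in> T" "\<And>c t. t \<in> T \<Longrightarrow> tsm c t \<in> T"
    and sem_cong: "\<And>s s' t t'. \<lbrakk>s \<in> T; s' \<in> T; t \<in> T; t' \<in> T; sem s = sem s'; sem t = sem t'\<rbrakk>
        \<Longrightarrow> sem (tadd s t) = sem (tadd s' t')"
      "\<And>s s' t t'. \<lbrakk>s \<in> T; s' \<in> T; t \<in> T; t' \<in> T; sem s = sem s'; sem t = sem t'\<rbrakk>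
        \<Longrightarrow> sem (tmul s t) = sem (tmul s' t')"
      "\<And>c t t'. \<lbrakk>t \<in> T; t' \<in> T; sem t = sem t'\<rbrakk> \<Longrightarrow> sem (tsm c t) = sem (tsm c t')"
    and sem_laws: "\<And>s t u. \<lbrakk>s \<in> T; t \<in> T; u \<in> T\<rbrakk> \<Longrightarrow> sem (tadd (tadd s t) u) = sem (tadd s (tadd t u))"
      "\<And>s t. \<lbrakk>s \<in> T; t \<in> T\<rbrakk> \<Longrightarrow> sem (tadd s t) = sem (tadd t s)"
      "\<And>t. t \<in> T \<Longrightarrow> sem (tadd (tsm 0 tone) t) = sem t"
      "\<And>t. t \<in> T \<Longrightarrow> sem (tadd (tsm (- 1) t) t) = sem (tsm 0 tone)"
      "\<And>s t u. \<lbrakk>s \<in> T; t \<in> T; u \<in> T\<rbrakk> \<Longrightarrow> sem (tmul (tmul s t) u) = sem (tmul s (tmul t u))"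
      "\<And>s t. \<lbrakk>s \<in> T; t \<in> T\<rbrakk> \<Longrightarrow> sem (tmul s t) = sem (tmul t s)"
      "\<And>t. t \<in> T \<Longrightarrow> sem (tmul tone t) = sem t"
      "\<And>s t u. \<lbrakk>s \<in> T; t \<in> T; u \<in> T\<rbrakk>
        \<Longrightarrow> sem (tmul (tadd s t) u) = sem (tadd (tmul s u) (tmul t u))"
      "\<And>c d t. t \<in> T \<Longrightarrow> sem (tsm (c + d) t) = sem (tadd (tsm c t) (tsm d t))"
      "\<And>c s t. \<lbrakk>s \<in> T; t \<in> T\<rbrakk> \<Longrightarrow> sem (tsm c (tadd s t)) = sem (tadd (tsm c s) (tsm c t))"
      "\<And>c d t. t \<in> T \<Longrightarrow> sem (tsm (c * d) t) = sem (tsm c (tsm d t))"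
      "\<And>t. t \<in> T \<Longrightarrow> sem (tsm 1 t) = sem t"
      "\<And>c s t. \<lbrakk>s \<in> T; t \<in> T\<rbrakk> \<Longrightarrow> sem (tmul (tsm c s) t) = sem (tsm c (tmul s t))"
begin

definition cls :: "'t \<Rightarrow> 'u" where
  "cls t = code (SOME t'. t' \<in> T \<and> sem t' = sem t)"

definition dec :: "'u \<Rightarrow> 't" where
  "dec x = (SOME t. t \<in> T \<and> cls t = x)"

definition alg :: "('c, 'u) module" where
  "alg = \<lparr>carrier = cls ` T, monoid.mult = (\<lambda>x y. cls (tmul (dec x) (dec y))), one = cls tone,
     ring.zero = cls (tsm 0 tone), add = (\<lambda>x y. cls (tadd (dec x) (dec y))),
     module.smult = (\<lambda>c x. cls (tsm c (dec x)))\<rparr>"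

lemma cls_eq_iff: "s \<in> T \<Longrightarrow> t \<in> T \<Longrightarrow> cls s = cls t \<longleftrightarrow> sem s = sem t"
proof -
  assume "s \<in> T" "t \<in> T"
  then have 1: "(SOME t'. t' \<in> T \<and> sem t' = sem s) \<in> T \<and> sem (SOME t'. t' \<in> T \<and> sem t' = sem s) = sem s"
    "(SOME t'. t' \<in> T \<and> sem t' = sem t) \<in> T \<and> sem (SOME t'. t' \<in> T \<and> sem t' = sem t) = sem t"
    by (auto intro: someI2)
  then have "cls s = cls t \<longleftrightarrow> (SOME t'. t' \<in> T \<and> sem t' = sem s) = (SOME t'. t' \<in> T \<and> sem t' = sem t)"
    unfolding cls_def by (intro inj_on_eq_iff[OF code_inj]) blast+
  also have "\<dots> \<longleftrightarrow> sem s = sem t"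
    using 1 by metis
  finally show ?thesis .
qed

lemma dec_cls: "t \<in> T \<Longrightarrow> dec (cls t) \<in> T" "t \<in> T \<Longrightarrow> sem (dec (cls t)) = sem t"
proof -
  assume t: "t \<in> T"
  then have d: "dec (cls t) \<in> T \<and> cls (dec (cls t)) = cls t"
    unfolding dec_def by (intro someI[where P="\<lambda>s. s \<in> T \<and> cls s = cls t"]) simp
  then show "dec (cls t) \<in> T" by blast
  with d t show "sem (dec (cls t)) = sem t" by (simp add: cls_eq_iff)
qed

lemma alg_carrier: "carrier alg = cls ` T" by (simp add: alg_def)

lemma cls_closed: "t \<in> T \<Longrightarrow> cls t \<in> carrier alg" by (simp add: alg_carrier)

lemma alg_ops:
  "\<one>\<^bsub>alg\<^esub> = cls tone" "\<zero>\<^bsub>alg\<^esub> = cls (tsm 0 tone)"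
  "\<lbrakk>s \<in> T; t \<in> T\<rbrakk> \<Longrightarrow> cls s \<oplus>\<^bsub>alg\<^esub> cls t = cls (tadd s t)"
  "\<lbrakk>s \<in> T; t \<in> T\<rbrakk> \<Longrightarrow> cls s \<otimes>\<^bsub>alg\<^esub> cls t = cls (tmul s t)"
  "t \<in> T \<Longrightarrow> c \<odot>\<^bsub>alg\<^esub> cls t = cls (tsm c t)"
  by (simp_all add: alg_def)
    (simp_all only: cls_eq_iff T_closed dec_cls, (rule sem_cong; simp only: dec_cls)+)

lemma alg_comm_alg: "comm_alg alg"
proof (rule comm_algI)
  note simps = alg_ops T_closed cls_eq_iff
  have "abelian_group alg"
  proof (rule abelian_groupI)
    fix x assume "x \<in> carrier alg"
    then obtain t where "t \<in> T" "x = cls t" by (auto simp: alg_carrier)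
    then show "\<exists>y\<in>carrier alg. y \<oplus>\<^bsub>alg\<^esub> x = \<zero>\<^bsub>alg\<^esub>"
      by (intro bexI[of _ "cls (tsm (- 1) t)"]) (simp_all add: simps sem_laws(4) cls_closed)
  qed (auto simp: alg_carrier simps sem_laws(1,3) intro: sem_laws(2))
  moreover have "comm_monoid alg"
    by (rule comm_monoidI) (auto simp: alg_carrier simps sem_laws(5,7) intro: sem_laws(6))
  ultimately show "cring alg"
    by (rule cringI) (auto simp: alg_carrier simps sem_laws(8))
qed (auto simp: alg_carrier alg_ops T_closed cls_eq_iff sem_laws(9-13))

lemma homs_from_alg:
  assumes f: "\<And>t. t \<in> T \<Longrightarrow> f t \<in> carrier S"
    and cong: "\<And>s t. s \<in> T \<Longrightarrow> t \<in> T \<Longrightarrow> sem s = sem t \<Longrightarrow> f s = f t"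
    and ops: "f tone = \<one>\<^bsub>S\<^esub>" "\<And>s t. s \<in> T \<Longrightarrow> t \<in> T \<Longrightarrow> f (tadd s t) = f s \<oplus>\<^bsub>S\<^esub> f t"
      "\<And>s t. s \<in> T \<Longrightarrow> t \<in> T \<Longrightarrow> f (tmul s t) = f s \<otimes>\<^bsub>S\<^esub> f t"
      "\<And>c t. t \<in> T \<Longrightarrow> f (tsm c t) = c \<odot>\<^bsub>S\<^esub> f t"
  shows "(\<lambda>x\<in>carrier alg. f (dec x)) \<in> homs alg S"
    and "\<And>t. t \<in> T \<Longrightarrow> (\<lambda>x\<in>carrier alg. f (dec x)) (cls t) = f t"
proof -
  have 1: "f (dec (cls t)) = f t" if "t \<in> T" for t
    using that by (intro cong dec_cls)
  then show "\<And>t. t \<in> T \<Longrightarrow> (\<lambda>x\<in>carrier alg. f (dec x)) (cls t) = f t"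
    by (simp add: cls_closed)
  show "(\<lambda>x\<in>carrier alg. f (dec x)) \<in> homs alg S"
    by (auto simp: alg_homs_def alg_carrier 1 f alg_ops T_closed ops)
qed

end

section \<open>Injective codes\<close>

lemma infinite_pairing:
  assumes "infinite (UNIV :: 'u set)"
  obtains pr :: "'u \<Rightarrow> 'u \<Rightarrow> 'u" and num :: "nat \<Rightarrow> 'u"
  where "\<And>a b c d. pr a b = pr c d \<longleftrightarrow> a = c \<and> b = d" "inj num"
proof -
  have "|UNIV \<times> UNIV :: ('u \<times> 'u) set| =o |UNIV :: 'u set|"
    by (rule card_of_Times_same_infinite) (use assms in auto)
  then obtain f where f: "bij_betw f (UNIV \<times> UNIV :: ('u \<times> 'u) set) (UNIV :: 'u set)"
    using card_of_ordIso by blast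
  then have "f (a, b) = f (c, d) \<longleftrightarrow> a = c \<and> b = d" for a b c d
    by (auto simp: bij_betw_def inj_on_def)
  moreover obtain num :: "nat \<Rightarrow> 'u" where "inj num"
    using infinite_countable_subset[OF assms] by blast
  ultimately show ?thesis using that[of "\<lambda>a b. f (a, b)" num] by blast
qed

lemma universe_infinite: "inj (\<iota> :: 'c::field_char_0 \<Rightarrow> 'u) \<Longrightarrow> infinite (UNIV :: 'u set)"
  using infinite_UNIV_char_0[where 'a='c] by (metis finite_imageD finite_subset subset_UNIV)

datatype ('c, 'w) alg_term = TOne | TVar 'w | TAdd "('c, 'w) alg_term" "('c, 'w) alg_term"
  | TMul "('c, 'w) alg_term" "('c, 'w) alg_term" | TSmult 'c "('c, 'w) alg_term"

primrec term_code ::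
  "('u \<Rightarrow> 'u \<Rightarrow> 'u) \<Rightarrow> (nat \<Rightarrow> 'u) \<Rightarrow> ('c \<Rightarrow> 'u) \<Rightarrow> ('w \<Rightarrow> 'u) \<Rightarrow> ('c, 'w) alg_term \<Rightarrow> 'u" where
  "term_code pr num ic iw TOne = pr (num 0) (num 0)"
| "term_code pr num ic iw (TVar w) = pr (num 1) (iw w)"
| "term_code pr num ic iw (TAdd s t) = pr (num 2) (pr (term_code pr num ic iw s) (term_code pr num ic iw t))"
| "term_code pr num ic iw (TMul s t) = pr (num 3) (pr (term_code pr num ic iw s) (term_code pr num ic iw t))"
| "term_code pr num ic iw (TSmult c t) = pr (num 4) (pr (ic c) (term_code pr num ic iw t))"

lemma alg_term_code_exists:
  fixes \<iota> :: "'c::field_char_0 \<Rightarrow> 'u"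
  assumes "inj \<iota>"
  shows "\<exists>code :: ('c, 'w::finite) alg_term \<Rightarrow> 'u. inj code"
proof -
  obtain pr :: "'u \<Rightarrow> 'u \<Rightarrow> 'u" and num :: "nat \<Rightarrow> 'u"
    where pr: "\<And>a b c d. pr a b = pr c d \<longleftrightarrow> a = c \<and> b = d" and num: "inj num"
    using infinite_pairing[OF universe_infinite[OF assms]] by blast
  obtain nw :: "'w \<Rightarrow> nat" where nw: "inj nw"
    using finite_imp_inj_to_nat_seg[OF finite, of "UNIV :: 'w set"] by auto
  define code :: "('c, 'w) alg_term \<Rightarrow> 'u" where "code = term_code pr num \<iota> (num \<circ> nw)"
  have "s = t" if "code s = code t" for s t
    using that unfolding code_def
  proof (induct s arbitrary: t)
    case TOne then show ?case by (cases t) (auto simp: pr inj_eq[OF num])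
  next
    case (TVar x) then show ?case by (cases t) (auto simp: pr inj_eq[OF num] inj_eq[OF nw])
  next
    case (TAdd s1 s2) then show ?case by (cases t) (auto simp: pr inj_eq[OF num])
  next
    case (TMul s1 s2) then show ?case by (cases t) (auto simp: pr inj_eq[OF num])
  next
    case (TSmult c s) then show ?case by (cases t) (auto simp: pr inj_eq[OF num] inj_eq[OF assms])
  qed
  then have "inj code" by (rule injI)
  then show ?thesis by blast
qed

primrec term_eval :: "('c, 'u) module \<Rightarrow> ('w \<Rightarrow> 'u) \<Rightarrow> ('c, 'w) alg_term \<Rightarrow> 'u" where
  "term_eval R v TOne = \<one>\<^bsub>R\<^esub>"
| "term_eval R v (TVar w) = v w"
| "term_eval R v (TAdd s t) = term_eval R v s \<oplus>\<^bsub>R\<^esub> term_eval R v t"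
| "term_eval R v (TMul s t) = term_eval R v s \<otimes>\<^bsub>R\<^esub> term_eval R v t"
| "term_eval R v (TSmult c t) = c \<odot>\<^bsub>R\<^esub> term_eval R v t"

lemma term_eval_closed:
  assumes R: "comm_alg R" and v: "\<And>w. v w \<in> carrier R"
  shows "term_eval R v t \<in> carrier R"
proof -
  interpret cring R using R by (rule comm_algD)
  show ?thesis by (induct t) (auto simp: v comm_alg_smult_closed[OF R])
qed

text \<open>The algebra of polynomial functions on a class of points, a point being a tuple of elements of some
test algebra. Terms are interpreted by their values at all points; so the evaluations at the points
are homomorphisms that jointly separate the elements.\<close>

locale function_algebra =
  fixes P :: "(('c::field, 'u) module \<times> ('w::finite \<Rightarrow> 'u)) set"
    and code :: "('c, 'w) alg_term \<Rightarrow> 'u"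
  assumes code: "inj code"
    and P: "\<And>R v. (R, v) \<in> P \<Longrightarrow> comm_alg R" "\<And>R v w. (R, v) \<in> P \<Longrightarrow> v w \<in> carrier R"
begin

definition sem :: "('c, 'w) alg_term \<Rightarrow> ('c, 'u) module \<times> ('w \<Rightarrow> 'u) \<Rightarrow> 'u" where
  "sem t = (\<lambda>p\<in>P. term_eval (fst p) (snd p) t)"

lemma sem_eq_iff: "sem s = sem t \<longleftrightarrow> (\<forall>R v. (R, v) \<in> P \<longrightarrow> term_eval R v s = term_eval R v t)"
  by (auto simp: sem_def fun_eq_iff restrict_def)

lemma eval_ring: "(R, v) \<in> P \<Longrightarrow> cring R" "(R, v) \<in> P \<Longrightarrow> term_eval R v t \<in> carrier R"
  using P by (auto intro: term_eval_closed comm_algD)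

lemma eval_smult_zero:
  assumes p: "(R, v) \<in> P" shows "0 \<odot>\<^bsub>R\<^esub> term_eval R v t = \<zero>\<^bsub>R\<^esub>"
proof -
  interpret cring R using p by (rule eval_ring)
  show ?thesis
    using struct_map_simps(3,6)[OF P(1)[OF p]] eval_ring(2)[OF p, of t] by (metis l_null)
qed

lemma eval_neg:
  assumes p: "(R, v) \<in> P"
  shows "(- 1) \<odot>\<^bsub>R\<^esub> term_eval R v t \<oplus>\<^bsub>R\<^esub> term_eval R v t = 0 \<odot>\<^bsub>R\<^esub> \<one>\<^bsub>R\<^esub>"
  using comm_alg_smult_l_distr[OF P(1)[OF p] eval_ring(2)[OF p], of "- 1" 1 t]
    eval_smult_zero[OF p, of TOne] eval_smult_zero[OF p, of t]
  by (simp add: comm_alg_smult_one[OF P(1)[OF p] eval_ring(2)[OF p]])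

lemma eval_neg_right:
  assumes p: "(R, v) \<in> P"
  shows "term_eval R v t \<oplus>\<^bsub>R\<^esub> (- 1) \<odot>\<^bsub>R\<^esub> term_eval R v t = \<zero>\<^bsub>R\<^esub>"
proof -
  interpret cring R using p by (rule eval_ring)
  show ?thesis
    using eval_neg[OF p, of t] eval_smult_zero[OF p, of TOne] eval_ring(2)[OF p]
      comm_alg_smult_closed[OF P(1)[OF p] eval_ring(2)[OF p]] by (simp add: a_comm)
qed

lemma eval_smult_right:
  assumes p: "(R, v) \<in> P"
  shows "term_eval R v s \<otimes>\<^bsub>R\<^esub> (c \<odot>\<^bsub>R\<^esub> term_eval R v t) = c \<odot>\<^bsub>R\<^esub> (term_eval R v s \<otimes>\<^bsub>R\<^esub> term_eval R v t)"
proof -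
  interpret cring R using p by (rule eval_ring)
  show ?thesis
    using comm_alg_smult_mult[OF P(1)[OF p] eval_ring(2)[OF p] eval_ring(2)[OF p], of c t s]
      comm_alg_smult_closed[OF P(1)[OF p] eval_ring(2)[OF p]] eval_ring(2)[OF p] by (simp add: m_comm)
qed

sublocale F: coded_algebra UNIV code sem TOne TAdd TMul TSmult
proof -
  note ring = cring.cring_simprules[OF eval_ring(1)] eval_ring(2)
  note r = comm_algD(2-7)[OF P(1)]
  note zero = eval_smult_zero[where t=TOne, simplified]
  show "coded_algebra UNIV code sem TOne TAdd TMul TSmult"
    by unfold_locales (use code in \<open>auto simp: sem_eq_iff eval_neg eval_neg_right eval_smult_right zero ring r\<close>)
qed

definition ev :: "('c, 'u) module \<Rightarrow> ('w \<Rightarrow> 'u) \<Rightarrow> 'u \<Rightarrow> 'u" where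
  "ev R v = (\<lambda>x\<in>carrier F.alg. term_eval R v (F.dec x))"

lemma ev_hom:
  assumes "(R, v) \<in> P" shows "ev R v \<in> homs F.alg R" "ev R v (F.cls t) = term_eval R v t"
proof -
  have "term_eval R v s = term_eval R v t" if "sem s = sem t" for s t
    using that assms by (auto simp: sem_eq_iff)
  note F.homs_from_alg[where f="term_eval R v" and S=R, OF _ this,
      OF term_eval_closed[OF P(1)[OF assms] P(2)[OF assms]]]
  then show "ev R v \<in> homs F.alg R" "ev R v (F.cls t) = term_eval R v t"
    unfolding ev_def by auto
qed

lemma alg_eqI:
  assumes "x \<in> carrier F.alg" "y \<in> carrier F.alg" "\<And>R v. (R, v) \<in> P \<Longrightarrow> ev R v x = ev R v y"
  shows "x = y"
proof -
  obtain s t where st: "x = F.cls s" "y = F.cls t" using assms(1,2) by (auto simp: F.alg_carrier)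
  have "term_eval R v s = term_eval R v t" if "(R, v) \<in> P" for R v
    using assms(3)[OF that] by (simp add: st ev_hom[OF that])
  then show ?thesis by (auto simp: st F.cls_eq_iff sem_eq_iff)
qed

lemma alg_hom_eqI:
  assumes f: "f \<in> homs F.alg S" and g: "g \<in> homs F.alg S"
    and eq: "\<And>w. f (F.cls (TVar w)) = g (F.cls (TVar w))"
  shows "f = g"
proof (rule extensionalityI[OF homs_ext[OF f] homs_ext[OF g]])
  note c = F.cls_closed[OF UNIV_I] and ops = F.alg_ops(3-5)[OF UNIV_I, symmetric] F.alg_ops(3,4)[OF UNIV_I UNIV_I, symmetric]
  have "f (F.cls t) = g (F.cls t)" for t
  proof (induct t)
    case TOne then show ?case using homs_one[OF f] homs_one[OF g] by (simp add: F.alg_ops(1))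
  qed (simp_all add: eq ops c homs_add[OF f] homs_add[OF g] homs_mult[OF f] homs_mult[OF g]
      homs_smult[OF f] homs_smult[OF g])
  then show "f x = g x" if "x \<in> carrier F.alg" for x
    using that by (auto simp: F.alg_carrier)
qed

lemma alg_finitely_generated: "finitely_generated_alg F.alg"
  unfolding finitely_generated_alg_def
proof (intro exI conjI allI impI)
  let ?S = "range (\<lambda>w. F.cls (TVar w))"
  show "finite ?S" by simp
  show "?S \<subseteq> carrier F.alg" by (auto simp: F.cls_closed)
  fix B assume B: "?S \<subseteq> B \<and> B \<subseteq> carrier F.alg \<and> \<one>\<^bsub>F.alg\<^esub> \<in> B \<and>
    (\<forall>x\<in>B. \<forall>y\<in>B. x \<oplus>\<^bsub>F.alg\<^esub> y \<in> B \<and> x \<otimes>\<^bsub>F.alg\<^esub> y \<in> B) \<and> (\<forall>c. \<forall>x\<in>B. c \<odot>\<^bsub>F.alg\<^esub> x \<in> B)"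
  have "F.cls t \<in> B" for t
  proof (induct t)
    case TOne then show ?case using B by (simp add: F.alg_ops(1))
  next
    case (TVar w) then show ?case using B by blast
  next
    case (TAdd s t) then show ?case using B F.alg_ops(3)[of s t] by (metis UNIV_I)
  next
    case (TMul s t) then show ?case using B F.alg_ops(4)[of s t] by (metis UNIV_I)
  next
    case (TSmult c t) then show ?case using B F.alg_ops(5)[of t c] by (metis UNIV_I)
  qed
  then show "B = carrier F.alg" using B by (auto simp: F.alg_carrier)
qed

end

section \<open>Stabilizers are algebraic groups\<close>

definition stab_pts :: "('k::field, 'a) module \<Rightarrow> ('i::finite \<Rightarrow> 'a) \<Rightarrow> ('i \<Rightarrow> 'k) \<Rightarrow> ('k, 'u) module
    \<Rightarrow> (('i \<Rightarrow> 'u) \<Rightarrow> ('i \<Rightarrow> 'u)) set" where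
  "stab_pts A e y R = {g \<in> auts A e R. g (base_point R y) = base_point R y}"

definition stab_group :: "('k::field, 'a) module \<Rightarrow> ('i::finite \<Rightarrow> 'a) \<Rightarrow> ('i \<Rightarrow> 'k)
    \<Rightarrow> ('k, 'u, ('i \<Rightarrow> 'u) \<Rightarrow> ('i \<Rightarrow> 'u)) grp_functor" where
  "stab_group A e y = stabilizer (aut_group A e) y"

lemma stab_group_simps:
  "pts (stab_group A e y) R = (aut_pts A e R)\<lparr>carrier := stab_pts A e y R\<rparr>"
  "pmap (stab_group A e y) R S h = aut_map A e R S h"
  by (simp_all add: stab_group_def stabilizer_def aut_group_def stab_pts_def)

lemma base_point_closed: "comm_alg R \<Longrightarrow> base_point R y \<in> vecs R"
  by (simp add: base_point_def vecs_def struct_map_simps)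

lemma map_base_point: "comm_alg R \<Longrightarrow> h \<in> homs R S \<Longrightarrow> h \<circ> base_point R y = base_point S y"
  by (auto simp: base_point_def homs_struct_map)

lemma stab_ptsD: "g \<in> stab_pts A e y R \<Longrightarrow> g \<in> auts A e R"
  "g \<in> stab_pts A e y R \<Longrightarrow> g (base_point R y) = base_point R y"
  by (simp_all add: stab_pts_def)

lemma stab_map:
  assumes "comm_alg R" "comm_alg S" "h \<in> homs R S" "g \<in> stab_pts A e y R"
  shows "aut_map A e R S h g \<in> stab_pts A e y S"
  using aut_map_aut[OF assms(1-3) stab_ptsD(1)[OF assms(4)]]
    aut_map_apply[OF assms(1-3) autD(2)[OF stab_ptsD(1)[OF assms(4)]] base_point_closed[OF assms(1), of y], of A e]
    stab_ptsD(2)[OF assms(4)]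
  by (simp add: stab_pts_def map_base_point[OF assms(1,3)])

lemma stab_subgroup:
  assumes R: "comm_alg R" shows "subgroup (stab_pts A e y R) (aut_pts A e R)"
proof -
  interpret G: group "aut_pts A e R" using R by (rule aut_group)
  note b = base_point_closed[OF R, of y]
  show ?thesis
  proof (rule G.subgroupI)
    show "stab_pts A e y R \<noteq> {}"
      using aut_id[OF R, of A e] b by (auto simp: stab_pts_def)
    fix g assume g: "g \<in> stab_pts A e y R"
    then show "inv\<^bsub>aut_pts A e R\<^esub> g \<in> stab_pts A e y R"
      using aut_inv_apply(1)[OF R _ b, of g A e] G.inv_closed[of g] by (simp add: stab_pts_def)
    fix h assume "h \<in> stab_pts A e y R"
    with g show "g \<otimes>\<^bsub>aut_pts A e R\<^esub> h \<in> stab_pts A e y R"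
      using b by (simp add: stab_pts_def aut_mult_apply)
  qed (auto simp: stab_pts_def)
qed

lemma stab_is_grp_functor:
  fixes A :: "('k::field, 'a) module" and e :: "'i::finite \<Rightarrow> 'a"
  shows "is_grp_functor (stab_group A e y :: ('k, 'u, ('i \<Rightarrow> 'u) \<Rightarrow> ('i \<Rightarrow> 'u)) grp_functor)"
  unfolding is_grp_functor_def stab_group_simps
proof (intro conjI allI impI ballI)
  fix R :: "('k, 'u) module" assume "comm_alg R"
  then show "group ((aut_pts A e R)\<lparr>carrier := stab_pts A e y R\<rparr>)"
    by (intro subgroup.subgroup_is_group stab_subgroup aut_group)
next
  fix R S :: "('k, 'u) module" and h
  assume RS: "comm_alg R \<and> comm_alg S" and h: "h \<in> homs R S"
  show "aut_map A e R S h \<in> hom ((aut_pts A e R)\<lparr>carrier := stab_pts A e y R\<rparr>)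
      ((aut_pts A e S)\<lparr>carrier := stab_pts A e y S\<rparr>)"
    using RS h by (auto simp: hom_def stab_map aut_map_mult stab_ptsD)
next
  fix R :: "('k, 'u) module" and p
  assume "comm_alg R" "p \<in> carrier ((aut_pts A e R)\<lparr>carrier := stab_pts A e y R\<rparr>)"
  then show "aut_map A e R R (\<lambda>r\<in>carrier R. r) p = p"
    by (simp add: aut_map_id stab_ptsD)
next
  fix R S T :: "('k, 'u) module" and h h' p
  assume "comm_alg R \<and> comm_alg S \<and> comm_alg T" "h \<in> homs R S" "h' \<in> homs S T"
    "p \<in> carrier ((aut_pts A e R)\<lparr>carrier := stab_pts A e y R\<rparr>)"
  then show "aut_map A e R T (compose (carrier R) h' h) p = aut_map A e S T h' (aut_map A e R S h p)"
    by (simp add: aut_map_compose stab_ptsD)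
qed

text \<open>The matrix entries of \<open>g\<close> and of its inverse, the latter marked by \<open>True\<close>. Including the inverse makes
the universal matrix invertible without recourse to determinants.\<close>

definition point_coords :: "('k::field, 'a) module \<Rightarrow> ('i::finite \<Rightarrow> 'a) \<Rightarrow> ('k, 'u) module
    \<Rightarrow> (('i \<Rightarrow> 'u) \<Rightarrow> ('i \<Rightarrow> 'u)) \<Rightarrow> bool \<times> 'i \<times> 'i \<Rightarrow> 'u" where
  "point_coords A e R g = (\<lambda>(s, i, l). (if s then inv\<^bsub>aut_pts A e R\<^esub> g else g) (unit_vec R i) l)"

definition stab_points :: "('k::field, 'a) module \<Rightarrow> ('i::finite \<Rightarrow> 'a) \<Rightarrow> ('i \<Rightarrow> 'k)
    \<Rightarrow> (('k, 'u) module \<times> (bool \<times> 'i \<times> 'i \<Rightarrow> 'u)) set" where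
  "stab_points A e y = {(R, point_coords A e R g) | R g. comm_alg R \<and> g \<in> stab_pts A e y R}"

text \<open>The coordinate ring consists of the polynomial functions, in the matrix entries, on all points of the
stabilizer over all test algebras. An identity between such functions holds as soon as it holds at
every point. The matrix of coordinate functions specializes to each point, and so it satisfies all
the equations that define the stabilizer: it is itself a point, over the coordinate ring. This point
is universal, as a homomorphism is determined by the values of the coordinate functions.\<close>

lemma stab_representable:
  fixes A :: "('k::field_char_0, 'a) module" and e :: "'i::finite \<Rightarrow> 'a" and \<iota> :: "'k \<Rightarrow> 'u"
  assumes "inj \<iota>"
  shows "representable_fin_type (stab_group A e y :: ('k, 'u, ('i \<Rightarrow> 'u) \<Rightarrow> ('i \<Rightarrow> 'u)) grp_functor)"
proof -
  obtain code :: "('k, bool \<times> 'i \<times> 'i) alg_term \<Rightarrow> 'u" where code: "inj code"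
    using alg_term_code_exists[OF assms] by blast
  let ?P = "stab_points A e y :: (('k, 'u) module \<times> (bool \<times> 'i \<times> 'i \<Rightarrow> 'u)) set"
  have coords: "point_coords A e R g w \<in> carrier R" if R: "comm_alg R" and g: "g \<in> auts A e R"
    for R :: "('k, 'u) module" and g w
  proof -
    interpret cring R using R by (rule comm_algD)
    interpret G: group "aut_pts A e R" using R by (rule aut_group)
    show ?thesis
      using vecsD[OF autD(6)[OF g unit_vec_closed]] vecsD[OF autD(6)[OF G.inv_closed[OF g] unit_vec_closed]]
      by (auto simp: point_coords_def split: prod.split)
  qed
  interpret function_algebra ?P code
    by (rule function_algebra.intro) (auto simp: code stab_points_def coords stab_ptsD)
  let ?O = "F.alg"
  note O = F.alg_comm_alg
  interpret O: cring ?O using O by (rule comm_algD)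
  \<comment> \<open>The universal matrix and, for \<open>s = True\<close>, its inverse.\<close>
  define U where "U s = restrict (mat_map ?O (\<lambda>i l. F.cls (TVar (s, i, l)))) (vecs ?O)" for s
  have Uv: "(\<lambda>l. F.cls (TVar (s, i, l))) \<in> vecs ?O" for s i
    by (simp add: vecs_def F.cls_closed)
  have U_lin: "linear_on ?O (U s)" for s
    unfolding U_def by (intro linear_on_restrict O.linear_mat_map Uv O.is_cring)
  have U_unit: "U s (unit_vec ?O i) = (\<lambda>l. F.cls (TVar (s, i, l)))" for s i
    by (simp add: U_def O.mat_map_unit[OF Uv])
  note U_closed = linear_onD(1)[OF U_lin]
  define act where "act s R g = (if s then inv\<^bsub>aut_pts A e R\<^esub> g else g)" for s and R :: "('k, 'u) module" and g
  have ev_U: "ev R (point_coords A e R g) \<circ> U s w = act s R g (ev R (point_coords A e R g) \<circ> w)"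
    if R: "comm_alg R" and g: "g \<in> stab_pts A e y R" and w: "w \<in> vecs ?O" for R g s w
  proof -
    interpret R: cring R using R by (rule comm_algD)
    interpret G: group "aut_pts A e R" using R by (rule aut_group)
    have p: "(R, point_coords A e R g) \<in> ?P" using R g by (auto simp: stab_points_def)
    let ?h = "ev R (point_coords A e R g)"
    have act: "act s R g \<in> auts A e R"
      using stab_ptsD(1)[OF g] by (simp add: act_def)
    have "?h \<circ> U s w = mat_map R (\<lambda>i. ?h \<circ> (\<lambda>l. F.cls (TVar (s, i, l)))) (?h \<circ> w)"
      using map_mat_map[OF O R ev_hom(1)[OF p] w Uv] w by (simp add: U_def)
    also have "(\<lambda>i. ?h \<circ> (\<lambda>l. F.cls (TVar (s, i, l)))) = (\<lambda>i. act s R g (unit_vec R i))"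
      by (simp add: fun_eq_iff ev_hom(2)[OF p]) (simp add: point_coords_def act_def)
    also have "mat_map R \<dots> (?h \<circ> w) = act s R g (?h \<circ> w)"
      using R.linear_expand[OF autD(2)[OF act] map_vecs[OF ev_hom(1)[OF p] w]] by simp
    finally show ?thesis .
  qed
  have vec_eqI: "v = w" if "v \<in> vecs ?O" "w \<in> vecs ?O"
    and eq: "\<And>R g. comm_alg R \<Longrightarrow> g \<in> stab_pts A e y R \<Longrightarrow>
      ev R (point_coords A e R g) \<circ> v = ev R (point_coords A e R g) \<circ> w" for v w
  proof
    fix l
    show "v l = w l"
    proof (rule alg_eqI)
      show "v l \<in> carrier ?O" "w l \<in> carrier ?O" using that(1,2) by (simp_all add: vecsD)
      fix R p assume "(R, p) \<in> ?P"
      then obtain g where "p = point_coords A e R g" "comm_alg R" "g \<in> stab_pts A e y R"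
        by (auto simp: stab_points_def)
      then show "ev R p (v l) = ev R p (w l)" using fun_cong[OF eq[of R g], of l] by simp
    qed
  qed
  have ev: "ev R (point_coords A e R g) \<in> homs ?O R" if "comm_alg R" "g \<in> stab_pts A e y R" for R g
    using that by (intro ev_hom) (auto simp: stab_points_def)
  have UU: "U s (U (\<not> s) w) = w" if w: "w \<in> vecs ?O" for s w
  proof (rule vec_eqI)
    fix R :: "('k, 'u) module" and g assume R: "comm_alg R" and g: "g \<in> stab_pts A e y R"
    show "ev R (point_coords A e R g) \<circ> U s (U (\<not> s) w) = ev R (point_coords A e R g) \<circ> w"
      using aut_inv_apply[OF R stab_ptsD(1)[OF g] map_vecs[OF ev[OF R g] w]]
      by (simp add: ev_U R g U_closed w act_def)
  qed (simp_all add: U_closed w)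
  have U: "U False \<in> stab_pts A e y ?O"
    unfolding stab_pts_def mem_Collect_eq
  proof (intro conjI autI_unit_vec[OF O])
    show "U False \<in> extensional (vecs ?O)" by (simp add: U_def)
    show "linear_on ?O (U False)" by (rule U_lin)
    show "bij_betw (U False) (vecs ?O) (vecs ?O)"
      by (rule bij_betw_byWitness[where f'="U True"])
        (use UU[of _ False] UU[of _ True] in \<open>auto simp: U_closed\<close>)
    show "U False (xone A e ?O) = xone A e ?O"
      by (rule vec_eqI) (auto simp: U_closed xone_closed[OF O] ev_U act_def
          map_xone[OF O ev] autD(3)[OF stab_ptsD(1)])
    show "U False (base_point ?O y) = base_point ?O y"
      by (rule vec_eqI) (auto simp: U_closed base_point_closed[OF O] ev_U act_def
          map_base_point[OF O ev] stab_ptsD(2))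
    show "U False (xmult A e ?O (unit_vec ?O i) (unit_vec ?O m))
        = xmult A e ?O (U False (unit_vec ?O i)) (U False (unit_vec ?O m))" for i m
    proof (rule vec_eqI)
      fix R :: "('k, 'u) module" and g assume R: "comm_alg R" and g: "g \<in> stab_pts A e y R"
      show "ev R (point_coords A e R g) \<circ> U False (xmult A e ?O (unit_vec ?O i) (unit_vec ?O m))
        = ev R (point_coords A e R g) \<circ> xmult A e ?O (U False (unit_vec ?O i)) (U False (unit_vec ?O m))"
        by (simp add: ev_U[OF R g] act_def U_closed xmult_closed[OF O] map_xmult[OF O R ev[OF R g]]
            autD(4)[OF stab_ptsD(1)[OF g]] map_vecs[OF ev[OF R g]])
    qed (simp_all add: U_closed xmult_closed[OF O])
  qed
  note Ua = stab_ptsD(1)[OF U]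
  have U_inv: "(inv\<^bsub>aut_pts A e ?O\<^esub> (U False)) (unit_vec ?O i) = U True (unit_vec ?O i)" for i
    using aut_inv_apply(1)[OF O Ua U_closed[of "unit_vec ?O i" True]] UU[of "unit_vec ?O i" False] by simp
  let ?\<eta> = "\<lambda>R \<phi>. aut_map A e ?O R \<phi> (U False)"
  have coords_\<eta>: "point_coords A e R (?\<eta> R \<phi>) w = \<phi> (F.cls (TVar w))"
    if R: "comm_alg R" and \<phi>: "\<phi> \<in> homs ?O R" for R :: "('k, 'u) module" and \<phi> w
  proof -
    obtain s i l where w: "w = (s, i, l)" by (cases w)
    interpret GO: group "aut_pts A e ?O" using O by (rule aut_group)
    interpret GR: group "aut_pts A e R" using R by (rule aut_group)
    interpret H: group_hom "aut_pts A e ?O" "aut_pts A e R" "aut_map A e ?O R \<phi>"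
      by unfold_locales (rule aut_map_hom[OF O R \<phi>])
    have inv_unit: "(inv\<^bsub>aut_pts A e R\<^esub> (?\<eta> R \<phi>)) (unit_vec R i) = \<phi> \<circ> U True (unit_vec ?O i)"
      by (simp only: H.hom_inv[OF Ua, symmetric] U_inv
          aut_map_unit_vec[OF O R \<phi> autD(2)[OF GO.inv_closed[OF Ua]]])
    show ?thesis
      by (simp add: w point_coords_def aut_map_unit_vec[OF O R \<phi>] autD(2)[OF Ua] U_unit inv_unit)
  qed
  have "bij_betw (?\<eta> R) (homs ?O R) (carrier (pts (stab_group A e y) R))" if R: "comm_alg R" for R :: "('k, 'u) module"
    unfolding bij_betw_def stab_group_simps
  proof (intro conjI inj_onI equalityI subsetI)
    fix \<phi> \<psi> assume "\<phi> \<in> homs ?O R" "\<psi> \<in> homs ?O R" "?\<eta> R \<phi> = ?\<eta> R \<psi>"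
    then show "\<phi> = \<psi>" using coords_\<eta>[OF R] by (metis alg_hom_eqI)
  next
    fix g assume "g \<in> ?\<eta> R ` homs ?O R"
    then show "g \<in> carrier (aut_pts A e R\<lparr>carrier := stab_pts A e y R\<rparr>)"
      using stab_map[OF O R _ U] by auto
  next
    fix g assume "g \<in> carrier (aut_pts A e R\<lparr>carrier := stab_pts A e y R\<rparr>)"
    then have g: "g \<in> stab_pts A e y R" by simp
    let ?h = "ev R (point_coords A e R g)"
    interpret R: cring R using R by (rule comm_algD)
    have "?\<eta> R ?h = g"
    proof (rule aut_eqI[OF aut_map_aut[OF O R ev[OF R g] Ua] stab_ptsD(1)[OF g] R])
      show "?\<eta> R ?h (unit_vec R i) = g (unit_vec R i)" for i
        by (simp add: aut_map_unit_vec[OF O R ev[OF R g] autD(2)[OF Ua]] ev_U[OF R g] act_def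
            map_unit_vec[OF O R ev[OF R g]])
    qed
    then show "g \<in> ?\<eta> R ` homs ?O R" using ev[OF R g] by (metis imageI)
  qed
  moreover have "?\<eta> S (compose (carrier ?O) h p) = pmap (stab_group A e y) R S h (?\<eta> R p)"
    if "comm_alg R \<and> comm_alg S" "h \<in> homs R S" "p \<in> homs ?O R"
    for R S :: "('k, 'u) module" and h p
    unfolding stab_group_simps using that by (intro aut_map_compose[OF O _ _ _ _ Ua]) auto
  ultimately show ?thesis
    unfolding representable_fin_type_def
    by (intro exI[of _ ?O] exI[of _ ?\<eta>] conjI O alg_finitely_generated allI impI ballI) auto
qed

section \<open>Restriction of scalars\<close>

locale field_hom =
  fixes j :: "'k::field \<Rightarrow> 'c::field"
  assumes j_add: "j (a + b) = j a + j b" and j_mult: "j (a * b) = j a * j b" and j_one: "j 1 = 1"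
begin

lemma j_zero: "j 0 = 0"
  using j_add[of 0 0] by (metis add.right_neutral add_left_cancel)

lemma j_eq_0_iff: "j a = 0 \<longleftrightarrow> a = 0"
  using j_mult[of a "inverse a"] j_one j_zero by (cases "a = 0") auto

lemma restrict_comm_alg: "comm_alg R \<Longrightarrow> comm_alg (restrict_scalars j R)"
proof (rule comm_algI)
  assume R: "comm_alg R"
  interpret R: cring R using R by (rule comm_algD)
  show "cring (restrict_scalars j R)"
  proof (intro cringI abelian_groupI comm_monoidI)
    fix x assume "x \<in> carrier (restrict_scalars j R)"
    then show "\<exists>y\<in>carrier (restrict_scalars j R). y \<oplus>\<^bsub>restrict_scalars j R\<^esub> x = \<zero>\<^bsub>restrict_scalars j R\<^esub>"
      by (intro bexI[of _ "\<ominus>\<^bsub>R\<^esub> x"]) (simp_all add: restrict_scalars_def R.l_neg)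
  qed (auto simp: restrict_scalars_def R.a_assoc R.m_assoc R.l_distr intro: R.a_comm R.m_comm)
qed (auto simp: restrict_scalars_def comm_algD(2-7) j_add j_mult j_one)

lemma restrict_simps:
  "carrier (restrict_scalars j R) = carrier R" "x \<oplus>\<^bsub>restrict_scalars j R\<^esub> y = x \<oplus>\<^bsub>R\<^esub> y"
  "x \<otimes>\<^bsub>restrict_scalars j R\<^esub> y = x \<otimes>\<^bsub>R\<^esub> y" "\<one>\<^bsub>restrict_scalars j R\<^esub> = \<one>\<^bsub>R\<^esub>"
  "\<zero>\<^bsub>restrict_scalars j R\<^esub> = \<zero>\<^bsub>R\<^esub>" "a \<odot>\<^bsub>restrict_scalars j R\<^esub> x = j a \<odot>\<^bsub>R\<^esub> x"
  by (simp_all add: restrict_scalars_def)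

lemma restrict_homs: "h \<in> homs R S \<Longrightarrow> h \<in> homs (restrict_scalars j R) (restrict_scalars j S)"
  by (auto simp: alg_homs_def restrict_scalars_def)

lemma field_alg_comm_alg: "comm_alg (field_alg j)"
proof (rule comm_algI)
  show "cring (field_alg j)"
  proof (intro cringI abelian_groupI comm_monoidI)
    fix x show "\<exists>y\<in>carrier (field_alg j). y \<oplus>\<^bsub>field_alg j\<^esub> x = \<zero>\<^bsub>field_alg j\<^esub>"
      by (intro bexI[of _ "- x"]) (simp_all add: field_alg_def)
  qed (auto simp: field_alg_def algebra_simps)
qed (auto simp: field_alg_def j_add j_mult j_one algebra_simps)

lemma struct_map_hom: "comm_alg R \<Longrightarrow> struct_map R \<in> homs (field_alg j) (restrict_scalars j R)"
  using struct_map_simps[of R]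
  by (auto simp: alg_homs_def restrict_scalars_def field_alg_def)

end

section \<open>Extension of scalars to the algebraic closure\<close>

interpretation ac: field_hom to_ac
  by unfold_locales simp_all

definition functional :: "('k::field alg_closure \<Rightarrow> 'k) \<Rightarrow> bool" where
  "functional f \<longleftrightarrow> (\<forall>x y. f (x + y) = f x + f y) \<and> (\<forall>a x. f (to_ac a * x) = a * f x)"

text \<open>Extend \<open>x\<close> to a basis of the closure over the base field.\<close>

lemma functional_exists:
  assumes "x \<noteq> (0 :: 'k::field alg_closure)" shows "\<exists>f. functional f \<and> f x = 1"
proof -
  interpret vector_space_pair "\<lambda>(a::'k) x. to_ac a * x" "(*) :: 'k \<Rightarrow> 'k \<Rightarrow> 'k"
    by unfold_locales (auto simp: algebra_simps)
  have "vs1.independent {x}" using assms by (simp add: vs1.dependent_single)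
  then obtain f where f: "Vector_Spaces.linear (\<lambda>(a::'k) x. to_ac a * x) (*) f" "f x = 1"
    using linear_independent_extend[of "{x}" "\<lambda>_. 1"] by auto
  interpret f: Vector_Spaces.linear "\<lambda>(a::'k) x. to_ac a * x" "(*)" f by fact
  show ?thesis using f(2) f.add f.scale unfolding functional_def by blast
qed

lemma functional_mult: "functional f \<Longrightarrow> functional (\<lambda>x. f (s * x))"
  by (simp add: functional_def distrib_left) (metis mult.left_commute)

section \<open>The tensor product with the algebraic closure\<close>

text \<open>A finite sum of pure tensors \<open>r \<otimes> s\<close>, with \<open>r\<close> in \<open>R\<close> and \<open>s\<close> in the closure, is represented by the
list of pairs \<open>(r, s)\<close>. Each \<open>k\<close>-linear functional \<open>f\<close> on the closure induces an \<open>R\<close>-linear map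
to \<open>R\<close> sending \<open>r \<otimes> s\<close> to \<open>f(s) r\<close>, and these maps jointly separate the elements of the tensor product.
So the tensor product is the set of lists modulo having the same value under every functional.\<close>

primrec tens_val :: "('k::field, 'u) module \<Rightarrow> ('k alg_closure \<Rightarrow> 'k) \<Rightarrow> ('u \<times> 'k alg_closure) list \<Rightarrow> 'u" where
  "tens_val R f [] = \<zero>\<^bsub>R\<^esub>"
| "tens_val R f (x # l) = f (snd x) \<odot>\<^bsub>R\<^esub> fst x \<oplus>\<^bsub>R\<^esub> tens_val R f l"

primrec tens_mult :: "('k::field, 'u) module \<Rightarrow> ('u \<times> 'k alg_closure) list \<Rightarrow> ('u \<times> 'k alg_closure) list
    \<Rightarrow> ('u \<times> 'k alg_closure) list" where
  "tens_mult R [] m = []"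
| "tens_mult R (x # l) m = map (\<lambda>y. (fst x \<otimes>\<^bsub>R\<^esub> fst y, snd x * snd y)) m @ tens_mult R l m"

definition tens_smult :: "'c::field \<Rightarrow> ('u \<times> 'c) list \<Rightarrow> ('u \<times> 'c) list" where
  "tens_smult c = map (\<lambda>y. (fst y, c * snd y))"

definition tens_lists :: "('k::field, 'u) module \<Rightarrow> ('u \<times> 'k alg_closure) list set" where
  "tens_lists R = {l. \<forall>x\<in>set l. fst x \<in> carrier R}"

definition tens_sem where
  "tens_sem R l = (\<lambda>f\<in>Collect functional. tens_val R f l)"

lemma tens_sem_eq_iff: "tens_sem R l = tens_sem R m \<longleftrightarrow> (\<forall>f. functional f \<longrightarrow> tens_val R f l = tens_val R f m)"
  by (auto simp: tens_sem_def fun_eq_iff restrict_def)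

lemma tens_lists_simps:
  "[] \<in> tens_lists R" "x # l \<in> tens_lists R \<longleftrightarrow> fst x \<in> carrier R \<and> l \<in> tens_lists R"
  "l @ m \<in> tens_lists R \<longleftrightarrow> l \<in> tens_lists R \<and> m \<in> tens_lists R"
  by (auto simp: tens_lists_def)

locale tensor =
  fixes R :: "('k::field, 'u) module" and code :: "('u \<times> 'k alg_closure) list \<Rightarrow> 'u"
  assumes R: "comm_alg R" and code: "inj code"
begin

sublocale R: cring R using R by (rule comm_algD)

lemmas r = comm_algD(2-7)[OF R]

lemma smult_mult_right: "x \<in> carrier R \<Longrightarrow> y \<in> carrier R \<Longrightarrow>
    x \<otimes>\<^bsub>R\<^esub> (c \<odot>\<^bsub>R\<^esub> y) = c \<odot>\<^bsub>R\<^esub> (x \<otimes>\<^bsub>R\<^esub> y)"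
  using r(6)[of y x c] r(1)[of y c] by (simp add: R.m_comm)

lemma zero_smult: "x \<in> carrier R \<Longrightarrow> 0 \<odot>\<^bsub>R\<^esub> x = \<zero>\<^bsub>R\<^esub>"
  using struct_map_simps(3,6)[OF R] by (metis R.l_null)

lemma val_closed: "l \<in> tens_lists R \<Longrightarrow> tens_val R f l \<in> carrier R"
  by (induct l) (auto simp: tens_lists_simps r)

lemma val_append: "l \<in> tens_lists R \<Longrightarrow> m \<in> tens_lists R \<Longrightarrow>
    tens_val R f (l @ m) = tens_val R f l \<oplus>\<^bsub>R\<^esub> tens_val R f m"
  by (induct l) (auto simp: tens_lists_simps val_closed r R.a_assoc)

lemma val_smult: "tens_val R f (tens_smult c l) = tens_val R (\<lambda>x. f (c * x)) l"
  by (induct l) (auto simp: tens_smult_def)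

lemma smult_lists: "l \<in> tens_lists R \<Longrightarrow> tens_smult c l \<in> tens_lists R"
  by (auto simp: tens_smult_def tens_lists_def)

lemma val_scale:
  "x \<in> carrier R \<Longrightarrow> m \<in> tens_lists R \<Longrightarrow>
    tens_val R f (map (\<lambda>y. (x \<otimes>\<^bsub>R\<^esub> fst y, s * snd y)) m) = x \<otimes>\<^bsub>R\<^esub> tens_val R (\<lambda>z. f (s * z)) m"
  by (induct m) (auto simp: tens_lists_simps r val_closed R.r_distr smult_mult_right)

lemma scale_lists: "x \<in> carrier R \<Longrightarrow> m \<in> tens_lists R \<Longrightarrow>
    map (\<lambda>y. (x \<otimes>\<^bsub>R\<^esub> fst y, s * snd y)) m \<in> tens_lists R"
  by (auto simp: tens_lists_def)

lemma mult_lists: "l \<in> tens_lists R \<Longrightarrow> m \<in> tens_lists R \<Longrightarrow> tens_mult R l m \<in> tens_lists R"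
  by (induct l) (auto simp: tens_lists_simps scale_lists)

lemma val_mult_Cons: "x # l \<in> tens_lists R \<Longrightarrow> m \<in> tens_lists R \<Longrightarrow>
    tens_val R f (tens_mult R (x # l) m)
      = fst x \<otimes>\<^bsub>R\<^esub> tens_val R (\<lambda>z. f (snd x * z)) m \<oplus>\<^bsub>R\<^esub> tens_val R f (tens_mult R l m)"
  by (simp add: tens_lists_simps val_append scale_lists mult_lists val_scale)

lemma val_mult_Cons_right: "l \<in> tens_lists R \<Longrightarrow> x # m \<in> tens_lists R \<Longrightarrow>
    tens_val R f (tens_mult R l (x # m))
      = fst x \<otimes>\<^bsub>R\<^esub> tens_val R (\<lambda>z. f (snd x * z)) l \<oplus>\<^bsub>R\<^esub> tens_val R f (tens_mult R l m)"
proof (induct l)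
  case (Cons y l)
  then show ?case
    by (simp add: val_mult_Cons tens_lists_simps del: tens_mult.simps)
      (simp add: tens_lists_simps val_closed r mult_lists R.r_distr smult_mult_right
        R.m_comm[of "fst y" "fst x"] mult.commute[of "snd y" "snd x"] R.a_ac)
qed (simp add: tens_lists_simps)

lemma val_mult_commute: "l \<in> tens_lists R \<Longrightarrow> m \<in> tens_lists R \<Longrightarrow>
    tens_val R f (tens_mult R l m) = tens_val R f (tens_mult R m l)"
proof (induct l)
  case Nil then show ?case by (induct m) (auto simp: tens_lists_simps)
next
  case (Cons x l)
  then show ?case by (simp add: val_mult_Cons val_mult_Cons_right del: tens_mult.simps)
      (simp add: tens_lists_simps)
qed

lemma val_mult_add: "l \<in> tens_lists R \<Longrightarrow> l' \<in> tens_lists R \<Longrightarrow> m \<in> tens_lists R \<Longrightarrow>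
    tens_val R f (tens_mult R (l @ l') m)
      = tens_val R f (tens_mult R l m) \<oplus>\<^bsub>R\<^esub> tens_val R f (tens_mult R l' m)"
  by (induct l) (auto simp: tens_lists_simps val_append scale_lists mult_lists val_closed R.a_assoc)

lemma val_mult_scale: "x \<in> carrier R \<Longrightarrow> l \<in> tens_lists R \<Longrightarrow> m \<in> tens_lists R \<Longrightarrow>
    tens_val R f (tens_mult R (map (\<lambda>y. (x \<otimes>\<^bsub>R\<^esub> fst y, s * snd y)) l) m)
      = x \<otimes>\<^bsub>R\<^esub> tens_val R (\<lambda>z. f (s * z)) (tens_mult R l m)"
proof (induct l)
  case (Cons y l)
  then show ?case
    by (simp add: val_mult_Cons tens_lists_simps scale_lists del: tens_mult.simps)
      (simp add: val_closed mult_lists R.m_assoc R.r_distr mult.assoc)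
qed (simp add: tens_lists_simps)

lemma val_mult_smult: "l \<in> tens_lists R \<Longrightarrow> m \<in> tens_lists R \<Longrightarrow>
    tens_val R f (tens_mult R (tens_smult c l) m) = tens_val R (\<lambda>z. f (c * z)) (tens_mult R l m)"
proof (induct l)
  case (Cons y l)
  have "tens_smult c (y # l) = (fst y, c * snd y) # tens_smult c l" by (simp add: tens_smult_def)
  with Cons show ?case
    by (simp add: val_mult_Cons tens_lists_simps smult_lists mult.assoc del: tens_mult.simps)
qed (simp add: tens_lists_simps tens_smult_def)

lemma val_mult_assoc: "l \<in> tens_lists R \<Longrightarrow> m \<in> tens_lists R \<Longrightarrow> n \<in> tens_lists R \<Longrightarrow>
    tens_val R f (tens_mult R (tens_mult R l m) n) = tens_val R f (tens_mult R l (tens_mult R m n))"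
  by (induct l) (auto simp: tens_lists_simps val_append scale_lists mult_lists val_closed val_scale
      val_mult_add val_mult_scale)

text \<open>Multiplication by \<open>r \<otimes> s\<close> followed by the functional \<open>f\<close> is, up to the factor \<open>r\<close>, the functional
\<open>f (s * _)\<close>. Hence the product depends only on the classes of its factors.\<close>

lemma val_mult_cong_right:
  assumes "l \<in> tens_lists R" "m \<in> tens_lists R" "m' \<in> tens_lists R"
    and "\<And>f. functional f \<Longrightarrow> tens_val R f m = tens_val R f m'" and "functional f"
  shows "tens_val R f (tens_mult R l m) = tens_val R f (tens_mult R l m')"
  using assms(1)
proof (induct l)
  case (Cons x l)
  then show ?case
    using assms functional_mult[OF assms(5)]
    by (simp add: val_mult_Cons del: tens_mult.simps) (simp add: tens_lists_simps)
qed simp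

lemma val_functional_add: "l \<in> tens_lists R \<Longrightarrow>
    tens_val R (\<lambda>x. f x + g x) l = tens_val R f l \<oplus>\<^bsub>R\<^esub> tens_val R g l"
  by (induct l) (auto simp: tens_lists_simps r val_closed R.a_ac)

lemma val_functional_zero: "l \<in> tens_lists R \<Longrightarrow> tens_val R (\<lambda>x. 0) l = \<zero>\<^bsub>R\<^esub>"
  by (induct l) (auto simp: tens_lists_simps zero_smult)

lemma functional_zero: "functional f \<Longrightarrow> f 0 = 0" "functional f \<Longrightarrow> f (- x) + f x = 0"
  using functional_def[of f] by (metis add_cancel_right_left, metis add.left_inverse add_cancel_right_left)

sublocale C: coded_algebra "tens_lists R" code "tens_sem R" "[(\<one>\<^bsub>R\<^esub>, 1)]" append "tens_mult R" tens_smult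
proof -
  have mult_cong: "tens_val R f (tens_mult R l m) = tens_val R f (tens_mult R l' m')"
    if "l \<in> tens_lists R" "l' \<in> tens_lists R" "m \<in> tens_lists R" "m' \<in> tens_lists R"
      "\<forall>f. functional f \<longrightarrow> tens_val R f l = tens_val R f l'"
      "\<forall>f. functional f \<longrightarrow> tens_val R f m = tens_val R f m'" "functional f" for f l l' m m'
    using val_mult_cong_right[of l m m' f] val_mult_cong_right[of m' l l' f]
      val_mult_commute[of l m' f] val_mult_commute[of l' m' f] that by simp
  have neg: "tens_val R f (tens_smult (- 1) l) \<oplus>\<^bsub>R\<^esub> tens_val R f l = \<zero>\<^bsub>R\<^esub>"
    if "l \<in> tens_lists R" "functional f" for f l
    using val_functional_add[OF that(1), of "\<lambda>x. f (- x)" f] val_functional_zero[OF that(1)]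
    by (simp add: val_smult functional_zero(2)[OF that(2)])
  have one: "tens_val R f (tens_mult R [(\<one>\<^bsub>R\<^esub>, 1)] l) = tens_val R f l" if "l \<in> tens_lists R" for f l
    using that by (subst val_mult_Cons) (auto simp: tens_lists_simps val_closed)
  show "coded_algebra (tens_lists R) code (tens_sem R) [(\<one>\<^bsub>R\<^esub>, 1)] append (tens_mult R) tens_smult"
  proof (rule coded_algebra.intro)
    show "inj_on code (tens_lists R)" using code by (rule inj_on_subset) simp
    show "[(\<one>\<^bsub>R\<^esub>, 1)] \<in> tens_lists R" by (simp add: tens_lists_simps)
  next
    fix l l' m m' assume *: "l \<in> tens_lists R" "l' \<in> tens_lists R" "m \<in> tens_lists R" "m' \<in> tens_lists R"
      "tens_sem R l = tens_sem R l'" "tens_sem R m = tens_sem R m'"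
    then show "tens_sem R (l @ m) = tens_sem R (l' @ m')" by (simp add: tens_sem_eq_iff val_append)
    show "tens_sem R (tens_mult R l m) = tens_sem R (tens_mult R l' m')"
      using * mult_cong unfolding tens_sem_eq_iff by blast
  next
    fix l l' c assume "l \<in> tens_lists R" "l' \<in> tens_lists R" "tens_sem R l = tens_sem R l'"
    then have eq: "tens_val R f l = tens_val R f l'" if "functional f" for f
      using that by (simp add: tens_sem_eq_iff)
    show "tens_sem R (tens_smult c l) = tens_sem R (tens_smult c l')"
      unfolding tens_sem_eq_iff val_smult by (blast intro: eq functional_mult)
  next
    fix l :: "('u \<times> 'k alg_closure) list" assume l: "l \<in> tens_lists R"
    have zero: "tens_val R f (tens_smult 0 [(\<one>\<^bsub>R\<^esub>, 1)]) = \<zero>\<^bsub>R\<^esub>" if "functional f" for f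
      using that by (simp add: tens_smult_def functional_zero zero_smult)
    have one_list: "tens_smult 0 [(\<one>\<^bsub>R\<^esub>, 1)] \<in> tens_lists R"
      by (simp add: tens_smult_def tens_lists_simps)
    show "tens_sem R (tens_smult (- 1) l @ l) = tens_sem R (tens_smult 0 [(\<one>\<^bsub>R\<^esub>, 1)])"
      using l by (simp add: tens_sem_eq_iff val_append smult_lists neg zero)
    show "tens_sem R (tens_smult 0 [(\<one>\<^bsub>R\<^esub>, 1)] @ l) = tens_sem R l"
      using l one_list zero by (simp add: tens_sem_eq_iff val_append val_closed)
    show "tens_sem R (tens_mult R [(\<one>\<^bsub>R\<^esub>, 1)] l) = tens_sem R l"
      using l by (simp add: tens_sem_eq_iff one del: tens_mult.simps)
    show "tens_sem R (tens_smult 1 l) = tens_sem R l"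
      by (simp add: tens_sem_eq_iff val_smult)
    fix c d
    show "tens_sem R (tens_smult (c + d) l) = tens_sem R (tens_smult c l @ tens_smult d l)"
    proof -
      have "tens_val R (\<lambda>x. f ((c + d) * x)) l
          = tens_val R (\<lambda>x. f (c * x)) l \<oplus>\<^bsub>R\<^esub> tens_val R (\<lambda>x. f (d * x)) l" if "functional f" for f
        using val_functional_add[OF l, of "\<lambda>x. f (c * x)" "\<lambda>x. f (d * x)"] that
        by (simp add: functional_def distrib_right)
      then show ?thesis using l by (simp add: tens_sem_eq_iff val_append smult_lists val_smult)
    qed
    show "tens_sem R (tens_smult (c * d) l) = tens_sem R (tens_smult c (tens_smult d l))"
      by (simp add: tens_sem_eq_iff val_smult mult.assoc mult.left_commute)
    fix m assume m: "m \<in> tens_lists R"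
    show "tens_sem R (l @ m) = tens_sem R (m @ l)"
      using l m by (simp add: tens_sem_eq_iff val_append val_closed R.a_comm)
    show "tens_sem R (tens_mult R l m) = tens_sem R (tens_mult R m l)"
      using val_mult_commute[OF l m] by (simp add: tens_sem_eq_iff)
    show "tens_sem R (tens_mult R (tens_smult c l) m) = tens_sem R (tens_smult c (tens_mult R l m))"
      using val_mult_smult[OF l m] by (simp add: tens_sem_eq_iff val_smult)
  qed (simp_all add: tens_sem_eq_iff mult_lists smult_lists tens_lists_simps val_append val_closed
      R.a_assoc val_smult val_mult_assoc val_mult_add)
qed

end

section \<open>An algebra as an equalizer of its extensions\<close>

context tensor
begin

abbreviation T0 where "T0 \<equiv> restrict_scalars to_ac C.alg"

definition emb :: "'u \<Rightarrow> 'u" where "emb = (\<lambda>r\<in>carrier R. C.cls [(r, 1)])"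

definition slice :: "('k alg_closure \<Rightarrow> 'k) \<Rightarrow> 'u \<Rightarrow> 'u" where
  "slice f x = tens_val R f (C.dec x)"

lemma T_comm_alg: "comm_alg C.alg" "comm_alg T0"
  by (rule C.alg_comm_alg) (rule ac.restrict_comm_alg[OF C.alg_comm_alg])

lemma pure_list: "r \<in> carrier R \<Longrightarrow> [(r, s)] \<in> tens_lists R"
  by (simp add: tens_lists_simps)

lemma carrier_cases: assumes "x \<in> carrier C.alg" obtains l where "l \<in> tens_lists R" "x = C.cls l"
  using assms by (auto simp: C.alg_carrier)

lemma slice_cls: "functional f \<Longrightarrow> l \<in> tens_lists R \<Longrightarrow> slice f (C.cls l) = tens_val R f l"
  using C.dec_cls[of l] by (simp add: slice_def tens_sem_eq_iff)

lemma slice_closed: "functional f \<Longrightarrow> x \<in> carrier C.alg \<Longrightarrow> slice f x \<in> carrier R"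
  by (auto simp: C.alg_carrier slice_cls val_closed)

lemma slice_add: "functional f \<Longrightarrow> x \<in> carrier C.alg \<Longrightarrow> y \<in> carrier C.alg \<Longrightarrow>
    slice f (x \<oplus>\<^bsub>C.alg\<^esub> y) = slice f x \<oplus>\<^bsub>R\<^esub> slice f y"
  by (auto simp: C.alg_carrier slice_cls C.alg_ops tens_lists_simps val_append)

lemma emb_cls: "r \<in> carrier R \<Longrightarrow> emb r = C.cls [(r, 1)]"
  by (simp add: emb_def)

lemma emb_hom: "emb \<in> homs R T0"
proof -
  have smult: "f (to_ac a) = a * f 1" if "functional f" for f a
    using that unfolding functional_def by (metis mult.right_neutral)
  have "C.cls [(r \<oplus>\<^bsub>R\<^esub> r', 1)] = C.cls [(r, 1)] \<oplus>\<^bsub>C.alg\<^esub> C.cls [(r', 1)]"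
    "C.cls [(r \<otimes>\<^bsub>R\<^esub> r', 1)] = C.cls [(r, 1)] \<otimes>\<^bsub>C.alg\<^esub> C.cls [(r', 1)]"
    if "r \<in> carrier R" "r' \<in> carrier R" for r r'
    using that by (simp_all add: C.alg_ops pure_list C.cls_eq_iff tens_lists_simps tens_sem_eq_iff r)
  moreover have "C.cls [(a \<odot>\<^bsub>R\<^esub> r, 1)] = to_ac a \<odot>\<^bsub>C.alg\<^esub> C.cls [(r, 1)]" if "r \<in> carrier R" for a r
    using that by (simp add: C.alg_ops pure_list C.cls_eq_iff tens_smult_def r tens_sem_eq_iff smult
        flip: r(4)) (simp add: mult.commute)
  ultimately show ?thesis
    by (auto simp: alg_homs_def emb_def ac.restrict_simps C.cls_closed pure_list r C.alg_ops)
qed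

lemma slice_emb: "functional f \<Longrightarrow> r \<in> carrier R \<Longrightarrow> slice f (emb r) = f 1 \<odot>\<^bsub>R\<^esub> r"
  by (simp add: emb_cls slice_cls pure_list r)

lemma emb_inj: "inj_on emb (carrier R)"
proof (rule inj_onI)
  obtain f :: "'k alg_closure \<Rightarrow> 'k" where f: "functional f" "f 1 = 1"
    using functional_exists[OF one_neq_zero] by blast
  have "slice f (emb x) = x" if "x \<in> carrier R" for x
    using slice_emb[OF f(1) that] r(5)[OF that] by (simp only: f(2))
  then show "x = y" if "x \<in> carrier R" "y \<in> carrier R" "emb x = emb y" for x y
    using that by metis
qed

lemma slice_emb_mult:
  assumes "functional f" "r \<in> carrier R" "x \<in> carrier C.alg"
  shows "slice f (emb r \<otimes>\<^bsub>C.alg\<^esub> x) = r \<otimes>\<^bsub>R\<^esub> slice f x"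
proof -
  obtain l where l: "l \<in> tens_lists R" "x = C.cls l" using assms(3) by (rule carrier_cases)
  show ?thesis
    using assms l val_mult_Cons[of "(r, 1)" "[]" l f]
    by (simp add: emb_cls C.alg_ops pure_list slice_cls mult_lists tens_lists_simps val_closed
        del: tens_mult.simps(2))
qed

lemma slice_struct_map: "functional f \<Longrightarrow> slice f (struct_map C.alg c) = struct_map R (f c)"
  by (simp add: struct_map_def C.alg_ops pure_list tens_smult_def slice_cls r)

definition tens_map :: "('k, 'u) module \<Rightarrow> ('u \<Rightarrow> 'u) \<Rightarrow> 'u \<Rightarrow> 'u" where
  "tens_map S h = (\<lambda>x\<in>carrier C.alg. coded_algebra.cls (tens_lists S) code (tens_sem S)
     (map (\<lambda>y. (h (fst y), snd y)) (C.dec x)))"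

lemma tens_map_hom:
  assumes S: "comm_alg S" and h: "h \<in> homs R S"
  defines "CS \<equiv> coded_algebra.alg (tens_lists S) code (tens_sem S) [(\<one>\<^bsub>S\<^esub>, 1)] append (tens_mult S) tens_smult"
    and "clsS \<equiv> coded_algebra.cls (tens_lists S) code (tens_sem S)"
  shows "tens_map S h \<in> homs C.alg CS"
    and "l \<in> tens_lists R \<Longrightarrow> tens_map S h (C.cls l) = clsS (map (\<lambda>y. (h (fst y), snd y)) l)"
proof -
  interpret S: tensor S code using S code by (rule tensor.intro)
  let ?m = "map (\<lambda>y. (h (fst y), snd y))"
  have cl: "?m l \<in> tens_lists S" if "l \<in> tens_lists R" for l
    using that homs_closed[OF h] by (auto simp: tens_lists_def)
  have val: "tens_val S f (?m l) = h (tens_val R f l)" if "l \<in> tens_lists R" for f l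
    using that by (induct l) (auto simp: tens_lists_simps homs_zero[OF R S h] homs_add[OF h]
        homs_smult[OF h] val_closed r)
  have mult: "?m (tens_mult R l m) = tens_mult S (?m l) (?m m)"
    if "l \<in> tens_lists R" "m \<in> tens_lists R" for l m
    using that(1)
  proof (induct l)
    case (Cons x l)
    then show ?case using that(2) by (auto simp: tens_lists_def homs_mult[OF h])
  qed simp
  have 1: "clsS (?m l) = clsS (?m m)"
    if "l \<in> tens_lists R" "m \<in> tens_lists R" "tens_sem R l = tens_sem R m" for l m
    using that by (simp add: clsS_def S.C.cls_eq_iff cl tens_sem_eq_iff val)
  have smult: "?m (tens_smult c l) = tens_smult c (?m l)" for c :: "'k alg_closure" and l
    by (simp add: tens_smult_def)
  define F where "F l = clsS (?m l)" for l
  have F: "l \<in> tens_lists R \<Longrightarrow> F l \<in> carrier CS" "F [(\<one>\<^bsub>R\<^esub>, 1)] = \<one>\<^bsub>CS\<^esub>"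
    "l \<in> tens_lists R \<Longrightarrow> m \<in> tens_lists R \<Longrightarrow> F (l @ m) = F l \<oplus>\<^bsub>CS\<^esub> F m"
    "l \<in> tens_lists R \<Longrightarrow> m \<in> tens_lists R \<Longrightarrow> F (tens_mult R l m) = F l \<otimes>\<^bsub>CS\<^esub> F m"
    "l \<in> tens_lists R \<Longrightarrow> F (tens_smult c l) = c \<odot>\<^bsub>CS\<^esub> F l"
    "l \<in> tens_lists R \<Longrightarrow> m \<in> tens_lists R \<Longrightarrow> tens_sem R l = tens_sem R m \<Longrightarrow> F l = F m" for l m c
    by (simp_all add: F_def clsS_def CS_def S.C.alg_ops cl mult smult homs_one[OF h] S.C.cls_closed
        S.C.cls_eq_iff tens_sem_eq_iff val)
  note H = C.homs_from_alg[of F CS, OF F(1) F(6) F(2) F(3) F(4) F(5)]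
  have eq: "tens_map S h = (\<lambda>x\<in>carrier C.alg. F (C.dec x))"
    by (simp add: tens_map_def F_def clsS_def)
  show "tens_map S h \<in> homs C.alg CS"
    unfolding eq by (rule H(1))
  show "tens_map S h (C.cls l) = clsS (?m l)" if "l \<in> tens_lists R"
    unfolding eq F_def[symmetric] using that by (rule H(2)[rotated -1])
qed

text \<open>Write \<open>T0\<close> for the tensor product as a \<open>k\<close>-algebra. The two maps send \<open>t\<close> to \<open>t \<otimes> 1\<close> and \<open>r \<otimes> s\<close> to
\<open>(r \<otimes> 1) \<otimes> s\<close>. Apply to the last factor a functional with value \<open>1\<close> at \<open>1\<close>: the first map followed
by it is the identity, and the second one followed by it has values in the image of \<open>R\<close>.\<close>

lemma emb_equalizer:
  defines "CT \<equiv> coded_algebra.alg (tens_lists T0) code (tens_sem T0) [(\<one>\<^bsub>T0\<^esub>, 1)] append (tens_mult T0) tens_smult"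
  shows "\<exists>i1\<in>homs T0 (restrict_scalars to_ac CT). \<exists>i2\<in>homs T0 (restrict_scalars to_ac CT).
    comm_alg CT \<and> (\<forall>t\<in>carrier T0. i1 t = i2 t \<longleftrightarrow> t \<in> emb ` carrier R)"
proof -
  interpret S: tensor T0 code using T_comm_alg(2) code by (rule tensor.intro)
  have CT: "CT = S.C.alg" by (simp add: CT_def)
  let ?i2 = "tens_map T0 emb"
  note i2 = tens_map_hom[OF T_comm_alg(2) emb_hom]
  obtain f :: "'k alg_closure \<Rightarrow> 'k" where f: "functional f" "f 1 = 1"
    using functional_exists[OF one_neq_zero] by blast
  have "S.emb t = ?i2 t \<longleftrightarrow> t \<in> emb ` carrier R" if t: "t \<in> carrier T0" for t
  proof
    assume eq: "S.emb t = ?i2 t"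
    obtain l where l: "l \<in> tens_lists R" "t = C.cls l"
      using t carrier_cases by (auto simp: ac.restrict_simps)
    have ml: "map (\<lambda>y. (emb (fst y), snd y)) l \<in> tens_lists T0"
      using l(1) homs_closed[OF emb_hom] by (auto simp: tens_lists_def)
    have "t = S.slice f (S.emb t)"
      using S.slice_emb[OF f(1) t] f(2) comm_alg_smult_one[OF T_comm_alg(2) t] by simp
    also have "\<dots> = tens_val T0 f (map (\<lambda>y. (emb (fst y), snd y)) l)"
      using eq i2(2)[OF l(1)] S.slice_cls[OF f(1) ml] by (simp only: l(2))
    also have "\<dots> = emb (tens_val R f l)"
      using l(1) by (induct l) (auto simp: tens_lists_simps homs_zero[OF R T_comm_alg(2) emb_hom]
          homs_add[OF emb_hom] homs_smult[OF emb_hom] val_closed r)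
    finally show "t \<in> emb ` carrier R" using val_closed[OF l(1)] by blast
  next
    assume "t \<in> emb ` carrier R"
    then obtain x where x: "x \<in> carrier R" "t = emb x" by blast
    then show "S.emb t = ?i2 t"
      using S.emb_cls[OF t] i2(2)[OF pure_list[OF x(1)], of 1] by (simp add: emb_cls)
  qed
  then show ?thesis
    unfolding CT using S.emb_hom ac.restrict_homs[OF i2(1)] S.T_comm_alg(1) by blast
qed

end

primrec list_code :: "('u \<Rightarrow> 'u \<Rightarrow> 'u) \<Rightarrow> (nat \<Rightarrow> 'u) \<Rightarrow> ('c \<Rightarrow> 'u) \<Rightarrow> ('u \<times> 'c) list \<Rightarrow> 'u" where
  "list_code pr num ic [] = pr (num 0) (num 0)"
| "list_code pr num ic (x # l) = pr (num 1) (pr (pr (fst x) (ic (snd x))) (list_code pr num ic l))"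

lemma list_code_exists:
  fixes \<iota> :: "'c::field_char_0 \<Rightarrow> 'u"
  assumes "inj \<iota>"
  shows "\<exists>code :: ('u \<times> 'c) list \<Rightarrow> 'u. inj code"
proof -
  obtain pr :: "'u \<Rightarrow> 'u \<Rightarrow> 'u" and num :: "nat \<Rightarrow> 'u"
    where pr: "\<And>a b c d. pr a b = pr c d \<longleftrightarrow> a = c \<and> b = d" and num: "inj num"
    using infinite_pairing[OF universe_infinite[OF assms]] by blast
  have "l = m" if "list_code pr num \<iota> l = list_code pr num \<iota> m" for l m
    using that
  proof (induct l arbitrary: m)
    case Nil then show ?case by (cases m) (auto simp: pr inj_eq[OF num])
  next
    case (Cons x l) then show ?case
      by (cases m) (auto simp: pr inj_eq[OF num] inj_eq[OF assms] prod_eq_iff)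
  qed
  then have "inj (list_code pr num \<iota>)" by (rule injI)
  then show ?thesis by blast
qed

text \<open>All that is needed of the tensor product \<open>T\<close> of \<open>R\<close> with the closure: the base change of functionals
to \<open>R\<close>-linear maps \<open>slice f\<close>, and \<open>R\<close> as an equalizer.\<close>

lemma closure_extension_exists:
  fixes R :: "('k::field_char_0, 'u) module" and \<iota> :: "'k alg_closure \<Rightarrow> 'u"
  assumes R: "comm_alg R" and \<iota>: "inj \<iota>"
  obtains T :: "('k alg_closure, 'u) module" and emb slice
    and S :: "('k alg_closure, 'u) module" and i1 i2
  where "comm_alg T" "comm_alg S"
    and "emb \<in> homs R (restrict_scalars to_ac T)" "inj_on emb (carrier R)"
    and "i1 \<in> homs (restrict_scalars to_ac T) (restrict_scalars to_ac S)"
    and "i2 \<in> homs (restrict_scalars to_ac T) (restrict_scalars to_ac S)"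
    and "\<And>t. t \<in> carrier T \<Longrightarrow> i1 t = i2 t \<longleftrightarrow> t \<in> emb ` carrier R"
    and "\<And>f x. functional f \<Longrightarrow> x \<in> carrier T \<Longrightarrow> slice f x \<in> carrier R"
    and "\<And>f x y. functional f \<Longrightarrow> x \<in> carrier T \<Longrightarrow> y \<in> carrier T \<Longrightarrow>
      slice f (x \<oplus>\<^bsub>T\<^esub> y) = slice f x \<oplus>\<^bsub>R\<^esub> slice f y"
    and "\<And>f r x. functional f \<Longrightarrow> r \<in> carrier R \<Longrightarrow> x \<in> carrier T \<Longrightarrow>
      slice f (emb r \<otimes>\<^bsub>T\<^esub> x) = r \<otimes>\<^bsub>R\<^esub> slice f x"
    and "\<And>f c. functional f \<Longrightarrow> slice f (struct_map T c) = struct_map R (f c)"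
proof -
  obtain code :: "('u \<times> 'k alg_closure) list \<Rightarrow> 'u" where "inj code"
    using list_code_exists[OF \<iota>] by blast
  with R interpret T: tensor R code by (rule tensor.intro)
  define S where "S = coded_algebra.alg (tens_lists T.T0) code (tens_sem T.T0)
    [(\<one>\<^bsub>T.T0\<^esub>, 1)] append (tens_mult T.T0) tens_smult"
  obtain i1 i2 where i: "i1 \<in> homs T.T0 (restrict_scalars to_ac S)" "i2 \<in> homs T.T0 (restrict_scalars to_ac S)"
    "comm_alg S" "\<forall>t\<in>carrier T.T0. i1 t = i2 t \<longleftrightarrow> t \<in> T.emb ` carrier R"
    using T.emb_equalizer unfolding S_def[symmetric] by blast
  show ?thesis
    by (rule that[of T.C.alg S T.emb i1 i2 T.slice])
      (use i in \<open>simp_all add: T.T_comm_alg T.emb_hom T.emb_inj T.slice_closed T.slice_add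
        T.slice_emb_mult T.slice_struct_map ac.restrict_simps\<close>)
qed

section \<open>Conjugacy of embedded stabilizers\<close>

text \<open>Groups over an extension field \<open>'c\<close> of \<open>'k\<close> that map to the automorphism group of the \<open>'k\<close>-algebra \<open>A\<close>.
The case where \<open>j\<close> is the identity is that of the base field.\<close>

locale form_setup = field_hom j for j :: "'k::field \<Rightarrow> 'c::field" +
  fixes A :: "('k, 'a) module" and e :: "'i::finite \<Rightarrow> 'a"
begin

abbreviation J where "J R \<equiv> restrict_scalars j R"
abbreviation GK where "GK \<equiv> auts A e (field_alg j)"

definition pt :: "('c, 'u) module \<Rightarrow> (('i \<Rightarrow> 'c) \<Rightarrow> ('i \<Rightarrow> 'c)) \<Rightarrow> (('i \<Rightarrow> 'u) \<Rightarrow> ('i \<Rightarrow> 'u))" where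
  "pt R g = aut_map A e (field_alg j) (J R) (struct_map R) g"

definition cstab :: "('i \<Rightarrow> 'c) \<Rightarrow> ('c, 'u) module \<Rightarrow> (('i \<Rightarrow> 'u) \<Rightarrow> ('i \<Rightarrow> 'u)) set" where
  "cstab x R = {g \<in> auts A e (J R). g (base_point R x) = base_point R x}"

definition conj_by :: "('c, 'u) module \<Rightarrow> (('i \<Rightarrow> 'c) \<Rightarrow> ('i \<Rightarrow> 'c)) \<Rightarrow> (('i \<Rightarrow> 'u) \<Rightarrow> ('i \<Rightarrow> 'u))
    \<Rightarrow> (('i \<Rightarrow> 'u) \<Rightarrow> ('i \<Rightarrow> 'u))" where
  "conj_by R g p = pt R g \<otimes>\<^bsub>aut_pts A e (J R)\<^esub> p \<otimes>\<^bsub>aut_pts A e (J R)\<^esub> inv\<^bsub>aut_pts A e (J R)\<^esub> (pt R g)"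

lemma vecs_field: "v \<in> vecs (field_alg j)" by (simp add: vecs_def field_alg_def)

lemma base_point_eq: "base_point R x = struct_map R \<circ> x"
  by (auto simp: base_point_def)

lemma cbase_point_closed: "comm_alg R \<Longrightarrow> base_point R x \<in> vecs (J R)"
  by (simp add: base_point_def vecs_def struct_map_simps restrict_simps)

lemma pt_aut: "comm_alg R \<Longrightarrow> g \<in> GK \<Longrightarrow> pt R g \<in> auts A e (J R)"
  unfolding pt_def by (intro aut_map_aut field_alg_comm_alg restrict_comm_alg struct_map_hom)

lemma pt_apply: "comm_alg R \<Longrightarrow> g \<in> GK \<Longrightarrow> pt R g (base_point R x) = base_point R (g x)"
  unfolding pt_def base_point_eq
  by (intro aut_map_apply field_alg_comm_alg restrict_comm_alg struct_map_hom autD(2) vecs_field)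

lemma pt_hom: "comm_alg R \<Longrightarrow> group_hom (aut_pts A e (field_alg j)) (aut_pts A e (J R)) (pt R)"
  unfolding pt_def[abs_def]
  by (intro group_hom.intro group_hom_axioms.intro aut_group aut_map_hom field_alg_comm_alg
      restrict_comm_alg struct_map_hom)

lemma G_group: "comm_alg R \<Longrightarrow> group (aut_pts A e (J R))"
  by (intro aut_group restrict_comm_alg)

lemma GK_group: "group (aut_pts A e (field_alg j))"
  by (intro aut_group field_alg_comm_alg)

lemma conj_by_closed: "comm_alg R \<Longrightarrow> g \<in> GK \<Longrightarrow> p \<in> auts A e (J R) \<Longrightarrow> conj_by R g p \<in> auts A e (J R)"
proof -
  assume R: "comm_alg R" and *: "g \<in> GK" "p \<in> auts A e (J R)"
  interpret G: group "aut_pts A e (J R)" using R by (rule G_group)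
  show ?thesis using pt_aut[OF R *(1)] * by (simp add: conj_by_def)
qed

lemma conj_by_mult:
  assumes R: "comm_alg R" and g: "g \<in> GK" and p: "p \<in> auts A e (J R)" and q: "q \<in> auts A e (J R)"
  shows "conj_by R g (p \<otimes>\<^bsub>aut_pts A e (J R)\<^esub> q) = conj_by R g p \<otimes>\<^bsub>aut_pts A e (J R)\<^esub> conj_by R g q"
proof -
  interpret G: group "aut_pts A e (J R)" using R by (rule G_group)
  show ?thesis using pt_aut[OF R g] p q by (simp add: conj_by_def G.m_assoc G.inv_solve_left)
qed

lemma conj_by_compose:
  assumes R: "comm_alg R" and g: "g \<in> GK" and h: "h \<in> GK" and p: "p \<in> auts A e (J R)"
  shows "conj_by R g (conj_by R h p) = conj_by R (g \<otimes>\<^bsub>aut_pts A e (field_alg j)\<^esub> h) p"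
proof -
  interpret G: group "aut_pts A e (J R)" using R by (rule G_group)
  interpret H: group_hom "aut_pts A e (field_alg j)" "aut_pts A e (J R)" "pt R" using R by (rule pt_hom)
  show ?thesis
    using pt_aut[OF R g] pt_aut[OF R h] p g h by (simp add: conj_by_def G.m_assoc G.inv_mult_group)
qed

lemma conj_by_one:
  assumes R: "comm_alg R" and p: "p \<in> auts A e (J R)"
  shows "conj_by R (\<one>\<^bsub>aut_pts A e (field_alg j)\<^esub>) p = p"
proof -
  interpret G: group "aut_pts A e (J R)" using R by (rule G_group)
  interpret H: group_hom "aut_pts A e (field_alg j)" "aut_pts A e (J R)" "pt R" using R by (rule pt_hom)
  show ?thesis using p by (simp add: conj_by_def)
qed

lemma conj_by_inverse:
  assumes R: "comm_alg R" and g: "g \<in> GK" and p: "p \<in> auts A e (J R)"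
  shows "conj_by R (inv\<^bsub>aut_pts A e (field_alg j)\<^esub> g) (conj_by R g p) = p"
    "conj_by R g (conj_by R (inv\<^bsub>aut_pts A e (field_alg j)\<^esub> g) p) = p"
proof -
  interpret K: group "aut_pts A e (field_alg j)" by (rule GK_group)
  show "conj_by R (inv\<^bsub>aut_pts A e (field_alg j)\<^esub> g) (conj_by R g p) = p"
    "conj_by R g (conj_by R (inv\<^bsub>aut_pts A e (field_alg j)\<^esub> g) p) = p"
    using conj_by_one[OF R p] g by (simp_all add: conj_by_compose[OF R _ _ p])
qed

lemma conj_by_inj: "comm_alg R \<Longrightarrow> g \<in> GK \<Longrightarrow> inj_on (conj_by R g) (cstab x R)"
  by (rule inj_on_inverseI[where g="conj_by R (inv\<^bsub>aut_pts A e (field_alg j)\<^esub> g)"])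
    (simp add: conj_by_inverse cstab_def)

lemma conj_by_cstab:
  assumes R: "comm_alg R" and g: "g \<in> GK"
  shows "conj_by R g ` cstab x R = cstab (g x) R"
proof -
  interpret K: group "aut_pts A e (field_alg j)" by (rule GK_group)
  interpret G: group "aut_pts A e (J R)" using R by (rule G_group)
  have *: "conj_by R h p \<in> cstab (h x) R" if h: "h \<in> GK" and p: "p \<in> cstab x R" for h p x
  proof -
    note a = pt_aut[OF R h] and b = cbase_point_closed[OF R]
    have pa: "p \<in> auts A e (J R)" "p (base_point R x) = base_point R x"
      using p by (simp_all add: cstab_def)
    have "(inv\<^bsub>aut_pts A e (J R)\<^esub> (pt R h)) (base_point R (h x)) = base_point R x"
      using aut_inv_apply(1)[OF restrict_comm_alg[OF R] a b] by (simp add: pt_apply[OF R h])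
    then have "conj_by R h p (base_point R (h x)) = base_point R (h x)"
      using a pa by (simp add: conj_by_def aut_mult_apply b pt_apply[OF R h] autD(6))
    then show ?thesis using conj_by_closed[OF R h pa(1)] by (simp add: cstab_def)
  qed
  have g_back: "(inv\<^bsub>aut_pts A e (field_alg j)\<^esub> g) (g x) = x"
    by (rule aut_inv_apply(1)[OF field_alg_comm_alg g vecs_field])
  show ?thesis
  proof (intro equalityI subsetI)
    fix p assume p: "p \<in> cstab (g x) R"
    then have "conj_by R (inv\<^bsub>aut_pts A e (field_alg j)\<^esub> g) p \<in> cstab x R"
      using *[OF K.inv_closed[OF g] p] by (simp add: g_back)
    moreover have "p = conj_by R g (conj_by R (inv\<^bsub>aut_pts A e (field_alg j)\<^esub> g) p)"
      using conj_by_inverse(2)[OF R g] p by (simp add: cstab_def)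
    ultimately show "p \<in> conj_by R g ` cstab x R" by blast
  qed (auto intro: *[OF g])
qed

lemma cstab_scale:
  assumes R: "comm_alg R" and "t \<noteq> 0"
  shows "cstab (\<lambda>l. t * x l) R = cstab x R"
proof -
  have *: "p \<in> cstab (\<lambda>l. s * x l) R" if "p \<in> cstab x R" for p s x
  proof -
    have p: "p \<in> auts A e (J R)" "p (base_point R x) = base_point R x"
      using that by (simp_all add: cstab_def)
    have eq: "base_point R (\<lambda>l. s * x l) = (\<lambda>l. struct_map R s \<otimes>\<^bsub>J R\<^esub> base_point R x l)"
      by (simp add: base_point_def struct_map_simps[OF R] restrict_simps)
    have "p (\<lambda>l. struct_map R s \<otimes>\<^bsub>J R\<^esub> base_point R x l) = (\<lambda>l. struct_map R s \<otimes>\<^bsub>J R\<^esub> p (base_point R x) l)"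
      by (rule linear_onD(4)[OF autD(2)[OF p(1)] _ cbase_point_closed[OF R]])
        (simp add: struct_map_simps[OF R] restrict_simps)
    then show ?thesis using p by (simp add: cstab_def eq)
  qed
  show ?thesis
    using *[of _ x t] *[of _ "\<lambda>l. t * x l" "inverse t"] assms(2) by (auto simp: mult.assoc[symmetric])
qed

definition onto_stab :: "('c, 'u, 'i) grp_over \<Rightarrow> ('i \<Rightarrow> 'c) \<Rightarrow> bool" where
  "onto_stab = (\<lambda>(H, f) x. grp_morphism H (base_change j (aut_group A e)) f \<and>
     (\<forall>R. comm_alg R \<longrightarrow> group (pts H R) \<and> bij_betw (f R) (carrier (pts H R)) (cstab x R)))"

lemma base_change_aut:
  "pts (base_change j (aut_group A e)) R = aut_pts A e (J R)"
  "pmap (base_change j (aut_group A e)) R S h = aut_map A e (J R) (J S) h"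
  by (simp_all add: base_change_def aut_group_def)

lemma conjugate_over_iff:
  "conjugate_over j A e (H, f) (H', f') \<longleftrightarrow> (\<exists>g\<in>GK. \<exists>\<phi>. grp_isomorphism H H' \<phi> \<and>
     (\<forall>R. comm_alg R \<longrightarrow> (\<forall>p\<in>carrier (pts H R). conj_by R g (f R p) = f' R (\<phi> R p))))"
  by (simp add: conjugate_over_def Let_def conj_by_def pt_def base_change_aut)

lemma stab_inclusion_onto: "onto_stab (stab_inclusion j A e x :: ('c, 'u, 'i) grp_over) x"
proof -
  have "subgroup (cstab x R) (aut_pts A e (J R))" if R: "comm_alg R" for R :: "('c, 'u) module"
  proof -
    interpret G: group "aut_pts A e (J R)" using R by (rule G_group)
    note b = cbase_point_closed[OF R, of x] and R' = restrict_comm_alg[OF R]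
    show ?thesis
    proof (rule G.subgroupI)
      show "cstab x R \<noteq> {}" using aut_id[OF R', of A e] b by (auto simp: cstab_def)
      fix g assume g: "g \<in> cstab x R"
      then show "inv\<^bsub>aut_pts A e (J R)\<^esub> g \<in> cstab x R"
        using aut_inv_apply(1)[OF R' _ b, of g A e] G.inv_closed[of g] by (simp add: cstab_def)
      fix h assume "h \<in> cstab x R"
      with g show "g \<otimes>\<^bsub>aut_pts A e (J R)\<^esub> h \<in> cstab x R"
        using b by (simp add: cstab_def aut_mult_apply)
    qed (auto simp: cstab_def)
  qed
  then show ?thesis
    by (auto simp: onto_stab_def stab_inclusion_def stabilizer_def base_change_def aut_group_def
        grp_morphism_def hom_def cstab_def bij_betw_def inj_on_def
        intro!: subgroup.subgroup_is_group[OF _ G_group])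
qed

lemma onto_stabD:
  assumes "onto_stab (H, f) x" "comm_alg R"
  shows "group (pts H R)" "bij_betw (f R) (carrier (pts H R)) (cstab x R)"
    "f R \<in> hom (pts H R) (aut_pts A e (J R))" "p \<in> carrier (pts H R) \<Longrightarrow> f R p \<in> auts A e (J R)"
    "comm_alg S \<Longrightarrow> h \<in> homs R S \<Longrightarrow> p \<in> carrier (pts H R) \<Longrightarrow>
      f S (pmap H R S h p) = aut_map A e (J R) (J S) h (f R p)"
  using assms by (auto simp: onto_stab_def grp_morphism_def base_change_aut hom_def)

lemma conj_by_natural:
  assumes R: "comm_alg R" and S: "comm_alg S" and h: "h \<in> homs R S" and g: "g \<in> GK"
    and p: "p \<in> auts A e (J R)"
  shows "aut_map A e (J R) (J S) h (conj_by R g p) = conj_by S g (aut_map A e (J R) (J S) h p)"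
proof -
  note R' = restrict_comm_alg[OF R] and S' = restrict_comm_alg[OF S] and h' = restrict_homs[OF h]
  interpret G: group "aut_pts A e (J R)" using R by (rule G_group)
  interpret H: group_hom "aut_pts A e (J R)" "aut_pts A e (J S)" "aut_map A e (J R) (J S) h"
    by (intro group_hom.intro group_hom_axioms.intro aut_group aut_map_hom R' S' h')
  have "compose (carrier (field_alg j)) h (struct_map R) = struct_map S"
    using homs_struct_map[OF h R] by (auto simp: compose_def field_alg_def)
  then have "aut_map A e (J R) (J S) h (pt R g) = pt S g"
    using aut_map_compose[OF field_alg_comm_alg R' S' struct_map_hom[OF R] h' g] by (simp add: pt_def)
  then show ?thesis
    using pt_aut[OF R g] p by (simp add: conj_by_def)
qed

text \<open>Conjugation by \<open>g\<close> maps the stabilizer of \<open>x\<close> onto that of \<open>g x\<close>. As \<open>f\<close> and \<open>f'\<close> are injective, an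
isomorphism between the groups that is compatible with this conjugation exists, and is then unique,
exactly if the images correspond.\<close>

lemma conjugate_iff_stab:
  fixes H H' :: "('c, 'u, ('i \<Rightarrow> 'u) \<Rightarrow> ('i \<Rightarrow> 'u)) grp_functor"
  assumes H: "onto_stab (H, f) x" and H': "onto_stab (H', f') x'"
    and pm: "\<And>R S h p. comm_alg R \<Longrightarrow> comm_alg S \<Longrightarrow> h \<in> homs R S \<Longrightarrow> p \<in> carrier (pts H R) \<Longrightarrow>
      pmap H R S h p \<in> carrier (pts H S)"
    and pm': "\<And>R S h p. comm_alg R \<Longrightarrow> comm_alg S \<Longrightarrow> h \<in> homs R S \<Longrightarrow> p \<in> carrier (pts H' R) \<Longrightarrow>
      pmap H' R S h p \<in> carrier (pts H' S)"
  shows "conjugate_over j A e (H, f) (H', f') \<longleftrightarrow>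
    (\<exists>g\<in>GK. \<forall>R :: ('c, 'u) module. comm_alg R \<longrightarrow> cstab (g x) R = cstab x' R)"
proof
  assume "conjugate_over j A e (H, f) (H', f')"
  then obtain g \<phi> where g: "g \<in> GK" and \<phi>: "grp_isomorphism H H' \<phi>"
    and eq: "\<And>R p. comm_alg R \<Longrightarrow> p \<in> carrier (pts H R) \<Longrightarrow> conj_by R g (f R p) = f' R (\<phi> R p)"
    unfolding conjugate_over_iff by blast
  have "cstab (g x) R = cstab x' R" if R: "comm_alg R" for R :: "('c, 'u) module"
  proof -
    have "cstab (g x) R = (\<lambda>p. conj_by R g (f R p)) ` carrier (pts H R)"
      using bij_betw_imp_surj_on[OF onto_stabD(2)[OF H R]] conj_by_cstab[OF R g, of x]
      by (simp add: image_image[symmetric])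
    also have "\<dots> = f' R ` \<phi> R ` carrier (pts H R)"
      using eq[OF R] by (simp add: image_image)
    also have "\<phi> R ` carrier (pts H R) = carrier (pts H' R)"
      using \<phi> R by (auto simp: grp_isomorphism_def iso_def bij_betw_def)
    also have "f' R ` \<dots> = cstab x' R"
      by (rule bij_betw_imp_surj_on[OF onto_stabD(2)[OF H' R]])
    finally show ?thesis .
  qed
  with g show "\<exists>g\<in>GK. \<forall>R :: ('c, 'u) module. comm_alg R \<longrightarrow> cstab (g x) R = cstab x' R" by blast
next
  assume "\<exists>g\<in>GK. \<forall>R :: ('c, 'u) module. comm_alg R \<longrightarrow> cstab (g x) R = cstab x' R"
  then obtain g where g: "g \<in> GK" and st: "\<And>R :: ('c, 'u) module. comm_alg R \<Longrightarrow> cstab (g x) R = cstab x' R"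
    by blast
  define \<phi> where "\<phi> R = (\<lambda>p. inv_into (carrier (pts H' R)) (f' R) (conj_by R g (f R p)))" for R
  have bij: "bij_betw (\<lambda>p. conj_by R g (f R p)) (carrier (pts H R)) (cstab x' R)" if R: "comm_alg R" for R :: "('c, 'u) module"
  proof -
    have "bij_betw (conj_by R g) (cstab x R) (cstab x' R)"
      using conj_by_cstab[OF R g, of x] st[OF R]
      by (simp add: bij_betw_def conj_by_inj[OF R g])
    from bij_betw_trans[OF onto_stabD(2)[OF H R] this] show ?thesis by (simp add: comp_def)
  qed
  have \<phi>_in: "\<phi> R p \<in> carrier (pts H' R)" and f\<phi>: "f' R (\<phi> R p) = conj_by R g (f R p)"
    if R: "comm_alg R" and p: "p \<in> carrier (pts H R)" for R :: "('c, 'u) module" and p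
  proof -
    have "conj_by R g (f R p) \<in> f' R ` carrier (pts H' R)"
      using bij_betw_apply[OF bij[OF R] p] bij_betw_imp_surj_on[OF onto_stabD(2)[OF H' R]] by simp
    then show "\<phi> R p \<in> carrier (pts H' R)" "f' R (\<phi> R p) = conj_by R g (f R p)"
      unfolding \<phi>_def by (rule inv_into_into, rule f_inv_into_f)
  qed
  have inj': "p = q" if "f' R p = f' R q" "p \<in> carrier (pts H' R)" "q \<in> carrier (pts H' R)" "comm_alg R" for R :: "('c, 'u) module" and p q
    using that onto_stabD(2)[OF H' that(4)] by (auto simp: bij_betw_def inj_on_def)
  have "grp_isomorphism H H' \<phi>"
    unfolding grp_isomorphism_def grp_morphism_def
  proof (intro conjI allI impI ballI)
    fix R :: "('c, 'u) module" assume R: "comm_alg R"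
    interpret PH: group "pts H R" by (rule onto_stabD(1)[OF H R])
    interpret PH': group "pts H' R" by (rule onto_stabD(1)[OF H' R])
    show hom: "\<phi> R \<in> hom (pts H R) (pts H' R)"
    proof (rule homI)
      fix p q assume pq: "p \<in> carrier (pts H R)" "q \<in> carrier (pts H R)"
      show "\<phi> R (p \<otimes>\<^bsub>pts H R\<^esub> q) = \<phi> R p \<otimes>\<^bsub>pts H' R\<^esub> \<phi> R q"
        by (rule inj'[OF _ _ _ R])
          (use pq in \<open>simp_all add: f\<phi>[OF R] \<phi>_in[OF R] hom_mult[OF onto_stabD(3)[OF H R]]
            hom_mult[OF onto_stabD(3)[OF H' R]] conj_by_mult[OF R g] onto_stabD(4)[OF H R]\<close>)
    qed (rule \<phi>_in[OF R])
    have "bij_betw (\<phi> R) (carrier (pts H R)) (carrier (pts H' R))"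
      unfolding \<phi>_def
      using bij_betw_trans[OF bij[OF R] bij_betw_inv_into[OF onto_stabD(2)[OF H' R]]] by (simp add: comp_def)
    with hom show "\<phi> R \<in> iso (pts H R) (pts H' R)" by (simp add: iso_def)
  next
    fix R S :: "('c, 'u) module" and h p
    assume RS: "comm_alg R \<and> comm_alg S" and h: "h \<in> homs R S" and p: "p \<in> carrier (pts H R)"
    then have R: "comm_alg R" and S: "comm_alg S" by blast+
    show "\<phi> S (pmap H R S h p) = pmap H' R S h (\<phi> R p)"
      by (rule inj'[OF _ _ _ S])
        (simp_all add: f\<phi>[OF S] f\<phi>[OF R] \<phi>_in[OF S] \<phi>_in[OF R] pm[OF R S h] pm'[OF R S h] p
          onto_stabD(5)[OF H R S h] onto_stabD(5)[OF H' R S h] conj_by_natural[OF R S h g]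
          onto_stabD(4)[OF H R])
  qed
  then show "conjugate_over j A e (H, f) (H', f')"
    unfolding conjugate_over_iff using g f\<phi> by (intro bexI[of _ g] exI[of _ \<phi>]) auto
qed

text \<open>A group that is conjugate to the stabilizer of \<open>x\<close> maps isomorphically onto the stabilizer of \<open>g x\<close>,
for the inverse \<open>g\<close> of the conjugating element.\<close>

lemma conjugate_imp_onto_stab:
  fixes H :: "('c, 'u, ('i \<Rightarrow> 'u) \<Rightarrow> ('i \<Rightarrow> 'u)) grp_functor"
  assumes conj: "conjugate_over j A e (H, f) (stab_inclusion j A e (x :: 'i \<Rightarrow> 'c) :: ('c, 'u, 'i) grp_over)"
    and mor: "grp_morphism H (base_change j (aut_group A e)) f" and H: "\<And>R. comm_alg R \<Longrightarrow> group (pts H R)"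
  shows "\<exists>g\<in>GK. onto_stab (H, f) (g x)"
proof -
  obtain H' f' where st: "(stab_inclusion j A e x :: ('c, 'u, 'i) grp_over) = (H', f')" by force
  have "onto_stab (stab_inclusion j A e x :: ('c, 'u, 'i) grp_over) x" by (rule stab_inclusion_onto)
  then have H': "onto_stab (H', f') x" by (simp only: st)
  obtain g \<phi> where g: "g \<in> GK" and \<phi>: "grp_isomorphism H H' \<phi>"
    and eq: "\<And>R p. comm_alg R \<Longrightarrow> p \<in> carrier (pts H R) \<Longrightarrow> conj_by R g (f R p) = f' R (\<phi> R p)"
    using conj unfolding conjugate_over_iff st by blast
  interpret K: group "aut_pts A e (field_alg j)" by (rule GK_group)
  let ?g' = "inv\<^bsub>aut_pts A e (field_alg j)\<^esub> g"
  have "bij_betw (f R) (carrier (pts H R)) (cstab (?g' x) R)" if R: "comm_alg R" for R :: "('c, 'u) module"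
  proof -
    have fa: "f R p \<in> auts A e (J R)" if "p \<in> carrier (pts H R)" for p
      using mor R that by (auto simp: grp_morphism_def base_change_aut hom_def)
    have "bij_betw (\<phi> R) (carrier (pts H R)) (carrier (pts H' R))"
      using \<phi> R by (auto simp: grp_isomorphism_def iso_def)
    from bij_betw_trans[OF this onto_stabD(2)[OF H' R]]
    have 1: "bij_betw (\<lambda>p. f' R (\<phi> R p)) (carrier (pts H R)) (cstab x R)" by (simp add: comp_def)
    have "bij_betw (conj_by R ?g') (cstab x R) (cstab (?g' x) R)"
      using conj_by_cstab[OF R K.inv_closed[OF g], of x]
      by (simp add: bij_betw_def conj_by_inj[OF R K.inv_closed[OF g]])
    from bij_betw_trans[OF 1 this]
    have 2: "bij_betw (\<lambda>p. conj_by R ?g' (f' R (\<phi> R p))) (carrier (pts H R)) (cstab (?g' x) R)"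
      by (simp add: comp_def)
    have "conj_by R ?g' (f' R (\<phi> R p)) = f R p" if "p \<in> carrier (pts H R)" for p
      using conj_by_inverse(1)[OF R g fa[OF that]] by (simp add: eq[OF R that])
    with 2 show ?thesis by (simp cong: bij_betw_cong)
  qed
  then have "onto_stab (H, f) (?g' x)" using mor H by (simp add: onto_stab_def)
  then show ?thesis using K.inv_closed[OF g] by blast
qed

end

interpretation idh: field_hom id
  by unfold_locales simp_all

lemma base_change_id [simp]: "base_change id F = F"
  by (simp add: base_change_def)

section \<open>Points over a copy of the base field\<close>

text \<open>Test algebras have their carrier in the type \<open>'u\<close>, so the rational points of a group functor are its
points over a copy of the field in \<open>'u\<close>.\<close>

lemma field_copy:
  fixes \<iota> :: "'c::field \<Rightarrow> 'u"
  assumes "inj \<iota>"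
  shows "\<exists>K :: ('c, 'u) module. comm_alg K \<and> inj (struct_map K)"
proof -
  interpret coded_algebra UNIV \<iota> id 1 "(+)" "(*)" "(*)"
    by unfold_locales (use assms in \<open>auto simp: algebra_simps\<close>)
  have "struct_map alg c = cls c" for c
    by (simp add: struct_map_def alg_ops)
  then have "inj (struct_map alg)" by (simp add: inj_def cls_eq_iff)
  with alg_comm_alg show ?thesis by blast
qed

context form_setup
begin

lemma cstab_subset_imp_fixed:
  fixes \<iota> :: "'c \<Rightarrow> 'u"
  assumes "inj \<iota>" and sub: "\<And>R :: ('c, 'u) module. comm_alg R \<Longrightarrow> cstab x R \<subseteq> cstab y R"
    and g: "g \<in> GK" "g x = x"
  shows "g y = y"
proof -
  obtain K :: "('c, 'u) module" where K: "comm_alg K" "inj (struct_map K)"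
    using field_copy[OF assms(1)] by blast
  have "pt K g \<in> cstab x K"
    using pt_apply[OF K(1) g(1), of x] pt_aut[OF K(1) g(1)] g(2) by (simp add: cstab_def)
  then have "pt K g (base_point K y) = base_point K y"
    using sub[OF K(1)] by (auto simp: cstab_def)
  then have "struct_map K \<circ> g y = struct_map K \<circ> y"
    by (simp only: pt_apply[OF K(1) g(1)]) (simp only: base_point_eq)
  then show ?thesis using K(2) by (auto simp: fun_eq_iff inj_eq)
qed

end

section \<open>Descent from the algebraic closure\<close>

text \<open>The part of \<open>closure_extension_exists\<close> that concerns one functional.\<close>

lemma closure_slice_exists:
  fixes R :: "('k::field_char_0, 'u) module" and \<iota> :: "'k alg_closure \<Rightarrow> 'u"
  assumes R: "comm_alg R" and \<iota>: "inj \<iota>" and fu: "functional fu"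
  obtains T :: "('k alg_closure, 'u) module" and emb sl
  where "comm_alg T" "emb \<in> homs R (restrict_scalars to_ac T)"
    and "\<And>x. x \<in> carrier T \<Longrightarrow> sl x \<in> carrier R"
    and "\<And>x y. x \<in> carrier T \<Longrightarrow> y \<in> carrier T \<Longrightarrow> sl (x \<oplus>\<^bsub>T\<^esub> y) = sl x \<oplus>\<^bsub>R\<^esub> sl y"
    and "\<And>r x. r \<in> carrier R \<Longrightarrow> x \<in> carrier T \<Longrightarrow> sl (emb r \<otimes>\<^bsub>T\<^esub> x) = r \<otimes>\<^bsub>R\<^esub> sl x"
    and "\<And>c. sl (struct_map T c) = struct_map R (fu c)"
proof (rule closure_extension_exists[OF R \<iota>])
  fix T S :: "('k alg_closure, 'u) module" and emb slice i1 i2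
  assume *: "comm_alg T" "emb \<in> homs R (restrict_scalars to_ac T)"
    "\<And>f x. functional f \<Longrightarrow> x \<in> carrier T \<Longrightarrow> slice f x \<in> carrier R"
    "\<And>f x y. functional f \<Longrightarrow> x \<in> carrier T \<Longrightarrow> y \<in> carrier T \<Longrightarrow>
      slice f (x \<oplus>\<^bsub>T\<^esub> y) = slice f x \<oplus>\<^bsub>R\<^esub> slice f y"
    "\<And>f r x. functional f \<Longrightarrow> r \<in> carrier R \<Longrightarrow> x \<in> carrier T \<Longrightarrow>
      slice f (emb r \<otimes>\<^bsub>T\<^esub> x) = r \<otimes>\<^bsub>R\<^esub> slice f x"
    "\<And>f c. functional f \<Longrightarrow> slice f (struct_map T c) = struct_map R (f c)"
  show thesis by (rule that[of T emb "slice fu"]) (simp_all add: * fu)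
qed

lemma closure_equalizer_exists:
  fixes R :: "('k::field_char_0, 'u) module" and \<iota> :: "'k alg_closure \<Rightarrow> 'u"
  assumes R: "comm_alg R" and \<iota>: "inj \<iota>"
  obtains T S :: "('k alg_closure, 'u) module" and emb i1 i2
  where "comm_alg T" "comm_alg S"
    and "emb \<in> homs R (restrict_scalars to_ac T)" "inj_on emb (carrier R)"
    and "i1 \<in> homs (restrict_scalars to_ac T) (restrict_scalars to_ac S)"
    and "i2 \<in> homs (restrict_scalars to_ac T) (restrict_scalars to_ac S)"
    and "\<And>t. t \<in> carrier T \<Longrightarrow> i1 t = i2 t \<longleftrightarrow> t \<in> emb ` carrier R"
proof (rule closure_extension_exists[OF R \<iota>])
  fix T S :: "('k alg_closure, 'u) module" and emb slice i1 i2
  assume *: "comm_alg T" "comm_alg S" "emb \<in> homs R (restrict_scalars to_ac T)" "inj_on emb (carrier R)"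
    "i1 \<in> homs (restrict_scalars to_ac T) (restrict_scalars to_ac S)"
    "i2 \<in> homs (restrict_scalars to_ac T) (restrict_scalars to_ac S)"
    "\<And>t. t \<in> carrier T \<Longrightarrow> i1 t = i2 t \<longleftrightarrow> t \<in> emb ` carrier R"
  show thesis by (rule that[of T S emb i1 i2]) (fact *)+
qed

lemma homs_ext_eqI:
  assumes "a \<in> homs B R" "b \<in> homs B R" "\<And>x. x \<in> carrier B \<Longrightarrow> a x = b x"
  shows "a = b"
  using assms by (intro extensionalityI[OF homs_ext homs_ext])

locale descent =
  fixes A :: "('k::field_char_0, 'a) module" and e :: "'i::finite \<Rightarrow> 'a"
    and H :: "('k, 'u, ('i \<Rightarrow> 'u) \<Rightarrow> ('i \<Rightarrow> 'u)) grp_functor"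
    and f :: "('k, 'u, ('i \<Rightarrow> 'u) \<Rightarrow> ('i \<Rightarrow> 'u), ('i \<Rightarrow> 'u) \<Rightarrow> ('i \<Rightarrow> 'u)) pts_map"
    and \<iota> :: "'k alg_closure \<Rightarrow> 'u"
  assumes H: "algebraic_group H" and f: "grp_morphism H (aut_group A e) f" and \<iota>: "inj \<iota>"
begin

sublocale ac: form_setup to_ac A e
  by unfold_locales

sublocale k: form_setup id A e
  by unfold_locales

lemma grp_functor: "is_grp_functor H" using H by (simp add: algebraic_group_def)

lemma pts_group: "comm_alg R \<Longrightarrow> group (pts H R)"
  using grp_functor by (simp add: is_grp_functor_def)

lemma pmap_closed: "comm_alg R \<Longrightarrow> comm_alg S \<Longrightarrow> h \<in> homs R S \<Longrightarrow> p \<in> carrier (pts H R) \<Longrightarrow>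
    pmap H R S h p \<in> carrier (pts H S)"
  using grp_functor unfolding is_grp_functor_def hom_def by blast

lemma f_natural: "comm_alg R \<Longrightarrow> comm_alg S \<Longrightarrow> h \<in> homs R S \<Longrightarrow> p \<in> carrier (pts H R) \<Longrightarrow>
    f S (pmap H R S h p) = aut_map A e R S h (f R p)"
  using f by (simp add: grp_morphism_def aut_group_def)

lemma f_hom: "comm_alg R \<Longrightarrow> f R \<in> hom (pts H R) (aut_pts A e R)"
  using f by (simp add: grp_morphism_def aut_group_def)

lemma f_aut: "comm_alg R \<Longrightarrow> p \<in> carrier (pts H R) \<Longrightarrow> f R p \<in> auts A e R"
  using f_hom[of R] by (auto simp: hom_def)

lemma base_change_morphism:
  "grp_morphism (base_change to_ac H) (base_change to_ac (aut_group A e)) (base_change_map to_ac f)"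
  by (auto simp: grp_morphism_def base_change_def base_change_map_def aut_group_def
      intro!: f_hom f_natural ac.restrict_comm_alg ac.restrict_homs)

lemma base_change_group: "comm_alg R \<Longrightarrow> group (pts (base_change to_ac H) R)"
  using pts_group[OF ac.restrict_comm_alg] by (simp add: base_change_def)

context
  fixes x :: "'i \<Rightarrow> 'k alg_closure"
  assumes onto: "ac.onto_stab (base_change to_ac H, base_change_map to_ac f) x"
begin

lemma ac_bij: "comm_alg R \<Longrightarrow> bij_betw (f (ac.J R)) (carrier (pts H (ac.J R))) (ac.cstab x R)"
  using ac.onto_stabD(2)[OF onto] by (simp add: base_change_def base_change_map_def)

text \<open>The matrix \<open>q\<close> of \<open>f R p\<close> has entries in \<open>R\<close>, and over the extension \<open>T\<close> of \<open>R\<close> to the closure it fixes \<open>x\<close>.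
Each coordinate of this equation has the form \<open>(\<Sum>i. q i * x i) = x l\<close>; applying the base change of the
functional, which is \<open>R\<close>-linear, replaces \<open>x\<close> by its image under the functional.\<close>

lemma functional_point_fixed:
  assumes R: "comm_alg R" and p: "p \<in> carrier (pts H R)" and fu: "functional fu"
  shows "f R p (base_point R (\<lambda>l. fu (x l))) = base_point R (\<lambda>l. fu (x l))"
proof
  fix l
  obtain T :: "('k alg_closure, 'u) module" and emb slice
    where T: "comm_alg T" and emb: "emb \<in> homs R (ac.J T)"
    and sl: "\<And>x. x \<in> carrier T \<Longrightarrow> slice x \<in> carrier R"
      "\<And>x y. x \<in> carrier T \<Longrightarrow> y \<in> carrier T \<Longrightarrow> slice (x \<oplus>\<^bsub>T\<^esub> y) = slice x \<oplus>\<^bsub>R\<^esub> slice y"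
      "\<And>r x. r \<in> carrier R \<Longrightarrow> x \<in> carrier T \<Longrightarrow> slice (emb r \<otimes>\<^bsub>T\<^esub> x) = r \<otimes>\<^bsub>R\<^esub> slice x"
      "\<And>c. slice (struct_map T c) = struct_map R (fu c)"
    by (rule closure_slice_exists[OF R \<iota> fu], rule that) (assumption | simp)+
  note T' = ac.restrict_comm_alg[OF T]
  interpret R: cring R using R by (rule comm_algD)
  interpret T: cring T using T by (rule comm_algD)
  note q = autD[OF f_aut[OF R p]]
  let ?q = "\<lambda>i. f R p (unit_vec R i) l" and ?x = "\<lambda>i. struct_map T (x i)"
  have qc: "?q i \<in> carrier R" for i using q(6)[OF R.unit_vec_closed] by (rule vecsD)
  have xc: "?x i \<in> carrier T" for i by (simp add: struct_map_simps T)
  have embc: "emb (?q i) \<in> carrier T" for i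
    using homs_closed[OF emb qc] by (simp add: ac.restrict_simps)
  have finsum_J: "(\<Oplus>\<^bsub>ac.J T\<^esub>i\<in>F. g i) = (\<Oplus>\<^bsub>T\<^esub>i\<in>F. g i)" for F and g :: "'i \<Rightarrow> 'u"
    by (simp add: finsum_def finprod_def restrict_scalars_def)
  have "f (ac.J T) (pmap H R (ac.J T) emb p) \<in> ac.cstab x T"
    using pmap_closed[OF R T' emb p] bij_betw_apply[OF ac_bij[OF T]] by blast
  then have "aut_map A e R (ac.J T) emb (f R p) (base_point T x) = base_point T x"
    by (simp add: f_natural[OF R T' emb p] ac.cstab_def)
  then have "(\<Oplus>\<^bsub>T\<^esub>i\<in>UNIV. ?x i \<otimes>\<^bsub>T\<^esub> emb (?q i)) = ?x l"
    using ac.cbase_point_closed[OF T, of x]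
    by (simp add: aut_map_eq mat_map_def fun_eq_iff finsum_J ac.restrict_simps base_point_def)
  also have "(\<Oplus>\<^bsub>T\<^esub>i\<in>UNIV. ?x i \<otimes>\<^bsub>T\<^esub> emb (?q i)) = (\<Oplus>\<^bsub>T\<^esub>i\<in>UNIV. emb (?q i) \<otimes>\<^bsub>T\<^esub> ?x i)"
    using xc embc by (intro T.finsum_cong') (auto simp: T.m_comm)
  finally have eq: "(\<Oplus>\<^bsub>T\<^esub>i\<in>UNIV. emb (?q i) \<otimes>\<^bsub>T\<^esub> ?x i) = ?x l" .
  have slice_sum: "slice (\<Oplus>\<^bsub>T\<^esub>i\<in>F. g i) = (\<Oplus>\<^bsub>R\<^esub>i\<in>F. slice (g i))"
    if "finite F" "g \<in> F \<rightarrow> carrier T" for F and g :: "'i \<Rightarrow> 'u"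
    using that
  proof (induct F)
    case empty
    have "slice \<zero>\<^bsub>T\<^esub> \<oplus>\<^bsub>R\<^esub> slice \<zero>\<^bsub>T\<^esub> = slice \<zero>\<^bsub>T\<^esub>"
      using sl(2)[OF T.zero_closed T.zero_closed] by simp
    then have "slice \<zero>\<^bsub>T\<^esub> = \<zero>\<^bsub>R\<^esub>" using sl(1)[OF T.zero_closed] by simp
    then show ?case by simp
  next
    case (insert i F)
    then have g: "g i \<in> carrier T" "g \<in> F \<rightarrow> carrier T" by auto
    then show ?case
      using insert sl(1) by (simp add: sl(2) T.finsum_closed Pi_iff)
  qed
  have "(\<Oplus>\<^bsub>R\<^esub>i\<in>UNIV. ?q i \<otimes>\<^bsub>R\<^esub> struct_map R (fu (x i))) = struct_map R (fu (x l))"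
    using arg_cong[OF eq, of "slice"] xc embc qc
    by (simp add: slice_sum sl(3,4) Pi_iff)
  moreover have "f R p (base_point R (\<lambda>l. fu (x l))) l
      = (\<Oplus>\<^bsub>R\<^esub>i\<in>UNIV. struct_map R (fu (x i)) \<otimes>\<^bsub>R\<^esub> ?q i)"
    using R.linear_expand[OF q(2) base_point_closed[OF R]]
    by (simp add: mat_map_def base_point_def)
  moreover have "\<dots> = (\<Oplus>\<^bsub>R\<^esub>i\<in>UNIV. ?q i \<otimes>\<^bsub>R\<^esub> struct_map R (fu (x i)))"
    using qc by (intro R.finsum_cong') (auto simp: R.m_comm struct_map_simps(1)[OF R])
  ultimately show "f R p (base_point R (\<lambda>l. fu (x l))) l = base_point R (\<lambda>l. fu (x l)) l"
    by (simp add: base_point_def)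
qed

lemma base_point_restrict: "base_point (ac.J R) y = base_point R (to_ac \<circ> y)"
  by (auto simp: base_point_def struct_map_def ac.restrict_simps)

lemma functional_point_cstab:
  fixes R :: "('k alg_closure, 'u) module"
  assumes fu: "functional fu" and R: "comm_alg R"
  shows "ac.cstab x R \<subseteq> ac.cstab (to_ac \<circ> (\<lambda>l. fu (x l))) R"
proof
  fix q assume q: "q \<in> ac.cstab x R"
  then have "q \<in> f (ac.J R) ` carrier (pts H (ac.J R))"
    using bij_betw_imp_surj_on[OF ac_bij[OF R]] by simp
  then obtain p where "p \<in> carrier (pts H (ac.J R))" "q = f (ac.J R) p" by blast
  then show "q \<in> ac.cstab (to_ac \<circ> (\<lambda>l. fu (x l))) R"
    using functional_point_fixed[OF ac.restrict_comm_alg[OF R] _ fu, of p] q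
    by (simp add: ac.cstab_def base_point_restrict)
qed

text \<open>Both \<open>H\<close> and the stabilizer of \<open>y\<close> turn the equalizer diagram of \<open>R\<close> into an equalizer of their points:
\<open>H\<close> because it is representable, the stabilizer because its points are matrices. Over the two
extensions in the diagram \<open>f\<close> is bijective, hence it is so over \<open>R\<close>.\<close>

lemma descent_onto_stab:
  assumes xy: "\<And>R :: ('k alg_closure, 'u) module. comm_alg R \<Longrightarrow> ac.cstab (to_ac \<circ> y) R = ac.cstab x R"
    and fixed: "\<And>R p. comm_alg R \<Longrightarrow> p \<in> carrier (pts H R) \<Longrightarrow> f R p (base_point R y) = base_point R y"
  shows "k.onto_stab (H, f) y"
proof -
  obtain B :: "('k, 'u) module" and \<eta> where B: "comm_alg B"
    and \<eta>: "\<And>R. comm_alg R \<Longrightarrow> bij_betw (\<eta> R) (homs B R) (carrier (pts H R))"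
    and \<eta>_nat: "\<And>R S h p. comm_alg R \<Longrightarrow> comm_alg S \<Longrightarrow> h \<in> homs R S \<Longrightarrow> p \<in> homs B R \<Longrightarrow>
      \<eta> S (compose (carrier B) h p) = pmap H R S h (\<eta> R p)"
    using H unfolding algebraic_group_def representable_fin_type_def by blast
  have \<eta>_inj: "a = b" if "\<eta> R a = \<eta> R b" "comm_alg R" "a \<in> homs B R" "b \<in> homs B R" for R a b
    using \<eta>[OF that(2)] that by (auto simp: bij_betw_def inj_on_def)
  have \<eta>_ex: "\<exists>a\<in>homs B R. p = \<eta> R a" if "comm_alg R" "p \<in> carrier (pts H R)" for R p
    using bij_betw_imp_surj_on[OF \<eta>[OF that(1)]] that(2) by blast
  have f_inj: "p = q" if "comm_alg T" "p \<in> carrier (pts H (ac.J T))" "q \<in> carrier (pts H (ac.J T))"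
    "f (ac.J T) p = f (ac.J T) q" for T p q
    using bij_betw_imp_inj_on[OF ac_bij[OF that(1)]] that by (auto dest: inj_onD)
  have "bij_betw (f R) (carrier (pts H R)) (k.cstab y R)" if R: "comm_alg R" for R
  proof -
    obtain T S :: "('k alg_closure, 'u) module" and emb i1 i2 where T: "comm_alg T" and S: "comm_alg S"
      and emb: "emb \<in> homs R (ac.J T)" "inj_on emb (carrier R)"
      and i1: "i1 \<in> homs (ac.J T) (ac.J S)" and i2: "i2 \<in> homs (ac.J T) (ac.J S)"
      and equalizer: "\<And>t. t \<in> carrier T \<Longrightarrow> i1 t = i2 t \<longleftrightarrow> t \<in> emb ` carrier R"
      by (rule closure_equalizer_exists[OF R \<iota>], rule that) (assumption | simp)+
    note T' = ac.restrict_comm_alg[OF T] and S' = ac.restrict_comm_alg[OF S]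
    interpret R: cring R using R by (rule comm_algD)
    interpret B: cring B using B by (rule comm_algD)
    have inj: "inj_on (f R) (carrier (pts H R))"
    proof (rule inj_onI)
      fix p q assume p: "p \<in> carrier (pts H R)" and q: "q \<in> carrier (pts H R)" and eq: "f R p = f R q"
      obtain a b where a: "a \<in> homs B R" "p = \<eta> R a" and b: "b \<in> homs B R" "q = \<eta> R b"
        using \<eta>_ex[OF R p] \<eta>_ex[OF R q] by blast
      have "pmap H R (ac.J T) emb p = pmap H R (ac.J T) emb q"
        by (rule f_inj[OF T]) (simp_all add: pmap_closed[OF R T' emb(1)] p q f_natural[OF R T' emb(1)] eq)
      then have "\<eta> (ac.J T) (compose (carrier B) emb a) = \<eta> (ac.J T) (compose (carrier B) emb b)"
        by (simp add: \<eta>_nat[OF R T' emb(1)] a b)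
      then have "compose (carrier B) emb a = compose (carrier B) emb b"
        by (rule \<eta>_inj[OF _ T' homs_compose[OF B a(1) emb(1)] homs_compose[OF B b(1) emb(1)]])
      then have emb_ab: "emb (a z) = emb (b z)" if "z \<in> carrier B" for z
        using that by (metis compose_eq)
      have "a = b"
        by (rule homs_ext_eqI[OF a(1) b(1)], rule inj_onD[OF emb(2) emb_ab])
          (auto intro: homs_closed[OF a(1)] homs_closed[OF b(1)])
      then show "p = q" by (simp add: a b)
    qed
    \<comment> \<open>A point \<open>s\<close> of the stabilizer lifts to a point of \<open>H\<close> over \<open>T\<close>, whose two images over \<open>S\<close> coincide as \<open>f\<close> is injective there; so the lift comes from \<open>R\<close>.\<close>
    have "k.cstab y R \<subseteq> f R ` carrier (pts H R)"
    proof
      fix s assume "s \<in> k.cstab y R"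
      then have s: "s \<in> auts A e R" "s (base_point R y) = base_point R y"
        by (simp_all add: k.cstab_def)
      have "aut_map A e R (ac.J T) emb s \<in> ac.cstab (to_ac \<circ> y) T"
        using aut_map_aut[OF R T' emb(1) s(1)]
          aut_map_apply[OF R T' emb(1) autD(2)[OF s(1)] base_point_closed[OF R, of y], of A e]
        by (simp add: ac.cstab_def s(2) map_base_point[OF R emb(1)] base_point_restrict)
      then have "aut_map A e R (ac.J T) emb s \<in> f (ac.J T) ` carrier (pts H (ac.J T))"
        using bij_betw_imp_surj_on[OF ac_bij[OF T]] xy[OF T] by simp
      then obtain p' where p': "p' \<in> carrier (pts H (ac.J T))" "f (ac.J T) p' = aut_map A e R (ac.J T) emb s"
        by auto
      obtain a' where a': "a' \<in> homs B (ac.J T)" "p' = \<eta> (ac.J T) a'"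
        using \<eta>_ex[OF T' p'(1)] by blast
      have comp_eq: "compose (carrier R) i1 emb = compose (carrier R) i2 emb"
        using equalizer homs_closed[OF emb(1)] by (auto simp: compose_def ac.restrict_simps)
      have "pmap H (ac.J T) (ac.J S) i1 p' = pmap H (ac.J T) (ac.J S) i2 p'"
        by (rule f_inj[OF S])
          (simp_all add: pmap_closed[OF T' S' i1] pmap_closed[OF T' S' i2] p' f_natural[OF T' S' i1]
            f_natural[OF T' S' i2] aut_map_compose[OF R T' S' emb(1) i1 s(1), symmetric]
            aut_map_compose[OF R T' S' emb(1) i2 s(1), symmetric] comp_eq)
      then have "\<eta> (ac.J S) (compose (carrier B) i1 a') = \<eta> (ac.J S) (compose (carrier B) i2 a')"
        by (simp add: \<eta>_nat[OF T' S' i1] \<eta>_nat[OF T' S' i2] a')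
      then have "compose (carrier B) i1 a' = compose (carrier B) i2 a'"
        by (rule \<eta>_inj[OF _ S' homs_compose[OF B a'(1) i1] homs_compose[OF B a'(1) i2]])
      then have i12: "i1 (a' z) = i2 (a' z)" if "z \<in> carrier B" for z
        using that by (metis compose_eq)
      have a'_emb: "a' z \<in> emb ` carrier R" if "z \<in> carrier B" for z
        using i12[OF that] equalizer[of "a' z"] homs_closed[OF a'(1) that]
        by (simp add: ac.restrict_simps)
      define a where "a = (\<lambda>z\<in>carrier B. inv_into (carrier R) emb (a' z))"
      have a: "a z \<in> carrier R" "emb (a z) = a' z" if "z \<in> carrier B" for z
        using a'_emb[OF that] that by (simp_all add: a_def inv_into_into f_inv_into_f)
      have emb_eq: "u = v" if "emb u = emb v" "u \<in> carrier R" "v \<in> carrier R" for u v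
        using emb(2) that by (auto dest: inj_onD)
      have "a \<in> homs B R"
        unfolding alg_homs_def
      proof (intro CollectI conjI ballI)
        show "a \<in> carrier B \<rightarrow>\<^sub>E carrier R" using a(1) by (auto simp: a_def)
        show "a \<one>\<^bsub>B\<^esub> = \<one>\<^bsub>R\<^esub>"
          by (rule emb_eq) (simp_all add: a homs_one[OF a'(1)] homs_one[OF emb(1)])
        fix z w assume zw: "z \<in> carrier B" "w \<in> carrier B"
        show "a (z \<oplus>\<^bsub>B\<^esub> w) = a z \<oplus>\<^bsub>R\<^esub> a w"
          by (rule emb_eq) (simp_all add: a zw homs_add[OF a'(1)] homs_add[OF emb(1)])
        show "a (z \<otimes>\<^bsub>B\<^esub> w) = a z \<otimes>\<^bsub>R\<^esub> a w"
          by (rule emb_eq) (simp_all add: a zw homs_mult[OF a'(1)] homs_mult[OF emb(1)])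
      next
        fix c z assume z: "z \<in> carrier B"
        show "a (c \<odot>\<^bsub>B\<^esub> z) = c \<odot>\<^bsub>R\<^esub> a z"
          by (rule emb_eq) (simp_all add: a z homs_smult[OF a'(1)] homs_smult[OF emb(1)]
              comm_alg_smult_closed[OF B] comm_alg_smult_closed[OF R])
      qed
      note ah = this
      have p: "\<eta> R a \<in> carrier (pts H R)" using bij_betw_apply[OF \<eta>[OF R] ah] .
      have "compose (carrier B) emb a = a'"
        by (rule homs_ext_eqI[OF homs_compose[OF B ah emb(1)] a'(1)]) (simp add: compose_eq a)
      then have "pmap H R (ac.J T) emb (\<eta> R a) = p'"
        using \<eta>_nat[OF R T' emb(1) ah] by (simp only: a'(2))
      then have "aut_map A e R (ac.J T) emb (f R (\<eta> R a)) = aut_map A e R (ac.J T) emb s"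
        using f_natural[OF R T' emb(1) p] p'(2) by (simp only:)
      then have "f R (\<eta> R a) = s"
        by (rule aut_map_inj[OF R T' emb(1) emb(2) f_aut[OF R p] s(1)])
      then show "s \<in> f R ` carrier (pts H R)" using p by blast
    qed
    moreover have "f R ` carrier (pts H R) \<subseteq> k.cstab y R"
      using f_aut[OF R] fixed[OF R] by (auto simp: k.cstab_def)
    ultimately show ?thesis using inj by (auto simp: bij_betw_def)
  qed
  then show ?thesis
    using f pts_group by (simp add: k.onto_stab_def)
qed

end

end

section \<open>Coordinates in an algebra with a basis\<close>

lemma field_alg_simps:
  "x \<oplus>\<^bsub>field_alg j\<^esub> y = x + y" "x \<otimes>\<^bsub>field_alg j\<^esub> y = x * y" "carrier (field_alg j) = UNIV"
  "\<one>\<^bsub>field_alg j\<^esub> = 1" "\<zero>\<^bsub>field_alg j\<^esub> = 0" "struct_map (field_alg j) a = j a"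
  by (simp_all add: field_alg_def struct_map_def)

lemma (in field_hom) finsum_field_alg: "finite F \<Longrightarrow> (\<Oplus>\<^bsub>field_alg j\<^esub>i\<in>F. g i) = (\<Sum>i\<in>F. g i)"
proof -
  interpret cring "field_alg j" using field_alg_comm_alg by (rule comm_algD)
  show "finite F \<Longrightarrow> ?thesis"
    by (induct F rule: finite_induct) (simp_all add: field_alg_simps)
qed

lemma linear_on_field: "linear_on (field_alg j) P \<longleftrightarrow>
    (\<forall>v w. P (\<lambda>l. v l + w l) = (\<lambda>l. P v l + P w l)) \<and> (\<forall>r v. P (\<lambda>l. r * v l) = (\<lambda>l. r * P v l))"
  by (simp add: linear_on_def vecs_def field_alg_simps)

locale based_algebra =
  fixes A :: "('k::field, 'a) module" and e :: "'i::finite \<Rightarrow> 'a"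
  assumes unital: "unital_algebra ring_of_type_algebra A" and basis: "is_basis A e"
begin

sublocale A: module ring_of_type_algebra A
  using unital by (simp add: unital_algebra_def)

lemma alg_rules:
  "x \<in> carrier A \<Longrightarrow> y \<in> carrier A \<Longrightarrow> x \<otimes>\<^bsub>A\<^esub> y \<in> carrier A"
  "x \<in> carrier A \<Longrightarrow> y \<in> carrier A \<Longrightarrow> z \<in> carrier A \<Longrightarrow> (x \<oplus>\<^bsub>A\<^esub> y) \<otimes>\<^bsub>A\<^esub> z = x \<otimes>\<^bsub>A\<^esub> z \<oplus>\<^bsub>A\<^esub> y \<otimes>\<^bsub>A\<^esub> z"
  "x \<in> carrier A \<Longrightarrow> y \<in> carrier A \<Longrightarrow> z \<in> carrier A \<Longrightarrow> z \<otimes>\<^bsub>A\<^esub> (x \<oplus>\<^bsub>A\<^esub> y) = z \<otimes>\<^bsub>A\<^esub> x \<oplus>\<^bsub>A\<^esub> z \<otimes>\<^bsub>A\<^esub> y"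
  "x \<in> carrier A \<Longrightarrow> y \<in> carrier A \<Longrightarrow> (r \<odot>\<^bsub>A\<^esub> x) \<otimes>\<^bsub>A\<^esub> y = r \<odot>\<^bsub>A\<^esub> (x \<otimes>\<^bsub>A\<^esub> y)"
  "x \<in> carrier A \<Longrightarrow> y \<in> carrier A \<Longrightarrow> x \<otimes>\<^bsub>A\<^esub> (r \<odot>\<^bsub>A\<^esub> y) = r \<odot>\<^bsub>A\<^esub> (x \<otimes>\<^bsub>A\<^esub> y)"
  "\<one>\<^bsub>A\<^esub> \<in> carrier A"
  using unital by (auto simp: unital_algebra_def)

lemma smult_rules:
  "x \<in> carrier A \<Longrightarrow> r \<odot>\<^bsub>A\<^esub> x \<in> carrier A"
  "x \<in> carrier A \<Longrightarrow> (r + s) \<odot>\<^bsub>A\<^esub> x = r \<odot>\<^bsub>A\<^esub> x \<oplus>\<^bsub>A\<^esub> s \<odot>\<^bsub>A\<^esub> x"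
  "x \<in> carrier A \<Longrightarrow> y \<in> carrier A \<Longrightarrow> r \<odot>\<^bsub>A\<^esub> (x \<oplus>\<^bsub>A\<^esub> y) = r \<odot>\<^bsub>A\<^esub> x \<oplus>\<^bsub>A\<^esub> r \<odot>\<^bsub>A\<^esub> y"
  "x \<in> carrier A \<Longrightarrow> (r * s) \<odot>\<^bsub>A\<^esub> x = r \<odot>\<^bsub>A\<^esub> (s \<odot>\<^bsub>A\<^esub> x)"
  "x \<in> carrier A \<Longrightarrow> 1 \<odot>\<^bsub>A\<^esub> x = x"
  using A.smult_closed[of r x] A.smult_l_distr[of r s x] A.smult_r_distr[of r x y]
    A.smult_assoc1[of r s x] A.smult_one[of x] by simp_all

lemma zero_smult: "x \<in> carrier A \<Longrightarrow> 0 \<odot>\<^bsub>A\<^esub> x = \<zero>\<^bsub>A\<^esub>"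
  using A.smult_l_null[of x] by simp

definition comb :: "('i \<Rightarrow> 'k) \<Rightarrow> 'a" where
  "comb c = (\<Oplus>\<^bsub>A\<^esub>i\<in>UNIV. c i \<odot>\<^bsub>A\<^esub> e i)"

lemma e_closed: "e i \<in> carrier A"
  using basis by (auto simp: is_basis_def)

lemma comb_closed: "comb c \<in> carrier A"
  unfolding comb_def by (rule A.finsum_closed) (auto simp: smult_rules e_closed)

lemma coord_comb: "coord A e (comb c) = c"
proof -
  have "\<exists>!d. comb c = (\<Oplus>\<^bsub>A\<^esub>i\<in>UNIV. d i \<odot>\<^bsub>A\<^esub> e i)"
    using basis comb_closed by (simp add: is_basis_def)
  then show ?thesis unfolding coord_def by (rule the1_equality) (simp add: comb_def)
qed

lemma comb_coord: "v \<in> carrier A \<Longrightarrow> comb (coord A e v) = v"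
proof -
  assume "v \<in> carrier A"
  then have "\<exists>!d. v = (\<Oplus>\<^bsub>A\<^esub>i\<in>UNIV. d i \<odot>\<^bsub>A\<^esub> e i)"
    using basis by (simp add: is_basis_def)
  from theI'[OF this] show ?thesis by (simp add: coord_def comb_def)
qed

lemma comb_add: "comb (\<lambda>i. c i + d i) = comb c \<oplus>\<^bsub>A\<^esub> comb d"
  unfolding comb_def
  by (subst A.finsum_addf[symmetric]) (auto simp: smult_rules e_closed intro!: A.finsum_cong')

lemma comb_scale: "comb (\<lambda>i. r * c i) = r \<odot>\<^bsub>A\<^esub> comb c"
proof -
  have "(\<Oplus>\<^bsub>A\<^esub>i\<in>F. (r * c i) \<odot>\<^bsub>A\<^esub> e i) = r \<odot>\<^bsub>A\<^esub> (\<Oplus>\<^bsub>A\<^esub>i\<in>F. c i \<odot>\<^bsub>A\<^esub> e i)" if "finite F" for F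
    using that
  proof (induct F)
    case empty then show ?case using A.smult_r_null[of r] by simp
  next
    case (insert x F)
    then show ?case
      by (simp add: Pi_iff smult_rules e_closed A.finsum_closed)
  qed
  then show ?thesis by (simp add: comb_def)
qed

lemma comb_unit: "comb (unit_vec (field_alg id) i) = e i"
proof -
  have "comb (unit_vec (field_alg id) i) = (\<Oplus>\<^bsub>A\<^esub>m\<in>UNIV. if i = m then e m else \<zero>\<^bsub>A\<^esub>)"
    unfolding comb_def
    by (intro A.finsum_cong') (auto simp: unit_vec_def field_alg_simps smult_rules zero_smult e_closed)
  also have "\<dots> = e i"
    by (subst A.add.finprod_singleton) (auto simp: e_closed)
  finally show ?thesis .
qed

lemma coord_add: "x \<in> carrier A \<Longrightarrow> y \<in> carrier A \<Longrightarrow> coord A e (x \<oplus>\<^bsub>A\<^esub> y) = (\<lambda>l. coord A e x l + coord A e y l)"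
  using coord_comb[of "\<lambda>l. coord A e x l + coord A e y l"] by (simp add: comb_add comb_coord)

lemma coord_scale: "x \<in> carrier A \<Longrightarrow> coord A e (r \<odot>\<^bsub>A\<^esub> x) = (\<lambda>l. r * coord A e x l)"
  using coord_comb[of "\<lambda>l. r * coord A e x l"] by (simp add: comb_scale comb_coord)

lemma coord_inj: "coord A e x = coord A e y \<Longrightarrow> x \<in> carrier A \<Longrightarrow> y \<in> carrier A \<Longrightarrow> x = y"
  by (drule arg_cong[of _ _ comb]) (simp only: comb_coord)

text \<open>Both sides are bilinear and agree on the basis by the definition of the structure constants.\<close>

lemma coord_mult:
  assumes "x \<in> carrier A" "y \<in> carrier A"
  shows "coord A e (x \<otimes>\<^bsub>A\<^esub> y) = xmult A e (field_alg id) (coord A e x) (coord A e y)"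
proof -
  let ?K = "field_alg id :: ('k, 'k) module"
  note K = idh.field_alg_comm_alg
  interpret K: cring ?K using K by (rule comm_algD)
  have v: "v \<in> vecs ?K" for v :: "'i \<Rightarrow> 'k" by (simp add: vecs_def field_alg_simps)
  have l: "linear_on ?K (\<lambda>v. coord A e (comb v \<otimes>\<^bsub>A\<^esub> comb w))"
    "linear_on ?K (\<lambda>v. coord A e (comb w \<otimes>\<^bsub>A\<^esub> comb v))" for w
    by (simp_all add: linear_on_field comb_add comb_scale alg_rules comb_closed coord_add coord_scale smult_rules)
  have u: "xmult A e ?K (unit_vec ?K i) (unit_vec ?K m) = coord A e (e i \<otimes>\<^bsub>A\<^esub> e m)" for i m
  proof -
    have p: "mat_map ?K (\<lambda>m l. struct_map ?K (coord A e (e i \<otimes>\<^bsub>A\<^esub> e m) l)) w \<in> vecs ?K" for i w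
      by (rule v)
    show ?thesis
      unfolding xmult_eq[OF K v v] K.mat_map_unit[OF p] K.mat_map_unit[OF v]
      by (simp add: field_alg_simps)
  qed
  have 1: "coord A e (comb (unit_vec ?K i) \<otimes>\<^bsub>A\<^esub> comb w) = xmult A e ?K (unit_vec ?K i) w" for i w
    by (rule K.linear_eqI[OF l(2) xmult_linear_right[OF K v] _ v]) (simp add: comb_unit u)
  have "coord A e (comb c \<otimes>\<^bsub>A\<^esub> comb w) = xmult A e ?K c w" for c w
    by (rule K.linear_eqI[OF l(1) xmult_linear_left[OF K v] 1 v])
  from this[of "coord A e x" "coord A e y"] show ?thesis using assms by (simp add: comb_coord)
qed

lemma coord_one: "coord A e \<one>\<^bsub>A\<^esub> = xone A e (field_alg id)"
  by (auto simp: xone_def extend_scalars_simps field_alg_simps)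

end

section \<open>Octonion coordinates over an extension field\<close>

context field_hom
begin

lemma j_minus: "j (- a) = - j a"
  using j_add[of a "- a"] j_zero by (simp add: minus_unique)

lemma j_diff: "j (a - b) = j a - j b"
  using j_add[of a "- b"] by (simp add: j_minus)

definition jo :: "'k oct \<Rightarrow> 'c oct" where
  "jo = (\<lambda>((x0, x1, x2, x3), (x4, x5, x6, x7)). ((j x0, j x1, j x2, j x3), (j x4, j x5, j x6, j x7)))"

lemma jo_simps:
  "jo (u + v) = jo u + jo v" "jo (oscale r u) = oscale (j r) (jo u)" "jo oone = oone"
  "jo (oconj u) = oconj (jo u)"
  by (cases u rule: oct_cases; cases v rule: oct_cases;
      simp add: jo_def oct_Pair_simps j_add j_mult j_minus j_zero j_one)+

lemma jo_mult: "jo (omult a b c u v) = omult (j a) (j b) (j c) (jo u) (jo v)"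
  by (cases u rule: oct_cases; cases v rule: oct_cases)
    (simp add: jo_def omult_Pair j_add j_mult j_diff)

lemma jo_obil: "j (obil a b c u v) = obil (j a) (j b) (j c) (jo u) (jo v)"
  by (cases u rule: oct_cases; cases v rule: oct_cases)
    (simp add: jo_def obil_def j_add j_mult j_diff)

end

definition oct_basis :: "'f::field oct list" where
  "oct_basis = [((1,0,0,0),(0,0,0,0)), ((0,1,0,0),(0,0,0,0)), ((0,0,1,0),(0,0,0,0)), ((0,0,0,1),(0,0,0,0)),
     ((0,0,0,0),(1,0,0,0)), ((0,0,0,0),(0,1,0,0)), ((0,0,0,0),(0,0,1,0)), ((0,0,0,0),(0,0,0,1))]"

definition oct_linear :: "('f::field oct \<Rightarrow> 'i \<Rightarrow> 'f) \<Rightarrow> bool" where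
  "oct_linear P \<longleftrightarrow> (\<forall>u v. P (u + v) = (\<lambda>l. P u l + P v l)) \<and> (\<forall>r u. P (oscale r u) = (\<lambda>l. r * P u l))"

lemma oct_decompose:
  "((x0, x1, x2, x3), (x4, x5, x6, x7)) = oscale x0 (oct_basis ! 0) + (oscale x1 (oct_basis ! 1)
    + (oscale x2 (oct_basis ! 2) + (oscale x3 (oct_basis ! 3) + (oscale x4 (oct_basis ! 4)
    + (oscale x5 (oct_basis ! 5) + (oscale x6 (oct_basis ! 6) + oscale x7 (oct_basis ! 7)))))))"
  by (simp add: oct_basis_def oscale_def numeral_eq_Suc)

lemma oct_linear_eqI:
  assumes P: "oct_linear P" and Q: "oct_linear Q" and eq: "\<And>f. f \<in> set oct_basis \<Longrightarrow> P f = Q f"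
  shows "P u = Q u"
proof (cases u rule: oct_cases)
  case (1 x0 x1 x2 x3 x4 x5 x6 x7)
  have n: "n < 8 \<Longrightarrow> P (oct_basis ! n) = Q (oct_basis ! n)" for n
    by (intro eq nth_mem) (simp add: oct_basis_def)
  show ?thesis
    using P Q unfolding 1 oct_decompose oct_linear_def by (simp add: n)
qed

text \<open>Elements of \<open>\<O>\<close> after extension of scalars are given by their coordinates with respect to the arbitrary
basis \<open>e\<close>, while the results on octonions concern pairs of quaternions over the extension field. The maps
\<open>\<Psi>\<close> and \<open>\<Theta>\<close> translate between the two; over the base field, \<open>\<kappa>\<close> does so.\<close>

locale oct_bridge = field_hom j for j :: "'k::field_char_0 \<Rightarrow> 'c::field_char_0" +
  fixes \<O> :: "('k, 'o) module" and \<sigma> :: "'o \<Rightarrow> 'o" and e :: "8 \<Rightarrow> 'o"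
    and a b c :: 'k and \<psi> :: "'k oct \<Rightarrow> 'o"
  assumes unital: "unital_algebra ring_of_type_algebra \<O>" and basis: "is_basis \<O> e"
    and nz: "a \<noteq> 0" "b \<noteq> 0" "c \<noteq> 0"
    and \<psi>: "\<psi> \<in> alg_isos ring_of_type_algebra (CD a b c) \<O>"
    and \<sigma>: "\<And>u. \<sigma> (\<psi> u) = \<psi> (oconj u)"
begin

sublocale B: based_algebra \<O> e
  using unital basis by unfold_locales

sublocale form_setup j \<O> e
  by unfold_locales

sublocale P: oct_params a b c
  using nz by unfold_locales

sublocale Q: oct_params "j a" "j b" "j c"
  using nz by unfold_locales (simp_all add: j_eq_0_iff)

lemma \<psi>_rules: "\<psi> u \<in> carrier \<O>" "\<psi> (u + v) = \<psi> u \<oplus>\<^bsub>\<O>\<^esub> \<psi> v" "\<psi> (oscale r u) = r \<odot>\<^bsub>\<O>\<^esub> \<psi> u"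
  "\<psi> (omult a b c u v) = \<psi> u \<otimes>\<^bsub>\<O>\<^esub> \<psi> v" "\<psi> oone = \<one>\<^bsub>\<O>\<^esub>"
  using \<psi> by (auto simp: alg_isos_def alg_homs_def CD_simps PiE_iff)

lemma \<psi>_bij: "bij_betw \<psi> UNIV (carrier \<O>)"
  using \<psi> by (simp add: alg_isos_def CD_simps)

lemma \<psi>_inj: "\<psi> u = \<psi> v \<longleftrightarrow> u = v"
  using \<psi>_bij by (auto simp: bij_betw_def inj_eq)

definition \<kappa> :: "'k oct \<Rightarrow> 8 \<Rightarrow> 'k" where "\<kappa> u = coord \<O> e (\<psi> u)"

lemma \<kappa>_rules: "\<kappa> (u + v) = (\<lambda>l. \<kappa> u l + \<kappa> v l)" "\<kappa> (oscale r u) = (\<lambda>l. r * \<kappa> u l)"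
  "\<kappa> (omult a b c u v) = xmult \<O> e (field_alg id) (\<kappa> u) (\<kappa> v)" "\<kappa> oone = xone \<O> e (field_alg id)"
  by (simp_all add: \<kappa>_def \<psi>_rules B.coord_add B.coord_scale B.coord_mult B.coord_one)

lemma \<kappa>_bij: "bij \<kappa>"
proof -
  have "inj \<kappa>"
    by (rule injI) (metis B.coord_inj \<kappa>_def \<psi>_inj \<psi>_rules(1))
  moreover have "\<exists>u. v = \<kappa> u" for v
    using \<psi>_bij B.comb_closed[of v] B.coord_comb[of v] by (metis \<kappa>_def bij_betw_imp_surj_on imageE)
  ultimately show ?thesis by (auto simp: bij_def surj_def)
qed

text \<open>The linear extension of \<open>\<kappa>\<close> along \<open>j\<close>: it maps \<open>jo u\<close> to \<open>j \<circ> \<kappa> u\<close>.\<close>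

definition \<Psi> :: "'c oct \<Rightarrow> 8 \<Rightarrow> 'c" where
  "\<Psi> = (\<lambda>((x0, x1, x2, x3), (x4, x5, x6, x7)) l.
     x0 * j (\<kappa> (oct_basis ! 0) l) + x1 * j (\<kappa> (oct_basis ! 1) l) + x2 * j (\<kappa> (oct_basis ! 2) l)
     + x3 * j (\<kappa> (oct_basis ! 3) l) + x4 * j (\<kappa> (oct_basis ! 4) l) + x5 * j (\<kappa> (oct_basis ! 5) l)
     + x6 * j (\<kappa> (oct_basis ! 6) l) + x7 * j (\<kappa> (oct_basis ! 7) l))"

lemma \<Psi>_add: "\<Psi> (u + v) = (\<lambda>l. \<Psi> u l + \<Psi> v l)"
  by (cases u rule: oct_cases; cases v rule: oct_cases) (simp add: \<Psi>_def fun_eq_iff algebra_simps)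

lemma \<Psi>_scale: "\<Psi> (oscale r u) = (\<lambda>l. r * \<Psi> u l)"
  by (cases u rule: oct_cases) (simp add: \<Psi>_def oscale_def fun_eq_iff algebra_simps)

lemma \<Psi>_jo: "\<Psi> (jo u) = j \<circ> \<kappa> u"
proof (cases u rule: oct_cases)
  case (1 x0 x1 x2 x3 x4 x5 x6 x7)
  have "\<Psi> (jo u) l = j (\<kappa> u l)" for l
    unfolding 1 by (subst oct_decompose) (simp add: \<kappa>_rules jo_def \<Psi>_def j_add j_mult)
  then show ?thesis by auto
qed

lemma basis_jo: "f \<in> set oct_basis \<Longrightarrow> \<exists>g \<in> set oct_basis. f = jo g"
  by (auto simp: oct_basis_def jo_def j_zero j_one)

lemma j_hom: "j \<in> homs (field_alg id) (field_alg j)"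
  by (auto simp: alg_homs_def field_alg_def j_add j_mult j_one)

lemma vecs_c: "v \<in> vecs (field_alg j)" for v :: "'i \<Rightarrow> 'c"
  by (simp add: vecs_def field_alg_simps)

lemma vecs_k: "v \<in> vecs (field_alg id)" for v :: "'i \<Rightarrow> 'k"
  by (simp add: vecs_def field_alg_simps)

lemma oct_linear_\<Psi>: "(\<And>u v. P (u + v) = P u + P v) \<Longrightarrow> (\<And>r u. P (oscale r u) = oscale r (P u)) \<Longrightarrow>
    oct_linear (\<lambda>u. \<Psi> (P u))"
  by (simp add: oct_linear_def \<Psi>_add \<Psi>_scale)

lemma oct_linear_comp: "linear_on (field_alg j) P \<Longrightarrow> oct_linear (\<lambda>u. P (\<Psi> u))"
  by (simp add: oct_linear_def linear_on_field \<Psi>_add \<Psi>_scale)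

lemma \<Psi>_mult: "\<Psi> (omult (j a) (j b) (j c) u v) = xmult \<O> e (field_alg j) (\<Psi> u) (\<Psi> v)"
proof -
  note K = field_alg_comm_alg
  have 1: "\<Psi> (omult (j a) (j b) (j c) (jo f) (jo g)) = xmult \<O> e (field_alg j) (\<Psi> (jo f)) (\<Psi> (jo g))" for f g
    by (simp only: jo_mult[symmetric] \<Psi>_jo \<kappa>_rules map_xmult[OF idh.field_alg_comm_alg K j_hom vecs_k vecs_k])
  have 2: "\<Psi> (omult (j a) (j b) (j c) (jo f) v) = xmult \<O> e (field_alg j) (\<Psi> (jo f)) (\<Psi> v)" for f v
    by (rule oct_linear_eqI[OF oct_linear_\<Psi> oct_linear_comp[OF xmult_linear_right[OF K vecs_c]]])
      (auto simp: omult_add_right omult_scale_right dest!: basis_jo intro: 1)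
  show ?thesis
    by (rule oct_linear_eqI[OF oct_linear_\<Psi> oct_linear_comp[OF xmult_linear_left[OF K vecs_c]]])
      (auto simp: omult_add_left omult_scale_left dest!: basis_jo intro: 2)
qed

lemma \<Psi>_one: "\<Psi> oone = xone \<O> e (field_alg j)"
  using \<Psi>_jo[of oone] map_xone[OF idh.field_alg_comm_alg j_hom, of \<O> e] by (simp add: jo_simps \<kappa>_rules)

definition \<Theta> :: "(8 \<Rightarrow> 'c) \<Rightarrow> 'c oct" where
  "\<Theta> v = (\<Sum>i\<in>UNIV. oscale (v i) (jo (inv_into UNIV \<kappa> (unit_vec (field_alg id) i))))"

lemma \<kappa>_sum: "\<kappa> (\<Sum>i\<in>F. oscale (w i) (g i)) = (\<lambda>l. \<Sum>i\<in>F. w i * \<kappa> (g i) l)"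
proof (induct F rule: infinite_finite_induct)
  have "\<kappa> 0 = (\<lambda>l. 0)" using \<kappa>_rules(2)[of 0 0] by (simp add: oscale_simps)
  then show "\<kappa> (\<Sum>i\<in>{}. oscale (w i) (g i)) = (\<lambda>l. \<Sum>i\<in>{}. w i * \<kappa> (g i) l)"
    "infinite F \<Longrightarrow> \<kappa> (\<Sum>i\<in>F. oscale (w i) (g i)) = (\<lambda>l. \<Sum>i\<in>F. w i * \<kappa> (g i) l)" for F by simp_all
qed (simp add: \<kappa>_rules)

lemma \<Psi>_sum: "\<Psi> (\<Sum>i\<in>F. oscale (w i) (g i)) = (\<lambda>l. \<Sum>i\<in>F. w i * \<Psi> (g i) l)"
proof (induct F rule: infinite_finite_induct)
  have "\<Psi> 0 = (\<lambda>l. 0)" using \<Psi>_scale[of 0 0] by (simp add: oscale_simps)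
  then show "\<Psi> (\<Sum>i\<in>{}. oscale (w i) (g i)) = (\<lambda>l. \<Sum>i\<in>{}. w i * \<Psi> (g i) l)"
    "infinite F \<Longrightarrow> \<Psi> (\<Sum>i\<in>F. oscale (w i) (g i)) = (\<lambda>l. \<Sum>i\<in>F. w i * \<Psi> (g i) l)" for F by simp_all
qed (simp add: \<Psi>_add \<Psi>_scale)

lemma \<kappa>_inv: "\<kappa> (inv_into UNIV \<kappa> w) = w"
  using \<kappa>_bij by (simp add: bij_is_surj surj_f_inv_f)

lemma \<Psi>_\<Theta>: "\<Psi> (\<Theta> v) = v"
proof
  fix l
  have "\<Psi> (\<Theta> v) l = (\<Sum>i\<in>UNIV. v i * j (unit_vec (field_alg id) i l))"
    by (simp add: \<Theta>_def \<Psi>_sum \<Psi>_jo \<kappa>_inv)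
  also have "\<dots> = (\<Sum>i\<in>UNIV. if i = l then v i else 0)"
    by (intro sum.cong) (auto simp: unit_vec_def field_alg_simps j_one j_zero)
  finally show "\<Psi> (\<Theta> v) l = v l" by simp
qed

lemma \<Psi>_inj: "inj \<Psi>"
proof (rule injI)
  have jo_sum: "jo (\<Sum>i\<in>F. oscale (w i) (g i)) = (\<Sum>i\<in>F. oscale (j (w i)) (jo (g i)))" for F w g
  proof (induct F rule: infinite_finite_induct)
    have "jo 0 = 0" using jo_simps(2)[of 0 0] by (simp add: oscale_simps j_zero)
    then show "jo (\<Sum>i\<in>{}. oscale (w i) (g i)) = (\<Sum>i\<in>{}. oscale (j (w i)) (jo (g i)))"
      "infinite F \<Longrightarrow> jo (\<Sum>i\<in>F. oscale (w i) (g i)) = (\<Sum>i\<in>F. oscale (j (w i)) (jo (g i)))" for F by simp_all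
  qed (simp add: jo_simps)
  have "\<Theta> (j \<circ> \<kappa> u) = jo u" for u
  proof -
    have "\<kappa> (\<Sum>i\<in>UNIV. oscale (\<kappa> u i) (inv_into UNIV \<kappa> (unit_vec (field_alg id) i))) = \<kappa> u"
      (is "\<kappa> ?s = _")
    proof
      fix l
      have "\<kappa> ?s l = (\<Sum>i\<in>UNIV. if i = l then \<kappa> u i else 0)"
        unfolding \<kappa>_sum \<kappa>_inv by (intro sum.cong) (auto simp: unit_vec_def field_alg_simps)
      then show "\<kappa> ?s l = \<kappa> u l" by simp
    qed
    then have "?s = u" using \<kappa>_bij by (simp add: bij_is_inj inj_eq)
    then show ?thesis by (simp add: \<Theta>_def jo_sum[symmetric])
  qed
  then have basis: "\<Theta> (\<Psi> f) = f" if "f \<in> set oct_basis" for f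
    using basis_jo[OF that] by (auto simp: \<Psi>_jo)
  have add: "\<Theta> (\<lambda>l. v l + w l) = \<Theta> v + \<Theta> w" for v w
    by (simp add: \<Theta>_def oscale_simps sum.distrib)
  have scale: "\<Theta> (\<lambda>l. r * v l) = oscale r (\<Theta> v)" for r v
  proof -
    have "oscale r (sum h F) = (\<Sum>i\<in>F. oscale r (h i))" for h :: "8 \<Rightarrow> 'c oct" and F
      by (induct F rule: infinite_finite_induct) (simp_all add: oscale_simps)
    then show ?thesis by (simp add: \<Theta>_def oscale_simps)
  qed
  have "\<Theta> (\<Psi> u) = u" for u
  proof (cases u rule: oct_cases)
    case (1 x0 x1 x2 x3 x4 x5 x6 x7)
    have n: "n < 8 \<Longrightarrow> \<Theta> (\<Psi> (oct_basis ! n)) = oct_basis ! n" for n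
      by (intro basis nth_mem) (simp add: oct_basis_def)
    show ?thesis unfolding 1 oct_decompose by (simp add: \<Psi>_add \<Psi>_scale add scale n)
  qed
  then show "u = v" if "\<Psi> u = \<Psi> v" for u v using that by metis
qed

lemma \<Psi>_bij: "bij \<Psi>"
  using \<Psi>_inj \<Psi>_\<Theta> by (auto simp: bij_def surj_def) metis

lemma \<Psi>_eq_iff: "\<Psi> u = \<Psi> v \<longleftrightarrow> u = v" using \<Psi>_inj by (simp add: inj_eq)

lemma \<Theta>_\<Psi>: "\<Theta> (\<Psi> u) = u" using \<Psi>_\<Theta>[of "\<Psi> u"] by (simp add: \<Psi>_eq_iff)

end

section \<open>Rational points acting on pure octonions\<close>

text \<open>A pure element is characterized by having a scalar square without being a nonzero scalar itself, and
its norm is minus its square.\<close>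

lemma (in oct_params) aut_pure:
  assumes h: "oct_aut a b c h" and x: "B oone x = 0"
  shows "B oone (h x) = 0" "B (h x) (h x) = B x x"
proof -
  have hom: "h (oscale r v) = oscale r (h v)" "h oone = oone" "h (v \<star> w) = h v \<star> h w" for r v w
    using h unfolding oct_aut_def oct_hom_def by blast+
  have inj: "h v = h w \<Longrightarrow> v = w" for v w using h by (simp add: oct_aut_def bij_is_inj inj_eq)
  have "h x \<star> h x = oscale (- B x x) oone"
    using arg_cong[OF pure_square[OF x], of h] by (simp add: hom)
  moreover have "h x \<star> oconj (h x) = oscale (2 * B oone (h x)) (h x) - h x \<star> h x"
    by (simp add: oconj_eq[of "h x" a b c] omult_diff omult_scale_right)
  ultimately have eq: "oscale (B (h x) (h x)) oone = oscale (2 * B oone (h x)) (h x) + oscale (B x x) oone"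
    by (simp add: mult_oconj oscale_minus)
  show 1: "B oone (h x) = 0"
  proof (rule ccontr)
    assume n: "B oone (h x) \<noteq> 0"
    define t where "t = B oone (h x)"
    have "oscale (2 * t) (h x) = oscale (B (h x) (h x) - B x x) oone"
      using eq by (simp add: t_def oscale_diff_left)
    then have "oscale (inverse (2 * t)) (oscale (2 * t) (h x))
        = oscale (inverse (2 * t)) (oscale (B (h x) (h x) - B x x) oone)" by simp
    then obtain r where "h x = oscale r oone"
      using n by (auto simp: oscale_simps t_def)
    then have "h x = h (oscale r oone)" by (simp add: hom)
    then have xr: "x = oscale r oone" by (rule inj)
    then have "r = 0" using x by (simp add: obil_simps' obil_one)
    then have "h x = 0" using hom(1)[of 0 x] xr by (simp add: oscale_simps)
    then show False using n by simp
  qed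
  show "B (h x) (h x) = B x x"
    using eq by (simp add: 1 oscale_simps) (simp add: oscale_def oone_def)
qed

context oct_bridge
begin

text \<open>Perpendicularity to \<open>1\<close> and the norm of a vector of coordinates. In contrast to \<open>perpendicular\<close> and
\<open>norm_form\<close>, whose values are multiples of \<open>1\<close>, they refer to scalars.\<close>

definition pureX :: "(8 \<Rightarrow> 'c) \<Rightarrow> bool" where "pureX x \<longleftrightarrow> Q.B oone (\<Theta> x) = 0"
definition normX :: "(8 \<Rightarrow> 'c) \<Rightarrow> 'c" where "normX x = Q.B (\<Theta> x) (\<Theta> x)"

lemma \<Theta>_scale: "\<Theta> (\<lambda>l. t * x l) = oscale t (\<Theta> x)"
proof -
  have "\<Psi> (oscale t (\<Theta> x)) = (\<lambda>l. t * x l)" by (simp add: \<Psi>_scale \<Psi>_\<Theta>)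
  then show ?thesis using \<Theta>_\<Psi> by metis
qed

lemma scaleX: "pureX x \<Longrightarrow> pureX (\<lambda>l. t * x l)" "normX (\<lambda>l. t * x l) = t * t * normX x"
  by (simp_all add: pureX_def normX_def \<Theta>_scale obil_simps obil_simps' mult.assoc)

lemma \<Theta>_\<kappa>: "\<Theta> (j \<circ> \<kappa> u) = jo u"
  using \<Theta>_\<Psi>[of "jo u"] by (simp add: \<Psi>_jo)

lemma pureX_\<kappa>: "pureX (j \<circ> \<kappa> u) \<longleftrightarrow> P.B oone u = 0"
  unfolding pureX_def \<Theta>_\<kappa> using jo_obil[of a b c oone u] j_eq_0_iff[of "P.B oone u"] by (simp add: jo_simps)

lemma normX_\<kappa>: "normX (j \<circ> \<kappa> u) = j (P.B u u)"
  by (simp add: normX_def \<Theta>_\<kappa> jo_obil)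

lemma obil_sum_right: "Q.B w (\<Sum>i\<in>F. oscale (v i) (g i)) = (\<Sum>i\<in>F. v i * Q.B w (g i))"
  by (induct F rule: infinite_finite_induct) (simp_all add: obil_simps')

text \<open>Perpendicularity to \<open>1\<close> is a linear equation with coefficients in the base field; this is why it is
preserved by functionals on the closure.\<close>

lemma pureX_iff: "pureX x \<longleftrightarrow>
    (\<Sum>i\<in>UNIV. x i * j (P.B oone (inv_into UNIV \<kappa> (unit_vec (field_alg id) i)))) = 0"
  using jo_obil[of a b c oone] by (simp add: pureX_def \<Theta>_def obil_sum_right jo_simps)

lemma GK_oct_aut:
  assumes g: "g \<in> GK" shows "oct_aut (j a) (j b) (j c) (\<lambda>u. \<Theta> (g (\<Psi> u)))"
proof -
  note g = autD[OF g]
  have lin: "g (\<lambda>l. v l + w l) = (\<lambda>l. g v l + g w l)" "g (\<lambda>l. r * v l) = (\<lambda>l. r * g v l)" for v w r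
    using g(2) by (simp_all add: linear_on_field)
  have eq: "\<Theta> v = u" if "v = \<Psi> u" for u v using that \<Theta>_\<Psi> by simp
  have "bij g" using g(5) vecs_c by (simp add: bij_betw_def bij_def inj_on_def vecs_def field_alg_simps)
  moreover have "bij \<Theta>" using \<Theta>_\<Psi> \<Psi>_\<Theta> by (metis bijI')
  ultimately have "bij (\<Theta> \<circ> (g \<circ> \<Psi>))" using \<Psi>_bij by (intro bij_comp)
  then have "bij (\<lambda>u. \<Theta> (g (\<Psi> u)))" by (simp add: comp_def)
  then show ?thesis
    unfolding oct_aut_def oct_hom_def
    by (auto intro!: eq simp: \<Psi>_add \<Psi>_scale \<Psi>_mult \<Psi>_one \<Psi>_\<Theta> lin g(3) g(4)[OF vecs_c vecs_c])
qed

lemma oct_aut_GK: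
  assumes h: "oct_aut (j a) (j b) (j c) h" shows "(\<lambda>v. \<Psi> (h (\<Theta> v))) \<in> GK"
proof -
  have hom: "h (v + w) = h v + h w" "h (oscale r v) = oscale r (h v)" "h oone = oone"
    "h (omult (j a) (j b) (j c) v w) = omult (j a) (j b) (j c) (h v) (h w)" for r v w
    using h unfolding oct_aut_def oct_hom_def by blast+
  have \<Theta>: "\<Theta> (\<lambda>l. v l + w l) = \<Theta> v + \<Theta> w" "\<Theta> (xone \<O> e (field_alg j)) = oone"
    "\<Theta> (xmult \<O> e (field_alg j) v w) = omult (j a) (j b) (j c) (\<Theta> v) (\<Theta> w)" for v w
    using \<Theta>_\<Psi>[of "\<Theta> v + \<Theta> w"] \<Theta>_\<Psi>[of oone] \<Theta>_\<Psi>[of "omult (j a) (j b) (j c) (\<Theta> v) (\<Theta> w)"]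
    by (simp_all add: \<Psi>_add \<Psi>_\<Theta> \<Psi>_one \<Psi>_mult)
  have "bij \<Theta>" using \<Theta>_\<Psi> \<Psi>_\<Theta> by (metis bijI')
  then have "bij (\<Psi> \<circ> (h \<circ> \<Theta>))" using \<Psi>_bij h unfolding oct_aut_def by (blast intro: bij_comp)
  then have bij: "bij (\<lambda>v. \<Psi> (h (\<Theta> v)))" by (simp add: comp_def)
  have V: "vecs (field_alg j) = (UNIV :: (8 \<Rightarrow> 'c) set)" using vecs_c by blast
  show ?thesis
    unfolding aut_iff linear_on_field V
    using bij by (simp add: \<Theta> \<Theta>_scale \<Psi>_add \<Psi>_scale \<Psi>_mult \<Psi>_one hom)
qed

lemma GK_pure:
  assumes "g \<in> GK" "pureX x" shows "pureX (g x)" "normX (g x) = normX x"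
  using Q.aut_pure[OF GK_oct_aut[OF assms(1)], of "\<Theta> x"] assms(2)
  by (simp_all add: pureX_def normX_def \<Psi>_\<Theta>)

lemma GK_transitive:
  assumes "pureX x" "pureX y" "normX x = normX y" "normX x \<noteq> 0"
  shows "\<exists>g\<in>GK. g x = y"
proof -
  obtain h where h: "oct_aut (j a) (j b) (j c) h" "h (\<Theta> x) = \<Theta> y"
    using Q.transitive[of "\<Theta> x" "\<Theta> y"] assms by (auto simp: pureX_def normX_def)
  show ?thesis
    using oct_aut_GK[OF h(1)] h(2) by (intro bexI[of _ "\<lambda>v. \<Psi> (h (\<Theta> v))"]) (simp_all add: \<Psi>_\<Theta>)
qed

lemma GK_fixed:
  assumes y: "pureX y" "normX y \<noteq> 0" and v: "pureX v"
    and fixed: "\<And>g. g \<in> GK \<Longrightarrow> g y = y \<Longrightarrow> g v = v"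
  shows "\<exists>s. v = (\<lambda>l. s * y l)"
proof -
  have "h (\<Theta> v) = \<Theta> v" if h: "oct_aut (j a) (j b) (j c) h" "h (\<Theta> y) = \<Theta> y" for h
    using fixed[OF oct_aut_GK[OF h(1)]] h(2) \<Theta>_\<Psi>[of "h (\<Theta> v)"] by (simp add: \<Psi>_\<Theta>)
  then obtain r s where rs: "\<Theta> v = oscale r oone + oscale s (\<Theta> y)"
    using Q.fixed_by_stabilizer[of "\<Theta> y" "\<Theta> v"] y by (auto simp: pureX_def normX_def)
  then have "r = 0" using v y by (simp add: pureX_def obil_simps' Q.obil_one)
  then have "v = \<Psi> (oscale s (\<Theta> y))" using rs \<Psi>_\<Theta>[of v] by (simp add: oscale_simps)
  then show ?thesis by (auto simp: \<Psi>_scale \<Psi>_\<Theta>)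
qed

lemma GK_scale: "g \<in> GK \<Longrightarrow> g (\<lambda>l. t * x l) = (\<lambda>l. t * g x l)"
  using autD(2)[of g \<O> e "field_alg j"] by (simp add: linear_on_field)

lemma cstab_subset_proportional:
  fixes \<iota> :: "'c \<Rightarrow> 'u"
  assumes "inj \<iota>" "pureX y" "normX y \<noteq> 0" "pureX v"
    and "\<And>R :: ('c, 'u) module. comm_alg R \<Longrightarrow> cstab y R \<subseteq> cstab v R"
  shows "\<exists>s. v = (\<lambda>l. s * y l)"
  using assms(2-4) by (rule GK_fixed) (rule cstab_subset_imp_fixed[OF assms(1,5)])

text \<open>If \<open>g y\<close> and \<open>y'\<close> have the same stabilizer, then \<open>y'\<close> is a multiple of \<open>g y\<close>, and its norm is changed by a
square. Conversely, \<open>t y\<close> has the same stabilizer as \<open>y\<close>, and transitivity carries it to \<open>y'\<close>.\<close>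

lemma stab_conj_iff:
  fixes \<iota> :: "'c \<Rightarrow> 'u"
  assumes \<iota>: "inj \<iota>" and y: "pureX y" "normX y \<noteq> 0" and y': "pureX y'" "normX y' \<noteq> 0"
  shows "(\<exists>g\<in>GK. \<forall>R :: ('c, 'u) module. comm_alg R \<longrightarrow> cstab (g y) R = cstab y' R)
    \<longleftrightarrow> (\<exists>t. t \<noteq> 0 \<and> normX y' = t * t * normX y)"
proof
  assume "\<exists>g\<in>GK. \<forall>R :: ('c, 'u) module. comm_alg R \<longrightarrow> cstab (g y) R = cstab y' R"
  then obtain g where g: "g \<in> GK" and eq: "\<And>R :: ('c, 'u) module. comm_alg R \<Longrightarrow> cstab (g y) R = cstab y' R"
    by blast
  note gy = GK_pure[OF g y(1)]
  obtain s where "y' = (\<lambda>l. s * g y l)"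
    using cstab_subset_proportional[OF \<iota> gy(1) _ y'(1)] eq gy(2) y(2) by auto
  then have "normX y' = s * s * normX y" by (simp add: scaleX gy)
  then show "\<exists>t. t \<noteq> 0 \<and> normX y' = t * t * normX y" using y'(2) by (intro exI[of _ s]) auto
next
  assume "\<exists>t. t \<noteq> 0 \<and> normX y' = t * t * normX y"
  then obtain t where t: "t \<noteq> 0" "normX y' = t * t * normX y" by blast
  obtain g where g: "g \<in> GK" "g (\<lambda>l. t * y l) = y'"
    using GK_transitive[of "\<lambda>l. t * y l" y'] y y' t by (auto simp: scaleX)
  then have "cstab (g y) R = cstab y' R" if "comm_alg R" for R :: "('c, 'u) module"
    using cstab_scale[OF that t(1), of "g y"] by (simp add: GK_scale[OF g(1)])
  with g(1) show "\<exists>g\<in>GK. \<forall>R :: ('c, 'u) module. comm_alg R \<longrightarrow> cstab (g y) R = cstab y' R" by blast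
qed

section \<open>The involution and the norm form\<close>

lemma \<sigma>_linear_ext: "extend_linear \<O> e (field_alg j) \<sigma> (\<Psi> u) = \<Psi> (oconj u)"
proof -
  define L where "L v = (\<lambda>l. \<Sum>i\<in>UNIV. v i * j (coord \<O> e (\<sigma> (e i)) l))" for v :: "8 \<Rightarrow> 'c"
  have ext: "extend_linear \<O> e (field_alg j) \<sigma> = L"
    by (auto simp: extend_linear_def L_def fun_eq_iff finsum_field_alg field_alg_simps)
  define w where "w i = inv_into UNIV \<kappa> (unit_vec (field_alg id) i)" for i
  have we: "\<psi> (w i) = e i" for i
  proof -
    have "coord \<O> e (\<psi> (w i)) = coord \<O> e (e i)"
      using \<kappa>_inv[of "unit_vec (field_alg id) i"] B.coord_comb[of "unit_vec (field_alg id) i"]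
      by (simp add: \<kappa>_def w_def B.comb_unit)
    then show ?thesis by (rule B.coord_inj) (simp_all add: \<psi>_rules B.e_closed)
  qed
  have \<sigma>e: "coord \<O> e (\<sigma> (e i)) = \<kappa> (oconj (w i))" for i
    using \<sigma>[of "w i"] by (simp add: we \<kappa>_def)
  have "\<Psi> (oconj (\<Theta> v)) = L v" for v
  proof -
    have oconj_sum: "oconj (\<Sum>i\<in>F. oscale (v i) (g i)) = (\<Sum>i\<in>F. oscale (v i) (oconj (g i)))"
      for F and v :: "8 \<Rightarrow> 'c" and g
    proof (induct F rule: infinite_finite_induct)
      have "oconj (0 :: 'c oct) = 0" using oconj_simps(2)[of 0 0] by (simp add: oscale_simps)
      then show "oconj (\<Sum>i\<in>{}. oscale (v i) (g i)) = (\<Sum>i\<in>{}. oscale (v i) (oconj (g i)))"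
        "infinite F \<Longrightarrow> oconj (\<Sum>i\<in>F. oscale (v i) (g i)) = (\<Sum>i\<in>F. oscale (v i) (oconj (g i)))" for F
        by simp_all
    qed (simp add: oconj_simps)
    show ?thesis
      by (simp add: \<Theta>_def oconj_sum \<Psi>_sum jo_simps(4)[symmetric] \<Psi>_jo L_def \<sigma>e w_def)
  qed
  from this[of "\<Psi> u"] show ?thesis by (simp add: ext \<Theta>_\<Psi>)
qed

abbreviation XK where "XK \<equiv> extend_scalars \<O> e (field_alg j)"

lemma XK_ops: "u \<oplus>\<^bsub>XK\<^esub> v = (\<lambda>l. u l + v l)" "r \<odot>\<^bsub>XK\<^esub> v = (\<lambda>l. r * v l)" "\<zero>\<^bsub>XK\<^esub> = (\<lambda>l. 0)"
  "\<one>\<^bsub>XK\<^esub> = \<Psi> oone" "\<Psi> s \<otimes>\<^bsub>XK\<^esub> \<Psi> t = \<Psi> (omult (j a) (j b) (j c) s t)"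
  by (simp_all add: extend_scalars_simps(2,3) field_alg_simps \<Psi>_one xone_def \<Psi>_mult xmult_def)
    (simp add: extend_scalars_def field_alg_simps)

lemma \<Psi>_zero: "\<Psi> 0 = (\<lambda>l. 0)"
  using \<Psi>_scale[of 0 0] by (simp add: oscale_simps)

lemma perpendicular_iff: "perpendicular XK (extend_linear \<O> e (field_alg j) \<sigma>) x \<one>\<^bsub>XK\<^esub> \<longleftrightarrow> pureX x"
proof -
  have x: "x = \<Psi> (\<Theta> x)" by (simp add: \<Psi>_\<Theta>)
  have eq: "bilin_form XK (extend_linear \<O> e (field_alg j) \<sigma>) (\<Psi> u) \<one>\<^bsub>XK\<^esub>
      = \<Psi> (oscale (Q.B oone u) oone)" for u
  proof -
    have "bilin_form XK (extend_linear \<O> e (field_alg j) \<sigma>) (\<Psi> u) \<one>\<^bsub>XK\<^esub>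
        = \<Psi> (oscale (1 / 2) (u + oconj u))"
      unfolding bilin_form_def XK_ops(4) \<sigma>_linear_ext XK_ops(5)
      by (simp add: XK_ops(1,2) oconj_simps \<Psi>_scale \<Psi>_add)
    also have "oscale (1 / 2) (u + oconj u) = oscale (Q.B oone u) oone"
      by (simp add: oconj_eq[of u "j a" "j b" "j c"] oscale_simps)
    finally show ?thesis .
  qed
  have "oscale r (oone :: 'c oct) = 0 \<longleftrightarrow> r = 0" for r
    by (auto simp: oscale_def oone_def zero_prod_def)
  then show ?thesis
    unfolding perpendicular_def XK_ops(3) \<Psi>_zero[symmetric]
    by (subst x) (simp add: eq \<Psi>_eq_iff pureX_def del: \<Psi>_\<Theta>)
qed

lemma norm_form_iff: "norm_form XK (extend_linear \<O> e (field_alg j) \<sigma>) x = \<zero>\<^bsub>XK\<^esub> \<longleftrightarrow> normX x = 0"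
proof -
  have x: "x = \<Psi> (\<Theta> x)" by (simp add: \<Psi>_\<Theta>)
  have eq: "norm_form XK (extend_linear \<O> e (field_alg j) \<sigma>) (\<Psi> u) = \<Psi> (oscale (Q.B u u) oone)" for u
    unfolding norm_form_def \<sigma>_linear_ext XK_ops(5) Q.mult_oconj ..
  have "oscale r (oone :: 'c oct) = 0 \<longleftrightarrow> r = 0" for r
    by (auto simp: oscale_def oone_def zero_prod_def)
  then show ?thesis
    unfolding XK_ops(3) \<Psi>_zero[symmetric]
    by (subst x) (simp add: eq \<Psi>_eq_iff normX_def)
qed

lemma perpendicular_\<psi>: "perpendicular \<O> \<sigma> (\<psi> u) \<one>\<^bsub>\<O>\<^esub> \<longleftrightarrow> P.B oone u = 0"
proof -
  have "bilin_form \<O> \<sigma> (\<psi> u) \<one>\<^bsub>\<O>\<^esub> = \<psi> (oscale (1 / 2) (u + oconj u))"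
    unfolding bilin_form_def \<psi>_rules(5)[symmetric] \<sigma> \<psi>_rules(4)[symmetric] \<psi>_rules(2,3)[symmetric]
    by (simp add: oconj_simps)
  also have "oscale (1 / 2) (u + oconj u) = oscale (P.B oone u) oone"
    by (simp add: oconj_eq[of u a b c] oscale_simps)
  finally have eq: "bilin_form \<O> \<sigma> (\<psi> u) \<one>\<^bsub>\<O>\<^esub> = \<psi> (oscale (P.B oone u) oone)" .
  have "\<psi> 0 = \<zero>\<^bsub>\<O>\<^esub>" using \<psi>_rules(3)[of 0 0] B.zero_smult[OF \<psi>_rules(1)] by (simp add: oscale_simps)
  then have "perpendicular \<O> \<sigma> (\<psi> u) \<one>\<^bsub>\<O>\<^esub> \<longleftrightarrow> oscale (P.B oone u) (oone :: 'k oct) = 0"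
    unfolding perpendicular_def eq by (metis \<psi>_inj)
  then show ?thesis by (auto simp: oscale_def oone_def zero_prod_def)
qed

end

section \<open>Isomorphisms of algebras\<close>

lemma alg_isosD:
  assumes "h \<in> alg_isos K A B"
  shows "x \<in> carrier A \<Longrightarrow> h x \<in> carrier B" "h \<one>\<^bsub>A\<^esub> = \<one>\<^bsub>B\<^esub>"
    "x \<in> carrier A \<Longrightarrow> y \<in> carrier A \<Longrightarrow> h (x \<oplus>\<^bsub>A\<^esub> y) = h x \<oplus>\<^bsub>B\<^esub> h y"
    "x \<in> carrier A \<Longrightarrow> y \<in> carrier A \<Longrightarrow> h (x \<otimes>\<^bsub>A\<^esub> y) = h x \<otimes>\<^bsub>B\<^esub> h y"
    "c \<in> carrier K \<Longrightarrow> x \<in> carrier A \<Longrightarrow> h (c \<odot>\<^bsub>A\<^esub> x) = c \<odot>\<^bsub>B\<^esub> h x"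
    "bij_betw h (carrier A) (carrier B)" "h \<in> extensional (carrier A)"
  using assms by (auto simp: alg_isos_def alg_homs_def PiE_iff)

lemma comm_alg_closed:
  fixes A :: "('k::field, 'a) module"
  assumes "comm_alg A"
  shows "\<one>\<^bsub>A\<^esub> \<in> carrier A" "x \<in> carrier A \<Longrightarrow> y \<in> carrier A \<Longrightarrow> x \<oplus>\<^bsub>A\<^esub> y \<in> carrier A"
    "x \<in> carrier A \<Longrightarrow> y \<in> carrier A \<Longrightarrow> x \<otimes>\<^bsub>A\<^esub> y \<in> carrier A"
    "x \<in> carrier A \<Longrightarrow> c \<odot>\<^bsub>A\<^esub> x \<in> carrier A"
proof -
  interpret cring A using assms by (rule comm_algD)
  show "\<one>\<^bsub>A\<^esub> \<in> carrier A" "x \<in> carrier A \<Longrightarrow> y \<in> carrier A \<Longrightarrow> x \<oplus>\<^bsub>A\<^esub> y \<in> carrier A"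
    "x \<in> carrier A \<Longrightarrow> y \<in> carrier A \<Longrightarrow> x \<otimes>\<^bsub>A\<^esub> y \<in> carrier A"
    "x \<in> carrier A \<Longrightarrow> c \<odot>\<^bsub>A\<^esub> x \<in> carrier A"
    using comm_alg_smult_closed[OF assms] by auto
qed

abbreviation isos where "isos \<equiv> alg_isos ring_of_type_algebra"

lemma isos_trans:
  assumes "comm_alg A" "h \<in> isos A B" "h' \<in> isos B C"
  shows "compose (carrier A) h' h \<in> isos A C"
  using alg_isosD[OF assms(2)] alg_isosD[OF assms(3)] comm_alg_closed[OF assms(1)]
    bij_betw_compose[OF alg_isosD(6)[OF assms(2)] alg_isosD(6)[OF assms(3)]]
  unfolding alg_isos_def alg_homs_def by (auto simp: compose_def)

lemma isos_sym:
  assumes A: "comm_alg A" and h: "h \<in> isos A B"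
  shows "restrict (inv_into (carrier A) h) (carrier B) \<in> isos B A"
proof -
  note h = alg_isosD[OF h] and c = comm_alg_closed[OF A]
  let ?i = "inv_into (carrier A) h"
  have B: "carrier B = h ` carrier A" using h(6) by (simp add: bij_betw_def)
  have i: "?i (h x) = x" if "x \<in> carrier A" for x
    using that h(6) by (simp add: bij_betw_inv_into_left)
  have ops: "\<one>\<^bsub>B\<^esub> = h \<one>\<^bsub>A\<^esub>" "x \<in> carrier A \<Longrightarrow> y \<in> carrier A \<Longrightarrow> h x \<oplus>\<^bsub>B\<^esub> h y = h (x \<oplus>\<^bsub>A\<^esub> y)"
    "x \<in> carrier A \<Longrightarrow> y \<in> carrier A \<Longrightarrow> h x \<otimes>\<^bsub>B\<^esub> h y = h (x \<otimes>\<^bsub>A\<^esub> y)"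
    "x \<in> carrier A \<Longrightarrow> r \<odot>\<^bsub>B\<^esub> h x = h (r \<odot>\<^bsub>A\<^esub> x)" for x y r
    using h(2-5) by simp_all
  have "bij_betw (restrict ?i (carrier B)) (carrier B) (carrier A)"
    using bij_betw_inv_into[OF h(6)] by simp
  then show ?thesis
    unfolding alg_isos_def alg_homs_def by (auto simp: B ops i c)
qed

lemma comm_alg_unital:
  assumes A: "comm_alg A" shows "unital_algebra ring_of_type_algebra A"
proof -
  interpret algebra ring_of_type_algebra A by (rule A)
  note d = comm_algD[OF A]
  show ?thesis
    unfolding unital_algebra_def
    using d(7) by (auto simp: module_axioms l_distr r_distr m_comm d(2) intro: module_axioms)
qed

section \<open>Quadratic algebras\<close>

text \<open>The algebra \<open>k[i]\<close> with \<open>i\<^sup>2 = - n\<close>, so that \<open>n\<close> is the norm of \<open>i\<close>.\<close>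

definition quad :: "'k::field \<Rightarrow> ('k, 'k \<times> 'k) module" where
  "quad n = \<lparr>carrier = UNIV,
     monoid.mult = (\<lambda>(x0, x1) (y0, y1). (x0 * y0 - n * x1 * y1, x0 * y1 + x1 * y0)),
     one = (1, 0), ring.zero = (0, 0), add = (\<lambda>(x0, x1) (y0, y1). (x0 + y0, x1 + y1)),
     module.smult = (\<lambda>c (x0, x1). (c * x0, c * x1))\<rparr>"

lemma quad_simps:
  "carrier (quad n) = UNIV" "(x0, x1) \<otimes>\<^bsub>quad n\<^esub> (y0, y1) = (x0 * y0 - n * x1 * y1, x0 * y1 + x1 * y0)"
  "\<one>\<^bsub>quad n\<^esub> = (1, 0)" "\<zero>\<^bsub>quad n\<^esub> = (0, 0)" "(x0, x1) \<oplus>\<^bsub>quad n\<^esub> (y0, y1) = (x0 + y0, x1 + y1)"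
  "c \<odot>\<^bsub>quad n\<^esub> (x0, x1) = (c * x0, c * x1)"
  by (simp_all add: quad_def)

lemma quad_comm_alg: "comm_alg (quad n)"
proof (rule comm_algI)
  show "cring (quad n)"
  proof (intro cringI abelian_groupI comm_monoidI)
    fix x assume "x \<in> carrier (quad n)"
    show "\<exists>y\<in>carrier (quad n). y \<oplus>\<^bsub>quad n\<^esub> x = \<zero>\<^bsub>quad n\<^esub>"
      by (cases x, intro bexI[of _ "(- fst x, - snd x)"]) (simp_all add: quad_simps)
  qed (auto simp: quad_simps algebra_simps)
qed (auto simp: quad_simps algebra_simps)

text \<open>An isomorphism maps \<open>i\<close> to an element \<open>p + q i\<close> whose square is the scalar \<open>- n\<close>, which forces \<open>p = 0\<close>.\<close>

lemma quad_iso_iff: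
  fixes n m :: "'k::field_char_0"
  assumes "n \<noteq> 0"
  shows "isos (quad n) (quad m) \<noteq> {} \<longleftrightarrow> (\<exists>t. t \<noteq> 0 \<and> m = t * t * n)"
proof
  assume "isos (quad n) (quad m) \<noteq> {}"
  then obtain h where h: "h \<in> isos (quad n) (quad m)" by blast
  note hd = alg_isosD[OF h]
  obtain p q where pq: "h (0, 1) = (p, q)" by (cases "h (0, 1)")
  have r: "h (r, 0) = (r, 0)" for r
    using hd(5)[of r "(1, 0)"] hd(2) by (simp add: quad_simps)
  have "h ((0, 1) \<otimes>\<^bsub>quad n\<^esub> (0, 1)) = (p, q) \<otimes>\<^bsub>quad m\<^esub> (p, q)"
    using hd(4)[of "(0, 1)" "(0, 1)"] by (simp add: pq quad_simps)
  then have eq: "- n = p * p - m * q * q" "p * q = 0"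
    using r[of "- n"] by (simp_all add: quad_simps)
  have "q \<noteq> 0"
  proof
    assume "q = 0"
    then have "h (0, 1) = h (p, 0)" by (simp add: pq r)
    then have "(0, 1) = (p, 0 :: 'k)" using hd(6) by (simp add: quad_simps bij_betw_def inj_eq)
    then show False by simp
  qed
  then have "m = (1 / q) * (1 / q) * n" using eq by (simp add: field_simps)
  then show "\<exists>t. t \<noteq> 0 \<and> m = t * t * n" using \<open>q \<noteq> 0\<close> by (intro exI[of _ "1 / q"]) simp
next
  assume "\<exists>t. t \<noteq> 0 \<and> m = t * t * n"
  then obtain t where t: "t \<noteq> 0" "m = t * t * n" by blast
  have "bij (\<lambda>(x0 :: 'k, x1 :: 'k). (x0, x1 / t))"
    by (rule o_bij[where g="\<lambda>(x0, x1). (x0, x1 * t)"]) (use t in \<open>auto simp: fun_eq_iff\<close>)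
  then have "(\<lambda>(x0, x1). (x0, x1 / t)) \<in> isos (quad n) (quad m)"
    unfolding alg_isos_def alg_homs_def using t by (auto simp: quad_simps field_simps)
  then show "isos (quad n) (quad m) \<noteq> {}" by blast
qed

lemma UNIV_2: "(UNIV :: 2 set) = {0, 1}"
  by (rule card_subset_eq[symmetric]) auto

lemma two_neq_zero: "(i :: 2) \<noteq> 0 \<longleftrightarrow> i = 1"
  using UNIV_2 by auto

text \<open>Over the closure \<open>- n\<close> has a square root \<open>r\<close>, and the two homomorphisms to the closure send \<open>i\<close> to \<open>r\<close>
and to \<open>- r\<close>.\<close>

lemma quad_etale:
  fixes n :: "'k::field_char_0"
  assumes n: "n \<noteq> 0" shows "quadratic_etale (quad n)"
proof -
  define b :: "2 \<Rightarrow> 'k \<times> 'k" where "b i = (if i = 0 then (1, 0) else (0, 1))" for i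
  interpret Q: cring "quad n" using quad_comm_alg by (rule comm_algD)
  have sum: "(\<Oplus>\<^bsub>quad n\<^esub>i\<in>UNIV. c i \<odot>\<^bsub>quad n\<^esub> b i) = (c 0, c 1)" for c
    unfolding UNIV_2 by (subst Q.finsum_insert) (auto simp: quad_simps b_def)
  have ex1: "\<exists>!c. v = (\<Oplus>\<^bsub>quad n\<^esub>i\<in>UNIV. c i \<odot>\<^bsub>quad n\<^esub> b i)" for v
  proof (rule ex1I[of _ "\<lambda>i. if i = 0 then fst v else snd v"])
    fix c assume "v = (\<Oplus>\<^bsub>quad n\<^esub>i\<in>UNIV. c i \<odot>\<^bsub>quad n\<^esub> b i)"
    then have v: "v = (c 0, c 1)" by (simp only: sum)
    show "c = (\<lambda>i. if i = 0 then fst v else snd v)"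
      by (rule ext) (auto simp: v two_neq_zero)
  qed (simp add: sum)
  then have basis: "is_basis (quad n) b" by (simp add: is_basis_def quad_simps)
  have coord: "coord (quad n) b (x0, x1) = (\<lambda>i. if i = 0 then x0 else x1)" for x0 x1
    unfolding coord_def by (rule the1_equality[OF ex1]) (simp add: sum)
  obtain r where r: "r * r = - to_ac n"
    using nth_root_exists[of 2 "- to_ac n"] by (auto simp: power2_eq_square)
  then have r0: "r \<noteq> 0" using n by auto
  let ?X = "alg_over_ac (quad n) b"
  define h :: "(2 \<Rightarrow> 'k alg_closure) \<Rightarrow> 2 \<Rightarrow> 'k alg_closure"
    where "h v = (\<lambda>l. if l = 0 then v 0 + r * v 1 else v 0 - r * v 1)" for v
  have X: "carrier ?X = UNIV" "\<one>\<^bsub>?X\<^esub> = (\<lambda>l. if l = 0 then 1 else 0)"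
    "v \<oplus>\<^bsub>?X\<^esub> w = (\<lambda>l. v l + w l)" "s \<odot>\<^bsub>?X\<^esub> v = (\<lambda>l. s * v l)" for v w s
    by (auto simp: extend_scalars_simps field_alg_simps vecs_def coord quad_simps fun_eq_iff)
  have X_mult: "v \<otimes>\<^bsub>?X\<^esub> w = (\<lambda>l. if l = 0 then v 0 * w 0 - to_ac n * v 1 * w 1 else v 0 * w 1 + v 1 * w 0)" for v w
    by (auto simp: extend_scalars_def ac.finsum_field_alg field_alg_simps UNIV_2 b_def quad_simps coord
        fun_eq_iff algebra_simps)
  have "bij h"
  proof (rule o_bij[where g="\<lambda>v l. if l = 0 then (v 0 + v 1) / 2 else (v 0 - v 1) / (2 * r)"])
    show "(\<lambda>v l. if l = 0 then (v 0 + v 1) / 2 else (v 0 - v 1) / (2 * r)) \<circ> h = id"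
      using r0 by (auto simp: h_def fun_eq_iff two_neq_zero)
    show "h \<circ> (\<lambda>v l. if l = 0 then (v 0 + v 1) / 2 else (v 0 - v 1) / (2 * r)) = id"
      using r0 by (auto simp: h_def fun_eq_iff two_neq_zero field_simps)
  qed
  moreover have "h (v \<otimes>\<^bsub>?X\<^esub> w) = (\<lambda>l. h v l * h w l)" for v w
  proof -
    have "r * (r * x) = - (to_ac n * x)" for x using r by (metis mult.assoc mult_minus_left)
    note rr = this
    show ?thesis by (auto simp: h_def X_mult fun_eq_iff algebra_simps rr)
  qed
  ultimately have "h \<in> isos ?X split_alg"
    unfolding alg_isos_def alg_homs_def
    by (auto simp: X split_alg_def) (auto simp: h_def fun_eq_iff algebra_simps)
  then show ?thesis
    unfolding quadratic_etale_def using quad_comm_alg basis by blast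
qed

section \<open>Etale algebras are reduced\<close>

text \<open>Over the closure the algebra becomes a product of fields.\<close>

lemma etale_reduced:
  fixes A :: "('k::field_char_0, 'a) module"
  assumes et: "quadratic_etale A" and s: "s \<in> carrier A" and sq: "s \<otimes>\<^bsub>A\<^esub> s = \<zero>\<^bsub>A\<^esub>"
  shows "s = \<zero>\<^bsub>A\<^esub>"
proof -
  obtain b :: "2 \<Rightarrow> 'a" and h where A: "comm_alg A" and b: "is_basis A b"
    and h: "h \<in> isos (alg_over_ac A b) (split_alg :: ('k alg_closure, 2 \<Rightarrow> 'k alg_closure) module)"
    using et unfolding quadratic_etale_def by blast
  interpret based_algebra A b using comm_alg_unital[OF A] b by unfold_locales
  let ?X = "alg_over_ac A b"
  have car: "v \<in> carrier ?X" for v by (simp add: extend_scalars_simps vecs_def field_alg_simps)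
  have K: "v \<in> vecs (field_alg id)" for v :: "2 \<Rightarrow> 'k" by (simp add: vecs_def field_alg_simps)
  have to_ac_hom: "to_ac \<in> homs (field_alg id) (field_alg to_ac)"
    by (auto simp: alg_homs_def field_alg_def)
  have zero: "coord A b \<zero>\<^bsub>A\<^esub> = (\<lambda>l. 0)"
    using coord_scale[OF A.zero_closed, of 0] zero_smult[OF A.zero_closed] by simp
  note hd = alg_isosD[OF h]
  let ?v = "to_ac \<circ> coord A b s"
  have hz: "h (\<lambda>l. 0) = (\<lambda>l. 0)"
    using hd(5)[of 0 "\<lambda>l. 0"] car by (simp add: extend_scalars_simps field_alg_simps split_alg_def)
  have "?v \<otimes>\<^bsub>?X\<^esub> ?v = to_ac \<circ> coord A b (s \<otimes>\<^bsub>A\<^esub> s)"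
    using map_xmult[OF idh.field_alg_comm_alg ac.field_alg_comm_alg to_ac_hom K K, of A b "coord A b s" "coord A b s"]
    by (simp add: coord_mult s xmult_def)
  also have "\<dots> = (\<lambda>l. 0)" by (auto simp: sq zero)
  finally have "(\<lambda>l. h ?v l * h ?v l) = (\<lambda>l. 0)"
    using hd(4)[OF car car, of ?v ?v] hz by (simp add: split_alg_def)
  then have "h ?v = h (\<lambda>l. 0)" by (auto simp: hz fun_eq_iff)
  then have "?v = (\<lambda>l. 0)" using hd(6) car by (auto simp: bij_betw_def inj_on_def)
  then have "coord A b s = coord A b \<zero>\<^bsub>A\<^esub>" by (auto simp: zero fun_eq_iff)
  then show ?thesis using s by (rule coord_inj) simp
qed

section \<open>Embedded quadratic etale algebras\<close>

locale etale_embedding = oct_bridge j \<O> \<sigma> e a b c \<psi>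
  for j :: "'k::field_char_0 \<Rightarrow> 'c::field_char_0" and \<O> :: "('k, 'o) module" and \<sigma> e a b c \<psi> +
  fixes A :: "('k, 'a) module" and \<iota>
  assumes et: "quadratic_etale A" and \<iota>: "\<iota> \<in> alg_embeddings ring_of_type_algebra A \<O>"
begin

lemma A: "comm_alg A" using et by (simp add: quadratic_etale_def)

sublocale A: cring A using A by (rule comm_algD)

lemmas A_closed = comm_alg_closed[OF A]

text \<open>The embedding in the coordinates of pairs of quaternions.\<close>

definition \<tau> where "\<tau> s = inv_into UNIV \<psi> (\<iota> s)"

lemma \<iota>_rules: "s \<in> carrier A \<Longrightarrow> \<iota> s \<in> carrier \<O>" "\<iota> \<one>\<^bsub>A\<^esub> = \<one>\<^bsub>\<O>\<^esub>"
  "s \<in> carrier A \<Longrightarrow> t \<in> carrier A \<Longrightarrow> \<iota> (s \<oplus>\<^bsub>A\<^esub> t) = \<iota> s \<oplus>\<^bsub>\<O>\<^esub> \<iota> t"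
  "s \<in> carrier A \<Longrightarrow> t \<in> carrier A \<Longrightarrow> \<iota> (s \<otimes>\<^bsub>A\<^esub> t) = \<iota> s \<otimes>\<^bsub>\<O>\<^esub> \<iota> t"
  "s \<in> carrier A \<Longrightarrow> \<iota> (r \<odot>\<^bsub>A\<^esub> s) = r \<odot>\<^bsub>\<O>\<^esub> \<iota> s" "inj_on \<iota> (carrier A)"
  using \<iota> by (auto simp: alg_embeddings_def alg_homs_def PiE_iff)

lemma \<psi>_\<tau>: "s \<in> carrier A \<Longrightarrow> \<psi> (\<tau> s) = \<iota> s"
  using \<psi>_bij \<iota>_rules(1) by (simp add: \<tau>_def bij_betw_inv_into_right)

lemma \<tau>_rules: "\<tau> \<one>\<^bsub>A\<^esub> = oone"
  "s \<in> carrier A \<Longrightarrow> t \<in> carrier A \<Longrightarrow> \<tau> (s \<oplus>\<^bsub>A\<^esub> t) = \<tau> s + \<tau> t"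
  "s \<in> carrier A \<Longrightarrow> t \<in> carrier A \<Longrightarrow> \<tau> (s \<otimes>\<^bsub>A\<^esub> t) = omult a b c (\<tau> s) (\<tau> t)"
  "s \<in> carrier A \<Longrightarrow> \<tau> (r \<odot>\<^bsub>A\<^esub> s) = oscale r (\<tau> s)"
  "s \<in> carrier A \<Longrightarrow> t \<in> carrier A \<Longrightarrow> \<tau> s = \<tau> t \<longleftrightarrow> s = t"
  subgoal using \<psi>_\<tau>[of "\<one>\<^bsub>A\<^esub>"] by (metis A_closed(1) \<iota>_rules(2) \<psi>_inj \<psi>_rules(5))
  subgoal by (metis A_closed(2) \<iota>_rules(3) \<psi>_\<tau> \<psi>_inj \<psi>_rules(2))
  subgoal by (metis A_closed(3) \<iota>_rules(4) \<psi>_\<tau> \<psi>_inj \<psi>_rules(4))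
  subgoal by (metis A_closed(4) \<iota>_rules(5) \<psi>_\<tau> \<psi>_inj \<psi>_rules(3))
  subgoal by (metis \<psi>_\<tau> \<iota>_rules(6) inj_on_def)
  done

lemma \<tau>_zero: "\<tau> \<zero>\<^bsub>A\<^esub> = 0"
  using \<tau>_rules(2)[of "\<zero>\<^bsub>A\<^esub>" "\<zero>\<^bsub>A\<^esub>"] by simp

text \<open>A pure element of norm zero has square zero.\<close>

lemma pure_norm:
  assumes s: "s \<in> carrier A" "P.B oone (\<tau> s) = 0" "s \<noteq> \<zero>\<^bsub>A\<^esub>"
  shows "P.B (\<tau> s) (\<tau> s) \<noteq> 0"
proof
  assume "P.B (\<tau> s) (\<tau> s) = 0"
  then have "\<tau> (s \<otimes>\<^bsub>A\<^esub> s) = \<tau> \<zero>\<^bsub>A\<^esub>"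
    using P.pure_square[OF s(2)] by (simp add: \<tau>_rules s(1) oscale_simps \<tau>_zero)
  then have "s \<otimes>\<^bsub>A\<^esub> s = \<zero>\<^bsub>A\<^esub>" using s(1) by (simp add: \<tau>_rules(5))
  then show False using etale_reduced[OF et s(1)] s(3) by blast
qed

lemma pure_exists: "\<exists>s\<in>carrier A. s \<noteq> \<zero>\<^bsub>A\<^esub> \<and> P.B oone (\<tau> s) = 0"
proof -
  obtain bs :: "2 \<Rightarrow> 'a" where bs: "is_basis A bs" using et by (auto simp: quadratic_etale_def)
  interpret BA: based_algebra A bs using comm_alg_unital[OF A] bs by unfold_locales
  have "\<exists>s\<in>carrier A. \<forall>r. s \<noteq> r \<odot>\<^bsub>A\<^esub> \<one>\<^bsub>A\<^esub>"
  proof (rule ccontr)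
    assume "\<not> ?thesis"
    then have "\<forall>i. \<exists>r. bs i = r \<odot>\<^bsub>A\<^esub> \<one>\<^bsub>A\<^esub>" using BA.e_closed by blast
    then obtain r where r: "\<And>i. bs i = r i \<odot>\<^bsub>A\<^esub> \<one>\<^bsub>A\<^esub>" by metis
    have cu: "coord A bs (bs i) = unit_vec (field_alg id) i" for i
      using BA.coord_comb[of "unit_vec (field_alg id) i"] by (simp add: BA.comb_unit)
    have c: "unit_vec (field_alg id) i = (\<lambda>l. r i * coord A bs \<one>\<^bsub>A\<^esub> l)" for i
      using cu[of i] BA.coord_scale[OF A_closed(1), of "r i"] by (simp add: r[of i, symmetric])
    define d where "d = coord A bs \<one>\<^bsub>A\<^esub>"
    have "r 0 * d 0 = 1" "r 1 * d 1 = 1" "r 0 * d 1 = 0"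
      using fun_cong[OF c[of 0], of 0] fun_cong[OF c[of 1], of 1] fun_cong[OF c[of 0], of 1]
      by (simp_all add: unit_vec_def field_alg_simps d_def)
    then show False by auto
  qed
  then obtain s where s: "s \<in> carrier A" "\<And>r. s \<noteq> r \<odot>\<^bsub>A\<^esub> \<one>\<^bsub>A\<^esub>" by blast
  define r where "r = P.B oone (\<tau> s)"
  define t where "t = s \<oplus>\<^bsub>A\<^esub> (- r) \<odot>\<^bsub>A\<^esub> \<one>\<^bsub>A\<^esub>"
  have t: "t \<in> carrier A" using s(1) A_closed by (simp add: t_def)
  have \<tau>t: "\<tau> t = \<tau> s + oscale (- r) oone"
    using s(1) A_closed by (simp add: t_def \<tau>_rules)
  have "P.B oone (\<tau> t) = 0"
    by (simp add: \<tau>t obil_simps' P.obil_one r_def)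
  moreover have "t \<noteq> \<zero>\<^bsub>A\<^esub>"
  proof
    assume "t = \<zero>\<^bsub>A\<^esub>"
    then have "\<tau> s = \<tau> (r \<odot>\<^bsub>A\<^esub> \<one>\<^bsub>A\<^esub>)"
      using \<tau>t A_closed by (simp add: \<tau>_rules \<tau>_zero oscale_minus)
    then show False using s A_closed by (simp add: \<tau>_rules(5))
  qed
  ultimately show ?thesis using t by blast
qed

text \<open>Pure elements \<open>s\<close>, \<open>t\<close> that commute have a product that equals its own conjugate, so \<open>s t\<close> is a scalar
and \<open>t\<close> is a multiple of \<open>s\<close>.\<close>

lemma pure_proportional:
  assumes s: "s \<in> carrier A" "P.B oone (\<tau> s) = 0" "s \<noteq> \<zero>\<^bsub>A\<^esub>"
    and t: "t \<in> carrier A" "P.B oone (\<tau> t) = 0"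
  shows "\<exists>r. \<tau> t = oscale r (\<tau> s)"
proof -
  let ?n = "P.B (\<tau> s) (\<tau> s)"
  note n = pure_norm[OF s]
  define w where "w = omult a b c (\<tau> s) (\<tau> t)"
  have comm: "omult a b c (\<tau> t) (\<tau> s) = w"
    using A.m_comm[OF s(1) t(1)] \<tau>_rules(3)[OF s(1) t(1)] \<tau>_rules(3)[OF t(1) s(1)] by (simp add: w_def)
  have "oconj w = w"
    using comm by (simp add: w_def oconj_mult P.pure_oconj[OF s(2)] P.pure_oconj[OF t(2)] omult_minus)
  then have "w + w = oscale (2 * P.B oone w) oone"
    using oconj_eq[of w a b c] by (metis add_diff_cancel_right' diff_add_cancel)
  then have w: "w = oscale (P.B oone w) oone" by (simp only: oct_double_cancel)
  have "oscale ?n (\<tau> t) = omult a b c (oconj (\<tau> s)) w"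
    using P.oconj_cancel[of "\<tau> s" "\<tau> t"] by (simp add: w_def)
  also have "\<dots> = oscale (- P.B oone w) (\<tau> s)"
    by (subst w) (simp add: P.pure_oconj[OF s(2)] omult_scale_right oscale_minus)
  finally have "oscale (inverse ?n) (oscale ?n (\<tau> t)) = oscale (inverse ?n) (oscale (- P.B oone w) (\<tau> s))"
    by simp
  then show ?thesis using n by (auto simp: oscale_simps)
qed

text \<open>By the preceding lemma, \<open>1\<close> and \<open>s\<close> form a basis of \<open>A\<close>, and \<open>s\<^sup>2 = - N(s)\<close>.\<close>

lemma iso_quad:
  assumes s: "s \<in> carrier A" "P.B oone (\<tau> s) = 0" "s \<noteq> \<zero>\<^bsub>A\<^esub>"
  shows "isos A (quad (P.B (\<tau> s) (\<tau> s))) \<noteq> {}" "isos (quad (P.B (\<tau> s) (\<tau> s))) A \<noteq> {}"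
proof -
  let ?n = "P.B (\<tau> s) (\<tau> s)"
  note n = pure_norm[OF s]
  define g where "g = (\<lambda>(x0, x1). x0 \<odot>\<^bsub>A\<^esub> \<one>\<^bsub>A\<^esub> \<oplus>\<^bsub>A\<^esub> x1 \<odot>\<^bsub>A\<^esub> s)"
  have gc: "g x \<in> carrier A" for x using A_closed s(1) by (auto simp: g_def split: prod.split)
  have \<tau>g: "\<tau> (g (x0, x1)) = oscale x0 oone + oscale x1 (\<tau> s)" for x0 x1
    using A_closed s(1) by (simp add: g_def \<tau>_rules)
  have eq: "x = y" if "\<tau> x = \<tau> y" "x \<in> carrier A" "y \<in> carrier A" for x y using that by (simp add: \<tau>_rules(5))
  have Bs: "P.B (\<tau> s) oone = 0" using s(2) by (simp add: obil_commute)
  have inj: "inj g"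
  proof (rule injI)
    fix x y assume "g x = g y"
    then have "P.B oone (\<tau> (g x)) = P.B oone (\<tau> (g y))" "P.B (\<tau> s) (\<tau> (g x)) = P.B (\<tau> s) (\<tau> (g y))"
      by simp_all
    then show "x = y"
      using n s(2) Bs by (cases x; cases y) (simp add: \<tau>g obil_simps' P.obil_one)
  qed
  have "\<exists>x. t = g x" if t: "t \<in> carrier A" for t
  proof -
    define r where "r = P.B oone (\<tau> t)"
    define t' where "t' = t \<oplus>\<^bsub>A\<^esub> (- r) \<odot>\<^bsub>A\<^esub> \<one>\<^bsub>A\<^esub>"
    have t': "t' \<in> carrier A" "\<tau> t' = \<tau> t + oscale (- r) oone"
      using t A_closed by (simp_all add: t'_def \<tau>_rules)
    then have "P.B oone (\<tau> t') = 0" by (simp add: obil_simps' P.obil_one r_def)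
    then obtain q where "\<tau> t' = oscale q (\<tau> s)" using pure_proportional[OF s t'(1)] by blast
    then have "\<tau> t = \<tau> (g (r, q))" using t'(2) by (simp add: \<tau>g oscale_minus algebra_simps)
    then show ?thesis using eq[OF _ t gc] by blast
  qed
  then have bij: "bij_betw g UNIV (carrier A)" using inj gc by (auto simp: bij_betw_def)
  have sq: "omult a b c (\<tau> s) (\<tau> s) = oscale (- ?n) oone" using P.pure_square[OF s(2)] .
  have "g \<in> isos (quad ?n) A"
    unfolding alg_isos_def alg_homs_def
  proof (intro CollectI conjI ballI)
    show "g \<in> carrier (quad ?n) \<rightarrow>\<^sub>E carrier A" using gc by (auto simp: quad_simps)
    show "bij_betw g (carrier (quad ?n)) (carrier A)" using bij by (simp add: quad_simps)
    show "g \<one>\<^bsub>quad ?n\<^esub> = \<one>\<^bsub>A\<^esub>"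
      by (rule eq) (use A_closed gc in \<open>auto simp: quad_simps \<tau>g oscale_simps \<tau>_rules\<close>)
    fix x y :: "'k \<times> 'k"
    obtain x0 x1 y0 y1 where xy: "x = (x0, x1)" "y = (y0, y1)" by (cases x, cases y)
    show "g (x \<oplus>\<^bsub>quad ?n\<^esub> y) = g x \<oplus>\<^bsub>A\<^esub> g y"
      by (rule eq) (use A_closed gc in \<open>auto simp: xy quad_simps \<tau>g oscale_simps \<tau>_rules\<close>)
    show "g (x \<otimes>\<^bsub>quad ?n\<^esub> y) = g x \<otimes>\<^bsub>A\<^esub> g y"
      by (rule eq) (use A_closed gc in \<open>auto simp: xy quad_simps \<tau>g oscale_simps \<tau>_rules omult_add_left
          omult_add_right omult_scale_left omult_scale_right sq oscale_diff oscale_diff_left oscale_minus algebra_simps\<close>)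
  next
    fix r and x :: "'k \<times> 'k"
    obtain x0 x1 where x: "x = (x0, x1)" by (cases x)
    show "g (r \<odot>\<^bsub>quad ?n\<^esub> x) = r \<odot>\<^bsub>A\<^esub> g x"
      by (rule eq) (use A_closed gc in \<open>auto simp: x quad_simps \<tau>g oscale_simps \<tau>_rules\<close>)
  qed
  then show "isos (quad ?n) A \<noteq> {}" by blast
  then show "isos A (quad ?n) \<noteq> {}" using isos_sym[OF quad_comm_alg] by blast
qed

end

context oct_bridge
begin

definition pure_norm_of :: "('k, 'a) module \<Rightarrow> 'k \<Rightarrow> bool" where
  "pure_norm_of A n \<longleftrightarrow> (\<exists>\<iota>\<in>alg_embeddings ring_of_type_algebra A \<O>. \<exists>u. \<psi> u \<in> \<iota> ` carrier A \<and>
     \<psi> u \<noteq> \<zero>\<^bsub>\<O>\<^esub> \<and> P.B oone u = 0 \<and> n = P.B u u)"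

lemma \<psi>_zero: "\<psi> 0 = \<zero>\<^bsub>\<O>\<^esub>"
  using \<psi>_rules(3)[of 0 0] B.zero_smult[OF \<psi>_rules(1)] by (simp add: oscale_simps)

lemma pure_norm_ofD:
  assumes et: "quadratic_etale A" and n: "pure_norm_of A n"
  shows "n \<noteq> 0" "isos A (quad n) \<noteq> {}" "isos (quad n) A \<noteq> {}"
proof -
  obtain \<iota> u where \<iota>: "\<iota> \<in> alg_embeddings ring_of_type_algebra A \<O>" and u: "\<psi> u \<in> \<iota> ` carrier A"
    "\<psi> u \<noteq> \<zero>\<^bsub>\<O>\<^esub>" "P.B oone u = 0" and nu: "n = P.B u u"
    using n unfolding pure_norm_of_def by blast
  interpret E: etale_embedding j \<O> \<sigma> e a b c \<psi> A \<iota> using et \<iota> by unfold_locales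
  obtain s where s: "s \<in> carrier A" "\<psi> u = \<iota> s" using u(1) by blast
  then have \<tau>s: "E.\<tau> s = u" using E.\<psi>_\<tau>[OF s(1)] \<psi>_inj by metis
  then have "s \<noteq> \<zero>\<^bsub>A\<^esub>" using u(2) E.\<tau>_zero \<psi>_zero by auto
  then show "n \<noteq> 0" "isos A (quad n) \<noteq> {}" "isos (quad n) A \<noteq> {}"
    using E.pure_norm[OF s(1)] E.iso_quad[OF s(1)] u(3) by (simp_all add: \<tau>s nu)
qed

lemma pure_norm_of_exists:
  assumes et: "quadratic_etale A" and \<iota>: "\<iota> \<in> alg_embeddings ring_of_type_algebra A \<O>"
  shows "\<exists>n. pure_norm_of A n"
proof -
  interpret E: etale_embedding j \<O> \<sigma> e a b c \<psi> A \<iota> using et \<iota> by unfold_locales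
  obtain s where s: "s \<in> carrier A" "s \<noteq> \<zero>\<^bsub>A\<^esub>" "P.B oone (E.\<tau> s) = 0" using E.pure_exists by blast
  have "E.\<tau> s \<noteq> 0" using s E.\<tau>_rules(5)[OF s(1) E.A.zero_closed] by (simp add: E.\<tau>_zero)
  then have "\<psi> (E.\<tau> s) \<noteq> \<zero>\<^bsub>\<O>\<^esub>" using \<psi>_zero \<psi>_inj by metis
  then show ?thesis
    unfolding pure_norm_of_def using \<iota> s E.\<psi>_\<tau>[OF s(1)] by blast
qed

lemma iso_iff_pure_norms:
  assumes "quadratic_etale A" "quadratic_etale A'" "pure_norm_of A n" "pure_norm_of A' n'"
  shows "isos A A' \<noteq> {} \<longleftrightarrow> (\<exists>t. t \<noteq> 0 \<and> n' = t * t * n)"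
proof -
  note d = pure_norm_ofD[OF assms(1,3)] pure_norm_ofD[OF assms(2,4)]
  have c: "comm_alg A" "comm_alg A'" using assms(1,2) by (simp_all add: quadratic_etale_def)
  have "isos A A' \<noteq> {} \<longleftrightarrow> isos (quad n) (quad n') \<noteq> {}"
    using d isos_trans[OF c(1)] isos_trans[OF quad_comm_alg] by (metis ex_in_conv)
  then show ?thesis by (simp add: quad_iso_iff[OF d(1)])
qed

text \<open>The algebra generated by \<open>u\<close>.\<close>

lemma quad_embedded:
  assumes u: "P.B oone u = 0" "P.B u u \<noteq> 0"
  shows "quad (P.B u u) \<in> embedded_quadratic_etale \<O>" "pure_norm_of (quad (P.B u u)) (P.B u u)"
proof -
  let ?n = "P.B u u"
  define g where "g = (\<lambda>(x0, x1). \<psi> (oscale x0 oone + oscale x1 u))"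
  have sq: "omult a b c u u = oscale (- ?n) oone" using P.pure_square[OF u(1)] .
  have "inj g"
  proof (rule injI)
    fix x y assume "g x = g y"
    then have eq: "oscale (fst x) oone + oscale (snd x) u = oscale (fst y) oone + oscale (snd y) u"
      by (simp add: g_def \<psi>_inj split_beta)
    have "P.B u oone = 0" using u(1) by (simp add: obil_commute)
    then show "x = y"
      using arg_cong[OF eq, of "P.B oone"] arg_cong[OF eq, of "P.B u"] u
      by (simp add: obil_simps' P.obil_one prod_eq_iff)
  qed
  moreover have "g \<in> homs (quad ?n) \<O>"
    by (auto simp: alg_homs_def quad_simps g_def \<psi>_rules(1,5) \<psi>_rules(2-4)[symmetric] \<psi>_inj oscale_simps
        omult_add_left omult_add_right omult_scale_left omult_scale_right sq oscale_diff oscale_diff_left oscale_minus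
        algebra_simps)
  ultimately have emb: "g \<in> alg_embeddings ring_of_type_algebra (quad ?n) \<O>"
    by (simp add: alg_embeddings_def quad_simps)
  then show "quad ?n \<in> embedded_quadratic_etale \<O>"
    using quad_etale[OF u(2)] by (auto simp: embedded_quadratic_etale_def)
  have "\<psi> u = g (0, 1)" by (simp add: g_def oscale_simps)
  moreover have "\<psi> u \<noteq> \<zero>\<^bsub>\<O>\<^esub>" using u(2) \<psi>_zero \<psi>_inj by (metis obil_zero(1))
  ultimately show "pure_norm_of (quad ?n) ?n"
    unfolding pure_norm_of_def using emb u(1) by (auto simp: quad_simps intro!: bexI[of _ g] exI[of _ u])
qed

end

section \<open>Comparing two quotients by an invariant\<close>

text \<open>Both relations are pulled back from one equivalence relation \<open>S\<close> on the values of invariants \<open>\<alpha>\<close> and \<open>\<beta>\<close>,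
and the invariants take the same values up to \<open>S\<close>. The bijection matches classes of related values.\<close>

lemma quotient_bij_by_invariant:
  assumes S: "\<And>n m. S n m \<Longrightarrow> S m n" "\<And>n m l. S n m \<Longrightarrow> S m l \<Longrightarrow> S n l" "\<And>n. S n n"
    and r: "\<And>A B. (A, B) \<in> r \<longleftrightarrow> A \<in> E \<and> B \<in> E \<and> S (\<alpha> A) (\<alpha> B)"
    and s: "\<And>t u. (t, u) \<in> s \<longleftrightarrow> t \<in> F \<and> u \<in> F \<and> S (\<beta> t) (\<beta> u)"
    and EF: "\<And>A. A \<in> E \<Longrightarrow> \<exists>t\<in>F. S (\<alpha> A) (\<beta> t)" and FE: "\<And>t. t \<in> F \<Longrightarrow> \<exists>A\<in>E. S (\<alpha> A) (\<beta> t)"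
  shows "\<exists>\<Phi>. bij_betw \<Phi> (E // r) (F // s) \<and>
    (\<forall>A\<in>E. \<forall>t\<in>F. S (\<alpha> A) (\<beta> t) \<longrightarrow> \<Phi> (r `` {A}) = s `` {t})"
proof -
  define \<Phi> where "\<Phi> C = {t \<in> F. \<exists>A\<in>C. S (\<alpha> A) (\<beta> t)}" for C
  have \<Phi>: "\<Phi> (r `` {A}) = s `` {t}" if "A \<in> E" "t \<in> F" "S (\<alpha> A) (\<beta> t)" for A t
  proof (intro equalityI subsetI)
    fix u assume "u \<in> \<Phi> (r `` {A})"
    then obtain B where B: "u \<in> F" "S (\<alpha> A) (\<alpha> B)" "S (\<alpha> B) (\<beta> u)" by (auto simp: \<Phi>_def r)
    have "S (\<beta> t) (\<beta> u)" by (rule S(2)[OF S(1)[OF that(3)] S(2)[OF B(2,3)]])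
    then show "u \<in> s `` {t}" using that(2) B(1) by (simp add: s)
  next
    fix u assume "u \<in> s `` {t}"
    then have u: "u \<in> F" "S (\<beta> t) (\<beta> u)" by (auto simp: s)
    have "A \<in> r `` {A}" using that(1) S(3) by (simp add: r)
    then show "u \<in> \<Phi> (r `` {A})" using u(1) S(2)[OF that(3) u(2)] unfolding \<Phi>_def by blast
  qed
  have "inj_on \<Phi> (E // r)"
  proof (rule inj_onI)
    fix C D assume C: "C \<in> E // r" and D: "D \<in> E // r" and eq: "\<Phi> C = \<Phi> D"
    obtain A B where A: "A \<in> E" "C = r `` {A}" and B: "B \<in> E" "D = r `` {B}"
      using C D by (auto simp: quotient_def)
    obtain t u where t: "t \<in> F" "S (\<alpha> A) (\<beta> t)" and u: "u \<in> F" "S (\<alpha> B) (\<beta> u)"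
      using EF A B by blast
    have "s `` {t} = s `` {u}"
      using eq \<Phi>[OF A(1) t] \<Phi>[OF B(1) u] A B by simp
    moreover have "u \<in> s `` {u}" using u(1) S(3) by (simp add: s)
    ultimately have "u \<in> s `` {t}" by simp
    then have tu: "S (\<beta> t) (\<beta> u)" by (simp add: s)
    have AB: "S (\<alpha> A) (\<alpha> B)" by (rule S(2)[OF t(2) S(2)[OF tu S(1)[OF u(2)]]])
    have "S (\<alpha> A) (\<alpha> C1) \<longleftrightarrow> S (\<alpha> B) (\<alpha> C1)" for C1
      using S(2)[OF S(1)[OF AB]] S(2)[OF AB] by blast
    then show "C = D"
      unfolding A(2) B(2) using A(1) B(1) by (auto simp: r)
  qed
  moreover have "\<Phi> ` (E // r) = F // s"
  proof (intro equalityI subsetI)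
    fix Q assume "Q \<in> \<Phi> ` (E // r)"
    then obtain A where A: "A \<in> E" "Q = \<Phi> (r `` {A})" by (auto simp: quotient_def)
    obtain t where "t \<in> F" "S (\<alpha> A) (\<beta> t)" using EF A by blast
    then show "Q \<in> F // s" using \<Phi> A by (auto simp: quotient_def)
  next
    fix Q assume "Q \<in> F // s"
    then obtain t where t: "t \<in> F" "Q = s `` {t}" by (auto simp: quotient_def)
    obtain A where A: "A \<in> E" "S (\<alpha> A) (\<beta> t)" using FE t by blast
    then have "Q = \<Phi> (r `` {A})" using \<Phi> t by simp
    then show "Q \<in> \<Phi> ` (E // r)" using A by (auto simp: quotient_def)
  qed
  ultimately show ?thesis using \<Phi> unfolding bij_betw_def by blast
qed

section \<open>Forms of a stabilizer\<close>

lemma (in form_setup) stab_inclusion_pmap: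
  assumes "comm_alg R" "comm_alg S" "h \<in> homs R S"
    and "p \<in> carrier (pts (fst (stab_inclusion j A e x :: ('c, 'u, 'i) grp_over)) R)"
  shows "pmap (fst (stab_inclusion j A e x :: ('c, 'u, 'i) grp_over)) R S h p
    \<in> carrier (pts (fst (stab_inclusion j A e x :: ('c, 'u, 'i) grp_over)) S)"
proof -
  note R' = restrict_comm_alg[OF assms(1)] and S' = restrict_comm_alg[OF assms(2)] and h' = restrict_homs[OF assms(3)]
  have p: "p \<in> auts A e (J R)" "p (base_point R x) = base_point R x"
    using assms(4) by (simp_all add: stab_inclusion_def stabilizer_def base_change_aut)
  have "h \<circ> base_point R x = base_point S x"
    by (rule map_base_point[OF assms(1,3)])
  then have "aut_map A e (J R) (J S) h p (base_point S x) = base_point S x"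
    using aut_map_apply[OF R' S' h' autD(2)[OF p(1)] cbase_point_closed[OF assms(1), of x], of A e] p(2) by simp
  then show ?thesis
    using aut_map_aut[OF R' S' h' p(1)]
    by (simp add: stab_inclusion_def stabilizer_def base_change_aut)
qed

locale octonion_forms =
  fixes \<O> :: "('k::field_char_0, 'o) module" and \<sigma> e a b c \<psi>
    and x :: "8 \<Rightarrow> 'k alg_closure" and \<iota> :: "'k alg_closure \<Rightarrow> 'u"
  assumes bridge: "oct_bridge id \<O> \<sigma> e a b c \<psi>" and \<iota>: "inj \<iota>"
    and perp: "perpendicular (alg_over_ac \<O> e) (linear_over_ac \<O> e \<sigma>) x \<one>\<^bsub>alg_over_ac \<O> e\<^esub>"
    and norm: "norm_form (alg_over_ac \<O> e) (linear_over_ac \<O> e \<sigma>) x \<noteq> \<zero>\<^bsub>alg_over_ac \<O> e\<^esub>"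
begin

sublocale K: oct_bridge id \<O> \<sigma> e a b c \<psi> by (rule bridge)

sublocale AC: oct_bridge to_ac \<O> \<sigma> e a b c \<psi>
  using bridge ac.field_hom_axioms by (simp add: oct_bridge_def)

lemma \<iota>k: "inj (\<iota> \<circ> to_ac)"
  using \<iota> inj_to_ac by (rule inj_compose)

lemma x: "AC.pureX x" "AC.normX x \<noteq> 0"
  using perp norm AC.perpendicular_iff AC.norm_form_iff by blast+

abbreviation stab :: "'k oct \<Rightarrow> ('k, 'u, 8) grp_over" where "stab u \<equiv> stab_inclusion id \<O> e (K.\<kappa> u)"

definition pure :: "'k oct \<Rightarrow> bool" where "pure u \<longleftrightarrow> K.P.B oone u = 0 \<and> K.P.B u u \<noteq> 0"

definition same_class :: "'k \<Rightarrow> 'k \<Rightarrow> bool" where "same_class n m \<longleftrightarrow> (\<exists>t. t \<noteq> 0 \<and> m = t * t * n)"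

lemma same_class_equiv: "same_class n m \<Longrightarrow> same_class m n" "same_class n m \<Longrightarrow> same_class m l \<Longrightarrow> same_class n l"
  "same_class n n"
proof -
  show "same_class n n" unfolding same_class_def by (intro exI[of _ 1]) simp
  show "same_class m n" if nm: "same_class n m"
  proof -
    obtain t where "t \<noteq> 0" "m = t * t * n" using nm by (auto simp: same_class_def)
    then show ?thesis unfolding same_class_def by (intro exI[of _ "1 / t"]) simp
  qed
  show "same_class n l" if nm: "same_class n m" "same_class m l"
  proof -
    obtain t s where "t \<noteq> 0" "m = t * t * n" "s \<noteq> 0" "l = s * s * m" using nm by (auto simp: same_class_def)
    then show ?thesis unfolding same_class_def by (intro exI[of _ "s * t"]) simp
  qed
qed

lemma stab_fst_snd: "stab u = (stab_group \<O> e (K.\<kappa> u), \<lambda>R p. p)"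
  by (simp add: stab_inclusion_def stab_group_def)

text \<open>Over the closure the ratio of the norms of \<open>x\<close> and \<open>u\<close> is a square.\<close>

lemma stab_form:
  assumes u: "pure u" shows "stab u \<in> forms_of_stabilizer \<O> e x"
proof -
  let ?y = "to_ac \<circ> K.\<kappa> u"
  have y: "AC.pureX ?y" "AC.normX ?y \<noteq> 0"
    using u AC.pureX_\<kappa>[of u] AC.normX_\<kappa>[of u] by (simp_all add: pure_def)
  have "(base_change to_ac (stab_group \<O> e (K.\<kappa> u)), base_change_map to_ac (\<lambda>R p. p))
      = (stab_inclusion to_ac \<O> e ?y :: ('k alg_closure, 'u, 8) grp_over)"
    by (auto simp: stab_inclusion_def stab_group_def stabilizer_def base_change_def base_change_map_def
        aut_group_def base_point_def struct_map_def ac.restrict_simps comp_def)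
  note bc = this
  obtain r where r: "r * r = AC.normX x / AC.normX ?y"
    using nth_root_exists[of 2 "AC.normX x / AC.normX ?y"] by (auto simp: power2_eq_square)
  have "r \<noteq> 0 \<and> AC.normX x = r * r * AC.normX ?y"
    using r x(2) y(2) by auto
  then have "\<exists>g\<in>AC.GK. \<forall>R :: ('k alg_closure, 'u) module. comm_alg R \<longrightarrow> AC.cstab (g ?y) R = AC.cstab x R"
    using AC.stab_conj_iff[OF \<iota> y x] by blast
  moreover obtain H1 f1 where s1: "(stab_inclusion to_ac \<O> e ?y :: ('k alg_closure, 'u, 8) grp_over) = (H1, f1)" by force
  moreover obtain H2 f2 where s2: "(stab_inclusion to_ac \<O> e x :: ('k alg_closure, 'u, 8) grp_over) = (H2, f2)" by force
  ultimately have ex: "\<exists>g\<in>AC.GK. \<forall>R :: ('k alg_closure, 'u) module. comm_alg R \<longrightarrow> AC.cstab (g ?y) R = AC.cstab x R"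
    and s1: "(stab_inclusion to_ac \<O> e ?y :: ('k alg_closure, 'u, 8) grp_over) = (H1, f1)"
    and s2: "(stab_inclusion to_ac \<O> e x :: ('k alg_closure, 'u, 8) grp_over) = (H2, f2)" by blast+
  have onto: "AC.onto_stab (stab_inclusion to_ac \<O> e ?y :: ('k alg_closure, 'u, 8) grp_over) ?y"
    "AC.onto_stab (stab_inclusion to_ac \<O> e x :: ('k alg_closure, 'u, 8) grp_over) x"
    by (rule AC.stab_inclusion_onto)+
  have pm: "pmap H1 R S h p \<in> carrier (pts H1 S)"
    if "comm_alg R" "comm_alg S" "h \<in> homs R S" "p \<in> carrier (pts H1 R)" for R S h p
  proof -
    have "p \<in> carrier (pts (fst (stab_inclusion to_ac \<O> e ?y :: ('k alg_closure, 'u, 8) grp_over)) R)"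
      using that(4) by (simp only: s1 fst_conv)
    from AC.stab_inclusion_pmap[OF that(1-3) this] show ?thesis by (simp only: s1 fst_conv)
  qed
  have pm': "pmap H2 R S h p \<in> carrier (pts H2 S)"
    if "comm_alg R" "comm_alg S" "h \<in> homs R S" "p \<in> carrier (pts H2 R)" for R S h p
  proof -
    have "p \<in> carrier (pts (fst (stab_inclusion to_ac \<O> e x :: ('k alg_closure, 'u, 8) grp_over)) R)"
      using that(4) by (simp only: s2 fst_conv)
    from AC.stab_inclusion_pmap[OF that(1-3) this] show ?thesis by (simp only: s2 fst_conv)
  qed
  have "conjugate_over to_ac \<O> e (H1, f1) (H2, f2)"
    using AC.conjugate_iff_stab[OF onto(1)[unfolded s1] onto(2)[unfolded s2] pm pm'] ex by blast
  then have conj: "conjugate_over to_ac \<O> e (base_change to_ac (stab_group \<O> e (K.\<kappa> u)), base_change_map to_ac (\<lambda>R p. p))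
      (stab_inclusion to_ac \<O> e x :: ('k alg_closure, 'u, 8) grp_over)"
    by (simp only: bc s1 s2)
  have "grp_morphism (stab_group \<O> e (K.\<kappa> u)) (aut_group \<O> e) (\<lambda>R p. p :: (8 \<Rightarrow> 'u) \<Rightarrow> (8 \<Rightarrow> 'u))"
  proof -
    have "K.onto_stab (stab u) (K.\<kappa> u)" by (rule K.stab_inclusion_onto)
    then show ?thesis by (simp add: stab_fst_snd K.onto_stab_def)
  qed
  moreover have "algebraic_group (stab_group \<O> e (K.\<kappa> u) :: ('k, 'u, (8 \<Rightarrow> 'u) \<Rightarrow> (8 \<Rightarrow> 'u)) grp_functor)"
    unfolding algebraic_group_def using stab_is_grp_functor stab_representable[OF \<iota>k] by blast
  ultimately show ?thesis
    using conj by (simp add: forms_of_stabilizer_def stab_fst_snd)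
qed

text \<open>Over the closure, \<open>H\<close> is identified with the stabilizer of a conjugate \<open>x'\<close> of \<open>x\<close>. A functional
that takes the value \<open>1\<close> at some coordinate of \<open>x'\<close> yields a rational vector that is fixed by \<open>H\<close>.
It is pure because \<open>x'\<close> is, hence it is a multiple of \<open>x'\<close>, and the multiple is nonzero.\<close>

lemma form_onto_stab:
  assumes t: "(H, f) \<in> (forms_of_stabilizer \<O> e x :: ('k, 'u, 8) grp_over set)"
  shows "\<exists>u. pure u \<and> K.onto_stab (H, f) (K.\<kappa> u)"
proof -
  have H: "algebraic_group H" and f: "grp_morphism H (aut_group \<O> e) f"
    and conj: "conjugate_over to_ac \<O> e (base_change to_ac H, base_change_map to_ac f)
       (stab_inclusion to_ac \<O> e x :: ('k alg_closure, 'u, 8) grp_over)"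
    using t by (auto simp: forms_of_stabilizer_def)
  interpret D: descent \<O> e H f \<iota>
    using H f \<iota> by unfold_locales
  obtain g where g: "g \<in> AC.GK" and onto: "AC.onto_stab (base_change to_ac H, base_change_map to_ac f) (g x)"
    using AC.conjugate_imp_onto_stab[OF conj D.base_change_morphism D.base_change_group] by blast
  define x' where "x' = g x"
  have x': "AC.pureX x'" "AC.normX x' \<noteq> 0"
    using AC.GK_pure[OF g x(1)] x(2) by (simp_all add: x'_def)
  note onto = onto[folded x'_def]
  have "x' \<noteq> (\<lambda>l. 0)"
    using x'(2) AC.scaleX(2)[of 0 x'] by auto
  then obtain l where l: "x' l \<noteq> 0" by auto
  obtain fu where fu: "functional fu" "fu (x' l) = 1" using functional_exists[OF l] by blast
  define y where "y = (\<lambda>l. fu (x' l))"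
  define u where "u = inv_into UNIV K.\<kappa> y"
  have yu: "y = K.\<kappa> u" by (simp add: u_def K.\<kappa>_inv)
  have fu_sum: "fu (\<Sum>i\<in>I. v i * to_ac (w i)) = (\<Sum>i\<in>I. fu (v i) * w i)" for I v and w :: "8 \<Rightarrow> 'k"
  proof (induct I rule: infinite_finite_induct)
    have "fu 0 = 0" using fu(1) unfolding functional_def by (metis add_cancel_right_left)
    then show "fu (\<Sum>i\<in>{}. v i * to_ac (w i)) = (\<Sum>i\<in>{}. fu (v i) * w i)"
      "infinite I \<Longrightarrow> fu (\<Sum>i\<in>I. v i * to_ac (w i)) = (\<Sum>i\<in>I. fu (v i) * w i)" for I by simp_all
  next
    fix i I assume *: "finite I" "i \<notin> I" "fu (\<Sum>i\<in>I. v i * to_ac (w i)) = (\<Sum>i\<in>I. fu (v i) * w i)"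
    have "fu (v i * to_ac (w i)) = fu (v i) * w i"
      using fu(1) unfolding functional_def by (metis mult.commute)
    then show "fu (\<Sum>i\<in>insert i I. v i * to_ac (w i)) = (\<Sum>i\<in>insert i I. fu (v i) * w i)"
      using * fu(1) by (simp add: functional_def)
  qed
  have "K.pureX y"
  proof -
    let ?w = "\<lambda>i. K.P.B oone (inv_into UNIV K.\<kappa> (unit_vec (field_alg id) i))"
    have "(\<Sum>i\<in>UNIV. x' i * to_ac (?w i)) = 0" using x'(1) AC.pureX_iff by simp
    then have "(\<Sum>i\<in>UNIV. y i * ?w i) = 0"
      using fu_sum[of x' ?w UNIV] fu_sum[of x' ?w "{}"] by (simp add: y_def)
    then show ?thesis by (simp add: K.pureX_iff)
  qed
  then have u1: "K.P.B oone u = 0" using K.pureX_\<kappa>[of u] by (simp add: yu)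
  have py: "AC.pureX (to_ac \<circ> y)" using AC.pureX_\<kappa>[of u] u1 by (simp add: yu)
  obtain s where s: "to_ac \<circ> y = (\<lambda>l. s * x' l)"
    using AC.cstab_subset_proportional[OF \<iota> x' py] D.functional_point_cstab[OF onto fu(1)]
    unfolding y_def by blast
  have "to_ac (y l) = s * x' l" using fun_cong[OF s, of l] by simp
  then have s0: "s \<noteq> 0" using fu(2) by (auto simp: y_def)
  have "AC.normX (to_ac \<circ> y) \<noteq> 0" unfolding s AC.scaleX(2) using s0 x'(2) by simp
  then have u2: "K.P.B u u \<noteq> 0" using AC.normX_\<kappa>[of u] by (auto simp: yu)
  have "K.onto_stab (H, f) y"
  proof (rule D.descent_onto_stab[OF onto])
    show "AC.cstab (to_ac \<circ> y) R = AC.cstab x' R" if "comm_alg R" for R :: "('k alg_closure, 'u) module"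
      unfolding s using AC.cstab_scale[OF that s0] .
    show "f R p (base_point R y) = base_point R y" if "comm_alg R" "p \<in> carrier (pts H R)" for R p
      unfolding y_def using D.functional_point_fixed[OF onto that fu(1)] .
  qed
  then show ?thesis using u1 u2 by (auto simp: pure_def yu)
qed

lemma forms_conj_iff:
  assumes t: "(H, f) \<in> (forms_of_stabilizer \<O> e x :: ('k, 'u, 8) grp_over set)" and u: "pure u" "K.onto_stab (H, f) (K.\<kappa> u)"
    and t': "(H', f') \<in> forms_of_stabilizer \<O> e x" and u': "pure u'" "K.onto_stab (H', f') (K.\<kappa> u')"
  shows "((H, f), (H', f')) \<in> forms_conj \<O> e x \<longleftrightarrow> same_class (K.P.B u u) (K.P.B u' u')"
proof -
  have pm: "pmap H R S h p \<in> carrier (pts H S)"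
    if "(H, f) \<in> forms_of_stabilizer \<O> e x" "comm_alg R" "comm_alg S" "h \<in> homs R S" "p \<in> carrier (pts H R)"
    for H :: "('k, 'u, (8 \<Rightarrow> 'u) \<Rightarrow> (8 \<Rightarrow> 'u)) grp_functor" and f R S h p
  proof -
    interpret D: descent \<O> e H f \<iota>
      using that(1) \<iota> by unfold_locales (auto simp: forms_of_stabilizer_def)
    show ?thesis using that(2-) by (rule D.pmap_closed)
  qed
  have n: "K.pureX (K.\<kappa> u)" "K.normX (K.\<kappa> u) = K.P.B u u" "K.pureX (K.\<kappa> u')" "K.normX (K.\<kappa> u') = K.P.B u' u'"
    using u(1) u'(1) K.pureX_\<kappa>[of u] K.pureX_\<kappa>[of u'] K.normX_\<kappa>[of u] K.normX_\<kappa>[of u'] by (simp_all add: pure_def)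
  have "((H, f), (H', f')) \<in> forms_conj \<O> e x \<longleftrightarrow> conjugate_over id \<O> e (H, f) (H', f')"
    using t t' by (simp add: forms_conj_def)
  also have "\<dots> \<longleftrightarrow> (\<exists>g\<in>K.GK. \<forall>R :: ('k, 'u) module. comm_alg R \<longrightarrow> K.cstab (g (K.\<kappa> u)) R = K.cstab (K.\<kappa> u') R)"
    by (rule K.conjugate_iff_stab[OF u(2) u'(2) pm[OF t] pm[OF t']])
  also have "\<dots> \<longleftrightarrow> same_class (K.P.B u u) (K.P.B u' u')"
    unfolding same_class_def
    using K.stab_conj_iff[OF \<iota>k n(1) _ n(3)] u(1) u'(1) by (simp add: n pure_def)
  finally show ?thesis .
qed

text \<open>The invariant of a form, well defined up to nonzero squares.\<close>

definition form_norm :: "('k, 'u, 8) grp_over \<Rightarrow> 'k \<Rightarrow> bool" where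
  "form_norm t n \<longleftrightarrow> (\<exists>u. pure u \<and> K.onto_stab t (K.\<kappa> u) \<and> n = K.P.B u u)"

lemma form_norm_conj:
  assumes "t \<in> forms_of_stabilizer \<O> e x" "t' \<in> forms_of_stabilizer \<O> e x" "form_norm t n" "form_norm t' n'"
  shows "(t, t') \<in> forms_conj \<O> e x \<longleftrightarrow> same_class n n'"
  using assms forms_conj_iff by (cases t; cases t') (auto simp: form_norm_def)

lemma form_norm_unique:
  assumes "t \<in> forms_of_stabilizer \<O> e x" "form_norm t n" "form_norm t m"
  shows "same_class n m"
  using form_norm_conj[OF assms(1,1,2,2)] form_norm_conj[OF assms(1,1,2,3)] same_class_equiv(3) by blast

lemma stab_form_norm: "pure u \<Longrightarrow> form_norm (stab u) (K.P.B u u)"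
  unfolding form_norm_def using K.stab_inclusion_onto by blast

section \<open>The classification\<close>

text \<open>The norms of pure elements give the invariants: on the algebras, of an element of an embedded copy; on
the forms, of a rational element whose stabilizer is the form. An element \<open>y\<close> of an embedded copy of \<open>A\<close>
provides the same value for \<open>A\<close> and for the stabilizer of \<open>y\<close>, which gives the description of the bijection.\<close>

lemma classification:
  "\<exists>\<Phi> :: ('k, 'k \<times> 'k) module set \<Rightarrow> ('k, 'u, 8) grp_over set.
    bij_betw \<Phi> (embedded_quadratic_etale \<O> // etale_iso \<O>)
      (forms_of_stabilizer \<O> e x // forms_conj \<O> e x) \<and>
    (\<forall>A\<in>embedded_quadratic_etale \<O>. \<forall>\<iota>\<in>alg_embeddings ring_of_type_algebra A \<O>.
       \<forall>y\<in>\<iota> ` carrier A. y \<noteq> \<zero>\<^bsub>\<O>\<^esub> \<and> perpendicular \<O> \<sigma> y \<one>\<^bsub>\<O>\<^esub> \<longrightarrow>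
         \<Phi> (etale_iso \<O> `` {A}) =
           forms_conj \<O> e x `` {stab_inclusion id \<O> e (coord \<O> e y)})"
proof -
  let ?E = "embedded_quadratic_etale \<O>" and ?F = "forms_of_stabilizer \<O> e x :: ('k, 'u, 8) grp_over set"
  define \<alpha> where "\<alpha> A = (SOME n. K.pure_norm_of A n)" for A :: "('k, 'k \<times> 'k) module"
  define \<beta> where "\<beta> t = (SOME n. form_norm t n)" for t
  have et: "quadratic_etale A" if "A \<in> ?E" for A using that by (simp add: embedded_quadratic_etale_def)
  have \<alpha>: "K.pure_norm_of A (\<alpha> A)" if "A \<in> ?E" for A
    unfolding \<alpha>_def
    by (rule someI_ex) (use that K.pure_norm_of_exists in \<open>auto simp: embedded_quadratic_etale_def\<close>)
  have \<beta>: "form_norm t (\<beta> t)" if "t \<in> ?F" for t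
    unfolding \<beta>_def by (rule someI_ex) (use that form_onto_stab in \<open>cases t; auto simp: form_norm_def\<close>)
  have \<alpha>_unique: "same_class (\<alpha> A) n" if "A \<in> ?E" "K.pure_norm_of A n" for A n
    using K.iso_iff_pure_norms[OF et et \<alpha> that(2), of A] K.iso_iff_pure_norms[OF et et \<alpha> \<alpha>, of A A] that(1)
      same_class_equiv(3)[of "\<alpha> A"] by (simp add: same_class_def)
  have norm_pure: "pure u" if "A \<in> ?E" "K.pure_norm_of A (K.P.B u u)" "K.P.B oone u = 0" for A u
    using K.pure_norm_ofD(1)[OF et[OF that(1)] that(2)] that(3) by (simp add: pure_def)
  have "\<exists>\<Phi>. bij_betw \<Phi> (?E // etale_iso \<O>) (?F // forms_conj \<O> e x) \<and>
    (\<forall>A\<in>?E. \<forall>t\<in>?F. same_class (\<alpha> A) (\<beta> t) \<longrightarrow> \<Phi> (etale_iso \<O> `` {A}) = forms_conj \<O> e x `` {t})"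
  proof (rule quotient_bij_by_invariant[OF same_class_equiv])
    show "(A, B) \<in> etale_iso \<O> \<longleftrightarrow> A \<in> ?E \<and> B \<in> ?E \<and> same_class (\<alpha> A) (\<alpha> B)" for A B
      using K.iso_iff_pure_norms[OF et et \<alpha> \<alpha>, of A B] by (auto simp: etale_iso_def same_class_def)
    show "(t, t') \<in> forms_conj \<O> e x \<longleftrightarrow> t \<in> ?F \<and> t' \<in> ?F \<and> same_class (\<beta> t) (\<beta> t')" for t t'
      using form_norm_conj[OF _ _ \<beta> \<beta>, of t t'] by (auto simp: forms_conj_def)
    show "\<exists>t\<in>?F. same_class (\<alpha> A) (\<beta> t)" if A: "A \<in> ?E" for A
    proof -
      obtain u where u: "K.P.B oone u = 0" "\<alpha> A = K.P.B u u"
        using \<alpha>[OF A] unfolding K.pure_norm_of_def by blast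
      then have "pure u" using norm_pure[OF A] \<alpha>[OF A] by simp
      then show ?thesis
        using stab_form[of u] form_norm_unique[OF stab_form stab_form_norm \<beta>[OF stab_form], of u]
        by (intro bexI[of _ "stab u"]) (simp_all add: u)
    qed
    show "\<exists>A\<in>?E. same_class (\<alpha> A) (\<beta> t)" if t: "t \<in> ?F" for t
    proof -
      obtain u where u: "pure u" "\<beta> t = K.P.B u u" using \<beta>[OF t] unfolding form_norm_def by blast
      then have u': "K.P.B oone u = 0" "K.P.B u u \<noteq> 0" by (simp_all add: pure_def)
      note q = K.quad_embedded[OF u']
      have "same_class (\<alpha> (quad (K.P.B u u))) (\<beta> t)"
        using \<alpha>_unique[OF q] by (simp only: u(2))
      then show ?thesis using q(1) by blast
    qed
  qed
  then obtain \<Phi> where bij: "bij_betw \<Phi> (?E // etale_iso \<O>) (?F // forms_conj \<O> e x)"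
    and \<Phi>: "\<And>A t. A \<in> ?E \<Longrightarrow> t \<in> ?F \<Longrightarrow> same_class (\<alpha> A) (\<beta> t) \<Longrightarrow>
      \<Phi> (etale_iso \<O> `` {A}) = forms_conj \<O> e x `` {t}" by blast
  have "\<Phi> (etale_iso \<O> `` {A}) = forms_conj \<O> e x `` {stab_inclusion id \<O> e (coord \<O> e y)}"
    if A: "A \<in> ?E" and i: "i \<in> alg_embeddings ring_of_type_algebra A \<O>" and y: "y \<in> i ` carrier A"
      "y \<noteq> \<zero>\<^bsub>\<O>\<^esub>" "perpendicular \<O> \<sigma> y \<one>\<^bsub>\<O>\<^esub>" for A i y
  proof -
    have "y \<in> carrier \<O>" using y(1) i by (auto simp: alg_embeddings_def alg_homs_def PiE_iff)
    then obtain u where u: "y = \<psi> u" using K.\<psi>_bij unfolding bij_betw_def by blast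
    have u1: "K.P.B oone u = 0" using y(3) K.perpendicular_\<psi> by (simp add: u)
    have n: "K.pure_norm_of A (K.P.B u u)"
      unfolding K.pure_norm_of_def using i y(1,2) u1 by (intro bexI[of _ i] exI[of _ u]) (simp_all add: u)
    have p: "pure u" by (rule norm_pure[OF A n u1])
    have "same_class (\<alpha> A) (\<beta> (stab u))"
      using \<alpha>_unique[OF A n] form_norm_unique[OF stab_form[OF p] stab_form_norm[OF p] \<beta>[OF stab_form[OF p]]]
        same_class_equiv(2) by blast
    from \<Phi>[OF A stab_form[OF p] this] show ?thesis by (simp add: u K.\<kappa>_def)
  qed
  with bij show ?thesis by (intro exI[of _ \<Phi>]) blast
qed

end

theorem theorem5p1:
  fixes \<O> :: "('k::field_char_0, 'o) module"
    and \<sigma> :: "'o \<Rightarrow> 'o"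
    and e :: "8 \<Rightarrow> 'o"
    and x :: "8 \<Rightarrow> 'k alg_closure"
  assumes "is_number_field (UNIV :: 'k set) \<or> is_completion_of_number_field TYPE('k)"
    and "octonion_algebra \<O> \<sigma>"
    and "is_basis \<O> e"
    and "perpendicular (alg_over_ac \<O> e) (linear_over_ac \<O> e \<sigma>) x \<one>\<^bsub>alg_over_ac \<O> e\<^esub>"
    and "norm_form (alg_over_ac \<O> e) (linear_over_ac \<O> e \<sigma>) x \<noteq> \<zero>\<^bsub>alg_over_ac \<O> e\<^esub>"
    and universe: "\<exists>\<iota> :: 'k alg_closure \<Rightarrow> 'u. inj \<iota>"
  shows "\<exists>\<Phi> :: ('k, 'k \<times> 'k) module set \<Rightarrow> ('k, 'u, 8) grp_over set.
    bij_betw \<Phi> (embedded_quadratic_etale \<O> // etale_iso \<O>)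
      (forms_of_stabilizer \<O> e x // forms_conj \<O> e x) \<and>
    (\<forall>A\<in>embedded_quadratic_etale \<O>. \<forall>\<iota>\<in>alg_embeddings ring_of_type_algebra A \<O>.
       \<forall>y\<in>\<iota> ` carrier A. y \<noteq> \<zero>\<^bsub>\<O>\<^esub> \<and> perpendicular \<O> \<sigma> y \<one>\<^bsub>\<O>\<^esub> \<longrightarrow>
         \<Phi> (etale_iso \<O> `` {A}) =
           forms_conj \<O> e x `` {stab_inclusion id \<O> e (coord \<O> e y)})"
proof -
  obtain \<iota> :: "'k alg_closure \<Rightarrow> 'u" where \<iota>: "inj \<iota>" using universe by blast
  obtain a b c \<psi> where abc: "a \<noteq> 0" "b \<noteq> 0" "c \<noteq> 0"
    and \<psi>: "\<psi> \<in> alg_isos ring_of_type_algebra (CD a b c) \<O>" "\<And>u. \<sigma> (\<psi> u) = \<psi> (oconj u)"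
    using assms(2) unfolding octonion_algebra_def CD_simps(1) cd_conj_eq by blast
  have "oct_bridge id \<O> \<sigma> e a b c \<psi>"
    using assms(2,3) abc \<psi> by unfold_locales (auto simp: octonion_algebra_def)
  then interpret octonion_forms \<O> \<sigma> e a b c \<psi> x \<iota>
    using \<iota> assms(4,5) by (rule octonion_forms.intro)
  show ?thesis by (rule classification)
qed

end
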